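(* Let $\{F_n\}_{n\in\mathbb N}$ be a sequence of functionals in the class $\mathfrak F$ (all with the same structural constants $c_1,\dots,c_5$ and the same function $\sigma$). Then there exist a functional $F\in\mathfrak F_{\rm sc}$ and a subsequence of $\{F_n\}_{n\in\mathbb N}$, not relabelled, such that for every bounded open set $U\subset\mathbb R^d$ the sequence $\{F_n(\cdot,U)\}_{n\in\mathbb N}$ $\Gamma$-converges to $F(\cdot,U)$ in the topology of $L^1_{\rm loc}(\mathbb R^d;\mathbb R^d)$.
   Context: Notation. $d$ is the fixed space dimension; $\mathbb S^{d-1}=\{\nu\in\mathbb R^d:|\nu|=1\}$; $\mathbb R^{d\times d}_{\rm sym}$ and $\mathbb R^{d\times d}_{\rm skew}$ are the spaces of real symmetric and antisymmetric $d\times d$ matrices, with the Frobenius norm $|\cdot|$; $\mathcal L^d$ is Lebesgue measure and $\mathcal H^{d-1}$ the $(d-1)$-dimensional Hausdorff measure; $\mathcal B(\mathbb R^d)$ is the family of Borel subsets of $\mathbb R^d$. For $U\subset\mathbb R^d$ open, ${\rm BD}(U)$ is the set of $u\in L^1(U;\mathbb R^d)$ whose distributional symmetrised gradient $Eu=\frac12(Du+Du^T)$ is a bounded Radon measure on $U$ with values in $\mathbb R^{d\times d}_{\rm sym}$; $|Eu|$ is its total variation measure. For a matrix $A$, $\ell_A(y)=Ay$. For $x,\zeta\in\mathbb R^d$ and $\nu\in\mathbb S^{d-1}$, $u_{x,\zeta,\nu}(y)=\zeta$ if $(y-x)\cdot\nu>0$ and $u_{x,\zeta,\nu}(y)=0$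 if $(y-x)\cdot\nu\le0$. A rigid motion is a map $y\mapsto Wy+b$ with $W\in\mathbb R^{d\times d}_{\rm skew}$, $b\in\mathbb R^d$. Class $\mathfrak F$. Fix constants $c_1,\dots,c_5\ge0$ with $0<c_1\le c_3$, and a continuous $\sigma:[0,+\infty)\to[0,+\infty)$ with $\sigma(0)=0$ and $\limsup_{t\to+\infty}\sigma(t)/t<+\infty$. $\mathfrak F$ is the set of all functionals $F:L^1_{\rm loc}(\mathbb R^d;\mathbb R^d)\times\mathcal B(\mathbb R^d)\to[0,+\infty]$ such that: (a) for every $u\in L^1_{\rm loc}(\mathbb R^d;\mathbb R^d)$, $F(u,\cdot)$ is a Borel measure and $F(u,B)=\inf\{F(u,U):U\text{ open},\,U\supset B\}$ for every $B\in\mathcal B(\mathbb R^d)$; (b) for every bounded open $U$ and $u,v\in L^1_{\rm loc}(\mathbb R^d;\mathbb R^d)$ with $u=v$ $\mathcal L^d$-a.e. on $U$, $F(u,U)=F(v,U)$; (c) for every $u\in L^1_{\rm loc}(\mathbb R^d;\mathbb R^d)$ and bounded open $U$: $c_1|Eu|(U)-c_2\mathcal L^d(U)\le F(u,U)\le c_3|Eu|(U)+c_4\mathcal L^d(U)$ if $u|_U\in{\rm BD}(U)$, and $F(u,U)=+\infty$ if $u|_U\notin{\rm BD}(U)$; (d) $F(u+w,B)=F(u,B)$ for every $u\in L^1_{\rm loc}(\mathbb R^d;\mathbb R^d)$, every rigid motion $w$ and every $B\in\mathcal B(\mathbb R^d)$; (e) $F(u+\ell_A,B)\le F(u,B)+c_5|A|\mathcal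 L^d(B)$ for every $u\in L^1_{\rm loc}(\mathbb R^d;\mathbb R^d)$, $A\in\mathbb R^{d\times d}_{\rm sym}$, $B\in\mathcal B(\mathbb R^d)$; (f) $F(u+u_{x,\zeta,\nu},B)\le F(u,B)+\sigma(|\zeta|)\mathcal H^{d-1}(B\cap\Pi^\nu_x)$ for every $u\in L^1_{\rm loc}(\mathbb R^d;\mathbb R^d)$, $x,\zeta\in\mathbb R^d$, $\nu\in\mathbb S^{d-1}$, $B\in\mathcal B(\mathbb R^d)$, where $\Pi^\nu_x=\{y:(y-x)\cdot\nu=0\}$. $\mathfrak F_{\rm sc}$ is the set of $F\in\mathfrak F$ such that for every open $U\subset\mathbb R^d$ the functional $F(\cdot,U)$ is lower semicontinuous with respect to $L^1_{\rm loc}(\mathbb R^d;\mathbb R^d)$-convergence. *)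

theory Defs
  imports "HOL-Analysis.Analysis"
begin

section \<open>Finite vector-valued Borel measures\<close>

abbreviation borel_subsets :: "'a::topological_space set \<Rightarrow> 'a set set" where
  "borel_subsets U \<equiv> {B \<in> sets borel. B \<subseteq> U}"

text \<open>A bounded Radon measure on an open set \<open>U\<close> of a Euclidean space with values in a
  finite-dimensional normed space is the same as a countably additive set function on the
  Borel subsets of \<open>U\<close> (\<open>\<mu> {} = 0\<close> follows by taking all \<open>A n\<close> empty). Values outside
  \<open>borel_subsets U\<close> carry no information.\<close>

definition vector_measure_on :: "'a::topological_space set \<Rightarrow> ('a set \<Rightarrow> 'b::real_normed_vector) \<Rightarrow> bool"
  where "vector_measure_on U \<mu> \<longleftrightarrow>
    (\<forall>A :: nat \<Rightarrow> 'a set. range A \<subseteq> borel_subsets U \<longrightarrow> disjoint_family A \<longrightarrow>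
      (\<lambda>n. \<mu> (A n)) sums \<mu> (\<Union>n. A n))"

definition total_variation :: "('a::topological_space set \<Rightarrow> 'b::real_normed_vector) \<Rightarrow> 'a set \<Rightarrow> ennreal"
  where "total_variation \<mu> B =
    (SUP A \<in> {A :: nat \<Rightarrow> 'a set. range A \<subseteq> sets borel \<and> disjoint_family A \<and> (\<Union>n. A n) = B}.
      \<Sum>n. ennreal (norm (\<mu> (A n))))"

text \<open>The Jordan parts \<open>(\<bar>\<nu>\<bar> + \<nu>) / 2\<close> and \<open>(\<bar>\<nu>\<bar> - \<nu>) / 2\<close> of a finite signed measure on \<open>U\<close> are
  \<open>positive_part U \<nu>\<close> and \<open>positive_part U (- \<nu>)\<close>.\<close>

definition positive_part :: "'a::topological_space set \<Rightarrow> ('a set \<Rightarrow> real) \<Rightarrow> 'a measure"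
  where "positive_part U \<nu> =
    measure_of U (borel_subsets U) (\<lambda>B. ennreal ((enn2real (total_variation \<nu> B) + \<nu> B) / 2))"

definition signed_integral :: "'a::topological_space set \<Rightarrow> ('a set \<Rightarrow> real) \<Rightarrow> ('a \<Rightarrow> real) \<Rightarrow> real"
  where "signed_integral U \<nu> \<phi> =
    (LINT x|positive_part U \<nu>. \<phi> x) - (LINT x|positive_part U (\<lambda>B. - \<nu> B). \<phi> x)"


section \<open>Test functions\<close>

definition partial_deriv :: "'d::finite \<Rightarrow> (real^'d \<Rightarrow> real) \<Rightarrow> real^'d \<Rightarrow> real"
  where "partial_deriv j \<phi> x = frechet_derivative \<phi> (at x) (axis j 1)"

definition smooth :: "(real^'d::finite \<Rightarrow> real) \<Rightarrow> bool"
  where "smooth \<phi> \<longleftrightarrow> (\<forall>js x. foldr partial_deriv js \<phi> differentiable at x)"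

text \<open>Elements of \<open>C\<^sub>c\<^sup>\<infinity>(U)\<close>, extended by zero to the whole space.\<close>

definition test_functions :: "(real^'d::finite) set \<Rightarrow> (real^'d \<Rightarrow> real) set"
  where "test_functions U =
    {\<phi>. smooth \<phi> \<and> compact (closure {x. \<phi> x \<noteq> 0}) \<and> closure {x. \<phi> x \<noteq> 0} \<subseteq> U}"


section \<open>Functions of bounded deformation\<close>

text \<open>\<open>\<mu>\<close> represents the distribution \<open>Eu = (Du + Du\<^sup>T) / 2\<close> on \<open>U\<close>, where
  \<open>(Du) $ i $ j = \<partial>\<^sub>j u\<^sub>i\<close> in the sense of distributions.\<close>

definition is_sym_gradient ::
  "(real^'d::finite) set \<Rightarrow> (real^'d \<Rightarrow> real^'d) \<Rightarrow> ((real^'d) set \<Rightarrow> real^'d^'d) \<Rightarrow> bool"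
  where "is_sym_gradient U u \<mu> \<longleftrightarrow>
    vector_measure_on U \<mu> \<and>
    (\<forall>B \<in> borel_subsets U. transpose (\<mu> B) = \<mu> B) \<and>
    (\<forall>\<phi> \<in> test_functions U. \<forall>i j.
      signed_integral U (\<lambda>B. \<mu> B $ i $ j) \<phi> =
      - (1/2) * (LINT x:U|lebesgue. u x $ i * partial_deriv j \<phi> x + u x $ j * partial_deriv i \<phi> x))"

definition BD :: "(real^'d::finite) set \<Rightarrow> (real^'d \<Rightarrow> real^'d) set"
  where "BD U = {u. u absolutely_integrable_on U \<and> (\<exists>\<mu>. is_sym_gradient U u \<mu>)}"

text \<open>For \<open>u \<in> BD U\<close> the measure is unique on \<open>borel_subsets U\<close>, so the choice is immaterial.\<close>

definition sym_gradient :: "(real^'d::finite) set \<Rightarrow> (real^'d \<Rightarrow> real^'d) \<Rightarrow> (real^'d) set \<Rightarrow> real^'d^'d"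
  where "sym_gradient U u = (SOME \<mu>. is_sym_gradient U u \<mu>)"


section \<open>Hausdorff measure\<close>

text \<open>Normalised so that it agrees with Lebesgue measure on \<open>k\<close>-dimensional planes. The exponent is a
  natural number, so \<open>0 ^ 0 = 1\<close> makes the case \<open>k = 0\<close> the counting measure, for which empty
  covering sets must be given weight 0 explicitly. Covering sets are required to be bounded because
  \<open>diameter\<close> is unspecified on unbounded sets.\<close>

definition hausdorff_pre :: "nat \<Rightarrow> real \<Rightarrow> 'a::metric_space set \<Rightarrow> ennreal"
  where "hausdorff_pre k \<delta> B =
    (INF C \<in> {C :: nat \<Rightarrow> 'a set. B \<subseteq> (\<Union>n. C n) \<and> (\<forall>n. bounded (C n) \<and> diameter (C n) \<le> \<delta>)}.
      \<Sum>n. if C n = {} then 0 else ennreal (unit_ball_vol (real k) * (diameter (C n) / 2) ^ k))"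

definition hausdorff :: "nat \<Rightarrow> 'a::metric_space set \<Rightarrow> ennreal"
  where "hausdorff k B = (SUP \<delta> \<in> {0<..}. hausdorff_pre k \<delta> B)"


section \<open>Locally integrable functions and Gamma-convergence\<close>

text \<open>Functions are used in place of their a.e.-equivalence classes. The topology below does not
  separate a.e. equal functions, and functionals in the class defined below respect a.e. equality.\<close>

definition L1loc :: "(real^'d::finite \<Rightarrow> real^'d) set"
  where "L1loc = {u. \<forall>K. compact K \<longrightarrow> u absolutely_integrable_on K}"

definition L1loc_topology :: "(real^'d::finite \<Rightarrow> real^'d) topology"
  where "L1loc_topology = topology_generated_by
    {{v \<in> L1loc. (LINT x:K|lebesgue. norm (v x - u x)) < \<epsilon>} | u K \<epsilon>. u \<in> L1loc \<and> compact K \<and> 0 < \<epsilon>}"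

definition Gamma_liminf :: "'x topology \<Rightarrow> (nat \<Rightarrow> 'x \<Rightarrow> ennreal) \<Rightarrow> 'x \<Rightarrow> ennreal"
  where "Gamma_liminf X f x = (SUP N \<in> {N. openin X N \<and> x \<in> N}. liminf (\<lambda>n. INF y \<in> N. f n y))"

definition Gamma_limsup :: "'x topology \<Rightarrow> (nat \<Rightarrow> 'x \<Rightarrow> ennreal) \<Rightarrow> 'x \<Rightarrow> ennreal"
  where "Gamma_limsup X f x = (SUP N \<in> {N. openin X N \<and> x \<in> N}. limsup (\<lambda>n. INF y \<in> N. f n y))"

definition Gamma_converges :: "'x topology \<Rightarrow> (nat \<Rightarrow> 'x \<Rightarrow> ennreal) \<Rightarrow> ('x \<Rightarrow> ennreal) \<Rightarrow> bool"
  where "Gamma_converges X f g \<longleftrightarrow>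
    (\<forall>x \<in> topspace X. Gamma_liminf X f x = g x \<and> Gamma_limsup X f x = g x)"


section \<open>The classes of functionals\<close>

type_synonym 'd functional = "(real^'d \<Rightarrow> real^'d) \<Rightarrow> (real^'d) set \<Rightarrow> ennreal"

definition jump_function :: "real^'d::finite \<Rightarrow> real^'d \<Rightarrow> real^'d \<Rightarrow> real^'d \<Rightarrow> real^'d"
  where "jump_function x \<zeta> \<nu> y = (if (y - x) \<bullet> \<nu> > 0 then \<zeta> else 0)"

definition hyperplane :: "real^'d::finite \<Rightarrow> real^'d \<Rightarrow> (real^'d) set"
  where "hyperplane x \<nu> = {y. (y - x) \<bullet> \<nu> = 0}"

text \<open>Only values at \<open>u \<in> L1loc\<close> and Borel sets are constrained. In the growth condition the term
  \<open>c\<^sub>2 \<L>\<^sup>d(U)\<close>, finite for bounded \<open>U\<close>, of the lower bound is moved to the right-hand side.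
  In \<open>ennreal\<close>, \<open>0 * \<infinity> = 0\<close>.\<close>

definition functional_class ::
  "real \<Rightarrow> real \<Rightarrow> real \<Rightarrow> real \<Rightarrow> real \<Rightarrow> (real \<Rightarrow> real) \<Rightarrow> ('d::finite) functional set"
  where "functional_class c1 c2 c3 c4 c5 \<sigma> = {F.
    (\<forall>u \<in> L1loc. measure_space UNIV (sets borel) (F u) \<and>
      (\<forall>B \<in> sets borel. F u B = (INF U \<in> {U. open U \<and> B \<subseteq> U}. F u U))) \<and>
    (\<forall>U. \<forall>u \<in> L1loc. \<forall>v \<in> L1loc. open U \<longrightarrow> bounded U \<longrightarrow>
      (AE x in lebesgue. x \<in> U \<longrightarrow> u x = v x) \<longrightarrow> F u U = F v U) \<and>
    (\<forall>u \<in> L1loc. \<forall>U. open U \<longrightarrow> bounded U \<longrightarrow>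
      (u \<in> BD U \<longrightarrow>
        ennreal c1 * total_variation (sym_gradient U u) U \<le> F u U + ennreal c2 * emeasure lborel U \<and>
        F u U \<le> ennreal c3 * total_variation (sym_gradient U u) U + ennreal c4 * emeasure lborel U) \<and>
      (u \<notin> BD U \<longrightarrow> F u U = \<infinity>)) \<and>
    (\<forall>u \<in> L1loc. \<forall>W b. transpose W = - W \<longrightarrow>
      (\<forall>B \<in> sets borel. F (\<lambda>y. u y + (W *v y + b)) B = F u B)) \<and>
    (\<forall>u \<in> L1loc. \<forall>A. transpose A = A \<longrightarrow>
      (\<forall>B \<in> sets borel. F (\<lambda>y. u y + A *v y) B \<le> F u B + ennreal (c5 * norm A) * emeasure lborel B)) \<and>
    (\<forall>u \<in> L1loc. \<forall>x \<zeta> \<nu>. norm \<nu> = 1 \<longrightarrow>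
      (\<forall>B \<in> sets borel. F (\<lambda>y. u y + jump_function x \<zeta> \<nu> y) B \<le>
        F u B + ennreal (\<sigma> (norm \<zeta>)) * hausdorff (CARD('d) - 1) (B \<inter> hyperplane x \<nu>)))}"

definition functional_class_sc ::
  "real \<Rightarrow> real \<Rightarrow> real \<Rightarrow> real \<Rightarrow> real \<Rightarrow> (real \<Rightarrow> real) \<Rightarrow> ('d::finite) functional set"
  where "functional_class_sc c1 c2 c3 c4 c5 \<sigma> = {F \<in> functional_class c1 c2 c3 c4 c5 \<sigma>.
    \<forall>U. open U \<longrightarrow> (\<forall>v u. (\<forall>k :: nat. v k \<in> L1loc) \<longrightarrow> limitin L1loc_topology v u sequentially \<longrightarrow>
      F u U \<le> liminf (\<lambda>k. F (v k) U))}"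

end

theory Submission imports Defs "HOL-Library.Diagonal_Subsequence"
begin

text \<open>\<open>\<Gamma>\<close>-limits along a subsequence come from a countable base, and for one set at a time there is nothing more to
it: if the infima of \<open>F n \<cdot> U\<close> over the sets of a countable base of the topology converge, then the lower and
the upper \<open>\<Gamma>\<close>-limit agree. \<open>L1loc\<close> has a countable base (\<open>L1loc_countable_base\<close>), so a diagonal argument
(\<open>Gamma_diagonal\<close>) produces one subsequence that works for all \<open>u\<close> and for all sets \<open>U\<close> of a countable family
\<open>R\<close> of bounded open sets which can be squeezed between any compact set and any of its open neighbourhoods. What
is left is to pass from \<open>R\<close> to all bounded open sets and to recognise the limit as a member of the class. Both
are localisation arguments for the lower and upper \<open>\<Gamma>\<close>-limits \<open>lower u U\<close> and \<open>upper u U\<close>, as functions of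
\<open>U\<close>.

The limit functional is defined by the De Giorgi--Letta construction: \<open>lower u\<close> is first regularised from
inside by relatively compact open sets and then from outside by open sets. The locale \<open>letta_increasing\<close> shows
that this is a Borel measure, given the agreement on \<open>R\<close> and provided that \<open>lower u\<close> is superadditive on disjoint sets, which it inherits from
the measures \<open>F n u\<close>, and that \<open>upper u\<close> is weakly subadditive, \<open>upper u (U' \<union> V) \<le> upper u U + upper u V\<close> when
the closure of \<open>U'\<close> lies in \<open>U\<close>. The second property is the fundamental estimate: a competitor \<open>u\<close> on \<open>U\<close> and
a competitor \<open>v\<close> on \<open>V\<close> are glued by \<open>w = \<eta> u + (1 - \<eta>) v\<close> with a smooth cutoff \<open>\<eta>\<close>. The energy of \<open>w\<close> on the
transition layer is bounded through the growth conditions by the energies of \<open>u\<close> and \<open>v\<close> there plus a multiple of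
\<open>\<integral> |u - v|\<close>; among \<open>N\<close> disjoint layers one carries at most the fraction \<open>1 / N\<close> of the energies
(\<open>fundamental_estimate\<close>), and \<open>\<integral> |u - v|\<close> tends to 0 for competitors with the same limit (\<open>upper_weak_subadd\<close>).

The key fact about \<open>BD\<close> is \<open>BD_closure\<close>: an \<open>L\<^sup>1\<close>-limit of functions whose symmetrised gradients have bounded
total variation is in \<open>BD\<close>, with the same bound. It gives the lower growth bound for the limit
(\<open>lower_coercive\<close>). It also shows that lower limit, limit and upper limit agree on every bounded open set \<open>U\<close>
(\<open>upper_le_inner\<close>): if the inner regularisation is finite at \<open>U\<close>, then \<open>u\<close> is in \<open>BD U\<close>, so the upper growth bound is
a finite measure on \<open>U\<close>, and the contribution of \<open>U - K\<close> is small for a large compact set \<open>K\<close>. Behind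
\<open>BD_closure\<close> is weak compactness of bounded sequences of measures, which is obtained from the same
De Giorgi--Letta construction (\<open>weak_limit_exists\<close>); distributional identities are moved between test functions
and Borel sets by treating measures as functionals on bounded Borel functions (\<open>daniell\<close>).

Locality and the behaviour under rigid motions, linear maps and jumps pass to the limit because the
competitors can be modified in the same way. On Borel sets one also needs that the measures on the right-hand
sides are outer regular (\<open>limit_shift\<close>); for the jumps this holds since \<open>(d-1)\<close>-dimensional Hausdorff measure is
finite on bounded pieces of hyperplanes (\<open>hausdorff_hyperplane_finite\<close>).\<close>

section \<open>Infima, suprema and limits of extended nonnegative reals\<close>

lemma ennreal_tail_tendsto_0:
  fixes g :: "nat \<Rightarrow> ennreal"
  assumes "(\<Sum>k. g k) < \<infinity>"
  shows "(\<lambda>n. \<Sum>k. g (k + n)) \<longlonglongrightarrow> 0"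
proof -
  have fin: "g k \<noteq> \<infinity>" for k
    using assms sum_le_suminf[of g "{k}"] by (auto simp: top_unique)
  define h where "h k = enn2real (g k)" for k
  have g: "g k = ennreal (h k)" for k
    using fin by (auto simp: h_def less_top)
  have h0: "h k \<ge> 0" for k by (simp add: h_def)
  have sh: "summable h"
    using assms h0 unfolding g by (intro summable_suminf_not_top) auto
  have "(\<Sum>k. g (k + n)) = ennreal (\<Sum>k. h (k + n))" for n
    unfolding g using sh h0 by (intro suminf_ennreal2) (auto simp: summable_iff_shift)
  moreover have "(\<lambda>n. \<Sum>k. h (k + n)) \<longlonglongrightarrow> 0"
    using sh by (rule suminf_exist_split2)
  ultimately show ?thesis
    using tendsto_ennrealI[of "\<lambda>n. \<Sum>k. h (k + n)" 0] by simp
qed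

lemma ennreal_INF_approx:
  fixes f :: "'i \<Rightarrow> ennreal"
  assumes "(INF i\<in>I. f i) < \<infinity>" "e > 0"
  obtains i where "i \<in> I" "f i \<le> (INF i\<in>I. f i) + e"
proof -
  have "(INF i\<in>I. f i) < (INF i\<in>I. f i) + e"
    using assms ennreal_add_left_cancel_less[of "INF i\<in>I. f i" 0 e] by (auto simp: less_top[symmetric])
  then obtain i where "i \<in> I" "f i < (INF i\<in>I. f i) + e" unfolding INF_less_iff by auto
  then show ?thesis using that by (auto simp: less_imp_le)
qed

text \<open>Suprema and infima over different index sets are added in this form, because a supremum of sums over one common
index would need the two families to be directed together.\<close>

lemma SUP_add_SUP_le_ennreal:
  fixes f :: "'i \<Rightarrow> ennreal" and g :: "'j \<Rightarrow> ennreal"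
  assumes "I \<noteq> {}" "J \<noteq> {}" "\<And>i j. i \<in> I \<Longrightarrow> j \<in> J \<Longrightarrow> f i + g j \<le> c"
  shows "(SUP i\<in>I. f i) + (SUP j\<in>J. g j) \<le> c"
proof -
  have "f i + (SUP j\<in>J. g j) \<le> c" if "i \<in> I" for i
  proof -
    have "f i + (SUP j\<in>J. g j) = (SUP j\<in>J. g j + f i)"
      using assms by (subst ennreal_SUP_add_left) (auto simp: add.commute)
    also have "\<dots> \<le> c" using assms that by (intro SUP_least) (simp add: add.commute)
    finally show ?thesis .
  qed
  moreover have "(SUP i\<in>I. f i) + (SUP j\<in>J. g j) = (SUP i\<in>I. f i + (SUP j\<in>J. g j))"
    using assms by (intro ennreal_SUP_add_left[symmetric])
  ultimately show ?thesis by (simp add: SUP_least)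
qed

lemma ennreal_le_add_epsilon:
  fixes x y :: ennreal
  assumes "\<And>e::real. e > 0 \<Longrightarrow> x \<le> y + ennreal e"
  shows "x \<le> y"
  by (rule ennreal_le_epsilon) (use assms in auto)

text \<open>The common pattern behind the countable subadditivity of outer measures defined as infima over coverings or
open neighbourhoods: choose for the \<open>n\<close>-th set an almost optimal index, with error \<open>e / 2\<^sup>n\<^sup>+\<^sup>1\<close>, and combine them.\<close>

lemma INF_countably_subadditive:
  fixes h :: "'i \<Rightarrow> ennreal" and T :: "'a set \<Rightarrow> 'i set"
  assumes comb: "\<And>i. (\<And>n. i n \<in> T (A n)) \<Longrightarrow> \<exists>j \<in> T (\<Union>n. A n). h j \<le> (\<Sum>n. h (i n))"
  shows "(INF j\<in>T (\<Union>n::nat. A n). h j) \<le> (\<Sum>n. INF i\<in>T (A n). h i)"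
proof (cases "(\<Sum>n. INF i\<in>T (A n). h i) = \<infinity>")
  case True then show ?thesis by simp
next
  case False
  have fin: "(INF i\<in>T (A n). h i) < \<infinity>" for n
    using False sum_le_suminf[of "\<lambda>n. INF i\<in>T (A n). h i" "{n}"] by (auto simp: top_unique less_top)
  show ?thesis
  proof (rule ennreal_le_add_epsilon)
    fix e :: real assume e: "e > 0"
    have "\<exists>i. i \<in> T (A n) \<and> h i \<le> (INF i\<in>T (A n). h i) + ennreal (e * (1/2) ^ Suc n)" for n
      using ennreal_INF_approx[OF fin[of n], of "ennreal (e * (1/2) ^ Suc n)"] e by auto
    then obtain i where i: "\<And>n. i n \<in> T (A n)"
        "\<And>n. h (i n) \<le> (INF i\<in>T (A n). h i) + ennreal (e * (1/2) ^ Suc n)"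
      by metis
    obtain j where j: "j \<in> T (\<Union>n. A n)" "h j \<le> (\<Sum>n. h (i n))" using comb[OF i(1)] by auto
    have "(INF j\<in>T (\<Union>n. A n). h j) \<le> h j" using j by (auto intro: INF_lower)
    also have "\<dots> \<le> (\<Sum>n. (INF i\<in>T (A n). h i) + ennreal (e * (1/2) ^ Suc n))"
      by (rule order_trans[OF j(2)]) (intro suminf_le i(2) summableI)
    also have "\<dots> = (\<Sum>n. INF i\<in>T (A n). h i) + (\<Sum>n. ennreal (e * (1/2) ^ Suc n))"
      by (intro suminf_add[symmetric] summableI)
    also have "(\<Sum>n. ennreal (e * (1/2) ^ Suc n)) = ennreal (e * 1)"
      using e by (intro suminf_ennreal_eq sums_mult power_half_series) auto
    finally show "(INF j\<in>T (\<Union>n. A n). h j) \<le> (\<Sum>n. INF i\<in>T (A n). h i) + ennreal e" by simp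
  qed
qed

lemma le_INF_add_INF_ennreal:
  fixes f :: "'i \<Rightarrow> ennreal" and g :: "'j \<Rightarrow> ennreal"
  assumes "\<And>i j. i \<in> I \<Longrightarrow> j \<in> J \<Longrightarrow> c \<le> f i + g j"
  shows "c \<le> (INF i\<in>I. f i) + (INF j\<in>J. g j)"
proof (cases "(INF i\<in>I. f i) < \<infinity> \<and> (INF j\<in>J. g j) < \<infinity>")
  case False then show ?thesis by (auto simp: less_top[symmetric])
next
  case True
  show ?thesis
  proof (rule ennreal_le_add_epsilon)
    fix e :: real assume e: "e > 0"
    obtain i where i: "i \<in> I" "f i \<le> (INF i\<in>I. f i) + ennreal (e/2)"
      using ennreal_INF_approx[of f I "ennreal (e/2)"] True e by auto
    obtain j where j: "j \<in> J" "g j \<le> (INF j\<in>J. g j) + ennreal (e/2)"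
      using ennreal_INF_approx[of g J "ennreal (e/2)"] True e by auto
    have "c \<le> f i + g j" using assms i j by auto
    also have "\<dots> \<le> ((INF i\<in>I. f i) + ennreal (e/2)) + ((INF j\<in>J. g j) + ennreal (e/2))" using i j by (intro add_mono) auto
    also have "\<dots> = (INF i\<in>I. f i) + (INF j\<in>J. g j) + (ennreal (e/2) + ennreal (e/2))" by (simp only: ac_simps)
    also have "ennreal (e/2) + ennreal (e/2) = ennreal e" using e by (simp add: ennreal_plus[symmetric] del: ennreal_plus)
    finally show "c \<le> (INF i\<in>I. f i) + (INF j\<in>J. g j) + ennreal e" .
  qed
qed

lemma liminf_superadd_ennreal:
  fixes f g :: "nat \<Rightarrow> ennreal"
  shows "liminf f + liminf g \<le> liminf (\<lambda>n. f n + g n)"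
  unfolding liminf_SUP_INF[of f] liminf_SUP_INF[of g]
proof (rule SUP_add_SUP_le_ennreal)
  fix i j :: nat
  have "(INF m\<in>{i..}. f m) + (INF m\<in>{j..}. g m) \<le> (INF m\<in>{max i j..}. f m + g m)"
    by (intro INF_greatest add_mono INF_lower) auto
  also have "\<dots> \<le> liminf (\<lambda>n. f n + g n)" unfolding liminf_SUP_INF by (intro SUP_upper) auto
  finally show "(INF m\<in>{i..}. f m) + (INF m\<in>{j..}. g m) \<le> liminf (\<lambda>n. f n + g n)" .
qed auto

lemma limsup_subadd_ennreal:
  fixes f g :: "nat \<Rightarrow> ennreal"
  shows "limsup (\<lambda>n. f n + g n) \<le> limsup f + limsup g"
  unfolding limsup_INF_SUP[of f] limsup_INF_SUP[of g]
proof (rule le_INF_add_INF_ennreal)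
  fix i j :: nat
  have "limsup (\<lambda>n. f n + g n) \<le> (SUP m\<in>{max i j..}. f m + g m)" unfolding limsup_INF_SUP by (intro INF_lower) auto
  also have "\<dots> \<le> (SUP m\<in>{i..}. f m) + (SUP m\<in>{j..}. g m)" by (intro SUP_least add_mono SUP_upper) auto
  finally show "limsup (\<lambda>n. f n + g n) \<le> (SUP m\<in>{i..}. f m) + (SUP m\<in>{j..}. g m)" .
qed

lemma affine_ennreal:
  fixes a b :: ennreal assumes "a < \<infinity>"
  shows affine_ennreal_mono: "mono (\<lambda>t. a * t + b)"
    and affine_ennreal_continuous: "continuous_on UNIV (\<lambda>t. a * t + b)"
proof -
  show "mono (\<lambda>t. a * t + b)" by (intro monoI add_mono mult_left_mono) simp_all
  show "continuous_on UNIV (\<lambda>t. a * t + b)"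
    using assms by (intro continuous_on_add_ennreal ennreal_continuous_on_cmult continuous_on_id continuous_on_const) simp
qed

lemma affine_ennreal_INF:
  fixes a b :: ennreal assumes "a < \<infinity>" "I \<noteq> {}"
  shows "(INF i\<in>I. a * f i + b) = a * (INF i\<in>I. f i) + b"
proof -
  have "continuous (at_right (Inf (f ` I))) (\<lambda>t. a * t + b)"
    by (rule continuous_on_imp_continuous_within[OF affine_ennreal_continuous[OF assms(1)]]) simp_all
  from continuous_at_Inf_mono[OF affine_ennreal_mono[OF assms(1)] this] assms(2) show ?thesis
    by (simp add: image_image)
qed

lemma affine_ennreal_limsup:
  fixes a b :: ennreal assumes "a < \<infinity>"
  shows "limsup (\<lambda>n. a * f n + b) = a * limsup f + b"
  by (rule Limsup_compose_continuous_mono[OF affine_ennreal_continuous[OF assms] affine_ennreal_mono[OF assms]]) simp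

text \<open>Abstract form of the last step of the gluing argument: first \<open>N\<close>, the number of layers, is chosen large, and
then \<open>m\<close>, which controls the distance of the competitors, large depending on \<open>N\<close>.\<close>

lemma ennreal_le_of_small_perturbation:
  fixes x y t :: ennreal and g :: "nat \<Rightarrow> real"
  assumes g: "\<And>N. 0 < N \<Longrightarrow> 0 \<le> g N" and t: "t < \<infinity>"
    and le: "\<And>N m. 0 < N \<Longrightarrow> l \<le> m \<Longrightarrow> x \<le> y + ennreal (1 / real N) * t + ennreal (g N * (2 / (real m + 1)))"
  shows "x \<le> y"
proof (rule ennreal_le_add_epsilon)
  fix e :: real assume e: "e > 0"
  define t' where "t' = enn2real t"
  have t': "t = ennreal t'" "0 \<le> t'" using t by (simp_all add: t'_def less_top)
  obtain N :: nat where N: "max 0 (2 * t' / e) < real N" using reals_Archimedean2 by blast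
  then have N0: "0 < N" by simp
  have "t' / real N \<le> e / 2" using N e by (simp add: field_simps)
  then have 1: "ennreal (1 / real N) * t \<le> ennreal (e / 2)" using t' by (simp add: ennreal_mult[symmetric] ennreal_leI)
  obtain m :: nat where m: "max (real l) (4 * g N / e) < real m" using reals_Archimedean2 by blast
  have "g N * (2 / (real m + 1)) \<le> e / 2"
  proof -
    have "4 * g N < e * real m" using m e by (simp add: field_simps)
    also have "\<dots> \<le> e * (real m + 1)" using e by simp
    finally show ?thesis by (simp add: field_simps)
  qed
  then have 2: "ennreal (g N * (2 / (real m + 1))) \<le> ennreal (e / 2)" by (rule ennreal_leI)
  have "x \<le> y + ennreal (1 / real N) * t + ennreal (g N * (2 / (real m + 1)))" using N0 m by (intro le) auto
  also have "\<dots> \<le> y + ennreal (e / 2) + ennreal (e / 2)" by (intro add_mono 1 2 order_refl)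
  also have "\<dots> = y + ennreal e" using e by (simp add: add.assoc ennreal_plus[symmetric] del: ennreal_plus)
  finally show "x \<le> y + ennreal e" .
qed

text \<open>Sequential compactness of \<open>[0, \<infinity>]\<close> and a diagonal argument.\<close>

lemma ennreal_diagonal_subsequence:
  fixes a :: "'s \<Rightarrow> nat \<Rightarrow> ennreal"
  assumes "countable S"
  shows "\<exists>r. strict_mono r \<and> (\<forall>s\<in>S. convergent (\<lambda>k. a s (r k)))"
proof (cases "S = {}")
  case True then show ?thesis by (auto intro: exI[of _ id] simp: strict_mono_def)
next
  case False
  define P where "P n r \<longleftrightarrow> convergent (\<lambda>k. a (from_nat_into S n) (r k))" for n and r :: "nat \<Rightarrow> nat"
  interpret subseqs P
  proof
    fix n and s :: "nat \<Rightarrow> nat"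
    obtain l r where "strict_mono r" "((\<lambda>k. a (from_nat_into S n) (s k)) \<circ> r) \<longlonglongrightarrow> l"
      using compact_complete_linorder[of "\<lambda>k. a (from_nat_into S n) (s k)"] by auto
    then show "\<exists>r. strict_mono r \<and> P n (s \<circ> r)" by (auto simp: P_def convergent_def o_def)
  qed
  have "P k diagseq" for k
  proof -
    have "P k (diagseq \<circ> ((+) (Suc k)))"
    proof (rule diagseq_holds)
      fix n s and r :: "nat \<Rightarrow> nat" assume r: "strict_mono r" and "P n s"
      then obtain l where "(\<lambda>k. a (from_nat_into S n) (s k)) \<longlonglongrightarrow> l" by (auto simp: P_def convergent_def)
      from LIMSEQ_subseq_LIMSEQ[OF this r] show "P n (s \<circ> r)" by (auto simp: P_def convergent_def o_def)
    qed
    then have "convergent (\<lambda>m. a (from_nat_into S k) (diagseq (m + Suc k)))" by (simp add: P_def o_def add.commute)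
    then obtain l where "(\<lambda>m. a (from_nat_into S k) (diagseq (m + Suc k))) \<longlonglongrightarrow> l" by (auto simp: convergent_def)
    then show ?thesis unfolding P_def convergent_def by (intro exI[of _ l]) (rule LIMSEQ_offset)
  qed
  then have "convergent (\<lambda>k. a s (diagseq k))" if "s \<in> S" for s
    using from_nat_into_surj[OF assms that] by (auto simp: P_def)
  then show ?thesis using subseq_diagseq by blast
qed

section \<open>Measures on Borel sets\<close>

text \<open>Turns a set function into an element of type \<open>measure\<close>, for which the library lemmas are stated.\<close>

lemma measure_space_obtain:
  assumes "measure_space UNIV (sets (borel :: 'a::topological_space measure)) \<mu>"
  obtains M where "sets M = sets (borel :: 'a measure)" "\<forall>B\<in>sets borel. emeasure M B = \<mu> B"
proof
  define M where "M = measure_of UNIV (sets (borel :: 'a measure)) \<mu>"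
  have "sigma_sets UNIV (sets (borel :: 'a measure)) = sets borel"
    using sets.sigma_sets_eq[of "borel :: 'a measure"] by simp
  then show "sets M = sets borel" by (simp add: M_def)
  show "\<forall>B\<in>sets borel. emeasure M B = \<mu> B"
    using assms unfolding measure_space_def M_def by (simp add: emeasure_measure_of_sigma)
qed

lemma borel_measure_space_mono:
  assumes "measure_space UNIV (sets borel) \<mu>" "A \<subseteq> B" "A \<in> sets borel" "B \<in> sets borel"
  shows "\<mu> A \<le> \<mu> B"
proof -
  obtain M where M: "sets M = sets borel" "\<forall>B\<in>sets borel. emeasure M B = \<mu> B" by (rule measure_space_obtain[OF assms(1)])
  have "emeasure M A \<le> emeasure M B" using assms M(1) by (intro emeasure_mono) auto
  then show ?thesis using M assms by simp
qed

lemma borel_measure_space_subadd3: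
  assumes "measure_space UNIV (sets borel) \<mu>" "A \<in> sets borel" "B \<in> sets borel" "C \<in> sets borel"
  shows "\<mu> (A \<union> (B \<union> C)) \<le> \<mu> A + (\<mu> B + \<mu> C)"
proof -
  obtain M where M: "sets M = sets borel" "\<forall>B\<in>sets borel. emeasure M B = \<mu> B" by (rule measure_space_obtain[OF assms(1)])
  have "emeasure M (A \<union> (B \<union> C)) \<le> emeasure M A + emeasure M (B \<union> C)"
    using assms M(1) by (intro emeasure_subadditive) auto
  also have "\<dots> \<le> emeasure M A + (emeasure M B + emeasure M C)"
    using assms M(1) by (intro add_left_mono emeasure_subadditive) auto
  finally show ?thesis using M assms by simp
qed

lemma borel_measure_space_sum_disjoint:
  assumes "measure_space UNIV (sets borel) \<mu>" "finite I" "\<And>i. i \<in> I \<Longrightarrow> A i \<in> sets borel" "disjoint_family_on A I"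
    "\<And>i. i \<in> I \<Longrightarrow> A i \<subseteq> B" "B \<in> sets borel"
  shows "(\<Sum>i\<in>I. \<mu> (A i)) \<le> \<mu> B"
proof -
  obtain M where M: "sets M = sets borel" "\<forall>B\<in>sets borel. emeasure M B = \<mu> B" by (rule measure_space_obtain[OF assms(1)])
  have "(\<Sum>i\<in>I. emeasure M (A i)) = emeasure M (\<Union>i\<in>I. A i)"
    by (rule sum_emeasure) (use assms M(1) in auto)
  also have "\<dots> \<le> emeasure M B" using assms M(1) by (intro emeasure_mono) auto
  finally show ?thesis using M(2) assms(3,6) by simp
qed

text \<open>Caratheodory's criterion. To split \<open>A\<close> along a closed set \<open>F\<close>, one removes from \<open>A - F\<close> the points closer than
\<open>1 / (n + 1)\<close> to \<open>F\<close>. What is removed is a union of shells \<open>D k\<close>, \<open>k \<ge> n\<close>. Shells with indices of the same parity have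
positive distance from each other, so the series of their outer measures is bounded by twice that of \<open>A\<close>, and its tails
vanish. Closed sets generate the Borel sets.\<close>

lemma metric_outer_measure_borel:
  fixes f :: "'a::metric_space set \<Rightarrow> ennreal"
  assumes empty: "f {} = 0"
    and mono: "\<And>A B. A \<subseteq> B \<Longrightarrow> f A \<le> f B"
    and csub: "\<And>A :: nat \<Rightarrow> 'a set. f (\<Union>n. A n) \<le> (\<Sum>n. f (A n))"
    and sep: "\<And>A B e. e > 0 \<Longrightarrow> (\<And>x y. x \<in> A \<Longrightarrow> y \<in> B \<Longrightarrow> dist x y \<ge> e) \<Longrightarrow> f A + f B \<le> f (A \<union> B)"
  shows "measure_space UNIV (sets borel) f"
proof -
  have fsub: "f (A \<union> B) \<le> f A + f B" for A B
  proof -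
    define S where "S n = (if n = 0 then A else if n = Suc 0 then B else {})" for n :: nat
    have "(\<Union>n. S n) = A \<union> B"
      by (auto simp: S_def split: if_splits)
    moreover have "(\<Sum>n. f (S n)) = (\<Sum>n\<in>{0,Suc 0}. f (S n))"
      by (intro suminf_finite) (auto simp: S_def empty)
    moreover have "\<dots> = f A + f B" by (simp add: S_def)
    ultimately show ?thesis using csub[of S] by simp
  qed
  have closed_split: "f (A \<inter> F) + f (A - F) \<le> f A" if "closed F" for A F
  proof (cases "f A = \<infinity> \<or> F = {}")
    case True then show ?thesis by (auto simp: empty)
  next
    case False
    \<comment> \<open>The points of \<open>A\<close> at distance at least \<open>1 / (n + 1)\<close> from \<open>F\<close>, and the shells between consecutive ones.\<close>
    define E where "E n = {x \<in> A. infdist x F \<ge> 1 / (real n + 1)}" for n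
    define D where "D n = E (Suc n) - E n" for n
    have EA: "E n \<subseteq> A" and DA: "D n \<subseteq> A" for n by (auto simp: E_def D_def)
    have dist_inf: "infdist x F - infdist y F \<le> dist x y" for x y
      using infdist_triangle[of x F y] by simp
    have DE: "D n \<subseteq> {x. infdist x F \<ge> 1 / (real n + 2)}" "D n \<subseteq> {x. infdist x F < 1 / (real n + 1)}" for n
      by (auto simp: D_def E_def algebra_simps)
    \<comment> \<open>Shells of equal parity are separated by the shell between them, so \<open>sep\<close> applies.\<close>
    have altern: "(\<Sum>k<m. f (D (2*k+p))) \<le> f (\<Union>k<m. D (2*k+p))" for m p
    proof (induction m)
      case 0 then show ?case by simp
    next
      case (Suc m)
      have "f (\<Union>k<m. D (2*k+p)) + f (D (2*m+p)) \<le> f ((\<Union>k<m. D (2*k+p)) \<union> D (2*m+p))"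
      proof (rule sep)
        show "(if m = 0 then 1 else 1 / (2 * real m + p) - 1 / (2 * real m + p + 1)) > 0"
          using divide_strict_left_mono[of "2 * real m + p" "2 * real m + p + 1" 1] by auto
        fix x y assume x: "x \<in> (\<Union>k<m. D (2*k+p))" and y: "y \<in> D (2*m+p)"
        from x obtain k where k: "k < m" "x \<in> D (2*k+p)" by auto
        have "1 / (2 * real m + p) \<le> 1 / (real (2*k+p) + 2)"
          using k by (intro divide_left_mono) auto
        also have "\<dots> \<le> infdist x F" using DE(1)[of "2*k+p"] k by auto
        finally have "1 / (2 * real m + p) \<le> infdist x F" .
        moreover have "infdist y F \<le> 1 / (2 * real m + p + 1)" using DE(2)[of "2*m+p"] y by auto
        ultimately show "(if m = 0 then 1 else 1 / (2 * real m + p) - 1 / (2 * real m + p + 1)) \<le> dist x y"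
          using dist_inf[of x y] k by auto
      qed
      then have "(\<Sum>k<Suc m. f (D (2*k+p))) \<le> f ((\<Union>k<m. D (2*k+p)) \<union> D (2*m+p))"
        using order_trans[OF add_right_mono[OF Suc]] by simp
      also have "(\<Union>k<m. D (2*k+p)) \<union> D (2*m+p) = (\<Union>k<Suc m. D (2*k+p))"
        by (auto simp: less_Suc_eq)
      finally show ?case .
    qed
    have altA: "(\<Sum>k<m. f (D (2*k+p))) \<le> f A" for m p
      by (rule order_trans[OF altern mono]) (use DA in auto)
    have split2: "(\<Sum>k<2*m. g k) = (\<Sum>k<m. g (2*k+0)) + (\<Sum>k<m. g (2*k+1))" for m and g :: "nat \<Rightarrow> ennreal"
      by (induction m) (auto simp: ac_simps)
    have "(\<Sum>k. f (D k)) \<le> f A + f A"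
    proof (rule suminf_le_const[OF summableI])
      fix n
      have "(\<Sum>k<n. f (D k)) \<le> (\<Sum>k<2*n. f (D k))" by (intro sum_mono2) auto
      also have "\<dots> \<le> f A + f A"
        unfolding split2 by (intro add_mono altA)
      finally show "(\<Sum>k<n. f (D k)) \<le> f A + f A" .
    qed
    also have "\<dots> < \<infinity>" using False by (simp add: less_top)
    finally have "(\<lambda>n. \<Sum>k. f (D (k + n))) \<longlonglongrightarrow> 0" by (rule ennreal_tail_tendsto_0)
    then have lim: "(\<lambda>n. f A + (\<Sum>k. f (D (k + n)))) \<longlonglongrightarrow> f A + 0"
      by (intro tendsto_add) auto
    have "f (A \<inter> F) + f (A - F) \<le> f A + (\<Sum>k. f (D (k + n)))" for n
    proof -
      have cov: "A - F \<subseteq> E n \<union> (\<Union>k. D (k + n))"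
      proof
        fix x assume x: "x \<in> A - F"
        then have "infdist x F > 0"
          using that False in_closed_iff_infdist_zero[of F x] infdist_nonneg[of x F] by auto
        then obtain N where "inverse (real (Suc N)) < infdist x F"
          using reals_Archimedean by blast
        then have "1 / (real N + 1) < infdist x F" by (simp add: inverse_eq_divide add.commute)
        then have xE: "\<exists>N. x \<in> E N" using x by (auto simp: E_def intro!: exI[of _ N])
        define M where "M = (LEAST N. x \<in> E N)"
        have M: "x \<in> E M" unfolding M_def using xE by (rule LeastI_ex)
        have Emono: "E a \<subseteq> E b" if "a \<le> b" for a b
        proof -
          have "1 / (real b + 1) \<le> 1 / (real a + 1)" using that by (intro divide_left_mono) auto
          then show ?thesis by (auto simp: E_def)
        qed
        show "x \<in> E n \<union> (\<Union>k. D (k + n))"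
        proof (cases "M \<le> n")
          case True then show ?thesis using M Emono by blast
        next
          case nM: False
          then have k: "M = Suc ((M - Suc n) + n)" by simp
          define k where "k = M - Suc n"
          have k: "M = Suc (k + n)" using k by (simp add: k_def)
          have "x \<notin> E (k + n)"
            using not_less_Least[of "k+n" "\<lambda>N. x \<in> E N"] k unfolding M_def by auto
          then have "x \<in> D (k+n)" using M k by (auto simp: D_def)
          then show ?thesis by auto
        qed
      qed
      have "f (A \<inter> F) + f (E n) \<le> f ((A \<inter> F) \<union> E n)"
      proof (rule sep)
        show "0 < 1 / (real n + 1)" by simp
        fix x y assume "x \<in> A \<inter> F" "y \<in> E n"
        then show "1 / (real n + 1) \<le> dist x y"
          using infdist_le[of x F y] by (auto simp: E_def dist_commute)
      qed
      also have "\<dots> \<le> f A" by (rule mono) (auto simp: E_def)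
      finally have 1: "f (A \<inter> F) + f (E n) \<le> f A" .
      have "f (A - F) \<le> f (E n) + (\<Sum>k. f (D (k + n)))"
        by (rule order_trans[OF mono[OF cov] order_trans[OF fsub add_left_mono[OF csub]]])
      then have "f (A \<inter> F) + f (A - F) \<le> (f (A \<inter> F) + f (E n)) + (\<Sum>k. f (D (k + n)))"
        by (simp add: add.assoc add_left_mono)
      also have "\<dots> \<le> f A + (\<Sum>k. f (D (k + n)))" using 1 by (rule add_right_mono)
      finally show ?thesis .
    qed
    then show ?thesis using LIMSEQ_le_const[OF lim] by auto
  qed
  have oms: "outer_measure_space (Pow UNIV) f"
    using empty mono csub
    by (auto simp: outer_measure_space_def positive_def increasing_def countably_subadditive_def)
  have ms: "measure_space UNIV (lambda_system UNIV (Pow UNIV) f) f"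
    by (rule sigma_algebra.caratheodory_lemma[OF sigma_algebra_Pow oms])
  have "F \<in> lambda_system UNIV (Pow UNIV) f" if "closed F" for F
  proof -
    have "f (x \<inter> F) + f (x - F) = f x" for x
      using closed_split[OF that, of x] fsub[of "x \<inter> F" "x - F"] by (simp add: Int_Diff_Un antisym)
    then show ?thesis
      using algebra.lambda_system_eq[OF algebra_Pow, of "UNIV :: 'a set" f] by simp
  qed
  then have cl: "Collect closed \<subseteq> lambda_system UNIV (Pow UNIV) f" by blast
  have sa: "sigma_algebra UNIV (lambda_system UNIV (Pow UNIV) f)"
    using ms by (simp add: measure_space_def)
  have "sets borel = sigma_sets UNIV (Collect closed :: 'a set set)"
    by (subst borel_eq_closed) (rule sets_measure_of, simp)
  then have "sets borel \<subseteq> lambda_system UNIV (Pow UNIV) f"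
    using sigma_algebra.sigma_sets_subset[OF sa cl] by simp
  moreover have "sigma_algebra UNIV (sets (borel :: 'a measure))"
    using sets.sigma_algebra_axioms[of "borel :: 'a measure"] by simp
  ultimately show ?thesis
    by (intro measure_down[OF ms])
qed

text \<open>Finite Borel measures are outer regular; the space is cut into countably many annuli, on which the measure is
finite.\<close>

lemma locally_finite_outer_regular:
  fixes M :: "'a::euclidean_space measure"
  assumes sets: "sets M = sets borel"
    and fin: "\<And>r. emeasure M (ball 0 r) < \<infinity>"
    and B: "B \<in> sets borel"
  shows "emeasure M B = (INF U\<in>{U. open U \<and> B \<subseteq> U}. emeasure M U)"
proof (rule antisym)
  show "emeasure M B \<le> (INF U\<in>{U. open U \<and> B \<subseteq> U}. emeasure M U)"
    by (intro INF_greatest emeasure_mono) (auto simp: sets)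
  define A where "A n = B \<inter> ball 0 (real (Suc n)) - ball 0 (real n)" for n :: nat
  have Bm[measurable]: "A n \<in> sets borel" for n using B by (simp add: A_def)
  have UA: "(\<Union>n. A n) = B"
  proof -
    have "x \<in> (\<Union>n. A n)" if "x \<in> B" for x
    proof -
      define n where "n = nat \<lfloor>norm x\<rfloor>"
      have "real n \<le> norm x" "norm x < real (Suc n)" unfolding n_def by (auto simp: floor_le_iff) linarith+
      then show ?thesis using that by (auto simp: A_def)
    qed
    then show ?thesis by (auto simp: A_def)
  qed
  have disj: "disjoint_family A"
    unfolding disjoint_family_on_def
  proof (intro ballI impI, rule ccontr)
    fix m n :: nat assume mn: "m \<noteq> n" "A m \<inter> A n \<noteq> {}"
    then obtain x where "x \<in> A m" "x \<in> A n" by auto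
    then have "real m \<le> norm x" "norm x < real (Suc m)" "real n \<le> norm x" "norm x < real (Suc n)"
      by (auto simp: A_def)
    then have "m < Suc n" "n < Suc m" by linarith+
    then show False using mn by simp
  qed
  have reg: "emeasure M (A n) = (INF U\<in>{U. open U \<and> A n \<subseteq> U}. emeasure M U)" for n
  proof (rule antisym)
    show "emeasure M (A n) \<le> (INF U\<in>{U. open U \<and> A n \<subseteq> U}. emeasure M U)"
      by (intro INF_greatest emeasure_mono) (auto simp: sets)
    define Ob where "Ob = ball (0::'a) (real (Suc n))"
    define N where "N = density M (indicator Ob)"
    have eN: "emeasure N X = emeasure M (Ob \<inter> X)" if "X \<in> sets borel" for X
      using that measurable_cong_sets[OF sets refl, of "borel :: ennreal measure"]
      unfolding N_def by (intro emeasure_restricted) (auto simp: sets Ob_def)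
    have "emeasure M (A n) = emeasure N (A n)"
      by (subst eN[OF Bm]) (auto simp: A_def Ob_def intro!: arg_cong[where f="emeasure M"])
    also have "\<dots> = (INF U \<in> {U. A n \<subseteq> U \<and> open U}. emeasure N U)"
    proof (rule outer_regular)
      show "sets N = sets borel" by (simp add: N_def sets)
      have "emeasure N (space N) = emeasure M Ob"
        using eN[of UNIV] by (simp add: N_def sets_eq_imp_space_eq[OF sets])
      then show "emeasure N (space N) \<noteq> \<infinity>" using fin[of "real (Suc n)"] by (simp add: Ob_def)
    qed simp
    also have "\<dots> \<ge> (INF U\<in>{U. open U \<and> A n \<subseteq> U}. emeasure M U)"
    proof (rule INF_greatest, safe)
      fix U assume U: "A n \<subseteq> U" "open U"
      show "(INF U\<in>{U. open U \<and> A n \<subseteq> U}. emeasure M U) \<le> emeasure N U"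
        using U by (subst eN) (auto intro!: INF_lower simp: Ob_def A_def)
    qed
    finally show "(INF U\<in>{U. open U \<and> A n \<subseteq> U}. emeasure M U) \<le> emeasure M (A n)" .
  qed
  have "(INF U\<in>{U. open U \<and> (\<Union>n. A n) \<subseteq> U}. emeasure M U) \<le> (\<Sum>n. INF U\<in>{U. open U \<and> A n \<subseteq> U}. emeasure M U)"
  proof (rule INF_countably_subadditive)
    fix U assume U: "\<And>n. U n \<in> {U. open U \<and> A n \<subseteq> U}"
    then show "\<exists>V\<in>{U. open U \<and> (\<Union>n. A n) \<subseteq> U}. emeasure M V \<le> (\<Sum>n. emeasure M (U n))"
      by (intro bexI[of _ "\<Union>n. U n"] emeasure_subadditive_countably) (auto simp: sets)
  qed
  also have "\<dots> = (\<Sum>n. emeasure M (A n))" by (simp add: reg)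
  also have "\<dots> = emeasure M B" using disj by (subst suminf_emeasure) (auto simp: sets UA)
  finally show "(INF U\<in>{U. open U \<and> B \<subseteq> U}. emeasure M U) \<le> emeasure M B" by (simp add: UA)
qed

lemma sets_borel_lebesgue: "sets borel \<subseteq> sets (lebesgue :: 'a::euclidean_space measure)"
  using sets_completionI_sub[of "lborel :: 'a measure"] by auto

lemma bounded_open_finite_measure:
  fixes U :: "'a::euclidean_space set"
  assumes "open U" "bounded U" shows "emeasure lborel U < \<infinity>"
  using emeasure_bounded_finite[OF assms(2)] by simp

lemma emeasure_bounded_open:
  fixes U :: "'a::euclidean_space set"
  shows "open U \<Longrightarrow> bounded U \<Longrightarrow> emeasure lborel U = ennreal (measure lborel U)"
  using bounded_open_finite_measure[of U] by (simp add: emeasure_eq_ennreal_measure less_top[symmetric])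

text \<open>Finite unions of bounded sets of a countable base.\<close>

lemma countable_dense_opens:
  obtains R :: "'a::euclidean_space set set" where "countable R" "\<And>U. U \<in> R \<Longrightarrow> open U" "\<And>U. U \<in> R \<Longrightarrow> bounded U"
    "\<And>K U. compact K \<Longrightarrow> open U \<Longrightarrow> K \<subseteq> U \<Longrightarrow> \<exists>V\<in>R. K \<subseteq> V \<and> closure V \<subseteq> U"
proof -
  obtain B :: "'a set set" where B: "countable B" "topological_basis B"
    using ex_countable_basis by auto
  define R where "R = Union ` {F. finite F \<and> F \<subseteq> {b\<in>B. bounded b}}"
  have "countable {F. finite F \<and> F \<subseteq> {b\<in>B. bounded b}}"
    using B by (intro countable_Collect_finite_subset) auto
  then have "countable R" unfolding R_def by (rule countable_image)
  moreover have "open U" "bounded U" if "U \<in> R" for U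
    using that B topological_basis_open[of B] by (auto simp: R_def intro!: open_Union)
  moreover have "\<exists>V\<in>R. K \<subseteq> V \<and> closure V \<subseteq> U" if "compact K" "open U" "K \<subseteq> U" for K U
  proof -
    have "\<exists>b\<in>B. x \<in> b \<and> bounded b \<and> closure b \<subseteq> U" if x: "x \<in> K" for x
    proof -
      obtain e where e: "e > 0" "cball x e \<subseteq> U"
        using \<open>open U\<close> \<open>K \<subseteq> U\<close> x open_contains_cball by blast
      obtain b where b: "b \<in> B" "x \<in> b" "b \<subseteq> ball x e"
        using topological_basisE[OF B(2), of "ball x e" x] e by auto
      have "closure b \<subseteq> cball x e"
        using b(3) ball_subset_cball closure_minimal[of b "cball x e"] by (meson closed_cball order_trans)
      moreover have "bounded b" using b(3) bounded_ball bounded_subset by blast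
      ultimately show ?thesis using b e by (intro bexI[of _ b]) auto
    qed
    then obtain b where b: "\<And>x. x \<in> K \<Longrightarrow> b x \<in> B \<and> x \<in> b x \<and> bounded (b x) \<and> closure (b x) \<subseteq> U"
      by metis
    then have "\<And>x. x \<in> K \<Longrightarrow> open (b x)" using B topological_basis_open by blast
    then obtain D where D: "D \<subseteq> K" "finite D" "K \<subseteq> (\<Union>x\<in>D. b x)"
      using compactE_image[of K K b] \<open>compact K\<close> b by (metis UN_I subsetI)
    have "\<Union>(b ` D) \<in> R" using D b by (auto simp: R_def)
    moreover have "closure (\<Union>(b ` D)) \<subseteq> U"
    proof -
      have "closure (\<Union>(b ` D)) \<subseteq> (\<Union>x\<in>D. closure (b x))"
        using D by (intro closure_minimal closed_UN UN_mono closure_subset) auto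
      then show ?thesis using D b by blast
    qed
    ultimately show ?thesis using D by auto
  qed
  ultimately show ?thesis using that by blast
qed

section \<open>The De Giorgi--Letta criterion\<close>

text \<open>The set functions \<open>al\<close> and \<open>be\<close> model a lower and an upper limit of a sequence of measures or of local functionals. On
general open sets the lower limit fails to be subadditive and the upper limit fails to be superadditive, and the
two may differ. They agree on the family \<open>R\<close>, however, and a set of \<open>R\<close> fits between any compact set and any of its
open neighbourhoods. So \<open>al\<close> and \<open>be\<close> have the same inner regularisation, which inherits the good property of
each of them.\<close>

locale letta_increasing =
  fixes al be :: "'a::euclidean_space set \<Rightarrow> ennreal" and R :: "'a set set"
  assumes al_le_be: "\<And>U. open U \<Longrightarrow> bounded U \<Longrightarrow> al U \<le> be U"
    and al_mono: "\<And>U V. open U \<Longrightarrow> open V \<Longrightarrow> bounded V \<Longrightarrow> U \<subseteq> V \<Longrightarrow> al U \<le> al V"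
    and be_mono: "\<And>U V. open U \<Longrightarrow> open V \<Longrightarrow> bounded V \<Longrightarrow> U \<subseteq> V \<Longrightarrow> be U \<le> be V"
    and be_empty: "be {} = 0"
    and al_super: "\<And>U V. open U \<Longrightarrow> open V \<Longrightarrow> bounded U \<Longrightarrow> bounded V \<Longrightarrow> U \<inter> V = {} \<Longrightarrow>
        al U + al V \<le> al (U \<union> V)"
    and be_sub: "\<And>U' U V. open U' \<Longrightarrow> open U \<Longrightarrow> open V \<Longrightarrow> bounded U \<Longrightarrow> bounded V \<Longrightarrow>
        closure U' \<subseteq> U \<Longrightarrow> be (U' \<union> V) \<le> be U + be V"
    and be_le_al: "\<And>U. U \<in> R \<Longrightarrow> open U \<Longrightarrow> bounded U \<Longrightarrow> be U \<le> al U"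
    and dense: "\<And>K U. compact K \<Longrightarrow> open U \<Longrightarrow> K \<subseteq> U \<Longrightarrow>
        \<exists>V\<in>R. open V \<and> bounded V \<and> K \<subseteq> V \<and> closure V \<subseteq> U"
begin

definition inner :: "'a set \<Rightarrow> ennreal" where
  "inner U = (SUP V\<in>{V. open V \<and> bounded V \<and> closure V \<subseteq> U}. al V)"

definition outer :: "'a set \<Rightarrow> ennreal" where
  "outer B = (INF U\<in>{U. open U \<and> B \<subseteq> U}. inner U)"

lemma inner_mono: "U \<subseteq> V \<Longrightarrow> inner U \<le> inner V"
  unfolding inner_def by (intro SUP_subset_mono) auto

lemma inner_le_al: "open U \<Longrightarrow> bounded U \<Longrightarrow> inner U \<le> al U"
  unfolding inner_def by (intro SUP_least al_mono) (auto dest: order_trans[OF closure_subset])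

lemma al_le_inner: "open V \<Longrightarrow> bounded V \<Longrightarrow> closure V \<subseteq> U \<Longrightarrow> al V \<le> inner U"
  unfolding inner_def by (intro SUP_upper) auto

text \<open>The link between the two limits: a member of \<open>R\<close> between \<open>closure V\<close> and \<open>U\<close> is where \<open>be\<close> is exchanged for \<open>al\<close>.\<close>

lemma be_le_inner:
  assumes "open V" "bounded V" "closure V \<subseteq> U" "open U"
  shows "be V \<le> inner U"
proof -
  obtain W where W: "W \<in> R" "open W" "bounded W" "closure V \<subseteq> W" "closure W \<subseteq> U"
    using dense[of "closure V" U] assms by (auto simp: compact_closure)
  have "be V \<le> be W" using W assms closure_subset[of V] by (intro be_mono) auto
  also have "\<dots> \<le> al W" using W by (intro be_le_al)
  also have "\<dots> \<le> inner U" using W by (intro al_le_inner)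
  finally show ?thesis .
qed

lemma inner_superadd:
  assumes "open U" "open V" "U \<inter> V = {}"
  shows "inner U + inner V \<le> inner (U \<union> V)"
proof -
  have ne: "{W. open W \<and> bounded W \<and> closure W \<subseteq> U} \<noteq> {}" for U :: "'a set"
    by (auto intro!: exI[of _ "{}"])
  have "al X + al Y \<le> inner (U \<union> V)" if "open X" "bounded X" "closure X \<subseteq> U"
     "open Y" "bounded Y" "closure Y \<subseteq> V" for X Y
  proof -
    have "X \<inter> Y = {}" using that assms closure_subset[of X] closure_subset[of Y] by blast
    then have "al X + al Y \<le> al (X \<union> Y)" using that by (intro al_super)
    also have "\<dots> \<le> inner (U \<union> V)" using that by (intro al_le_inner) auto
    finally show ?thesis .
  qed
  then show ?thesis
    unfolding inner_def[of U] inner_def[of V] by (intro SUP_add_SUP_le_ennreal ne) auto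
qed

text \<open>The part of \<open>closure W\<close> outside \<open>V\<close> is compact in \<open>U\<close> and the rest is covered by a relatively compact part of \<open>V\<close>; then
weak subadditivity of \<open>be\<close> applies.\<close>

lemma inner_subadd:
  assumes "open U" "open V"
  shows "inner (U \<union> V) \<le> inner U + inner V"
  unfolding inner_def[of "U \<union> V"]
proof (rule SUP_least, safe)
  fix W assume W: "open W" "bounded W" "closure W \<subseteq> U \<union> V"
  \<comment> \<open>\<open>U1\<close> takes care of the part outside \<open>V\<close>, \<open>V1\<close> of the part outside \<open>U1\<close>; \<open>U2\<close> leaves room for weak subadditivity.\<close>
  have "compact (closure W - V)" using W assms by (intro compact_diff) auto
  moreover have "closure W - V \<subseteq> U" using W by auto
  ultimately obtain U1 where U1: "open U1" "bounded U1" "closure W - V \<subseteq> U1" "closure U1 \<subseteq> U"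
    using dense[of "closure W - V" U] assms by auto
  obtain U2 where U2: "open U2" "bounded U2" "closure U1 \<subseteq> U2" "closure U2 \<subseteq> U"
    using dense[of "closure U1" U] assms U1 by (auto simp: compact_closure)
  have "compact (closure W - U1)" using W U1 by (intro compact_diff) auto
  moreover have "closure W - U1 \<subseteq> V" using U1 by auto
  ultimately obtain V1 where V1: "open V1" "bounded V1" "closure W - U1 \<subseteq> V1" "closure V1 \<subseteq> V"
    using dense[of "closure W - U1" V] assms by auto
  have "al W \<le> be W" using W by (intro al_le_be)
  also have "W \<subseteq> U1 \<union> V1" using V1 closure_subset[of W] by auto
  then have "be W \<le> be (U1 \<union> V1)" using U1 V1 W by (intro be_mono) auto
  also have "\<dots> \<le> be U2 + be V1" using U1 U2 V1 by (intro be_sub)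
  also have "\<dots> \<le> inner U + inner V" using U2 V1 assms by (intro add_mono be_le_inner)
  finally show "al W \<le> inner U + inner V" .
qed

lemma inner_empty: "inner {} = 0"
  using inner_le_al[of "{}"] al_le_be[of "{}"] be_empty by auto

lemma inner_countable_subadd:
  assumes "\<And>n::nat. open (U n)"
  shows "inner (\<Union>n. U n) \<le> (\<Sum>n. inner (U n))"
  unfolding inner_def[of "\<Union>n. U n"]
proof (rule SUP_least, safe)
  fix W assume W: "open W" "bounded W" "closure W \<subseteq> (\<Union>n. U n)"
  have fin: "inner (\<Union>n\<in>I. U n) \<le> (\<Sum>n\<in>I. inner (U n))" if "finite I" for I
    using that
  proof induction
    case empty then show ?case by (simp add: inner_empty)
  next
    case (insert i I)
    have "inner (\<Union>n\<in>insert i I. U n) \<le> inner (U i) + inner (\<Union>n\<in>I. U n)"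
      using assms by (auto intro!: inner_subadd)
    also have "\<dots> \<le> inner (U i) + (\<Sum>n\<in>I. inner (U n))" using insert by (intro add_left_mono)
    finally show ?case using insert by simp
  qed
  have "compact (closure W)" using W by (simp add: compact_closure)
  then obtain I where I: "finite I" "closure W \<subseteq> (\<Union>n\<in>I. U n)"
    using compactE_image[of "closure W" UNIV U] W assms by metis
  have "al W \<le> inner (\<Union>n\<in>I. U n)" using W I by (intro al_le_inner)
  also have "\<dots> \<le> (\<Sum>n\<in>I. inner (U n))" using fin I by auto
  also have "\<dots> \<le> (\<Sum>n. inner (U n))" using I by (intro sum_le_suminf) auto
  finally show "al W \<le> (\<Sum>n. inner (U n))" .
qed

lemma outer_open: "open U \<Longrightarrow> outer U = inner U"
  unfolding outer_def by (auto intro!: antisym INF_lower INF_greatest inner_mono)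

text \<open>Sets at distance \<open>e\<close> from each other have disjoint open \<open>e/2\<close>-neighbourhoods, on which \<open>inner\<close> is superadditive;
so \<open>outer\<close> is a metric outer measure.\<close>

lemma measure_space_outer: "measure_space UNIV (sets borel) outer"
proof (rule metric_outer_measure_borel)
  show "outer {} = 0" by (simp add: outer_open inner_empty)
  show "outer A \<le> outer B" if "A \<subseteq> B" for A B
    unfolding outer_def using that by (intro INF_superset_mono) auto
  show "outer (\<Union>n. A n) \<le> (\<Sum>n. outer (A n))" for A :: "nat \<Rightarrow> 'a set"
    unfolding outer_def
  proof (rule INF_countably_subadditive)
    fix U assume "\<And>n. U n \<in> {U. open U \<and> A n \<subseteq> U}"
    then show "\<exists>j\<in>{U. open U \<and> (\<Union>n. A n) \<subseteq> U}. inner j \<le> (\<Sum>n. inner (U n))"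
      by (intro bexI[of _ "\<Union>n. U n"] inner_countable_subadd) auto
  qed
  fix A B :: "'a set" and e :: real
  assume e: "e > 0" and AB: "\<And>x y. x \<in> A \<Longrightarrow> y \<in> B \<Longrightarrow> e \<le> dist x y"
  show "outer A + outer B \<le> outer (A \<union> B)"
    unfolding outer_def[of "A \<union> B"]
  proof (rule INF_greatest, safe)
    fix U assume U: "open U" "A \<union> B \<subseteq> U"
    define NA where "NA = U \<inter> (\<Union>x\<in>A. ball x (e/2))"
    define NB where "NB = U \<inter> (\<Union>x\<in>B. ball x (e/2))"
    have NO: "open NA" "open NB" "A \<subseteq> NA" "B \<subseteq> NB" "NA \<union> NB \<subseteq> U"
      using U e by (auto simp: NA_def NB_def)
    have disj: "NA \<inter> NB = {}"
    proof (safe)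
      fix z assume "z \<in> NA" "z \<in> NB"
      then obtain x y where "x \<in> A" "y \<in> B" "dist x z < e/2" "dist y z < e/2"
        by (auto simp: NA_def NB_def)
      then show "z \<in> {}" using AB[of x y] dist_triangle[of x y z] by (auto simp: dist_commute)
    qed
    have "outer A + outer B \<le> inner NA + inner NB"
      unfolding outer_def using NO by (intro add_mono INF_lower) auto
    also have "\<dots> \<le> inner (NA \<union> NB)" using NO disj by (intro inner_superadd)
    also have "\<dots> \<le> inner U" using NO by (intro inner_mono)
    finally show "outer A + outer B \<le> inner U" .
  qed
qed

end

section \<open>Hausdorff measure\<close>

text \<open>Naming the summand and the admissible coverings of the definition makes the premeasure an infimum of the shape
treated by \<open>INF_countably_subadditive\<close>.\<close>

definition hausdorff_weight :: "nat \<Rightarrow> 'a::metric_space set \<Rightarrow> ennreal" where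
  "hausdorff_weight k C = (if C = {} then 0 else ennreal (unit_ball_vol (real k) * (diameter C / 2) ^ k))"

definition hausdorff_covers :: "real \<Rightarrow> 'a::metric_space set \<Rightarrow> (nat \<Rightarrow> 'a set) set" where
  "hausdorff_covers \<delta> B = {C. B \<subseteq> (\<Union>n. C n) \<and> (\<forall>n. bounded (C n) \<and> diameter (C n) \<le> \<delta>)}"

lemma hausdorff_pre_eq:
  "hausdorff_pre k \<delta> B = (INF C\<in>hausdorff_covers \<delta> B. \<Sum>n. hausdorff_weight k (C n))"
  by (simp add: hausdorff_pre_def hausdorff_covers_def hausdorff_weight_def)

lemma hausdorff_pre_mono: "A \<subseteq> B \<Longrightarrow> hausdorff_pre k \<delta> A \<le> hausdorff_pre k \<delta> B"
  unfolding hausdorff_pre_eq by (intro INF_superset_mono) (auto simp: hausdorff_covers_def)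

lemma hausdorff_pre_antimono: "\<delta> \<le> \<delta>' \<Longrightarrow> hausdorff_pre k \<delta>' A \<le> hausdorff_pre k \<delta> A"
  unfolding hausdorff_pre_eq
  by (intro INF_superset_mono) (auto simp: hausdorff_covers_def intro: order_trans)

lemma hausdorff_mono: "A \<subseteq> B \<Longrightarrow> hausdorff k A \<le> hausdorff k B"
  unfolding hausdorff_def by (intro SUP_mono) (auto intro!: hausdorff_pre_mono)

lemma hausdorff_pre_countable_subadd:
  "hausdorff_pre k \<delta> (\<Union>n::nat. A n) \<le> (\<Sum>n. hausdorff_pre k \<delta> (A n))"
  unfolding hausdorff_pre_eq
proof (rule INF_countably_subadditive)
  fix C assume C: "\<And>n. C n \<in> hausdorff_covers \<delta> (A n)"
  \<comment> \<open>The coverings of the sets \<open>A n\<close>, enumerated as a single sequence.\<close>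
  define D where "D m = (case prod_decode m of (n, i) \<Rightarrow> C n i)" for m
  have "(\<Sum>m. hausdorff_weight k (D m)) = (\<Sum>n. \<Sum>i. hausdorff_weight k (C n i))"
  proof -
    have "(\<Sum>m. (case prod_decode m of (n, i) \<Rightarrow> hausdorff_weight k (C n i))) = (\<Sum>n. \<Sum>i. hausdorff_weight k (C n i))"
      using suminf_ennreal_2dimen[of "\<lambda>n. \<Sum>i. hausdorff_weight k (C n i)" "\<lambda>(n, i). hausdorff_weight k (C n i)"]
      by (simp add: comp_def)
    then show ?thesis by (simp add: D_def split_beta)
  qed
  moreover have "D \<in> hausdorff_covers \<delta> (\<Union>n. A n)"
  proof -
    have "x \<in> (\<Union>m. D m)" if "x \<in> A n" for x n
    proof -
      have "x \<in> (\<Union>i. C n i)" using C[of n] that by (auto simp: hausdorff_covers_def)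
      then obtain i where "x \<in> C n i" by auto
      then show ?thesis by (auto simp: D_def intro!: exI[of _ "prod_encode (n,i)"])
    qed
    then show ?thesis using C by (auto simp: hausdorff_covers_def D_def split: prod.split)
  qed
  ultimately show "\<exists>D\<in>hausdorff_covers \<delta> (\<Union>n. A n).
      (\<Sum>m. hausdorff_weight k (D m)) \<le> (\<Sum>n. \<Sum>i. hausdorff_weight k (C n i))"
    by (intro bexI[of _ D]) auto
qed

lemma hausdorff_pre_le: "\<delta> > 0 \<Longrightarrow> hausdorff_pre k \<delta> A \<le> hausdorff k A"
  unfolding hausdorff_def by (intro SUP_upper) auto

lemma hausdorff_empty [simp]: "hausdorff k ({} :: 'a::metric_space set) = 0"
proof -
  have "hausdorff_pre k \<delta> ({} :: 'a set) \<le> (\<Sum>n. hausdorff_weight k ({} :: 'a set))" if "\<delta> > 0" for \<delta> :: real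
  proof -
    have "(\<lambda>_. {}) \<in> hausdorff_covers \<delta> ({} :: 'a set)"
      using that by (auto simp: hausdorff_covers_def diameter_def)
    then show ?thesis unfolding hausdorff_pre_eq by (rule INF_lower)
  qed
  then show ?thesis by (auto simp: hausdorff_def hausdorff_weight_def)
qed

text \<open>A covering set of diameter less than \<open>e\<close> cannot meet two sets at distance \<open>e\<close>, so every fine covering of
the union splits into coverings of the two parts.\<close>

lemma measure_space_hausdorff:
  "measure_space UNIV (sets borel) (hausdorff k :: 'a::metric_space set \<Rightarrow> ennreal)"
proof (rule metric_outer_measure_borel)
  show "hausdorff k A \<le> hausdorff k B" if "A \<subseteq> B" for A B :: "'a set"
    using that by (rule hausdorff_mono)
  show "hausdorff k (\<Union>n. A n) \<le> (\<Sum>n. hausdorff k (A n))" for A :: "nat \<Rightarrow> 'a set"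
    unfolding hausdorff_def[of k "\<Union>n. A n"]
    by (intro SUP_least order_trans[OF hausdorff_pre_countable_subadd] suminf_le hausdorff_pre_le summableI) auto
  fix A B :: "'a set" and e :: real
  assume e: "e > 0" and AB: "\<And>x y. x \<in> A \<Longrightarrow> y \<in> B \<Longrightarrow> e \<le> dist x y"
  have pre: "hausdorff_pre k \<delta> A + hausdorff_pre k \<delta> B \<le> hausdorff_pre k \<delta> (A \<union> B)" if "\<delta> > 0" "\<delta> < e" for \<delta>
    unfolding hausdorff_pre_eq[of k \<delta> "A \<union> B"]
  proof (rule INF_greatest)
    fix C assume C: "C \<in> hausdorff_covers \<delta> (A \<union> B)"
    \<comment> \<open>Only the covering sets that meet \<open>X\<close> are kept.\<close>
    define P where "P X n = (if C n \<inter> X = {} then {} else C n)" for X :: "'a set" and n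
    have P: "P X \<in> hausdorff_covers \<delta> X" if XAB: "X \<subseteq> A \<union> B" for X
    proof -
      have "X \<subseteq> (\<Union>n. P X n)"
      proof
        fix x assume x: "x \<in> X"
        have "x \<in> (\<Union>n. C n)" using x C XAB unfolding hausdorff_covers_def by blast
        then obtain n where "x \<in> C n" by blast
        then show "x \<in> (\<Union>n. P X n)" using x by (auto simp: P_def intro!: exI[of _ n])
      qed
      moreover have "bounded (P X n) \<and> diameter (P X n) \<le> \<delta>" for n
        using C \<open>\<delta> > 0\<close> by (auto simp: hausdorff_covers_def P_def diameter_def[of "{}"])
      ultimately show ?thesis by (simp add: hausdorff_covers_def)
    qed
    have PA: "P A \<in> hausdorff_covers \<delta> A" and PB: "P B \<in> hausdorff_covers \<delta> B" by (auto intro!: P)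
    have "hausdorff_weight k (P A n) + hausdorff_weight k (P B n) \<le> hausdorff_weight k (C n)" for n
    proof (cases "C n \<inter> A = {} \<or> C n \<inter> B = {}")
      case True then show ?thesis by (auto simp: P_def hausdorff_weight_def)
    next
      case False
      then obtain x y where "x \<in> C n" "x \<in> A" "y \<in> C n" "y \<in> B" by auto
      moreover from this have "dist x y \<le> diameter (C n)"
        using C by (intro diameter_bounded_bound) (auto simp: hausdorff_covers_def)
      moreover have "diameter (C n) \<le> \<delta>" using C by (auto simp: hausdorff_covers_def)
      ultimately show ?thesis using AB[of x y] that by auto
    qed
    then have "(\<Sum>n. hausdorff_weight k (P A n)) + (\<Sum>n. hausdorff_weight k (P B n)) \<le> (\<Sum>n. hausdorff_weight k (C n))"
      by (subst suminf_add) (auto intro!: suminf_le)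
    moreover have "hausdorff_pre k \<delta> A \<le> (\<Sum>n. hausdorff_weight k (P A n))"
        "hausdorff_pre k \<delta> B \<le> (\<Sum>n. hausdorff_weight k (P B n))"
      unfolding hausdorff_pre_eq using PA PB by (auto intro: INF_lower)
    ultimately show "hausdorff_pre k \<delta> A + hausdorff_pre k \<delta> B \<le> (\<Sum>n. hausdorff_weight k (C n))"
      by (meson add_mono order_trans)
  qed
  have "hausdorff_pre k \<delta>1 A + hausdorff_pre k \<delta>2 B \<le> hausdorff k (A \<union> B)" if "\<delta>1 > 0" "\<delta>2 > 0" for \<delta>1 \<delta>2
  proof -
    define \<delta> where "\<delta> = min (min \<delta>1 \<delta>2) (e/2)"
    have \<delta>: "\<delta> > 0" "\<delta> < e" using that e by (auto simp: \<delta>_def)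
    have "hausdorff_pre k \<delta>1 A + hausdorff_pre k \<delta>2 B \<le> hausdorff_pre k \<delta> A + hausdorff_pre k \<delta> B"
      by (intro add_mono hausdorff_pre_antimono) (auto simp: \<delta>_def)
    also have "\<dots> \<le> hausdorff_pre k \<delta> (A \<union> B)" using \<delta> by (intro pre)
    also have "\<dots> \<le> hausdorff k (A \<union> B)" using \<delta> by (intro hausdorff_pre_le)
    finally show ?thesis .
  qed
  moreover have ne: "{0::real<..} \<noteq> {}" by auto
  ultimately show "hausdorff k A + hausdorff k B \<le> hausdorff k (A \<union> B)"
    unfolding hausdorff_def[of k A] hausdorff_def[of k B] by (intro SUP_add_SUP_le_ennreal ne) auto
qed simp

lemma hausdorff_pre_finite_cover:
  fixes Cv :: "'i \<Rightarrow> 'a::metric_space set"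
  assumes "finite Q" "B \<subseteq> (\<Union>q\<in>Q. Cv q)" "\<And>q. q \<in> Q \<Longrightarrow> bounded (Cv q)" "\<And>q. q \<in> Q \<Longrightarrow> diameter (Cv q) \<le> \<delta>" "\<delta> > 0"
  shows "hausdorff_pre k \<delta> B \<le> of_nat (card Q) * ennreal (unit_ball_vol (real k) * (\<delta> / 2) ^ k)"
proof -
  obtain e where e: "bij_betw e {..<card Q} Q"
    using ex_bij_betw_nat_finite[OF assms(1)] by (auto simp: lessThan_atLeast0)
  define C where "C n = (if n < card Q then Cv (e n) else {})" for n
  have "C \<in> hausdorff_covers \<delta> B"
  proof -
    have "x \<in> (\<Union>n. C n)" if xB: "x \<in> B" for x
    proof -
      obtain q where "q \<in> Q" "x \<in> Cv q" using xB assms(2) by blast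
      then have "q \<in> e ` {..<card Q}" using e by (simp add: bij_betw_def)
      then obtain n where "n < card Q" "e n = q" by auto
      then show ?thesis using \<open>x \<in> Cv q\<close> by (auto simp: C_def intro!: exI[of _ n])
    qed
    moreover have "e n \<in> Q" if "n < card Q" for n using e that by (auto simp: bij_betw_def)
    ultimately show ?thesis
      using assms by (auto simp: hausdorff_covers_def C_def diameter_def[of "{}"])
  qed
  then have "hausdorff_pre k \<delta> B \<le> (\<Sum>n. hausdorff_weight k (C n))"
    unfolding hausdorff_pre_eq by (rule INF_lower)
  also have "\<dots> = (\<Sum>n<card Q. hausdorff_weight k (C n))"
    by (intro suminf_finite) (auto simp: C_def hausdorff_weight_def)
  also have "\<dots> \<le> (\<Sum>n<card Q. ennreal (unit_ball_vol (real k) * (\<delta> / 2) ^ k))"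
  proof (intro sum_mono)
    fix n assume "n \<in> {..<card Q}"
    then have "e n \<in> Q" using e by (auto simp: bij_betw_def)
    then show "hausdorff_weight k (C n) \<le> ennreal (unit_ball_vol (real k) * (\<delta> / 2) ^ k)"
      using assms \<open>n \<in> _\<close>
      by (auto simp: hausdorff_weight_def C_def intro!: ennreal_leI mult_left_mono power_mono diameter_ge_0)
  qed
  finally show ?thesis by simp
qed

text \<open>On a hyperplane with \<open>\<nu> $ i \<noteq> 0\<close> the \<open>i\<close>-th coordinate is a Lipschitz function of the other \<open>d - 1\<close> coordinates. So a
grid of mesh \<open>1 / m\<close> in those coordinates cuts the ball into at most \<open>c m\<^sup>d\<^sup>-\<^sup>1\<close> pieces, each of diameter at most \<open>L / m\<close>.\<close>

lemma hausdorff_hyperplane_finite: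
  fixes x \<nu> :: "real^'d::finite"
  assumes "norm \<nu> = 1"
  shows "hausdorff (CARD('d) - 1) (cball 0 r \<inter> hyperplane x \<nu>) < \<infinity>"
proof -
  have "\<nu> \<noteq> 0" using assms by auto
  then obtain i where i: "\<nu> $ i \<noteq> 0" by (auto simp: vec_eq_iff)
  define k where "k = CARD('d) - 1"
  define L where "L = real CARD('d) * (1 + (\<Sum>j\<in>UNIV. \<bar>\<nu> $ j\<bar>) / \<bar>\<nu> $ i\<bar>)"
  have L0: "L > 0" unfolding L_def by (intro mult_pos_pos add_pos_nonneg) (auto intro!: divide_nonneg_nonneg sum_nonneg)
  obtain r0 :: nat where r0: "r \<le> real r0" using real_arch_simple by blast
  define K where "K = unit_ball_vol (real k) * ((2 * real r0 + 1) * L / 2) ^ k"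
  have bound: "hausdorff_pre k (L / real m) (cball 0 r \<inter> hyperplane x \<nu>) \<le> ennreal K" if m: "m > 0" for m :: nat
  proof -
    define Q :: "('d \<Rightarrow> int) set" where "Q = PiE (UNIV - {i}) (\<lambda>_. {- int (m * r0) .. int (m * r0)})"
    \<comment> \<open>Grid cells in all coordinates except \<open>i\<close>, which the equation of the hyperplane determines.\<close>
    define Cv where "Cv q = {y \<in> cball 0 r \<inter> hyperplane x \<nu>. \<forall>j. j \<noteq> i \<longrightarrow> \<lfloor>real m * y $ j\<rfloor> = q j}" for q :: "'d \<Rightarrow> int"
    have finQ: "finite Q" unfolding Q_def by (intro finite_PiE) auto
    have cardQ: "card Q = (2 * (m * r0) + 1) ^ k"
    proof -
      have "card Q = (\<Prod>j\<in>UNIV - {i}. card {- int (m * r0) .. int (m * r0)})"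
        unfolding Q_def by (rule card_PiE) auto
      also have "card {- int (m * r0) .. int (m * r0)} = 2 * (m * r0) + 1"
        unfolding card_atLeastAtMost_int by linarith
      finally show ?thesis by (simp add: k_def card_Diff_singleton)
    qed
    have cov: "cball 0 r \<inter> hyperplane x \<nu> \<subseteq> (\<Union>q\<in>Q. Cv q)"
    proof
      fix y assume y: "y \<in> cball 0 r \<inter> hyperplane x \<nu>"
      have yj: "\<bar>y $ j\<bar> \<le> real r0" for j
        using component_le_norm_cart[of y j] y r0 by auto
      have "\<bar>real m * y $ j\<bar> \<le> real (m * r0)" for j
        using yj[of j] m by (simp add: abs_mult)
      then have "\<lfloor>real m * y $ j\<rfloor> \<in> {- int (m * r0) .. int (m * r0)}" for j
        by (simp add: abs_le_iff le_floor_iff floor_le_iff) (metis add_less_cancel_left add.right_neutral less_add_one order_le_less_trans minus_le_iff)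
      then have "restrict (\<lambda>j. \<lfloor>real m * y $ j\<rfloor>) (UNIV - {i}) \<in> Q"
        by (auto simp: Q_def simp del: atLeastAtMost_iff)
      moreover have "y \<in> Cv (restrict (\<lambda>j. \<lfloor>real m * y $ j\<rfloor>) (UNIV - {i}))"
        using y by (auto simp: Cv_def)
      ultimately show "y \<in> (\<Union>q\<in>Q. Cv q)" by blast
    qed
    have bd: "bounded (Cv q)" for q
      by (rule bounded_subset[of "cball 0 r"]) (auto simp: Cv_def)
    have diam: "diameter (Cv q) \<le> L / real m" for q
    proof (rule diameter_le)
      show "Cv q \<noteq> {} \<or> 0 \<le> L / real m" using L0 by simp
      fix y z assume yz: "y \<in> Cv q" "z \<in> Cv q"
      have c: "\<bar>(y - z) $ j\<bar> \<le> 1 / m" if "j \<noteq> i" for j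
      proof -
        have "\<lfloor>real m * y $ j\<rfloor> = \<lfloor>real m * z $ j\<rfloor>" using yz that by (auto simp: Cv_def)
        then have "\<bar>real m * y $ j - real m * z $ j\<bar> \<le> 1" by linarith
        then have "real m * \<bar>y $ j - z $ j\<bar> \<le> 1" by (simp add: abs_mult right_diff_distrib[symmetric])
        then show ?thesis using m by (simp add: field_simps)
      qed
      have "(y - z) \<bullet> \<nu> = 0" using yz by (auto simp: Cv_def hyperplane_def algebra_simps inner_diff_left)
      then have "(\<Sum>j\<in>UNIV. (y - z) $ j * \<nu> $ j) = 0" by (simp add: inner_vec_def)
      then have "(y - z) $ i * \<nu> $ i = - (\<Sum>j\<in>UNIV-{i}. (y - z) $ j * \<nu> $ j)"
        by (subst (asm) sum.remove[of _ i]) auto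
      then have "\<bar>(y - z) $ i\<bar> * \<bar>\<nu> $ i\<bar> = \<bar>\<Sum>j\<in>UNIV-{i}. (y - z) $ j * \<nu> $ j\<bar>"
        by (metis abs_minus_cancel abs_mult)
      also have "\<dots> \<le> (\<Sum>j\<in>UNIV-{i}. \<bar>(y - z) $ j\<bar> * \<bar>\<nu> $ j\<bar>)"
        by (rule order_trans[OF sum_abs]) (simp add: abs_mult)
      also have "\<dots> \<le> (\<Sum>j\<in>UNIV-{i}. (1/m) * \<bar>\<nu> $ j\<bar>)"
        using c by (intro sum_mono mult_right_mono) auto
      also have "\<dots> \<le> (\<Sum>j\<in>UNIV. (1/m) * \<bar>\<nu> $ j\<bar>)" by (intro sum_mono2) auto
      finally have "\<bar>(y - z) $ i\<bar> * \<bar>\<nu> $ i\<bar> \<le> (1/m) * (\<Sum>j\<in>UNIV. \<bar>\<nu> $ j\<bar>)"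
        by (simp add: sum_distrib_left)
      \<comment> \<open>The equation of the hyperplane, solved for the \<open>i\<close>-th coordinate.\<close>
      then have ci: "\<bar>(y - z) $ i\<bar> \<le> (1/m) * ((\<Sum>j\<in>UNIV. \<bar>\<nu> $ j\<bar>) / \<bar>\<nu> $ i\<bar>)"
        using i unfolding times_divide_eq_right by (subst pos_le_divide_eq) auto
      have call: "\<bar>(y - z) $ j\<bar> \<le> (1/m) * (1 + (\<Sum>j\<in>UNIV. \<bar>\<nu> $ j\<bar>) / \<bar>\<nu> $ i\<bar>)" for j
      proof (cases "j = i")
        case True
        have "\<bar>(y - z) $ i\<bar> \<le> (1/m) * (1 + (\<Sum>j\<in>UNIV. \<bar>\<nu> $ j\<bar>) / \<bar>\<nu> $ i\<bar>)"
          by (rule order_trans[OF ci mult_left_mono]) auto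
        then show ?thesis using True by simp
      next
        case False
        have "1 / m \<le> (1/m) * (1 + (\<Sum>j\<in>UNIV. \<bar>\<nu> $ j\<bar>) / \<bar>\<nu> $ i\<bar>)"
          using mult_left_mono[of 1 "1 + (\<Sum>j\<in>UNIV. \<bar>\<nu> $ j\<bar>) / \<bar>\<nu> $ i\<bar>" "1/m"] by (auto intro!: divide_nonneg_nonneg sum_nonneg)
        then show ?thesis using c[OF False] by linarith
      qed
      have "norm (y - z) \<le> (\<Sum>j\<in>UNIV. \<bar>(y - z) $ j\<bar>)" by (rule norm_le_l1_cart)
      also have "\<dots> \<le> (\<Sum>j\<in>(UNIV::'d set). (1/m) * (1 + (\<Sum>j\<in>UNIV. \<bar>\<nu> $ j\<bar>) / \<bar>\<nu> $ i\<bar>))"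
        by (intro sum_mono call)
      also have "\<dots> = L / m" by (simp add: L_def)
      finally show "norm (y - z) \<le> L / real m" .
    qed
    have "hausdorff_pre k (L / real m) (cball 0 r \<inter> hyperplane x \<nu>)
        \<le> of_nat (card Q) * ennreal (unit_ball_vol (real k) * (L / real m / 2) ^ k)"
      using L0 m by (intro hausdorff_pre_finite_cover[OF finQ cov bd diam]) auto
    also have "\<dots> = ennreal (real (card Q) * (unit_ball_vol (real k) * (L / real m / 2) ^ k))"
      by (simp add: ennreal_mult' ennreal_of_nat_eq_real_of_nat)
    also have "\<dots> \<le> ennreal K"
    proof (rule ennreal_leI)
      have "real (card Q) \<le> (real m * (2 * real r0 + 1)) ^ k"
        unfolding cardQ of_nat_power using m by (intro power_mono) (auto simp: algebra_simps)
      then have "real (card Q) * (unit_ball_vol (real k) * (L / real m / 2) ^ k) \<le>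
          (real m * (2 * real r0 + 1)) ^ k * (unit_ball_vol (real k) * (L / real m / 2) ^ k)"
        using L0 by (intro mult_right_mono) auto
      also have "\<dots> = unit_ball_vol (real k) * ((real m * (2 * real r0 + 1)) * (L / real m / 2)) ^ k"
        by (simp only: power_mult_distrib mult.assoc mult.left_commute)
      also have "(real m * (2 * real r0 + 1)) * (L / real m / 2) = (2 * real r0 + 1) * L / 2"
        using m by (simp add: field_simps)
      finally show "real (card Q) * (unit_ball_vol (real k) * (L / real m / 2) ^ k) \<le> K"
        by (simp add: K_def)
    qed
    finally show ?thesis .
  qed
  have "hausdorff k (cball 0 r \<inter> hyperplane x \<nu>) \<le> ennreal K"
    unfolding hausdorff_def
  proof (rule SUP_least)
    fix \<delta> :: real assume "\<delta> \<in> {0<..}"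
    obtain m :: nat where "max 1 (L/\<delta>) < real m" using reals_Archimedean2 by blast
    then have m: "m > 0" "L / \<delta> < real m" by auto
    have "L / real m \<le> \<delta>" using m \<open>\<delta> \<in> _\<close> by (simp add: field_simps)
    then show "hausdorff_pre k \<delta> (cball 0 r \<inter> hyperplane x \<nu>) \<le> ennreal K"
      by (rule order_trans[OF hausdorff_pre_antimono bound[OF m(1)]])
  qed
  then show ?thesis by (simp add: k_def order_le_less_trans)
qed

section \<open>Smooth functions and cutoffs\<close>

text \<open>Recursion on the order of differentiability, where the first derivative to be taken is split off. This makes
closure under products and composition provable by induction on the order, for all functions at once.\<close>

fun differentiable_times :: "nat \<Rightarrow> (real^'d::finite \<Rightarrow> real) \<Rightarrow> bool" where
  "differentiable_times 0 f \<longleftrightarrow> (\<forall>x. f differentiable at x)"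
| "differentiable_times (Suc n) f \<longleftrightarrow>
    (\<forall>x. f differentiable at x) \<and> (\<forall>j. differentiable_times n (partial_deriv j f))"

lemma differentiable_times_iff:
  "differentiable_times n f \<longleftrightarrow> (\<forall>js x. length js \<le> n \<longrightarrow> foldr partial_deriv js f differentiable at x)"
proof (induction n arbitrary: f)
  case 0 then show ?case by auto
next
  case (Suc n)
  show ?case
  proof
    assume L: "differentiable_times (Suc n) f"
    show "\<forall>js x. length js \<le> Suc n \<longrightarrow> foldr partial_deriv js f differentiable at x"
    proof (intro allI impI)
      fix js :: "'a list" and x assume js: "length js \<le> Suc n"
      show "foldr partial_deriv js f differentiable at x"
      proof (cases js rule: rev_cases)
        case Nil then show ?thesis using L by simp
      next
        case (snoc ks k) then show ?thesis using L Suc js by auto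
      qed
    qed
  next
    assume R: "\<forall>js x. length js \<le> Suc n \<longrightarrow> foldr partial_deriv js f differentiable at x"
    have "\<forall>x. f differentiable at x" using R[rule_format, of "[]"] by auto
    moreover have "differentiable_times n (partial_deriv j f)" for j
      unfolding Suc using R[rule_format, of "_ @ [j]"] by auto
    ultimately show "differentiable_times (Suc n) f" by simp
  qed
qed

lemma smooth_iff: "smooth f \<longleftrightarrow> (\<forall>n. differentiable_times n f)"
  unfolding smooth_def differentiable_times_iff by auto

lemma differentiable_timesD: "differentiable_times n f \<Longrightarrow> f differentiable at x"
  by (cases n) auto

lemma differentiable_times_Suc: "differentiable_times (Suc n) f \<Longrightarrow> differentiable_times n f"
  unfolding differentiable_times_iff by auto

lemma partial_deriv_eq: "(f has_derivative f') (at x) \<Longrightarrow> partial_deriv j f x = f' (axis j 1)"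
  unfolding partial_deriv_def by (simp add: frechet_derivative_at[symmetric])

lemma partial_deriv_const [simp]: "partial_deriv j (\<lambda>_. c) = (\<lambda>_. 0)"
  by (rule ext) (rule partial_deriv_eq[OF has_derivative_const])

lemma partial_deriv_component: "partial_deriv j (\<lambda>x. x $ i) = (\<lambda>_. if i = j then 1 else 0)"
proof
  fix x :: "real^'a"
  have "((\<lambda>x::real^'a. x $ i) has_derivative (\<lambda>h. h $ i)) (at x)"
    by (rule bounded_linear.has_derivative[OF bounded_linear_vec_nth has_derivative_ident])
  from partial_deriv_eq[OF this, of j]
  show "partial_deriv j (\<lambda>x. x $ i) x = (if i = j then 1 else 0)" by (simp add: axis_def)
qed

lemma
  assumes "f differentiable at x" "g differentiable at x"
  shows partial_deriv_add: "partial_deriv j (\<lambda>x. f x + g x) x = partial_deriv j f x + partial_deriv j g x"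
    and partial_deriv_mult: "partial_deriv j (\<lambda>x. f x * g x) x = f x * partial_deriv j g x + partial_deriv j f x * g x"
proof -
  note F = assms[THEN frechet_derivative_works[THEN iffD1]]
  show "partial_deriv j (\<lambda>x. f x + g x) x = partial_deriv j f x + partial_deriv j g x"
    using partial_deriv_eq[OF has_derivative_add[OF F], of j] by (simp add: partial_deriv_def)
  show "partial_deriv j (\<lambda>x. f x * g x) x = f x * partial_deriv j g x + partial_deriv j f x * g x"
    using partial_deriv_eq[OF has_derivative_mult[OF F], of j] by (simp add: partial_deriv_def)
qed

lemma partial_deriv_chain:
  assumes "f differentiable at x" "(h has_real_derivative d) (at (f x))"
  shows "partial_deriv j (\<lambda>x. h (f x)) x = d * partial_deriv j f x"
proof -
  have "((\<lambda>x. h (f x)) has_derivative (\<lambda>v. d * frechet_derivative f (at x) v)) (at x)"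
    using has_derivative_compose[OF assms(1)[THEN frechet_derivative_works[THEN iffD1]]
        assms(2)[unfolded has_field_derivative_def]] by simp
  from partial_deriv_eq[OF this, of j] show ?thesis by (simp add: partial_deriv_def)
qed

lemma differentiable_times_const: "differentiable_times n (\<lambda>_. c)"
  by (induction n arbitrary: c) auto

lemma differentiable_times_component: "differentiable_times n (\<lambda>x. x $ i)"
proof (cases n)
  have D: "(\<lambda>x::real^'a. x $ i) differentiable at x" for x
    using bounded_linear.has_derivative[OF bounded_linear_vec_nth has_derivative_ident] unfolding differentiable_def by blast
  { case 0 then show ?thesis using D by simp
  next case (Suc n) then show ?thesis using D by (simp add: partial_deriv_component differentiable_times_const) }
qed

lemma differentiable_times_add:
  "differentiable_times n f \<Longrightarrow> differentiable_times n g \<Longrightarrow> differentiable_times n (\<lambda>x. f x + g x)"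
proof (induction n arbitrary: f g)
  case 0 then show ?case by (auto intro: differentiable_add)
next
  case (Suc n)
  have "partial_deriv j (\<lambda>x. f x + g x) = (\<lambda>x. partial_deriv j f x + partial_deriv j g x)" for j
    using Suc.prems by (intro ext partial_deriv_add) auto
  then show ?case using Suc by (auto intro: differentiable_add)
qed

lemma differentiable_times_mult:
  "differentiable_times n f \<Longrightarrow> differentiable_times n g \<Longrightarrow> differentiable_times n (\<lambda>x. f x * g x)"
proof (induction n arbitrary: f g)
  case 0 then show ?case by (auto intro: differentiable_mult)
next
  case (Suc n)
  have "partial_deriv j (\<lambda>x. f x * g x) = (\<lambda>x. f x * partial_deriv j g x + partial_deriv j f x * g x)" for j
    using Suc.prems by (intro ext partial_deriv_mult) auto
  moreover have "differentiable_times n f" "differentiable_times n g"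
    using Suc.prems by (blast intro: differentiable_times_Suc)+
  ultimately show ?case using Suc
    by (auto intro!: differentiable_mult differentiable_times_add Suc.IH)
qed

text \<open>The induction needs the derivatives of the outer function as well, which are therefore given as a sequence \<open>h\<close>.\<close>

lemma differentiable_times_chain:
  assumes "\<And>k t. (h k has_real_derivative h (Suc k) t) (at t)"
  shows "differentiable_times n f \<Longrightarrow> differentiable_times n (\<lambda>x. h k (f x))"
proof (induction n arbitrary: f k)
  case 0
  have "h k differentiable at t" for t
    using assms[of k t] by (auto simp: differentiable_def has_field_derivative_def)
  then show ?case using 0 by (auto intro: differentiable_compose)
next
  case (Suc n)
  have "h k differentiable at t" for t
    using assms[of k t] by (auto simp: differentiable_def has_field_derivative_def)
  moreover have "partial_deriv j (\<lambda>x. h k (f x)) = (\<lambda>x. h (Suc k) (f x) * partial_deriv j f x)" for j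
    using Suc.prems by (intro ext partial_deriv_chain assms) auto
  moreover have "differentiable_times n (\<lambda>x. h (Suc k) (f x))"
    using Suc.prems by (intro Suc.IH) (rule differentiable_times_Suc)
  ultimately show ?case using Suc
    by (auto intro!: differentiable_times_mult intro: differentiable_compose)
qed

lemma differentiable_times_inverse:
  assumes "\<And>x. f x \<noteq> 0"
  shows "differentiable_times n f \<Longrightarrow> differentiable_times n (\<lambda>x. inverse (f x))"
proof (induction n)
  case 0 then show ?case using assms by (auto intro: differentiable_inverse)
next
  case (Suc n)
  have "partial_deriv j (\<lambda>x. inverse (f x)) = (\<lambda>x. (- 1) * (inverse (f x) * inverse (f x)) * partial_deriv j f x)" for j
  proof
    fix x
    have "(inverse has_real_derivative - (inverse (f x) * inverse (f x))) (at (f x))"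
      using DERIV_inverse[of "f x" UNIV] assms[of x] by (simp add: power2_eq_square numeral_2_eq_2)
    from partial_deriv_chain[where h = inverse and f = f and x = x and j = j, OF _ this] Suc.prems
    show "partial_deriv j (\<lambda>x. inverse (f x)) x = (- 1) * (inverse (f x) * inverse (f x)) * partial_deriv j f x"
      by auto
  qed
  moreover have "differentiable_times n (\<lambda>x. inverse (f x))"
    using Suc.prems by (intro Suc.IH) (rule differentiable_times_Suc)
  moreover have "\<forall>x. (\<lambda>x. inverse (f x)) differentiable at x"
    using Suc.prems assms by (auto intro: differentiable_inverse)
  moreover have "differentiable_times n (\<lambda>x. (- 1) * (inverse (f x) * inverse (f x)) * partial_deriv j f x)" for j
    using Suc.prems calculation(2) by (intro differentiable_times_mult differentiable_times_const) auto
  ultimately show ?case by (simp only: differentiable_times.simps) simp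
qed

lemma smooth_const [intro]: "smooth (\<lambda>_. c)"
  and smooth_component [intro]: "smooth (\<lambda>x. x $ i)"
  and smooth_add [intro]: "smooth f \<Longrightarrow> smooth g \<Longrightarrow> smooth (\<lambda>x. f x + g x)"
  and smooth_mult [intro]: "smooth f \<Longrightarrow> smooth g \<Longrightarrow> smooth (\<lambda>x. f x * g x)"
  and smooth_inverse: "smooth f \<Longrightarrow> (\<And>x. f x \<noteq> 0) \<Longrightarrow> smooth (\<lambda>x. inverse (f x))"
  and smooth_partial_deriv: "smooth f \<Longrightarrow> smooth (partial_deriv j f)"
proof -
  show "smooth f \<Longrightarrow> smooth (partial_deriv j f)"
    unfolding smooth_iff by (meson differentiable_times.simps(2))
qed (auto simp: smooth_iff intro: differentiable_times_const differentiable_times_component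
      differentiable_times_add differentiable_times_mult differentiable_times_inverse)

lemma smooth_differentiable: "smooth f \<Longrightarrow> f differentiable at x"
  by (meson smooth_iff differentiable_timesD)

lemma smooth_diff: "smooth f \<Longrightarrow> smooth g \<Longrightarrow> smooth (\<lambda>x. f x - g x)"
  using smooth_add[of f "\<lambda>x. (-1) * g x"] smooth_mult[OF smooth_const[of "-1"], of g] by simp

lemma smooth_sum: "finite I \<Longrightarrow> (\<And>i. i \<in> I \<Longrightarrow> smooth (f i)) \<Longrightarrow> smooth (\<lambda>x. \<Sum>i\<in>I. f i x)"
  by (induction I rule: finite_induct) (auto intro!: smooth_add)

lemma smooth_continuous: "smooth f \<Longrightarrow> continuous_on S f"
  by (meson smooth_differentiable differentiable_imp_continuous_within continuous_at_imp_continuous_on)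

text \<open>The flat function \<open>exp (- 1 / t)\<close>, extended by 0, together with polynomial multiples in \<open>1 / t\<close>: this class is
closed under differentiation.\<close>

definition exp_flat :: "real poly \<Rightarrow> real \<Rightarrow> real" where
  "exp_flat p t = (if t > 0 then poly p (1/t) * exp (- (1/t)) else 0)"

lemma poly_times_exp_tendsto_0: "((\<lambda>x::real. poly p x * exp (- x)) \<longlongrightarrow> 0) at_top"
proof -
  have mono: "((\<lambda>x::real. x ^ n * exp (- x)) \<longlongrightarrow> 0) at_top" for n
    using tendsto_power_div_exp_0[of n] by (simp add: exp_minus divide_inverse)
  have "((\<lambda>x. \<Sum>i\<le>degree p. coeff p i * (x ^ i * exp (- x))) \<longlongrightarrow> (\<Sum>i\<le>degree p. coeff p i * 0)) at_top"
    by (intro tendsto_sum tendsto_mult tendsto_const mono)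
  then show ?thesis by (simp add: poly_altdef sum_distrib_right mult.assoc)
qed

text \<open>With \<open>s = 1 / t\<close>, the derivative of \<open>p(s) exp (- s)\<close> in \<open>t\<close> is \<open>s\<^sup>2 (p(s) - p'(s)) exp (- s)\<close>. At 0 the
difference quotient vanishes in the limit since the exponential beats every polynomial.\<close>

lemma has_derivative_exp_flat:
  "(exp_flat p has_real_derivative exp_flat ([:0, 0, 1:] * (p - pderiv p)) t) (at t)"
proof -
  consider "t > 0" | "t < 0" | "t = 0" by linarith
  then show ?thesis
  proof cases
    case 1
    have "((\<lambda>t. poly p (1/t) * exp (- (1/t))) has_real_derivative
        exp_flat ([:0, 0, 1:] * (p - pderiv p)) t) (at t)"
    proof -
      have d1: "((\<lambda>t. 1/t) has_real_derivative - (1 / (t * t))) (at t)"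
        using 1 by (auto intro!: derivative_eq_intros)
      have d2: "((\<lambda>t. exp (- (1/t))) has_real_derivative exp (- (1/t)) * (1 / (t * t))) (at t)"
        using DERIV_chain2[OF DERIV_exp DERIV_minus[OF d1]] by simp
      have d3: "((\<lambda>t. poly p (1/t)) has_real_derivative poly (pderiv p) (1/t) * - (1 / (t * t))) (at t)"
        by (rule DERIV_chain2[OF poly_DERIV d1])
      have "poly (pderiv p) (1/t) * - (1 / (t * t)) * exp (- (1/t)) + exp (- (1/t)) * (1 / (t * t)) * poly p (1/t)
          = exp_flat ([:0, 0, 1:] * (p - pderiv p)) t"
        using 1 by (simp add: exp_flat_def algebra_simps)
      then show ?thesis using DERIV_mult[OF d3 d2] by simp
    qed
    then show ?thesis
      by (rule DERIV_cong_ev[THEN iffD1, rotated -1])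
         (use 1 in \<open>auto simp: exp_flat_def eventually_nhds intro!: exI[of _ "{0<..}"]\<close>)
  next
    case 2
    have "((\<lambda>t. 0) has_real_derivative exp_flat ([:0, 0, 1:] * (p - pderiv p)) t) (at t)"
      using 2 by (simp add: exp_flat_def)
    then show ?thesis
      by (rule DERIV_cong_ev[THEN iffD1, rotated -1])
         (use 2 in \<open>auto simp: exp_flat_def eventually_nhds intro!: exI[of _ "{..<0}"]\<close>)
  next
    case 3
    have "((\<lambda>y. exp_flat p y / y) \<longlongrightarrow> 0) (at_right 0)"
    proof -
      have "((\<lambda>x. poly ([:0,1:] * p) (inverse x) * exp (- inverse x)) \<longlongrightarrow> 0) (at_right 0)"
        by (rule filterlim_compose[OF poly_times_exp_tendsto_0 filterlim_inverse_at_top_right])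
      then show ?thesis
        by (rule Lim_transform_eventually)
           (auto simp: exp_flat_def eventually_at_filter field_simps)
    qed
    moreover have "((\<lambda>y. exp_flat p y / y) \<longlongrightarrow> 0) (at_left 0)"
      by (rule Lim_transform_eventually[OF tendsto_const])
         (auto simp: exp_flat_def eventually_at_filter)
    ultimately have "((\<lambda>y. exp_flat p y / y) \<longlongrightarrow> 0) (at 0)" by (simp add: filterlim_split_at)
    then show ?thesis using 3 by (simp add: has_field_derivative_iff exp_flat_def)
  qed
qed

definition bump_base :: "real \<Rightarrow> real" where "bump_base = exp_flat 1"

lemma bump_base_pos: "t > 0 \<Longrightarrow> bump_base t > 0" and bump_base_0: "t \<le> 0 \<Longrightarrow> bump_base t = 0"
  and bump_base_nonneg: "bump_base t \<ge> 0"
  by (auto simp: bump_base_def exp_flat_def)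

lemma smooth_bump_base: "smooth f \<Longrightarrow> smooth (\<lambda>x. bump_base (f x))"
proof -
  \<comment> \<open>The polynomials belonging to the successive derivatives of \<open>bump_base\<close>.\<close>
  define P where "P k = ((\<lambda>p. [:0, 0, 1:] * (p - pderiv p)) ^^ k) (1 :: real poly)" for k
  have "(exp_flat (P k) has_real_derivative exp_flat (P (Suc k)) t) (at t)" for k t
    using has_derivative_exp_flat[of "P k" t] by (simp add: P_def)
  from differentiable_times_chain[of "\<lambda>k. exp_flat (P k)", OF this, of _ f 0]
  show "smooth f \<Longrightarrow> smooth (\<lambda>x. bump_base (f x))"
    by (simp add: smooth_iff P_def bump_base_def)
qed

definition smooth_step :: "real \<Rightarrow> real" where
  "smooth_step t = bump_base t * inverse (bump_base t + bump_base (1 - t))"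

lemma bump_base_sum_pos: "bump_base t + bump_base (1 - t) > 0"
  using bump_base_pos[of t] bump_base_pos[of "1 - t"] bump_base_nonneg[of t] bump_base_nonneg[of "1 - t"]
  by (cases "t > 0") (auto intro: add_pos_nonneg add_nonneg_pos)

lemma smooth_step_ge_0: "smooth_step t \<ge> 0" and smooth_step_le_1: "smooth_step t \<le> 1"
  and smooth_step_0: "t \<le> 0 \<Longrightarrow> smooth_step t = 0" and smooth_step_1: "t \<ge> 1 \<Longrightarrow> smooth_step t = 1"
proof -
  note pos = bump_base_sum_pos[of t]
  show "smooth_step t \<ge> 0"
    unfolding smooth_step_def using pos bump_base_nonneg[of t] by (intro mult_nonneg_nonneg) auto
  show "smooth_step t \<le> 1"
    unfolding smooth_step_def divide_inverse[symmetric] using pos bump_base_nonneg[of "1 - t"]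
    by (subst pos_divide_le_eq) auto
  show "t \<le> 0 \<Longrightarrow> smooth_step t = 0" by (simp add: smooth_step_def bump_base_0)
  show "t \<ge> 1 \<Longrightarrow> smooth_step t = 1"
    using pos bump_base_0[of "1 - t"] by (simp add: smooth_step_def)
qed

lemma smooth_smooth_step: "smooth f \<Longrightarrow> smooth (\<lambda>x. smooth_step (f x))"
  unfolding smooth_step_def
  using bump_base_sum_pos
  by (intro smooth_mult smooth_inverse smooth_add smooth_bump_base smooth_diff smooth_const)
     (auto simp: less_imp_neq[symmetric])

lemma smooth_dist_sq: "smooth (\<lambda>x::real^'d::finite. (\<Sum>i\<in>UNIV. (x $ i - a $ i) * (x $ i - a $ i)))"
  by (intro smooth_sum smooth_mult smooth_diff smooth_component smooth_const) auto

lemma test_functionsI: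
  assumes "smooth \<phi>" "compact K" "K \<subseteq> U" "\<And>x. x \<notin> K \<Longrightarrow> \<phi> x = 0"
  shows "\<phi> \<in> test_functions U"
proof -
  have "closure {x. \<phi> x \<noteq> 0} \<subseteq> K"
    using assms by (intro closure_minimal compact_imp_closed) auto
  moreover from this have "compact (closure {x. \<phi> x \<noteq> 0})"
    using compact_Int_closed[OF assms(2) closed_closure, of "{x. \<phi> x \<noteq> 0}"] by (simp add: inf.absorb2)
  ultimately show ?thesis using assms by (auto simp: test_functions_def)
qed

lemma ball_bump:
  fixes a :: "real^'d::finite"
  assumes "r > 0"
  obtains b where "smooth b" "\<And>x. b x \<ge> 0" "\<And>x. x \<in> ball a r \<Longrightarrow> b x > 0" "\<And>x. x \<notin> ball a r \<Longrightarrow> b x = 0"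
proof
  define b where "b x = bump_base (r * r - (\<Sum>i\<in>UNIV. (x $ i - a $ i) * (x $ i - a $ i)))" for x :: "real^'d"
  have s: "(\<Sum>i\<in>UNIV. (x $ i - a $ i) * (x $ i - a $ i)) = (dist a x)\<^sup>2" for x
  proof -
    have "(dist x a)\<^sup>2 = (\<Sum>i\<in>UNIV. (x $ i - a $ i) * (x $ i - a $ i))"
      unfolding dist_norm norm_vec_def L2_set_def
      by (subst real_sqrt_pow2) (auto simp: power2_eq_square intro!: sum_nonneg)
    then show ?thesis by (simp add: dist_commute)
  qed
  show "smooth b" unfolding b_def
    by (intro smooth_bump_base smooth_diff smooth_const smooth_dist_sq)
  show "b x \<ge> 0" for x by (simp add: b_def bump_base_nonneg)
  show "b x > 0" if "x \<in> ball a r" for x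
    unfolding b_def s using that assms
    by (intro bump_base_pos) (simp add: power2_eq_square mult_strict_mono)
  show "b x = 0" if "x \<notin> ball a r" for x
    unfolding b_def s using that assms
    by (intro bump_base_0) (simp add: power2_eq_square mult_mono)
qed

text \<open>Finitely many bumps with supports in \<open>U\<close> cover \<open>K\<close>. Their sum has a positive minimum on \<open>K\<close>; composing the rescaled
sum with \<open>smooth_step\<close> makes it 1 there.\<close>

lemma smooth_cutoff:
  fixes K U :: "(real^'d::finite) set"
  assumes "compact K" "open U" "K \<subseteq> U"
  obtains \<Phi> where "\<Phi> \<in> test_functions U" "\<And>x. 0 \<le> \<Phi> x" "\<And>x. \<Phi> x \<le> 1" "\<And>x. x \<in> K \<Longrightarrow> \<Phi> x = 1"
proof -
  have "\<exists>r>0. cball x r \<subseteq> U" if "x \<in> K" for x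
    using assms that open_contains_cball by blast
  then obtain r where r: "\<And>x. x \<in> K \<Longrightarrow> r x > 0 \<and> cball x (r x) \<subseteq> U" by metis
  have cov: "K \<subseteq> (\<Union>x\<in>K. ball x (r x))" using r by force
  obtain D where D: "D \<subseteq> K" "finite D" "K \<subseteq> (\<Union>x\<in>D. ball x (r x))"
    by (rule compactE_image[OF assms(1) _ cov]) auto
  have "\<exists>b. smooth b \<and> (\<forall>x. b x \<ge> 0) \<and> (\<forall>x\<in>ball a (r a). b x > 0) \<and> (\<forall>x. x \<notin> ball a (r a) \<longrightarrow> b x = 0)" if "a \<in> D" for a
    using ball_bump[of "r a" a] r D that by (metis subsetD)
  then obtain b where b: "\<And>a. a \<in> D \<Longrightarrow> smooth (b a)" "\<And>a x. a \<in> D \<Longrightarrow> b a x \<ge> 0"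
     "\<And>a x. a \<in> D \<Longrightarrow> x \<in> ball a (r a) \<Longrightarrow> b a x > 0" "\<And>a x. a \<in> D \<Longrightarrow> x \<notin> ball a (r a) \<Longrightarrow> b a x = 0"
    by metis
  define S where "S x = (\<Sum>a\<in>D. b a x)" for x
  have S: "smooth S" unfolding S_def using D b by (intro smooth_sum)
  have Spos: "S x > 0" if xK: "x \<in> K" for x
  proof -
    obtain a where "a \<in> D" "x \<in> ball a (r a)" using D xK by blast
    then show ?thesis unfolding S_def using b D by (intro sum_pos2[of _ a]) auto
  qed
  have "\<exists>m>0. \<forall>x\<in>K. m \<le> S x"
  proof (cases "K = {}")
    case True then show ?thesis by (auto intro: exI[of _ 1])
  next
    case False
    then obtain x0 where "x0 \<in> K" "\<forall>x\<in>K. S x0 \<le> S x"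
      using continuous_attains_inf[OF assms(1) False smooth_continuous[OF S]] by auto
    then show ?thesis using Spos by auto
  qed
  then obtain m where m: "m > 0" "\<And>x. x \<in> K \<Longrightarrow> m \<le> S x" by auto
  define \<Phi> where "\<Phi> x = smooth_step (inverse m * S x)" for x
  define C where "C = (\<Union>a\<in>D. cball a (r a))"
  have "compact C" unfolding C_def using D by (intro compact_UN) auto
  moreover have "C \<subseteq> U" using r D by (auto simp: C_def)
  moreover have "\<Phi> x = 0" if "x \<notin> C" for x
  proof -
    have "b a x = 0" if "a \<in> D" for a using \<open>x \<notin> C\<close> that by (intro b) (auto simp: C_def)
    then have "S x = 0" by (simp add: S_def)
    then show ?thesis by (simp add: \<Phi>_def smooth_step_0)
  qed
  ultimately have "\<Phi> \<in> test_functions U"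
    unfolding \<Phi>_def using S by (intro test_functionsI[of _ C] smooth_smooth_step smooth_mult smooth_const)
  moreover have "\<Phi> x = 1" if "x \<in> K" for x
    unfolding \<Phi>_def using m(2)[OF that] m(1) by (intro smooth_step_1) (simp add: field_simps)
  ultimately show ?thesis
    using that[of \<Phi>] smooth_step_ge_0 smooth_step_le_1 by (auto simp: \<Phi>_def)
qed

lemma test_functions_smooth: "\<phi> \<in> test_functions U \<Longrightarrow> smooth \<phi>"
  by (simp add: test_functions_def)

lemma test_functions_support:
  assumes "\<phi> \<in> test_functions U"
  obtains K where "compact K" "K \<subseteq> U" "\<forall>x. x \<notin> K \<longrightarrow> \<phi> x = 0"
  using assms closure_subset[of "{x. \<phi> x \<noteq> 0}"] by (intro that[of "closure {x. \<phi> x \<noteq> 0}"]) (auto simp: test_functions_def)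

lemma test_functions_mono: "U \<subseteq> V \<Longrightarrow> test_functions U \<subseteq> test_functions V"
  by (auto simp: test_functions_def)

lemma test_functions_mult: "\<phi> \<in> test_functions U \<Longrightarrow> smooth f \<Longrightarrow> (\<lambda>x. f x * \<phi> x) \<in> test_functions U"
proof -
  assume \<phi>: "\<phi> \<in> test_functions U" and f: "smooth f"
  obtain K where "compact K" "K \<subseteq> U" "\<forall>x. x \<notin> K \<longrightarrow> \<phi> x = 0" by (rule test_functions_support[OF \<phi>])
  then show ?thesis
    by (intro test_functionsI[OF smooth_mult[OF f test_functions_smooth[OF \<phi>]]]) auto
qed

lemma partial_deriv_eq_0:
  fixes \<phi> :: "real^'d::finite \<Rightarrow> real"
  assumes "open S" "x \<in> S" "\<And>y. y \<in> S \<Longrightarrow> \<phi> y = 0"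
  shows "partial_deriv j \<phi> x = 0"
proof -
  have "((\<lambda>_. 0) has_derivative (\<lambda>_. 0)) (at x)" by (rule has_derivative_const)
  then have "(\<phi> has_derivative (\<lambda>_. 0)) (at x)"
    by (rule has_derivative_transform_within_open[OF _ assms(1,2)]) (simp add: assms(3))
  from partial_deriv_eq[OF this] show ?thesis by simp
qed

lemma partial_deriv_test_functions:
  assumes "\<phi> \<in> test_functions U" shows "partial_deriv j \<phi> \<in> test_functions U"
proof -
  obtain K where K: "compact K" "K \<subseteq> U" "\<forall>x. x \<notin> K \<longrightarrow> \<phi> x = 0" by (rule test_functions_support[OF assms])
  show ?thesis
    by (rule test_functionsI[OF smooth_partial_deriv[OF test_functions_smooth[OF assms]] K(1,2)])
       (rule partial_deriv_eq_0[of "- K"], use K in \<open>auto simp: compact_imp_closed open_Compl\<close>)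
qed

lemma test_functions_bounded:
  assumes "\<phi> \<in> test_functions U" obtains B where "B > 0" "\<And>x. \<bar>\<phi> x\<bar> \<le> B"
proof -
  obtain K where K: "compact K" "K \<subseteq> U" "\<forall>x. x \<notin> K \<longrightarrow> \<phi> x = 0" by (rule test_functions_support[OF assms])
  have "compact (\<phi> ` K)"
    using K smooth_continuous[OF test_functions_smooth[OF assms]] by (intro compact_continuous_image)
  then obtain B where "B > 0" "\<forall>x\<in>\<phi> ` K. norm x \<le> B" by (meson bounded_pos compact_imp_bounded)
  then have "\<bar>\<phi> x\<bar> \<le> B" for x using K(3) by (cases "x \<in> K") auto
  then show ?thesis using that \<open>B > 0\<close> by blast
qed

lemma test_functions_measurable: "\<phi> \<in> test_functions U \<Longrightarrow> \<phi> \<in> borel_measurable borel"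
  by (intro borel_measurable_continuous_onI smooth_continuous test_functions_smooth)

text \<open>Cutoffs for \<open>K\<close> in shrinking neighbourhoods of \<open>K\<close>. Only pointwise convergence is needed, since it will be used
under dominated convergence.\<close>

lemma test_functions_approx_compact:
  fixes K U :: "(real^'d::finite) set"
  assumes "compact K" "open U" "K \<subseteq> U"
  obtains \<phi> :: "nat \<Rightarrow> real^'d \<Rightarrow> real"
  where "\<And>n. \<phi> n \<in> test_functions U" "\<And>n x. 0 \<le> \<phi> n x" "\<And>n x. \<phi> n x \<le> 1"
    "\<And>n x. x \<in> K \<Longrightarrow> \<phi> n x = 1" "\<And>x. (\<lambda>n. \<phi> n x) \<longlonglongrightarrow> indicator K x"
proof -
  define V where "V n = U \<inter> (\<Union>y\<in>K. ball y (1 / (real n + 1)))" for n :: nat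
  have V: "open (V n)" "K \<subseteq> V n" "V n \<subseteq> U" for n using assms by (auto simp: V_def)
  have "\<exists>\<phi>. \<phi> \<in> test_functions (V n) \<and> (\<forall>x. 0 \<le> \<phi> x) \<and> (\<forall>x. \<phi> x \<le> 1) \<and> (\<forall>x\<in>K. \<phi> x = 1)" for n
    using smooth_cutoff[OF assms(1) V(1,2)] by metis
  then obtain \<phi> where \<phi>: "\<And>n. \<phi> n \<in> test_functions (V n)" "\<And>n x. 0 \<le> \<phi> n x" "\<And>n x. \<phi> n x \<le> 1"
    "\<And>n x. x \<in> K \<Longrightarrow> \<phi> n x = 1" by metis
  have "(\<lambda>n. \<phi> n x) \<longlonglongrightarrow> indicator K x" for x
  proof (cases "x \<in> K")
    case True then show ?thesis by (simp add: \<phi>(4))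
  next
    case False
    show ?thesis
    proof (cases "K = {}")
      case True
      then have "\<phi> n x = 0" for n using \<phi>(1)[of n] by (auto simp: V_def elim: test_functions_support)
      then show ?thesis using False by simp
    next
      case ne: False
      have "infdist x K > 0"
        using False ne in_closed_iff_infdist_zero[OF compact_imp_closed[OF assms(1)] ne, of x] infdist_nonneg[of x K] by auto
      then obtain N where N: "inverse (real (Suc N)) < infdist x K" using reals_Archimedean by blast
      have "\<phi> n x = 0" if "n \<ge> N" for n
      proof -
        have "x \<notin> V n"
        proof
          assume "x \<in> V n"
          then obtain y where y: "y \<in> K" "dist y x < 1 / (real n + 1)" by (auto simp: V_def)
          have "1 / (real n + 1) \<le> inverse (real (Suc N))" using that by (simp add: field_simps)
          then show False using y N infdist_le[OF y(1), of x] by (simp add: dist_commute)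
        qed
        then show ?thesis using \<phi>(1)[of n] by (auto elim: test_functions_support)
      qed
      then have "\<forall>\<^sub>F n in sequentially. \<phi> n x = 0" by (auto simp: eventually_sequentially)
      then show ?thesis using False by (simp add: tendsto_eventually)
    qed
  qed
  moreover have "\<phi> n \<in> test_functions U" for n using \<phi>(1) test_functions_mono[OF V(3)] by blast
  ultimately show ?thesis using that \<phi>(2-4) by blast
qed

section \<open>Total variation\<close>

lemma vector_measure_onD:
  assumes "vector_measure_on U \<mu>" "\<And>n::nat. A n \<in> borel_subsets U" "disjoint_family A"
  shows "(\<lambda>n. \<mu> (A n)) sums \<mu> (\<Union>n. A n)"
proof -
  have "range A \<subseteq> borel_subsets U" using assms(2) by blast
  then show ?thesis using assms(1,3) unfolding vector_measure_on_def by blast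
qed

lemma vector_measure_on_empty:
  assumes "vector_measure_on U \<mu>" shows "\<mu> {} = 0"
proof -
  have "(\<lambda>n::nat. \<mu> {}) sums \<mu> {}"
    using vector_measure_onD[OF assms, of "\<lambda>_. {}"] by (simp add: disjoint_family_on_def)
  then have "(\<lambda>n::nat. \<mu> {}) \<longlonglongrightarrow> 0" by (intro summable_LIMSEQ_zero) (auto simp: sums_iff)
  then show ?thesis by (simp add: LIMSEQ_const_iff)
qed

lemma vector_measure_on_Un:
  assumes "vector_measure_on U \<mu>" "A \<in> borel_subsets U" "B \<in> borel_subsets U" "A \<inter> B = {}"
  shows "\<mu> (A \<union> B) = \<mu> A + \<mu> B"
proof -
  define S where "S n = (if n = 0 then A else if n = Suc 0 then B else {})" for n :: nat
  have "(\<lambda>n. \<mu> (S n)) sums \<mu> (\<Union>n. S n)"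
    using assms by (intro vector_measure_onD[OF assms(1)]) (auto simp: S_def disjoint_family_on_def)
  moreover have "(\<Union>n. S n) = A \<union> B" by (auto simp: S_def split: if_splits)
  moreover have "(\<lambda>n. \<mu> (S n)) sums (\<Sum>n\<in>{0,Suc 0}. \<mu> (S n))"
    by (rule sums_finite) (auto simp: S_def vector_measure_on_empty[OF assms(1)])
  ultimately show ?thesis by (auto simp: S_def dest: sums_unique2)
qed

lemma vector_measure_on_finite_UN:
  assumes "vector_measure_on U \<mu>" "finite \<A>" "\<A> \<subseteq> borel_subsets U" "disjoint \<A>"
  shows "\<mu> (\<Union>\<A>) = (\<Sum>A\<in>\<A>. \<mu> A)"
  using assms(2-4)
proof (induction \<A> rule: finite_induct)
  case empty then show ?case by (simp add: vector_measure_on_empty[OF assms(1)])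
next
  case (insert A \<A>)
  have d: "A \<inter> \<Union>\<A> = {}" using insert by (auto simp: disjoint_def)
  have "\<mu> (\<Union>(insert A \<A>)) = \<mu> (A \<union> \<Union>\<A>)" by simp
  also have "\<dots> = \<mu> A + \<mu> (\<Union>\<A>)"
    using insert d by (intro vector_measure_on_Un[OF assms(1)]) (auto intro!: sets.finite_Union)
  finally show ?case using insert by (auto simp: disjoint_def)
qed

lemma vector_measure_on_subset:
  "vector_measure_on U \<mu> \<Longrightarrow> V \<subseteq> U \<Longrightarrow> vector_measure_on V \<mu>"
  unfolding vector_measure_on_def by blast

lemma vector_measure_on_bounded_linear:
  assumes "vector_measure_on U \<mu>" "bounded_linear T" shows "vector_measure_on U (\<lambda>B. T (\<mu> B))"
  using assms(1) bounded_linear.sums[OF assms(2)] unfolding vector_measure_on_def by blast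

lemma total_variation_cong: "(\<And>A. A \<subseteq> B \<Longrightarrow> A \<in> sets borel \<Longrightarrow> \<mu> A = \<nu> A) \<Longrightarrow> total_variation \<mu> B = total_variation \<nu> B"
  unfolding total_variation_def by (intro SUP_cong refl arg_cong[where f=suminf] ext arg_cong[where f=ennreal] arg_cong[where f=norm]) blast

text \<open>Padding a finite disjoint family by the remainder of \<open>B\<close> and by empty sets gives a countable partition. The
converse is \<open>total_variation_le_finite\<close>, so finite families compute the same supremum; they are easier to combine.\<close>

lemma total_variation_ge_finite:
  assumes "finite \<A>" "\<A> \<subseteq> sets borel" "disjoint \<A>" "\<Union>\<A> \<subseteq> B" "B \<in> sets borel"
  shows "(\<Sum>A\<in>\<A>. ennreal (norm (\<mu> A))) \<le> total_variation \<mu> B"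
proof -
  obtain e where e: "bij_betw e {..<card \<A>} \<A>"
    using ex_bij_betw_nat_finite[OF assms(1)] by (auto simp: lessThan_atLeast0)
  define A where "A n = (if n < card \<A> then e n else if n = card \<A> then B - \<Union>\<A> else {})" for n
  have eA: "e n \<in> \<A>" if "n < card \<A>" for n using e that by (auto simp: bij_betw_def)
  have im: "e ` {..<card \<A>} = \<A>" using e by (simp add: bij_betw_def)
  have "range A \<subseteq> sets borel"
    using assms eA by (auto simp: A_def intro!: sets.Diff sets.finite_Union)
  moreover have "disjoint_family A"
    unfolding disjoint_family_on_def
  proof (intro ballI impI)
    fix m n :: nat assume "m \<noteq> n"
    moreover have "e m \<inter> e n = {}" if "m < card \<A>" "n < card \<A>" "m \<noteq> n"
    proof -
      have "e m \<noteq> e n" using that e by (auto simp: bij_betw_def inj_on_def)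
      then show ?thesis using assms(3) eA that by (auto simp: disjoint_def)
    qed
    moreover have "e n \<inter> (B - \<Union>\<A>) = {}" if "n < card \<A>" for n using eA[OF that] by blast
    ultimately show "A m \<inter> A n = {}" by (auto simp: A_def)
  qed
  moreover have "(\<Union>n. A n) = B"
  proof
    show "(\<Union>n. A n) \<subseteq> B" using eA assms(4) by (fastforce simp: A_def split: if_splits)
    show "B \<subseteq> (\<Union>n. A n)"
    proof
      fix x assume x: "x \<in> B"
      show "x \<in> (\<Union>n. A n)"
      proof (cases "x \<in> \<Union>\<A>")
        case True
        then obtain n where "n < card \<A>" "x \<in> e n" using im by blast
        then show ?thesis by (auto simp: A_def intro!: exI[of _ n])
      next
        case False
        then show ?thesis using x by (auto simp: A_def intro!: exI[of _ "card \<A>"])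
      qed
    qed
  qed
  ultimately have *: "(\<Sum>n. ennreal (norm (\<mu> (A n)))) \<le> total_variation \<mu> B"
    unfolding total_variation_def by (intro SUP_upper) auto
  have "(\<Sum>A\<in>\<A>. ennreal (norm (\<mu> A))) = (\<Sum>n<card \<A>. ennreal (norm (\<mu> (e n))))"
    using sum.reindex_bij_betw[OF e, of "\<lambda>A. ennreal (norm (\<mu> A))"] by simp
  also have "\<dots> = (\<Sum>n<card \<A>. ennreal (norm (\<mu> (A n))))" by (simp add: A_def)
  also have "\<dots> \<le> (\<Sum>n. ennreal (norm (\<mu> (A n))))" by (intro sum_le_suminf) auto
  finally show ?thesis using * by simp
qed

lemma total_variation_le_finite:
  assumes "vector_measure_on U \<mu>" "B \<subseteq> U"
    "\<And>\<A>. finite \<A> \<Longrightarrow> \<A> \<subseteq> sets borel \<Longrightarrow> disjoint \<A> \<Longrightarrow> \<Union>\<A> \<subseteq> B \<Longrightarrow> (\<Sum>A\<in>\<A>. ennreal (norm (\<mu> A))) \<le> c"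
  shows "total_variation \<mu> B \<le> c"
  unfolding total_variation_def
proof (rule SUP_least, safe)
  fix A :: "nat \<Rightarrow> 'a set" assume A: "range A \<subseteq> sets borel" "disjoint_family A" "B = (\<Union>n. A n)"
  show "(\<Sum>n. ennreal (norm (\<mu> (A n)))) \<le> c"
  proof (rule suminf_le_const[OF summableI])
    fix n
    have "(\<Sum>k<n. ennreal (norm (\<mu> (A k)))) = (\<Sum>X\<in>A ` {..<n}. ennreal (norm (\<mu> X)))"
    proof (rule sum.reindex_nontrivial[symmetric, unfolded o_def])
      fix x y assume "x \<noteq> y" "A x = A y"
      then have "A x = {}" using A(2) unfolding disjoint_family_on_def by blast
      then show "ennreal (norm (\<mu> (A x))) = 0" using vector_measure_on_empty[OF assms(1)] by simp
    qed simp
    also have "\<dots> \<le> c"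
    proof (rule assms(3))
      show "disjoint (A ` {..<n})"
        by (rule disjoint_family_on_disjoint_image[OF disjoint_family_on_mono[OF subset_UNIV A(2)]])
    qed (use A in auto)
    finally show "(\<Sum>k<n. ennreal (norm (\<mu> (A k)))) \<le> c" .
  qed
qed

lemma norm_le_total_variation:
  "B \<in> sets borel \<Longrightarrow> ennreal (norm (\<mu> B)) \<le> total_variation \<mu> B"
  using total_variation_ge_finite[of "{B}" B \<mu>] by (simp add: disjoint_def)

lemma total_variation_empty: "vector_measure_on U \<mu> \<Longrightarrow> total_variation \<mu> {} = 0"
proof -
  assume \<mu>: "vector_measure_on U \<mu>"
  have "total_variation \<mu> {} \<le> 0"
  proof (rule total_variation_le_finite[OF \<mu>])
    fix \<A> :: "'a set set" assume "\<Union>\<A> \<subseteq> {}"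
    then have "\<mu> A = 0" if "A \<in> \<A>" for A using that vector_measure_on_empty[OF \<mu>] by (cases "A = {}") auto
    then show "(\<Sum>A\<in>\<A>. ennreal (norm (\<mu> A))) \<le> 0" by simp
  qed simp
  then show ?thesis by simp
qed

lemma total_variation_countable_subadd:
  fixes \<mu> :: "'a::topological_space set \<Rightarrow> 'b::real_normed_vector" and A :: "nat \<Rightarrow> 'a set"
  assumes \<mu>: "vector_measure_on U \<mu>" and A: "\<And>n. A n \<in> borel_subsets U" "disjoint_family A"
  shows "total_variation \<mu> (\<Union>n. A n) \<le> (\<Sum>n. total_variation \<mu> (A n))"
proof (rule total_variation_le_finite[OF \<mu>])
  fix \<A> assume \<A>: "finite \<A>" "\<A> \<subseteq> sets borel" "disjoint \<A>" "\<Union>\<A> \<subseteq> (\<Union>n. A n)"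
  have "ennreal (norm (\<mu> X)) \<le> (\<Sum>n. ennreal (norm (\<mu> (X \<inter> A n))))" if X: "X \<in> \<A>" for X
  proof (cases "(\<Sum>n. ennreal (norm (\<mu> (X \<inter> A n)))) = \<infinity>")
    case False
    have "(\<lambda>n. \<mu> (X \<inter> A n)) sums \<mu> (\<Union>n. X \<inter> A n)"
    proof (rule vector_measure_onD[OF \<mu>])
      show "X \<inter> A n \<in> borel_subsets U" for n using X \<A> A(1)[of n] by auto
      show "disjoint_family (\<lambda>n. X \<inter> A n)" using A(2) by (auto simp: disjoint_family_on_def)
    qed
    moreover have "(\<Union>n. X \<inter> A n) = X" using X \<A> by blast
    ultimately have s: "(\<lambda>n. \<mu> (X \<inter> A n)) sums \<mu> X" by simp
    have "summable (\<lambda>n. norm (\<mu> (X \<inter> A n)))"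
      using False by (intro summable_suminf_not_top) auto
    moreover from this s have "norm (\<mu> X) \<le> (\<Sum>n. norm (\<mu> (X \<inter> A n)))"
    proof -
      have "(\<lambda>n. norm (\<Sum>k<n. \<mu> (X \<inter> A k))) \<longlonglongrightarrow> norm (\<mu> X)"
        using s unfolding sums_def by (rule tendsto_norm)
      moreover have "norm (\<Sum>k<n. \<mu> (X \<inter> A k)) \<le> (\<Sum>n. norm (\<mu> (X \<inter> A n)))" for n
        by (rule order_trans[OF norm_sum sum_le_suminf]) (use \<open>summable (\<lambda>n. norm (\<mu> (X \<inter> A n)))\<close> in auto)
      ultimately show ?thesis by (intro LIMSEQ_le_const2) auto
    qed
    ultimately show ?thesis by (subst suminf_ennreal2) (auto intro: ennreal_leI)
  qed simp
  then have "(\<Sum>X\<in>\<A>. ennreal (norm (\<mu> X))) \<le> (\<Sum>X\<in>\<A>. \<Sum>n. ennreal (norm (\<mu> (X \<inter> A n))))"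
    by (intro sum_mono)
  also have "\<dots> = (\<Sum>n. \<Sum>X\<in>\<A>. ennreal (norm (\<mu> (X \<inter> A n))))"
    by (intro suminf_sum[symmetric] summableI)
  also have "\<dots> \<le> (\<Sum>n. total_variation \<mu> (A n))"
  proof (intro suminf_le summableI)
    fix n
    have "(\<Sum>X\<in>\<A>. ennreal (norm (\<mu> (X \<inter> A n)))) = (\<Sum>Y\<in>(\<lambda>X. X \<inter> A n) ` \<A>. ennreal (norm (\<mu> Y)))"
    proof (rule sum.reindex_nontrivial[symmetric, unfolded o_def])
      fix X Y assume "X \<in> \<A>" "Y \<in> \<A>" "X \<noteq> Y" "X \<inter> A n = Y \<inter> A n"
      then have "X \<inter> A n = {}" using \<A>(3) unfolding disjoint_def by blast
      then show "ennreal (norm (\<mu> (X \<inter> A n))) = 0" using vector_measure_on_empty[OF \<mu>] by simp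
    qed (rule \<A>)
    also have "\<dots> \<le> total_variation \<mu> (A n)"
    proof (rule total_variation_ge_finite)
      show "disjoint ((\<lambda>X. X \<inter> A n) ` \<A>)" using \<A>(3) unfolding disjoint_def by blast
    qed (use \<A> A(1)[of n] in auto)
    finally show "(\<Sum>X\<in>\<A>. ennreal (norm (\<mu> (X \<inter> A n)))) \<le> total_variation \<mu> (A n)" .
  qed
  finally show "(\<Sum>X\<in>\<A>. ennreal (norm (\<mu> X))) \<le> (\<Sum>n. total_variation \<mu> (A n))" .
qed (use A in auto)

lemma total_variation_mono:
  assumes "vector_measure_on U \<mu>" "A \<subseteq> B" "B \<in> borel_subsets U"
  shows "total_variation \<mu> A \<le> total_variation \<mu> B"
  using assms by (intro total_variation_le_finite[OF assms(1)] total_variation_ge_finite) auto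

lemma total_variation_superadd:
  assumes \<mu>: "vector_measure_on U \<mu>" and AB: "A \<in> borel_subsets U" "B \<in> borel_subsets U" "A \<inter> B = {}"
  shows "total_variation \<mu> A + total_variation \<mu> B \<le> total_variation \<mu> (A \<union> B)"
proof -
  have 0: "ennreal (norm (\<mu> {})) = 0" using vector_measure_on_empty[OF \<mu>] by simp
  have key: "(\<Sum>X\<in>\<A>. ennreal (norm (\<mu> X))) + (\<Sum>X\<in>\<B>. ennreal (norm (\<mu> X))) \<le> total_variation \<mu> (A \<union> B)"
    if \<A>: "finite \<A>" "\<A> \<subseteq> sets borel" "disjoint \<A>" "\<Union>\<A> \<subseteq> A"
      and \<B>: "finite \<B>" "\<B> \<subseteq> sets borel" "disjoint \<B>" "\<Union>\<B> \<subseteq> B" for \<A> \<B>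
  proof -
    have "(\<Sum>X\<in>\<A>. ennreal (norm (\<mu> X))) + (\<Sum>X\<in>\<B>. ennreal (norm (\<mu> X))) = (\<Sum>X\<in>\<A>\<union>\<B>. ennreal (norm (\<mu> X)))"
    proof (rule sum.union_inter_neutral[symmetric])
      show "\<forall>X\<in>\<A> \<inter> \<B>. ennreal (norm (\<mu> X)) = 0"
      proof
        fix X assume "X \<in> \<A> \<inter> \<B>"
        then have "X = {}" using \<A> \<B> AB(3) by blast
        then show "ennreal (norm (\<mu> X)) = 0" using 0 by simp
      qed
    qed (use \<A> \<B> in auto)
    also have "\<dots> \<le> total_variation \<mu> (A \<union> B)"
    proof (rule total_variation_ge_finite)
      have "X \<inter> Y = {}" if "X \<in> \<A>" "Y \<in> \<B>" for X Y using that \<A>(4) \<B>(4) AB(3) by blast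
      then show "disjoint (\<A> \<union> \<B>)" using \<A>(3) \<B>(3) unfolding disjoint_def by (metis Un_iff Int_commute)
    qed (use \<A> \<B> AB in auto)
    finally show ?thesis .
  qed
  have "(SUP \<A>\<in>{\<A>. finite \<A> \<and> \<A> \<subseteq> sets borel \<and> disjoint \<A> \<and> \<Union>\<A> \<subseteq> C}. \<Sum>X\<in>\<A>. ennreal (norm (\<mu> X))) = total_variation \<mu> C"
    if "C \<in> borel_subsets U" for C
  proof (rule antisym)
    show "total_variation \<mu> C \<le> (SUP \<A>\<in>{\<A>. finite \<A> \<and> \<A> \<subseteq> sets borel \<and> disjoint \<A> \<and> \<Union>\<A> \<subseteq> C}. \<Sum>X\<in>\<A>. ennreal (norm (\<mu> X)))"
      using that by (intro total_variation_le_finite[OF \<mu>] SUP_upper) auto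
    show "(SUP \<A>\<in>{\<A>. finite \<A> \<and> \<A> \<subseteq> sets borel \<and> disjoint \<A> \<and> \<Union>\<A> \<subseteq> C}. \<Sum>X\<in>\<A>. ennreal (norm (\<mu> X))) \<le> total_variation \<mu> C"
      using that by (intro SUP_least total_variation_ge_finite) auto
  qed
  then have eq: "total_variation \<mu> A = (SUP \<A>\<in>{\<A>. finite \<A> \<and> \<A> \<subseteq> sets borel \<and> disjoint \<A> \<and> \<Union>\<A> \<subseteq> A}. \<Sum>X\<in>\<A>. ennreal (norm (\<mu> X)))"
     "total_variation \<mu> B = (SUP \<A>\<in>{\<A>. finite \<A> \<and> \<A> \<subseteq> sets borel \<and> disjoint \<A> \<and> \<Union>\<A> \<subseteq> B}. \<Sum>X\<in>\<A>. ennreal (norm (\<mu> X)))"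
    using AB by auto
  have ne: "{\<A>. finite \<A> \<and> \<A> \<subseteq> sets borel \<and> disjoint \<A> \<and> \<Union>\<A> \<subseteq> C} \<noteq> {}" for C :: "'a set"
    by (auto intro!: exI[of _ "{}"] simp: disjoint_def)
  show ?thesis unfolding eq by (intro SUP_add_SUP_le_ennreal ne) (use key in auto)
qed

lemma total_variation_sums:
  assumes \<mu>: "vector_measure_on U \<mu>" and A: "\<And>n::nat. A n \<in> borel_subsets U" "disjoint_family A"
  shows "(\<Sum>n. total_variation \<mu> (A n)) = total_variation \<mu> (\<Union>n. A n)"
proof (rule antisym)
  have fin: "(\<Sum>k<n. total_variation \<mu> (A k)) \<le> total_variation \<mu> (\<Union>k<n. A k)" for n
  proof (induction n)
    case (Suc n)
    have "(\<Sum>k<Suc n. total_variation \<mu> (A k)) \<le> total_variation \<mu> (\<Union>k<n. A k) + total_variation \<mu> (A n)"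
      using Suc by (simp add: add_right_mono)
    also have "\<dots> \<le> total_variation \<mu> ((\<Union>k<n. A k) \<union> A n)"
    proof (rule total_variation_superadd[OF \<mu>])
      show "(\<Union>k<n. A k) \<in> borel_subsets U" using A(1) by auto
      show "(\<Union>k<n. A k) \<inter> A n = {}" using A(2) by (auto simp: disjoint_family_on_def) (metis IntI emptyE less_irrefl)
    qed (rule A)
    also have "(\<Union>k<n. A k) \<union> A n = (\<Union>k<Suc n. A k)" by (auto simp: less_Suc_eq)
    finally show ?case .
  qed simp
  show "(\<Sum>n. total_variation \<mu> (A n)) \<le> total_variation \<mu> (\<Union>n. A n)"
  proof (rule suminf_le_const[OF summableI])
    fix n
    have "total_variation \<mu> (\<Union>k<n. A k) \<le> total_variation \<mu> (\<Union>n. A n)"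
      using A(1) by (intro total_variation_mono[OF \<mu>]) auto
    then show "(\<Sum>k<n. total_variation \<mu> (A k)) \<le> total_variation \<mu> (\<Union>n. A n)" using fin[of n] by simp
  qed
qed (rule total_variation_countable_subadd[OF assms])

lemma total_variation_Un:
  assumes \<mu>: "vector_measure_on U \<mu>" and AB: "A \<in> borel_subsets U" "B \<in> borel_subsets U" "A \<inter> B = {}"
  shows "total_variation \<mu> (A \<union> B) = total_variation \<mu> A + total_variation \<mu> B"
proof -
  define S where "S n = (if n = 0 then A else if n = Suc 0 then B else {})" for n :: nat
  have "(\<Sum>n. total_variation \<mu> (S n)) = total_variation \<mu> (\<Union>n. S n)"
    using assms by (intro total_variation_sums[OF \<mu>]) (auto simp: S_def disjoint_family_on_def)
  moreover have "(\<Union>n. S n) = A \<union> B" by (auto simp: S_def split: if_splits)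
  moreover have "(\<Sum>n. total_variation \<mu> (S n)) = (\<Sum>n\<in>{0,Suc 0}. total_variation \<mu> (S n))"
    by (rule suminf_finite) (auto simp: S_def total_variation_empty[OF \<mu>])
  ultimately show ?thesis by (auto simp: S_def)
qed

text \<open>Take a finite family in \<open>E\<close> with \<open>\<Sum> |\<nu> A| > 2 (1 + |\<nu> E|)\<close>. The members of one sign already contribute more than half, so
their union \<open>A\<close> satisfies \<open>|\<nu> A| > 1 + |\<nu> E|\<close> and hence also \<open>|\<nu> (E - A)| > 1\<close>. One of \<open>A\<close> and \<open>E - A\<close> still has infinite
variation.\<close>

lemma total_variation_real_split:
  fixes \<nu> :: "'a::topological_space set \<Rightarrow> real"
  assumes \<nu>: "vector_measure_on U \<nu>" and E: "E \<in> borel_subsets U" "total_variation \<nu> E = \<infinity>"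
  obtains B where "B \<in> borel_subsets U" "B \<subseteq> E" "total_variation \<nu> B = \<infinity>" "\<bar>\<nu> (E - B)\<bar> > 1"
proof -
  define t where "t = 2 * (1 + \<bar>\<nu> E\<bar>)"
  have "\<not> total_variation \<nu> E \<le> ennreal t" using E(2) by (simp add: top_unique)
  moreover have "total_variation \<nu> E \<le> ennreal t"
    if "\<forall>\<A>. finite \<A> \<and> \<A> \<subseteq> sets borel \<and> disjoint \<A> \<and> \<Union>\<A> \<subseteq> E \<longrightarrow> (\<Sum>A\<in>\<A>. ennreal (norm (\<nu> A))) \<le> ennreal t"
    by (rule total_variation_le_finite[OF \<nu>]) (use that E(1) in auto)
  ultimately obtain \<A> where \<A>: "finite \<A>" "\<A> \<subseteq> sets borel" "disjoint \<A>" "\<Union>\<A> \<subseteq> E"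
    "\<not> (\<Sum>A\<in>\<A>. ennreal (norm (\<nu> A))) \<le> ennreal t"
    by meson
  have "t < (\<Sum>A\<in>\<A>. \<bar>\<nu> A\<bar>)"
  proof -
    have "ennreal t < ennreal (\<Sum>A\<in>\<A>. \<bar>\<nu> A\<bar>)" using \<A>(5) by (simp add: not_le)
    moreover have "t \<ge> 0" by (simp add: t_def)
    ultimately show ?thesis by (simp add: ennreal_less_iff)
  qed
  \<comment> \<open>One of the two signs accounts for more than half of the sum.\<close>
  define P where "P = {A\<in>\<A>. \<nu> A \<ge> 0}"
  define N where "N = {A\<in>\<A>. \<nu> A < 0}"
  have PN: "\<A> = P \<union> N" "P \<inter> N = {}" "finite P" "finite N" using \<A>(1) by (auto simp: P_def N_def)
  have "(\<Sum>A\<in>\<A>. \<bar>\<nu> A\<bar>) = (\<Sum>A\<in>P. \<bar>\<nu> A\<bar>) + (\<Sum>A\<in>N. \<bar>\<nu> A\<bar>)"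
    unfolding PN(1) using PN by (intro sum.union_disjoint) auto
  also have "(\<Sum>A\<in>P. \<bar>\<nu> A\<bar>) = \<bar>\<Sum>A\<in>P. \<nu> A\<bar>"
  proof -
    have "0 \<le> (\<Sum>A\<in>P. \<nu> A)" by (intro sum_nonneg) (auto simp: P_def)
    moreover have "(\<Sum>A\<in>P. \<bar>\<nu> A\<bar>) = (\<Sum>A\<in>P. \<nu> A)" by (intro sum.cong) (auto simp: P_def)
    ultimately show ?thesis by simp
  qed
  also have "(\<Sum>A\<in>N. \<bar>\<nu> A\<bar>) = \<bar>\<Sum>A\<in>N. \<nu> A\<bar>"
  proof -
    have "(\<Sum>A\<in>N. \<nu> A) \<le> 0" by (intro sum_nonpos) (auto simp: N_def)
    moreover have "(\<Sum>A\<in>N. \<bar>\<nu> A\<bar>) = - (\<Sum>A\<in>N. \<nu> A)"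
      unfolding sum_negf[symmetric] by (intro sum.cong) (auto simp: N_def)
    ultimately show ?thesis by simp
  qed
  finally have "t/2 < \<bar>\<Sum>A\<in>P. \<nu> A\<bar> \<or> t/2 < \<bar>\<Sum>A\<in>N. \<nu> A\<bar>"
    using \<open>t < (\<Sum>A\<in>\<A>. \<bar>\<nu> A\<bar>)\<close> by auto
  moreover have "P \<subseteq> \<A>" "N \<subseteq> \<A>" by (auto simp: P_def N_def)
  ultimately have "\<exists>\<P>. \<P> \<subseteq> \<A> \<and> t/2 < \<bar>\<Sum>A\<in>\<P>. \<nu> A\<bar>" by blast
  then obtain \<P> where \<P>: "\<P> \<subseteq> \<A>" "t/2 < \<bar>\<Sum>A\<in>\<P>. \<nu> A\<bar>" by blast
  define A where "A = \<Union>\<P>"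
  have fP: "finite \<P>" by (rule finite_subset[OF \<P>(1) \<A>(1)])
  have "A \<in> sets borel"
    unfolding A_def using \<A>(2) \<P>(1) by (intro sets.finite_Union[OF fP] subsetI) blast
  moreover have AE: "A \<subseteq> E" unfolding A_def using \<A>(4) \<P>(1) by blast
  moreover have EU: "E \<subseteq> U" using E(1) by simp
  ultimately have A: "A \<in> borel_subsets U" "A \<subseteq> E" by auto
  have PU: "\<P> \<subseteq> borel_subsets U"
  proof
    fix X assume X: "X \<in> \<P>"
    then have "X \<subseteq> A" unfolding A_def by blast
    moreover have "X \<in> sets borel" using X \<A>(2) \<P>(1) by blast
    ultimately show "X \<in> borel_subsets U" using AE EU by simp
  qed
  have "disjoint \<P>" using \<A>(3) \<P>(1) unfolding disjoint_def by blast
  then have "\<nu> A = (\<Sum>A\<in>\<P>. \<nu> A)"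
    unfolding A_def by (intro vector_measure_on_finite_UN[OF \<nu> fP PU])
  then have nA: "\<bar>\<nu> A\<bar> > 1 + \<bar>\<nu> E\<bar>" using \<P>(2) by (simp add: t_def)
  have EA: "E - A \<in> borel_subsets U" using E A by auto
  have "\<nu> (A \<union> (E - A)) = \<nu> A + \<nu> (E - A)" using A EA by (intro vector_measure_on_Un[OF \<nu>]) auto
  moreover have un: "A \<union> (E - A) = E" using A by auto
  ultimately have nEA: "\<bar>\<nu> (E - A)\<bar> > 1" using nA by simp
  have "total_variation \<nu> (A \<union> (E - A)) = total_variation \<nu> A + total_variation \<nu> (E - A)"
    using A EA by (intro total_variation_Un[OF \<nu>]) auto
  then have "total_variation \<nu> A + total_variation \<nu> (E - A) = top"
    unfolding un E(2) infinity_ennreal_def by (rule sym)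
  then have "total_variation \<nu> A = \<infinity> \<or> total_variation \<nu> (E - A) = \<infinity>" by simp
  then show ?thesis
  proof
    assume "total_variation \<nu> A = \<infinity>"
    then show ?thesis using that[of A] A nEA by auto
  next
    assume "total_variation \<nu> (E - A) = \<infinity>"
    moreover have "E - (E - A) = A" using A by auto
    ultimately show ?thesis using that[of "E - A"] EA nA by auto
  qed
qed

text \<open>Otherwise iterating \<open>total_variation_real_split\<close> yields disjoint sets on which \<open>|\<nu>| > 1\<close>, although their values
must be summable.\<close>

lemma total_variation_real_finite:
  fixes \<nu> :: "'a::topological_space set \<Rightarrow> real"
  assumes \<nu>: "vector_measure_on U \<nu>" and B: "B \<in> borel_subsets U"
  shows "total_variation \<nu> B < \<infinity>"
proof (rule ccontr)
  assume "\<not> total_variation \<nu> B < \<infinity>"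
  then have inf: "total_variation \<nu> B = \<infinity>" by (simp add: less_top[symmetric])
  define Q where "Q E \<longleftrightarrow> E \<in> borel_subsets U \<and> total_variation \<nu> E = \<infinity>" for E
  have "\<exists>E. \<forall>n::nat. Q (E n) \<and> (E (Suc n) \<subseteq> E n \<and> \<bar>\<nu> (E n - E (Suc n))\<bar> > 1)"
  proof (rule dependent_nat_choice)
    show "\<exists>E. Q E" using B inf by (auto simp: Q_def)
    show "\<exists>E'. Q E' \<and> (E' \<subseteq> E \<and> \<bar>\<nu> (E - E')\<bar> > 1)" if "Q E" for E n
      using total_variation_real_split[OF \<nu>, of E] that unfolding Q_def by metis
  qed
  then obtain E where E: "\<And>n::nat. Q (E n)" "\<And>n. E (Suc n) \<subseteq> E n" "\<And>n. \<bar>\<nu> (E n - E (Suc n))\<bar> > 1" by blast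
  define D where "D n = E n - E (Suc n)" for n
  have mono: "E n \<subseteq> E m" if "m \<le> n" for m n using E(2) that by (rule lift_Suc_antimono_le)
  have "D m \<inter> D n = {}" if "m < n" for m n
    using mono[of "Suc m" n] that by (auto simp: D_def)
  then have "disjoint_family D"
    unfolding disjoint_family_on_def by (metis Int_commute linorder_neqE_nat)
  moreover have "D n \<in> borel_subsets U" for n using E(1)[of n] E(1)[of "Suc n"] by (auto simp: Q_def D_def)
  ultimately have "(\<lambda>n. \<nu> (D n)) sums \<nu> (\<Union>n. D n)" by (intro vector_measure_onD[OF \<nu>])
  then have "(\<lambda>n. \<nu> (D n)) \<longlonglongrightarrow> 0" by (intro summable_LIMSEQ_zero) (auto simp: sums_iff)
  then have "\<forall>\<^sub>F n in sequentially. norm (\<nu> (D n)) < 1" using order_tendstoD(2)[OF tendsto_norm_zero, of "\<lambda>n. \<nu> (D n)" sequentially 1] by auto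
  then obtain n where "\<bar>\<nu> (D n)\<bar> < 1" by (auto simp: eventually_sequentially)
  then show False using E(3)[of n] by (simp add: D_def)
qed

lemma total_variation_matrix_finite:
  fixes \<mu> :: "'a::topological_space set \<Rightarrow> real^'n::finite^'m::finite"
  assumes \<mu>: "vector_measure_on U \<mu>" and B: "B \<in> borel_subsets U"
  shows "total_variation \<mu> B < \<infinity>"
proof -
  have c: "vector_measure_on U (\<lambda>B. \<mu> B $ i $ j)" for i j
    using vector_measure_on_bounded_linear[OF vector_measure_on_bounded_linear[OF \<mu> bounded_linear_vec_nth[of i]] bounded_linear_vec_nth[of j]] .
  define S where "S = (\<Sum>i\<in>UNIV. \<Sum>j\<in>UNIV. total_variation (\<lambda>B. \<mu> B $ i $ j) B)"
  have "total_variation \<mu> B \<le> S"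
  proof (rule total_variation_le_finite[OF \<mu>])
    fix \<A> assume \<A>: "finite \<A>" "\<A> \<subseteq> sets borel" "disjoint \<A>" "\<Union>\<A> \<subseteq> B"
    have "norm M \<le> (\<Sum>i\<in>UNIV. \<Sum>j\<in>UNIV. \<bar>M $ i $ j\<bar>)" for M :: "real^'n^'m"
    proof -
      have "norm M \<le> (\<Sum>i\<in>UNIV. norm (M $ i))" by (simp add: norm_vec_def L2_set_le_sum)
      also have "\<dots> \<le> (\<Sum>i\<in>UNIV. \<Sum>j\<in>UNIV. \<bar>M $ i $ j\<bar>)" by (intro sum_mono norm_le_l1_cart)
      finally show ?thesis .
    qed
    then have "ennreal (norm (\<mu> A)) \<le> (\<Sum>i\<in>UNIV. \<Sum>j\<in>UNIV. ennreal (norm (\<mu> A $ i $ j)))" for A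
      by (simp add: sum_ennreal sum_nonneg ennreal_leI)
    then have "(\<Sum>A\<in>\<A>. ennreal (norm (\<mu> A))) \<le> (\<Sum>A\<in>\<A>. \<Sum>i\<in>UNIV. \<Sum>j\<in>UNIV. ennreal (norm (\<mu> A $ i $ j)))"
      by (intro sum_mono)
    also have "\<dots> = (\<Sum>i\<in>UNIV. \<Sum>j\<in>UNIV. \<Sum>A\<in>\<A>. ennreal (norm (\<mu> A $ i $ j)))"
      by (subst sum.swap) (intro sum.cong refl sum.swap)
    also have "\<dots> \<le> S" unfolding S_def using \<A> B by (intro sum_mono total_variation_ge_finite) auto
    finally show "(\<Sum>A\<in>\<A>. ennreal (norm (\<mu> A))) \<le> S" .
  qed (use B in auto)
  also have "S < \<infinity>" unfolding S_def using total_variation_real_finite[OF c B] by simp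
  finally show ?thesis .
qed

section \<open>Jordan decomposition\<close>

lemma finite_measure_of_real:
  fixes m :: "'a::topological_space set \<Rightarrow> real"
  assumes m: "vector_measure_on UNIV m" and pos: "\<And>B. B \<in> sets borel \<Longrightarrow> 0 \<le> m B"
  obtains M where "sets M = sets borel" "finite_measure M" "\<forall>B\<in>sets borel. measure M B = m B"
proof -
  define M where "M = measure_of UNIV (sets borel) (\<lambda>B. ennreal (m B))"
  have "sigma_sets UNIV (sets (borel :: 'a measure)) = sets borel"
    using sets.sigma_sets_eq[of "borel :: 'a measure"] by simp
  then have sM: "sets M = sets borel" "space M = UNIV" by (simp_all add: M_def)
  have em: "emeasure M B = ennreal (m B)" if "B \<in> sets borel" for B
    unfolding M_def
  proof (rule emeasure_measure_of_sigma)
    show "sigma_algebra UNIV (sets (borel :: 'a measure))"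
      using sets.sigma_algebra_axioms[of "borel :: 'a measure"] by simp
    show "positive (sets borel) (\<lambda>B. ennreal (m B))"
      by (simp add: positive_def vector_measure_on_empty[OF m])
    show "countably_additive (sets borel) (\<lambda>B. ennreal (m B))"
    proof (rule countably_additiveI)
      fix A :: "nat \<Rightarrow> 'a set" assume A: "range A \<subseteq> sets borel" "disjoint_family A"
      then have "(\<lambda>n. m (A n)) sums m (\<Union>n. A n)" by (intro vector_measure_onD[OF m]) auto
      then show "(\<Sum>i. ennreal (m (A i))) = ennreal (m (\<Union> (range A)))"
        using pos A by (intro suminf_ennreal_eq) auto
    qed
  qed (rule that)
  show ?thesis
  proof
    show "finite_measure M" by (rule finite_measureI) (use em[of UNIV] sM in auto)
    show "\<forall>B\<in>sets borel. measure M B = m B" using em pos by (simp add: measure_def)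
  qed (rule sM)
qed

lemma vector_measure_on_add:
  "vector_measure_on U \<mu> \<Longrightarrow> vector_measure_on U \<nu> \<Longrightarrow> vector_measure_on U (\<lambda>B. \<mu> B + \<nu> B)"
  unfolding vector_measure_on_def by (simp add: sums_add)

lemma vector_measure_on_Int:
  assumes \<mu>: "vector_measure_on U \<mu>" and U: "U \<in> sets borel"
  shows "vector_measure_on UNIV (\<lambda>B. \<mu> (B \<inter> U))"
  unfolding vector_measure_on_def
proof (intro allI impI)
  fix A :: "nat \<Rightarrow> 'a set" assume A: "range A \<subseteq> borel_subsets UNIV" "disjoint_family A"
  have "(\<lambda>n. \<mu> (A n \<inter> U)) sums \<mu> (\<Union>n. A n \<inter> U)"
    using A U by (intro vector_measure_onD[OF \<mu>]) (auto simp: disjoint_family_on_def)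
  then show "(\<lambda>n. \<mu> (A n \<inter> U)) sums \<mu> ((\<Union>n. A n) \<inter> U)" by simp
qed

lemma vector_measure_on_variation:
  assumes \<mu>: "vector_measure_on U \<mu>" and U: "U \<in> sets borel" and fin: "total_variation \<mu> U < \<infinity>"
  shows "vector_measure_on UNIV (\<lambda>B. enn2real (total_variation \<mu> (B \<inter> U)))"
  unfolding vector_measure_on_def
proof (intro allI impI)
  fix A :: "nat \<Rightarrow> 'a set" assume A: "range A \<subseteq> borel_subsets UNIV" "disjoint_family A"
  have finB: "total_variation \<mu> (B \<inter> U) < \<infinity>" for B
    using total_variation_mono[OF \<mu>, of "B \<inter> U" U] U fin by (auto simp: order_le_less_trans)
  have "(\<Sum>n. total_variation \<mu> (A n \<inter> U)) = total_variation \<mu> (\<Union>n. A n \<inter> U)"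
    using A U by (intro total_variation_sums[OF \<mu>]) (auto simp: disjoint_family_on_def)
  then have eq: "(\<Sum>n. ennreal (enn2real (total_variation \<mu> (A n \<inter> U)))) = total_variation \<mu> ((\<Union>n. A n) \<inter> U)"
    using finB by (simp add: less_top)
  have s: "summable (\<lambda>n. enn2real (total_variation \<mu> (A n \<inter> U)))"
    by (rule summable_suminf_not_top) (use finB[of "\<Union> (range A)"] in \<open>auto simp: eq less_top\<close>)
  have "(\<Sum>n. ennreal (enn2real (total_variation \<mu> (A n \<inter> U)))) = ennreal (\<Sum>n. enn2real (total_variation \<mu> (A n \<inter> U)))"
    by (rule suminf_ennreal2) (use s in auto)
  then have "(\<Sum>n. enn2real (total_variation \<mu> (A n \<inter> U))) = enn2real (total_variation \<mu> ((\<Union>n. A n) \<inter> U))"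
    using eq by (metis enn2real_ennreal enn2real_nonneg s suminf_nonneg)
  then show "(\<lambda>n. enn2real (total_variation \<mu> (A n \<inter> U))) sums enn2real (total_variation \<mu> ((\<Union>n. A n) \<inter> U))"
    using s by (simp add: sums_iff)
qed

text \<open>The variation and everything derived from it is extended by 0 to a measure on the whole space, so that measures and
functions on different open sets can be handled together.\<close>

lemma variation_measure:
  assumes \<mu>: "vector_measure_on U \<mu>" and U: "U \<in> sets borel" and fin: "total_variation \<mu> U < \<infinity>"
  obtains \<rho> where "sets \<rho> = sets borel" "finite_measure \<rho>"
    "\<forall>B\<in>sets borel. emeasure \<rho> B = total_variation \<mu> (B \<inter> U)"
    "\<forall>B\<in>sets borel. norm (\<mu> (B \<inter> U)) \<le> measure \<rho> B"
proof -
  obtain \<rho> where \<rho>: "sets \<rho> = sets borel" "finite_measure \<rho>"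
    "\<forall>B\<in>sets borel. measure \<rho> B = enn2real (total_variation \<mu> (B \<inter> U))"
    by (rule finite_measure_of_real[OF vector_measure_on_variation[OF assms]]) auto
  note \<rho> = \<rho>(1,2) \<rho>(3)[rule_format]
  interpret finite_measure \<rho> by fact
  have finB: "total_variation \<mu> (B \<inter> U) < \<infinity>" for B
    using total_variation_mono[OF \<mu>, of "B \<inter> U" U] U fin by (auto simp: order_le_less_trans)
  have em: "emeasure \<rho> B = total_variation \<mu> (B \<inter> U)" if "B \<in> sets borel" for B
    using \<rho>(3)[OF that] finB[of B] by (simp add: emeasure_eq_measure less_top)
  have "norm (\<mu> (B \<inter> U)) \<le> measure \<rho> B" if "B \<in> sets borel" for B
  proof -
    have "ennreal (norm (\<mu> (B \<inter> U))) \<le> ennreal (measure \<rho> B)"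
      using norm_le_total_variation[of "B \<inter> U" \<mu>] that U em[OF that] by (simp add: emeasure_eq_measure)
    then show ?thesis by (simp add: ennreal_le_iff)
  qed
  then show ?thesis using that[OF \<rho>(1,2)] em by simp
qed

lemma signed_integral_representation:
  fixes \<nu> :: "'a::topological_space set \<Rightarrow> real"
  assumes \<nu>: "vector_measure_on U \<nu>" and U: "U \<in> sets borel"
  obtains P N where "sets P = sets borel" "sets N = sets borel" "finite_measure P" "finite_measure N"
    "\<forall>B\<in>sets borel. measure P B = (enn2real (total_variation \<nu> (B \<inter> U)) + \<nu> (B \<inter> U)) / 2"
    "\<forall>B\<in>sets borel. measure N B = (enn2real (total_variation \<nu> (B \<inter> U)) - \<nu> (B \<inter> U)) / 2"
    "\<forall>\<phi>\<in>borel_measurable borel. signed_integral U \<nu> \<phi> = (LINT x|P. \<phi> x) - (LINT x|N. \<phi> x)"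
proof -
  have pp: "\<exists>P. sets P = sets borel \<and> finite_measure P \<and>
      (\<forall>B\<in>sets borel. measure P B = (enn2real (total_variation \<nu> (B \<inter> U)) + \<nu> (B \<inter> U)) / 2) \<and>
      (\<forall>\<phi>\<in>(borel_measurable borel :: ('a \<Rightarrow> real) set). (LINT x|positive_part U \<nu>. \<phi> x) = (LINT x|P. \<phi> x))"
    if \<nu>: "vector_measure_on U \<nu>" for \<nu> :: "'a set \<Rightarrow> real"
  proof -
    have fin: "total_variation \<nu> U < \<infinity>" using total_variation_real_finite[OF \<nu>] U by auto
    have finB: "total_variation \<nu> (B \<inter> U) < \<infinity>" for B
      using total_variation_mono[OF \<nu>, of "B \<inter> U" U] U fin by (auto simp: order_le_less_trans)
    define m where "m B = (enn2real (total_variation \<nu> (B \<inter> U)) + \<nu> (B \<inter> U)) / 2" for B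
    have vm: "vector_measure_on UNIV m"
      unfolding m_def
      by (rule vector_measure_on_bounded_linear[where T = "\<lambda>x. x / 2", OF vector_measure_on_add])
         (intro vector_measure_on_variation \<nu> U fin vector_measure_on_Int bounded_linear_divide)+
    have bd: "\<bar>\<nu> (B \<inter> U)\<bar> \<le> enn2real (total_variation \<nu> (B \<inter> U))" if "B \<in> sets borel" for B
      using norm_le_total_variation[of "B \<inter> U" \<nu>] that U finB[of B]
      by (metis enn2real_ennreal enn2real_mono infinity_ennreal_def norm_ge_zero real_norm_def sets.Int)
    have pos: "0 \<le> m B" if "B \<in> sets borel" for B using bd[OF that] by (simp add: m_def)
    obtain P where P: "sets P = sets borel" "finite_measure P" "\<forall>B\<in>sets borel. measure P B = m B"
      by (rule finite_measure_of_real[OF vm pos])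
    note P = P(1,2) P(3)[rule_format]
    have spP: "space P = UNIV" using sets_eq_imp_space_eq[OF P(1)] by simp
    interpret P: finite_measure P by fact
    have br: "(\<inter>) U ` sets P = borel_subsets U" using U by (auto simp: P(1))
    have ss: "sigma_sets U (borel_subsets U) = borel_subsets U"
    proof -
      have "space (restrict_space borel U) = U" by (simp add: space_restrict_space)
      moreover have "sets (restrict_space borel U) = borel_subsets U"
        using br by (simp add: sets_restrict_space P(1))
      ultimately show ?thesis using sets.sigma_sets_eq[of "restrict_space borel U"] by simp
    qed
    have "positive_part U \<nu> = restrict_space P U"
      unfolding positive_part_def restrict_space_def spP Int_UNIV_right br
    proof (rule measure_of_eq)
      fix B assume "B \<in> sigma_sets U (borel_subsets U)"
      then have B: "B \<in> sets borel" "B \<inter> U = B" unfolding ss by auto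
      then show "ennreal ((enn2real (total_variation \<nu> B) + \<nu> B) / 2) = emeasure P B"
        unfolding P.emeasure_eq_measure P(3)[OF B(1)] m_def B(2) by simp
    qed auto
    then have e1: "(LINT x|positive_part U \<nu>. \<phi> x) = (LINT x|P. indicator U x * \<phi> x)" for \<phi> :: "'a \<Rightarrow> real"
      using U integral_restrict_space[of U P \<phi>] by (simp add: P(1) spP)
    have e2: "(LINT x|P. indicator U x * \<phi> x) = (LINT x|P. \<phi> x)" if "\<phi> \<in> borel_measurable borel" for \<phi> :: "'a \<Rightarrow> real"
    proof (rule integral_cong_AE)
      have [measurable_cong]: "sets P = sets borel" by (rule P(1))
      have [measurable]: "\<phi> \<in> borel_measurable borel" "U \<in> sets borel" by (fact that U)+
      show "(\<lambda>x. indicator U x * \<phi> x) \<in> borel_measurable P" by measurable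
      show "\<phi> \<in> borel_measurable P" by measurable
      have "measure P (- U) = 0"
        using P(3)[of "- U"] U vector_measure_on_empty[OF \<nu>] total_variation_empty[OF \<nu>] by (simp add: m_def)
      then have "- U \<in> null_sets P" using U by (simp add: null_sets_def P.emeasure_eq_measure P(1))
      from AE_not_in[OF this] show "AE x in P. indicator U x * \<phi> x = \<phi> x"
        by eventually_elim (auto simp: indicator_def)
    qed
    have e3: "\<forall>\<phi>\<in>(borel_measurable borel :: ('a \<Rightarrow> real) set). (LINT x|positive_part U \<nu>. \<phi> x) = (LINT x|P. \<phi> x)"
    proof
      fix \<phi> :: "'a \<Rightarrow> real" assume "\<phi> \<in> borel_measurable borel"
      then show "(LINT x|positive_part U \<nu>. \<phi> x) = (LINT x|P. \<phi> x)" by (rule trans[OF e1 e2])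
    qed
    show ?thesis
      using P e3 unfolding m_def by (intro exI[of _ P] conjI ballI) simp_all
  qed
  have \<nu>': "vector_measure_on U (\<lambda>B. - \<nu> B)" by (rule vector_measure_on_bounded_linear[OF \<nu>]) (rule bounded_linear_minus[OF bounded_linear_ident])
  obtain P where P: "sets P = sets borel" "finite_measure P"
      "\<forall>B\<in>sets borel. measure P B = (enn2real (total_variation \<nu> (B \<inter> U)) + \<nu> (B \<inter> U)) / 2"
      "\<forall>\<phi>\<in>(borel_measurable borel :: ('a \<Rightarrow> real) set). (LINT x|positive_part U \<nu>. \<phi> x) = (LINT x|P. \<phi> x)"
    using pp[OF \<nu>] by blast
  have tvm: "total_variation (\<lambda>B. - \<nu> B) B = total_variation \<nu> B" for B by (simp add: total_variation_def)
  obtain N where N: "sets N = sets borel" "finite_measure N"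
      "\<forall>B\<in>sets borel. measure N B = (enn2real (total_variation \<nu> (B \<inter> U)) - \<nu> (B \<inter> U)) / 2"
      "\<forall>\<phi>\<in>(borel_measurable borel :: ('a \<Rightarrow> real) set). (LINT x|positive_part U (\<lambda>B. - \<nu> B). \<phi> x) = (LINT x|N. \<phi> x)"
    using pp[OF \<nu>'] unfolding tvm by auto
  show ?thesis
    by (rule that[of P N]) (use P N in \<open>auto simp: signed_integral_def\<close>)
qed

section \<open>Integrals as functionals on bounded Borel functions\<close>

definition bounded_borel :: "('a::topological_space \<Rightarrow> real) set" where
  "bounded_borel = {f \<in> borel_measurable borel. \<exists>C. \<forall>x. \<bar>f x\<bar> \<le> C}"

text \<open>The functionals on bounded Borel functions that are integrals with respect to finite signed measures, described by
linearity and bounded pointwise convergence. The description makes sums, differences and weighted functionals immediate,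
without Jordan decompositions of the results, and it allows passing between indicators and test functions.\<close>

definition daniell :: "(('a::topological_space \<Rightarrow> real) \<Rightarrow> real) \<Rightarrow> bool" where
  "daniell T \<longleftrightarrow>
    (\<forall>f\<in>bounded_borel. \<forall>g\<in>bounded_borel. T (\<lambda>x. f x + g x) = T f + T g) \<and>
    (\<forall>f\<in>bounded_borel. \<forall>c. T (\<lambda>x. c * f x) = c * T f) \<and>
    (\<forall>f g C. (\<forall>n::nat. f n \<in> borel_measurable borel) \<longrightarrow> (\<forall>n x. \<bar>f n x\<bar> \<le> C) \<longrightarrow>
       (\<forall>x. (\<lambda>n. f n x) \<longlonglongrightarrow> g x) \<longrightarrow> (\<lambda>n. T (f n)) \<longlonglongrightarrow> T g)"

lemma bounded_borelI: "f \<in> borel_measurable borel \<Longrightarrow> (\<And>x. \<bar>f x\<bar> \<le> C) \<Longrightarrow> f \<in> bounded_borel"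
  by (auto simp: bounded_borel_def)

lemma bounded_borel_const [simp]: "(\<lambda>_. c) \<in> bounded_borel"
  by (rule bounded_borelI[of _ "\<bar>c\<bar>"]) auto

lemma bounded_borel_indicator [simp]: "B \<in> sets borel \<Longrightarrow> indicator B \<in> bounded_borel"
  by (rule bounded_borelI[of _ 1]) (auto simp: indicator_def)

lemma bounded_borel_add: "f \<in> bounded_borel \<Longrightarrow> g \<in> bounded_borel \<Longrightarrow> (\<lambda>x. f x + g x) \<in> bounded_borel"
  and bounded_borel_mult: "f \<in> bounded_borel \<Longrightarrow> g \<in> bounded_borel \<Longrightarrow> (\<lambda>x. f x * g x) \<in> bounded_borel"
proof -
  assume f: "f \<in> bounded_borel" and g: "g \<in> bounded_borel"
  then obtain C D where CD: "\<And>x. \<bar>f x\<bar> \<le> C" "\<And>x. \<bar>g x\<bar> \<le> D" by (auto simp: bounded_borel_def)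
  show "(\<lambda>x. f x + g x) \<in> bounded_borel"
    by (rule bounded_borelI[of _ "C + D"])
       (use f g CD in \<open>auto simp: bounded_borel_def intro: order_trans[OF abs_triangle_ineq add_mono]\<close>)
  show "(\<lambda>x. f x * g x) \<in> bounded_borel"
    by (rule bounded_borelI[of _ "C * D"])
       (use f g CD order_trans[OF abs_ge_zero CD(1)] in \<open>auto simp: bounded_borel_def abs_mult intro!: mult_mono\<close>)
qed

lemma daniell_add: "daniell T \<Longrightarrow> f \<in> bounded_borel \<Longrightarrow> g \<in> bounded_borel \<Longrightarrow> T (\<lambda>x. f x + g x) = T f + T g"
  and daniell_scale: "daniell T \<Longrightarrow> f \<in> bounded_borel \<Longrightarrow> T (\<lambda>x. c * f x) = c * T f"
  by (auto simp: daniell_def)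

lemma daniell_lim:
  "daniell T \<Longrightarrow> (\<And>n::nat. f n \<in> borel_measurable borel) \<Longrightarrow> (\<And>n x. \<bar>f n x\<bar> \<le> C) \<Longrightarrow>
     (\<And>x. (\<lambda>n. f n x) \<longlonglongrightarrow> g x) \<Longrightarrow> (\<lambda>n. T (f n)) \<longlonglongrightarrow> T g"
  unfolding daniell_def by blast

lemma daniellI:
  assumes "\<And>f g. f \<in> bounded_borel \<Longrightarrow> g \<in> bounded_borel \<Longrightarrow> T (\<lambda>x. f x + g x) = T f + T g"
    "\<And>f c. f \<in> bounded_borel \<Longrightarrow> T (\<lambda>x. c * f x) = c * T f"
    "\<And>(f :: nat \<Rightarrow> _) g C. (\<And>n. f n \<in> borel_measurable borel) \<Longrightarrow> (\<And>n x. \<bar>f n x\<bar> \<le> C) \<Longrightarrow>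
       (\<And>x. (\<lambda>n. f n x) \<longlonglongrightarrow> g x) \<Longrightarrow> (\<lambda>n. T (f n)) \<longlonglongrightarrow> T g"
  shows "daniell T"
  unfolding daniell_def
proof (intro conjI ballI allI impI)
  fix f :: "nat \<Rightarrow> 'a \<Rightarrow> real" and g C
  assume a: "\<forall>n. f n \<in> borel_measurable borel" "\<forall>n x. \<bar>f n x\<bar> \<le> C" "\<forall>x. (\<lambda>n. f n x) \<longlonglongrightarrow> g x"
  show "(\<lambda>n. T (f n)) \<longlonglongrightarrow> T g" by (rule assms(3)[where C = C]) (use a in auto)
qed (use assms(1,2) in auto)

lemma daniell_diff: "daniell T \<Longrightarrow> f \<in> bounded_borel \<Longrightarrow> g \<in> bounded_borel \<Longrightarrow> T (\<lambda>x. f x - g x) = T f - T g"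
  using daniell_add[of T f "\<lambda>x. -1 * g x"] daniell_scale[of T g "-1"] bounded_borel_mult[of "\<lambda>_. -1" g] by simp

lemma daniell_zero: "daniell T \<Longrightarrow> T (\<lambda>_. 0) = 0"
  using daniell_scale[of T "\<lambda>_. 0" 0] by simp

lemma daniell_sum:
  "finite I \<Longrightarrow> daniell T \<Longrightarrow> (\<And>i. i \<in> I \<Longrightarrow> f i \<in> bounded_borel) \<Longrightarrow> T (\<lambda>x. \<Sum>i\<in>I. f i x) = (\<Sum>i\<in>I. T (f i)) \<and> (\<lambda>x. \<Sum>i\<in>I. f i x) \<in> bounded_borel"
proof (induction I rule: finite_induct)
  case empty then show ?case by (simp add: daniell_zero)
next
  case (insert i I)
  then show ?case using daniell_add[of T "f i" "\<lambda>x. \<Sum>i\<in>I. f i x"] bounded_borel_add[of "f i" "\<lambda>x. \<Sum>i\<in>I. f i x"] by simp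
qed

lemma daniell_plus: "daniell S \<Longrightarrow> daniell T \<Longrightarrow> daniell (\<lambda>f. S f + T f)"
  and daniell_minus: "daniell S \<Longrightarrow> daniell T \<Longrightarrow> daniell (\<lambda>f. S f - T f)"
  and daniell_cmult: "daniell T \<Longrightarrow> daniell (\<lambda>f. c * T f)"
proof -
  assume S: "daniell S" and T: "daniell T"
  show "daniell (\<lambda>f. S f + T f)"
  proof (rule daniellI)
    fix f :: "nat \<Rightarrow> 'a \<Rightarrow> real" and g C
    assume a: "\<And>n. f n \<in> borel_measurable borel" "\<And>n x. \<bar>f n x\<bar> \<le> C" "\<And>x. (\<lambda>n. f n x) \<longlonglongrightarrow> g x"
    show "(\<lambda>n. S (f n) + T (f n)) \<longlonglongrightarrow> S g + T g"
      by (intro tendsto_add daniell_lim[OF S a] daniell_lim[OF T a])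
  qed (simp_all add: daniell_add[OF S] daniell_add[OF T] daniell_scale[OF S] daniell_scale[OF T] distrib_left)
  show "daniell (\<lambda>f. S f - T f)"
  proof (rule daniellI)
    fix f :: "nat \<Rightarrow> 'a \<Rightarrow> real" and g C
    assume a: "\<And>n. f n \<in> borel_measurable borel" "\<And>n x. \<bar>f n x\<bar> \<le> C" "\<And>x. (\<lambda>n. f n x) \<longlonglongrightarrow> g x"
    show "(\<lambda>n. S (f n) - T (f n)) \<longlonglongrightarrow> S g - T g"
      by (intro tendsto_diff daniell_lim[OF S a] daniell_lim[OF T a])
  qed (simp_all add: daniell_add[OF S] daniell_add[OF T] daniell_scale[OF S] daniell_scale[OF T] right_diff_distrib)
next
  assume T: "daniell T"
  show "daniell (\<lambda>f. c * T f)"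
  proof (rule daniellI)
    fix f :: "nat \<Rightarrow> 'a \<Rightarrow> real" and g C
    assume a: "\<And>n. f n \<in> borel_measurable borel" "\<And>n x. \<bar>f n x\<bar> \<le> C" "\<And>x. (\<lambda>n. f n x) \<longlonglongrightarrow> g x"
    show "(\<lambda>n. c * T (f n)) \<longlonglongrightarrow> c * T g"
      by (intro tendsto_mult tendsto_const daniell_lim[OF T a])
  qed (simp_all add: daniell_add[OF T] daniell_scale[OF T] distrib_left)
qed

lemma daniell_sum_functionals: "finite I \<Longrightarrow> (\<And>i. i \<in> I \<Longrightarrow> daniell (T i)) \<Longrightarrow> daniell (\<lambda>f. \<Sum>i\<in>I. T i f)"
proof (induction I rule: finite_induct)
  case empty show ?case by (auto simp: daniell_def)
qed (auto intro!: daniell_plus)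

lemma daniell_weight:
  assumes T: "daniell T" and h: "h \<in> bounded_borel" shows "daniell (\<lambda>f. T (\<lambda>x. h x * f x))"
  unfolding daniell_def
proof (intro conjI ballI allI impI)
  fix f g :: "'a \<Rightarrow> real" assume "f \<in> bounded_borel" "g \<in> bounded_borel"
  then show "T (\<lambda>x. h x * (f x + g x)) = T (\<lambda>x. h x * f x) + T (\<lambda>x. h x * g x)"
    using daniell_add[OF T bounded_borel_mult[OF h, of f] bounded_borel_mult[OF h, of g]] by (simp add: distrib_left)
next
  fix f :: "'a \<Rightarrow> real" and c assume "f \<in> bounded_borel"
  then show "T (\<lambda>x. h x * (c * f x)) = c * T (\<lambda>x. h x * f x)"
    using daniell_scale[OF T bounded_borel_mult[OF h, of f], of c] by (simp add: ac_simps)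
next
  fix f :: "nat \<Rightarrow> 'a \<Rightarrow> real" and g C
  assume f: "\<forall>n. f n \<in> borel_measurable borel" "\<forall>n x. \<bar>f n x\<bar> \<le> C" "\<forall>x. (\<lambda>n. f n x) \<longlonglongrightarrow> g x"
  obtain D where D: "\<And>x. \<bar>h x\<bar> \<le> D" and hm: "h \<in> borel_measurable borel" using h by (auto simp: bounded_borel_def)
  show "(\<lambda>n. T (\<lambda>x. h x * f n x)) \<longlonglongrightarrow> T (\<lambda>x. h x * g x)"
  proof (rule daniell_lim[OF T, where C = "D * C"])
    show "\<bar>h x * f n x\<bar> \<le> D * C" for n x
      using D[of x] f(2) order_trans[OF abs_ge_zero D] unfolding abs_mult by (intro mult_mono) auto
  qed (use f hm in \<open>auto intro!: tendsto_intros borel_measurable_times\<close>)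
qed

text \<open>A weight \<open>h\<close> that is integrable with respect to a larger \<open>\<sigma>\<close>-algebra is admitted because the functions in \<open>L1loc\<close> are
only Lebesgue measurable.\<close>

lemma daniell_integral:
  fixes M :: "'a::topological_space measure"
  assumes sets: "sets borel \<subseteq> sets M" and sp: "space M = UNIV" and h: "integrable M h"
  shows "daniell (\<lambda>f. LINT x|M. h x * f x)"
proof -
  have meas: "f \<in> borel_measurable M" if "f \<in> borel_measurable borel" for f :: "'a \<Rightarrow> real"
    using borel_measurable_subalgebra[of borel M f] sets sp that by simp
  have int: "integrable M (\<lambda>x. h x * f x)" if f: "f \<in> bounded_borel" for f
  proof -
    obtain C where C: "\<And>x. \<bar>f x\<bar> \<le> C" "f \<in> borel_measurable borel" using f by (auto simp: bounded_borel_def)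
    show ?thesis
    proof (rule Bochner_Integration.integrable_bound[where f = "\<lambda>x. C * \<bar>h x\<bar>"])
      show "integrable M (\<lambda>x. C * \<bar>h x\<bar>)" by (intro integrable_mult_right integrable_abs h)
      show "(\<lambda>x. h x * f x) \<in> borel_measurable M"
        by (rule borel_measurable_times[OF borel_measurable_integrable[OF h] meas[OF C(2)]])
      have "norm (h x * f x) \<le> norm (C * \<bar>h x\<bar>)" for x
      proof -
        have "\<bar>h x\<bar> * \<bar>f x\<bar> \<le> \<bar>h x\<bar> * C" using C(1)[of x] by (intro mult_left_mono) auto
        also have "\<dots> \<le> \<bar>C * \<bar>h x\<bar>\<bar>" by (simp add: mult.commute)
        finally show ?thesis by (simp add: abs_mult)
      qed
      then show "AE x in M. norm (h x * f x) \<le> norm (C * \<bar>h x\<bar>)" by simp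
    qed
  qed
  show ?thesis
    unfolding daniell_def
  proof (intro conjI ballI allI impI)
    fix f :: "nat \<Rightarrow> 'a \<Rightarrow> real" and g C
    assume f: "\<forall>n. f n \<in> borel_measurable borel" "\<forall>n x. \<bar>f n x\<bar> \<le> C" "\<forall>x. (\<lambda>n. f n x) \<longlonglongrightarrow> g x"
    have gm: "g \<in> borel_measurable borel" by (rule borel_measurable_LIMSEQ_real[where u = f]) (use f in auto)
    show "(\<lambda>n. LINT x|M. h x * f n x) \<longlonglongrightarrow> (LINT x|M. h x * g x)"
    proof (rule integral_dominated_convergence[where w = "\<lambda>x. \<bar>h x\<bar> * C"])
      note hm = borel_measurable_integrable[OF h]
      show "(\<lambda>x. h x * g x) \<in> borel_measurable M" by (rule borel_measurable_times[OF hm meas[OF gm]])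
      show "(\<lambda>x. h x * f n x) \<in> borel_measurable M" for n
        by (rule borel_measurable_times[OF hm meas]) (use f in blast)
      show "integrable M (\<lambda>x. \<bar>h x\<bar> * C)" by (intro integrable_mult_left integrable_abs h)
      have "(\<lambda>n. h x * f n x) \<longlonglongrightarrow> h x * g x" for x
        by (rule tendsto_mult[OF tendsto_const]) (use f in blast)
      then show "AE x in M. (\<lambda>n. h x * f n x) \<longlonglongrightarrow> h x * g x" by simp
      have "norm (h x * f n x) \<le> \<bar>h x\<bar> * C" for n x
        using f(2) by (simp add: abs_mult mult_left_mono)
      then show "AE x in M. norm (h x * f n x) \<le> \<bar>h x\<bar> * C" for n by simp
    qed
  qed (use int in \<open>simp_all add: distrib_left mult.left_commute\<close>)
qed

lemma daniell_finite_measure: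
  assumes "sets M = sets borel" "finite_measure M" shows "daniell (\<lambda>f. LINT x|M. f x)"
proof -
  interpret finite_measure M by fact
  have "daniell (\<lambda>f. LINT x|M. 1 * f x)"
    by (rule daniell_integral) (use assms sets_eq_imp_space_eq[OF assms(1)] in auto)
  then show ?thesis by simp
qed

lemma daniell_signed_integral:
  assumes \<nu>: "vector_measure_on U \<nu>" and U: "U \<in> sets borel"
  shows "\<exists>T. daniell T \<and> (\<forall>B\<in>sets borel. T (indicator B) = \<nu> (B \<inter> U)) \<and> (\<forall>f\<in>borel_measurable borel. signed_integral U \<nu> f = T f)"
proof -
  obtain P N where PN: "sets P = sets borel" "sets N = sets borel" "finite_measure P" "finite_measure N"
    "\<forall>B\<in>sets borel. measure P B = (enn2real (total_variation \<nu> (B \<inter> U)) + \<nu> (B \<inter> U)) / 2"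
    "\<forall>B\<in>sets borel. measure N B = (enn2real (total_variation \<nu> (B \<inter> U)) - \<nu> (B \<inter> U)) / 2"
    "\<forall>\<phi>\<in>borel_measurable borel. signed_integral U \<nu> \<phi> = (LINT x|P. \<phi> x) - (LINT x|N. \<phi> x)"
    by (rule signed_integral_representation[OF assms])
  have sp: "space P = UNIV" "space N = UNIV" using PN(1,2)[THEN sets_eq_imp_space_eq] by auto
  show ?thesis
    by (intro exI[of _ "\<lambda>f. (LINT x|P. f x) - (LINT x|N. f x)"] conjI daniell_minus daniell_finite_measure PN ballI)
       (auto simp: PN sp field_simps)
qed

text \<open>Nonnegative functions are approximated from below by \<open>\<lfloor>n f\<rfloor> / n\<close>, which is an average of indicators of superlevel
sets.\<close>

lemma daniell_nonneg:
  assumes T: "daniell T" and ind: "\<And>B. B \<in> sets borel \<Longrightarrow> 0 \<le> T (indicator B)"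
    and f: "f \<in> bounded_borel" "\<And>x. 0 \<le> f x"
  shows "0 \<le> T f"
proof -
  obtain C where C: "\<And>x. f x \<le> C" and fm[measurable]: "f \<in> borel_measurable borel" using f by (auto simp: bounded_borel_def abs_le_iff)
  define g where "g n x = (\<Sum>k\<in>{1..nat \<lceil>real (Suc n) * C\<rceil>}. (1 / real (Suc n)) * indicator {x. real k \<le> real (Suc n) * f x} x)" for n x
  have ge: "g n x = real_of_int \<lfloor>real (Suc n) * f x\<rfloor> / real (Suc n)" for n x
  proof -
    define y where "y = real (Suc n) * f x"
    have y: "0 \<le> y" "y \<le> real_of_int \<lceil>real (Suc n) * C\<rceil>"
      unfolding y_def using f(2)[of x]
      by (auto intro!: order_trans[OF mult_left_mono[OF C[of x]] le_of_int_ceiling] simp del: of_nat_Suc)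
    have "{k\<in>{1..nat \<lceil>real (Suc n) * C\<rceil>}. real k \<le> y} = {1..nat \<lfloor>y\<rfloor>}"
      using y by (auto simp: le_nat_iff le_floor_iff)
    then have "(\<Sum>k\<in>{1..nat \<lceil>real (Suc n) * C\<rceil>}. indicator {x. real k \<le> real (Suc n) * f x} x) = real (nat \<lfloor>y\<rfloor>)"
      unfolding y_def indicator_def by (simp add: sum.If_cases Int_def)
    then have "g n x = (1 / real (Suc n)) * real (nat \<lfloor>y\<rfloor>)" by (simp only: g_def sum_distrib_left[symmetric])
    then show ?thesis using y(1) by (simp add: y_def)
  qed
  have bb: "(\<lambda>x. (1 / real (Suc n)) * indicator {x. real k \<le> real (Suc n) * f x} x) \<in> bounded_borel" for n k
    by (intro bounded_borel_mult bounded_borel_const bounded_borel_indicator, (measurable)?)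
  have "T (g n) = (\<Sum>k\<in>{1..nat \<lceil>real (Suc n) * C\<rceil>}. (1 / real (Suc n)) * T (indicator {x. real k \<le> real (Suc n) * f x}))" for n
  proof -
    have "T (g n) = (\<Sum>k\<in>{1..nat \<lceil>real (Suc n) * C\<rceil>}. T (\<lambda>x. (1 / real (Suc n)) * indicator {x. real k \<le> real (Suc n) * f x} x))"
      unfolding g_def using daniell_sum[OF _ T bb, of "{1..nat \<lceil>real (Suc n) * C\<rceil>}"] by auto
    also have "\<dots> = (\<Sum>k\<in>{1..nat \<lceil>real (Suc n) * C\<rceil>}. (1 / real (Suc n)) * T (indicator {x. real k \<le> real (Suc n) * f x}))"
      by (intro sum.cong refl daniell_scale[OF T] bounded_borel_indicator) measurable
    finally show ?thesis .
  qed
  moreover have "0 \<le> T (indicator {x. real k \<le> real (Suc n) * f x})" for n k by (rule ind) measurable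
  ultimately have pos: "0 \<le> T (g n)" for n by (simp add: sum_nonneg)
  have close: "\<bar>g n x - f x\<bar> \<le> 1 / real (Suc n)" for n x
  proof -
    have "\<bar>real_of_int \<lfloor>real (Suc n) * f x\<rfloor> - real (Suc n) * f x\<bar> \<le> 1" by linarith
    then have "\<bar>real_of_int \<lfloor>real (Suc n) * f x\<rfloor> - real (Suc n) * f x\<bar> / real (Suc n) \<le> 1 / real (Suc n)"
      by (intro divide_right_mono) auto
    moreover have "g n x - f x = (real_of_int \<lfloor>real (Suc n) * f x\<rfloor> - real (Suc n) * f x) / real (Suc n)"
      by (simp add: ge diff_divide_distrib del: of_nat_Suc)
    ultimately show ?thesis by (simp only: abs_divide abs_of_nat)
  qed
  have "(\<lambda>n. T (g n)) \<longlonglongrightarrow> T f"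
  proof (rule daniell_lim[OF T, where C = "C + 1"])
    show "g n \<in> borel_measurable borel" for n unfolding g_def by measurable
    show "\<bar>g n x\<bar> \<le> C + 1" for n x
    proof -
      have "1 / real (Suc n) \<le> 1" by simp
      then show ?thesis using close[of n x] f(2)[of x] C[of x] by linarith
    qed
    show "(\<lambda>n. g n x) \<longlonglongrightarrow> f x" for x
    proof (rule LIMSEQ_I)
      fix e :: real assume "e > 0"
      then obtain N where N: "inverse (real (Suc N)) < e" using reals_Archimedean by blast
      have "norm (g n x - f x) < e" if "n \<ge> N" for n
      proof -
        have "1 / real (Suc n) \<le> inverse (real (Suc N))" using that by (simp add: field_simps)
        then show ?thesis using close[of n x] N by simp
      qed
      then show "\<exists>no. \<forall>n\<ge>no. norm (g n x - f x) < e" by blast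
    qed
  qed
  then show ?thesis using pos by (intro LIMSEQ_le_const) auto
qed

lemma daniell_mono:
  assumes "daniell S" "daniell T" "\<And>B. B \<in> sets borel \<Longrightarrow> S (indicator B) \<le> T (indicator B)"
    "f \<in> bounded_borel" "\<And>x. 0 \<le> f x"
  shows "S f \<le> T f"
  using daniell_nonneg[OF daniell_minus[OF assms(2,1)], of f] assms by simp

lemma daniell_eq:
  assumes "daniell S" "daniell T" "\<And>B. B \<in> sets borel \<Longrightarrow> S (indicator B) = T (indicator B)"
    and f: "f \<in> bounded_borel"
  shows "S f = T f"
proof -
  obtain C where C: "\<And>x. \<bar>f x\<bar> \<le> C" using f by (auto simp: bounded_borel_def)
  have eq: "S h = T h" if h: "h \<in> bounded_borel" "\<And>x. 0 \<le> h x" for h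
  proof (rule antisym)
    show "S h \<le> T h" by (rule daniell_mono[OF assms(1,2) _ h]) (simp add: assms(3))
    show "T h \<le> S h" by (rule daniell_mono[OF assms(2,1) _ h]) (simp add: assms(3))
  qed
  have g: "(\<lambda>x. f x + C) \<in> bounded_borel" by (intro bounded_borel_add f bounded_borel_const)
  have pos: "0 \<le> f x + C" for x using C[of x] by linarith
  have "S (\<lambda>x. f x + C) = T (\<lambda>x. f x + C)"
    using eq[OF g pos] .
  moreover have "0 \<le> C" using C[of undefined] by linarith
  then have "S (\<lambda>_. C) = T (\<lambda>_. C)"
    using eq[OF bounded_borel_const[of C]] by simp
  ultimately show ?thesis using daniell_add[OF assms(1) f, of "\<lambda>_. C"] daniell_add[OF assms(2) f, of "\<lambda>_. C"] by simp
qed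

lemma daniell_vector_measure:
  assumes T: "daniell T" shows "vector_measure_on UNIV (\<lambda>B. T (indicator B))"
  unfolding vector_measure_on_def
proof (intro allI impI)
  fix A :: "nat \<Rightarrow> 'a set" assume A: "range A \<subseteq> borel_subsets UNIV" "disjoint_family A"
  have Am: "A n \<in> sets borel" for n using A by auto
  have "(\<Sum>k<n. T (indicator (A k))) = T (indicator (\<Union>k<n. A k))" for n
  proof -
    have "(\<Sum>k<n. T (indicator (A k))) = T (\<lambda>x. \<Sum>k<n. indicator (A k) x)"
      using daniell_sum[OF finite_lessThan T, of n "\<lambda>k. indicator (A k)"] Am by simp
    also have "(\<lambda>x. \<Sum>k<n. indicator (A k) x) = (indicator (\<Union>k<n. A k) :: 'a \<Rightarrow> real)"
      by (rule ext, rule indicator_UN_disjoint[OF finite_lessThan disjoint_family_on_mono[OF subset_UNIV A(2)], symmetric])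
    finally show ?thesis .
  qed
  moreover have "(\<lambda>n. T (indicator (\<Union>k<n. A k))) \<longlonglongrightarrow> T (indicator (\<Union>k. A k))"
  proof (rule daniell_lim[OF T, where C = 1])
    show "(indicator (\<Union>k<n. A k) :: 'a \<Rightarrow> real) \<in> borel_measurable borel" for n
      using Am by (intro borel_measurable_indicator) auto
    show "(\<lambda>n. indicator (\<Union>k<n. A k) x :: real) \<longlonglongrightarrow> indicator (\<Union>k. A k) x" for x
      by (rule LIMSEQ_indicator_UN)
  qed (simp add: indicator_def)
  ultimately show "(\<lambda>n. T (indicator (A n))) sums T (indicator (\<Union>n. A n))" by (simp add: sums_def)
qed

text \<open>Test functions converge boundedly to the indicator of a compact subset of \<open>U\<close>; a Borel subset is approximated from
inside by compact sets with respect to the variation of the signed measure.\<close>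

lemma daniell_nonneg_of_test_functions:
  fixes U :: "(real^'d::finite) set"
  assumes T: "daniell T" and U: "open U"
    and test: "\<And>\<phi>. \<phi> \<in> test_functions U \<Longrightarrow> (\<And>x. 0 \<le> \<phi> x) \<Longrightarrow> 0 \<le> T \<phi>"
    and B: "B \<in> sets borel" "B \<subseteq> U"
  shows "0 \<le> T (indicator B)"
proof -
  have K: "0 \<le> T (indicator K)" if K: "compact K" "K \<subseteq> U" for K
  proof -
    show ?thesis
    proof (rule test_functions_approx_compact[OF K(1) U K(2)])
      fix \<phi> :: "nat \<Rightarrow> real^'d \<Rightarrow> real"
      assume \<phi>: "\<And>n. \<phi> n \<in> test_functions U" "\<And>n x. 0 \<le> \<phi> n x" "\<And>n x. \<phi> n x \<le> 1"
        "\<And>n x. x \<in> K \<Longrightarrow> \<phi> n x = 1" "\<And>x. (\<lambda>n. \<phi> n x) \<longlonglongrightarrow> indicator K x"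
      have "(\<lambda>n. T (\<phi> n)) \<longlonglongrightarrow> T (indicator K)"
      proof (rule daniell_lim[OF T, where C = 1])
        show "\<bar>\<phi> n x\<bar> \<le> 1" for n x using \<phi>(2,3)[of n x] by simp
        show "\<phi> n \<in> borel_measurable borel" for n by (rule test_functions_measurable[OF \<phi>(1)])
      qed (rule \<phi>(5))
      then show "0 \<le> T (indicator K)" using test[OF \<phi>(1,2)] by (intro LIMSEQ_le_const) auto
    qed
  qed
  define m where "m B = T (indicator B)" for B
  have vm: "vector_measure_on UNIV m" unfolding m_def by (rule daniell_vector_measure[OF T])
  obtain \<rho> where \<rho>: "sets \<rho> = sets borel" "finite_measure \<rho>"
    "\<forall>B\<in>sets borel. emeasure \<rho> B = total_variation m (B \<inter> UNIV)"
    "\<forall>B\<in>sets borel. norm (m (B \<inter> UNIV)) \<le> measure \<rho> B"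
    by (rule variation_measure[OF vm _ total_variation_real_finite[OF vm]]) auto
  note \<rho> = \<rho>(1,2) \<rho>(4)[rule_format]
  interpret finite_measure \<rho> by fact
  have "- e \<le> m B" if e: "e > 0" for e
  proof -
    have "emeasure \<rho> B = (SUP K \<in> {K. K \<subseteq> B \<and> compact K}. emeasure \<rho> K)"
      using \<rho> B by (intro inner_regular) (auto simp: emeasure_eq_measure)
    moreover have "ennreal (measure \<rho> B - e) < emeasure \<rho> B \<or> measure \<rho> B - e < 0"
      using e by (auto simp: emeasure_eq_measure ennreal_less_iff)
    ultimately have "\<exists>D. D \<subseteq> B \<and> compact D \<and> measure \<rho> B - e < measure \<rho> D"
    proof (cases "measure \<rho> B - e < 0")
      case True then show ?thesis by (intro exI[of _ "{}"]) auto
    next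
      case False
      assume "emeasure \<rho> B = (SUP K \<in> {K. K \<subseteq> B \<and> compact K}. emeasure \<rho> K)"
        "ennreal (measure \<rho> B - e) < emeasure \<rho> B \<or> measure \<rho> B - e < 0"
      then have "ennreal (measure \<rho> B - e) < (SUP K \<in> {K. K \<subseteq> B \<and> compact K}. emeasure \<rho> K)"
        using False by simp
      then obtain K where "K \<subseteq> B" "compact K" "ennreal (measure \<rho> B - e) < emeasure \<rho> K"
        unfolding less_SUP_iff by auto
      then show ?thesis using False by (auto simp: emeasure_eq_measure ennreal_less_iff)
    qed
    then obtain D where D: "D \<subseteq> B" "compact D" "measure \<rho> B - e < measure \<rho> D" by blast
    have Dm: "D \<in> sets borel" using D by (auto intro: borel_compact)
    have "m B = m D + m (B - D)"
      using vector_measure_on_Un[OF vm, of D "B - D"] D Dm B by (auto simp: Un_absorb1)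
    moreover have "0 \<le> m D" unfolding m_def using K D B by auto
    moreover have "\<bar>m (B - D)\<bar> \<le> measure \<rho> (B - D)" using \<rho>(3)[of "B - D"] B Dm by auto
    moreover have "measure \<rho> (B - D) = measure \<rho> B - measure \<rho> D"
      using D Dm B \<rho>(1) by (intro finite_measure_Diff) auto
    ultimately show ?thesis using D(3) by linarith
  qed
  then have "0 \<le> m B + e" if "e > 0" for e using that by (metis add.commute diff_ge_0_iff_ge diff_minus_eq_add)
  then show ?thesis unfolding m_def by (rule field_le_epsilon)
qed

lemma daniell_eq_of_test_functions:
  fixes U :: "(real^'d::finite) set"
  assumes S: "daniell S" and T: "daniell T" and U: "open U"
    and test: "\<And>\<phi>. \<phi> \<in> test_functions U \<Longrightarrow> S \<phi> = T \<phi>"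
    and B: "B \<in> sets borel" "B \<subseteq> U"
  shows "S (indicator B) = T (indicator B)"
  using daniell_nonneg_of_test_functions[OF daniell_minus[OF S T] U _ B]
    daniell_nonneg_of_test_functions[OF daniell_minus[OF T S] U _ B] test by simp

lemma test_functions_bounded_borel: "\<phi> \<in> test_functions U \<Longrightarrow> \<phi> \<in> bounded_borel"
  by (meson bounded_borelI test_functions_bounded test_functions_measurable)

section \<open>Symmetrised gradients as functionals\<close>

lemma borel_measurable_lebesgueI: "f \<in> borel_measurable borel \<Longrightarrow> f \<in> borel_measurable (lebesgue :: 'a::euclidean_space measure)"
  by (rule borel_measurable_subalgebra[OF sets_borel_lebesgue]) simp_all

definition weighted_integral :: "'a::euclidean_space set \<Rightarrow> ('a \<Rightarrow> real) \<Rightarrow> ('a \<Rightarrow> real) \<Rightarrow> real" where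
  "weighted_integral S h f = (LINT x|lebesgue. (indicator S x * h x) * f x)"

lemma weighted_integrable:
  assumes "set_integrable lebesgue S h" "f \<in> bounded_borel"
  shows "integrable lebesgue (\<lambda>x. (indicator S x * h x) * f x)"
proof -
  obtain C where C: "\<And>x. \<bar>f x\<bar> \<le> C" and f: "f \<in> borel_measurable borel"
    using assms(2) by (auto simp: bounded_borel_def)
  have h: "integrable lebesgue (\<lambda>x. indicator S x * h x)" using assms(1) by (simp add: set_integrable_def)
  show ?thesis
  proof (rule Bochner_Integration.integrable_bound[where f = "\<lambda>x. C * \<bar>indicator S x * h x\<bar>"])
    show "integrable lebesgue (\<lambda>x. C * \<bar>indicator S x * h x\<bar>)" by (intro integrable_mult_right integrable_abs h)
    show "(\<lambda>x. (indicator S x * h x) * f x) \<in> borel_measurable lebesgue"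
      by (rule borel_measurable_times[OF borel_measurable_integrable[OF h] borel_measurable_lebesgueI[OF f]])
    have "norm ((indicator S x * h x) * f x) \<le> norm (C * \<bar>indicator S x * h x\<bar>)" for x
    proof -
      have "\<bar>indicator S x * h x\<bar> * \<bar>f x\<bar> \<le> \<bar>indicator S x * h x\<bar> * C" using C[of x] by (rule mult_left_mono) simp
      also have "\<dots> \<le> \<bar>C * \<bar>indicator S x * h x\<bar>\<bar>" by (simp add: mult.commute)
      finally show ?thesis by (simp only: real_norm_def abs_mult[of "indicator S x * h x"])
    qed
    then show "AE x in lebesgue. norm ((indicator S x * h x) * f x) \<le> norm (C * \<bar>indicator S x * h x\<bar>)" by simp
  qed
qed

lemma daniell_weighted_integral:
  assumes "set_integrable lebesgue S h" shows "daniell (weighted_integral S h)"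
  unfolding weighted_integral_def
  by (rule daniell_integral[OF sets_borel_lebesgue]) (use assms in \<open>simp_all add: set_integrable_def\<close>)

lemma set_integrable_component:
  fixes u :: "'a::euclidean_space \<Rightarrow> real^'n::finite"
  assumes "u absolutely_integrable_on S" shows "set_integrable lebesgue S (\<lambda>x. u x $ i)"
  using integrable_bounded_linear[OF bounded_linear_vec_nth[of i] assms[unfolded set_integrable_def]]
  by (simp add: set_integrable_def)

text \<open>The right-hand side in the definition of \<open>is_sym_gradient\<close>, as a combination of functionals that satisfy \<open>daniell\<close>.\<close>

definition sym_weak :: "(real^'d::finite) set \<Rightarrow> (real^'d \<Rightarrow> real^'d) \<Rightarrow> 'd \<Rightarrow> 'd \<Rightarrow> (real^'d \<Rightarrow> real) \<Rightarrow> real" where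
  "sym_weak U u i j \<phi> = - (1/2) * (weighted_integral U (\<lambda>x. u x $ i) (partial_deriv j \<phi>) + weighted_integral U (\<lambda>x. u x $ j) (partial_deriv i \<phi>))"

lemma sym_weak_commute: "sym_weak U u i j \<phi> = sym_weak U u j i \<phi>"
  by (simp add: sym_weak_def)

lemma partial_deriv_bounded_borel: "\<phi> \<in> test_functions U \<Longrightarrow> partial_deriv j \<phi> \<in> bounded_borel"
  by (rule test_functions_bounded_borel[OF partial_deriv_test_functions])

lemma sym_weak_eq:
  assumes u: "u absolutely_integrable_on U" and \<phi>: "\<phi> \<in> test_functions V"
  shows "sym_weak U u i j \<phi> = - (1/2) * (LINT x:U|lebesgue. u x $ i * partial_deriv j \<phi> x + u x $ j * partial_deriv i \<phi> x)"
proof -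
  have "(LINT x:U|lebesgue. u x $ i * partial_deriv j \<phi> x + u x $ j * partial_deriv i \<phi> x)
      = (LINT x|lebesgue. (indicator U x * u x $ i) * partial_deriv j \<phi> x + (indicator U x * u x $ j) * partial_deriv i \<phi> x)"
    unfolding set_lebesgue_integral_def by (rule Bochner_Integration.integral_cong) (simp_all add: algebra_simps)
  also have "\<dots> = weighted_integral U (\<lambda>x. u x $ i) (partial_deriv j \<phi>) + weighted_integral U (\<lambda>x. u x $ j) (partial_deriv i \<phi>)"
    unfolding weighted_integral_def
    by (rule Bochner_Integration.integral_add) (rule weighted_integrable[OF set_integrable_component[OF u] partial_deriv_bounded_borel[OF \<phi>]])+
  finally show ?thesis by (simp add: sym_weak_def)
qed

lemma sym_weak_restrict:
  assumes \<phi>: "\<phi> \<in> test_functions V" and V: "V \<subseteq> U"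
  shows "sym_weak V u i j \<phi> = sym_weak U u i j \<phi>"
proof -
  have "weighted_integral V h (partial_deriv k \<phi>) = weighted_integral U h (partial_deriv k \<phi>)" for h k
  proof -
    obtain K where K: "compact K" "K \<subseteq> V" "\<forall>x. x \<notin> K \<longrightarrow> partial_deriv k \<phi> x = 0"
      by (rule test_functions_support[OF partial_deriv_test_functions[OF \<phi>]])
    have "(indicator V x * h x) * partial_deriv k \<phi> x = (indicator U x * h x) * partial_deriv k \<phi> x" for x
    proof (cases "x \<in> K")
      case True then have "x \<in> V" "x \<in> U" using K V by auto
      then show ?thesis by simp
    next
      case False then show ?thesis using K(3) by simp
    qed
    then show ?thesis unfolding weighted_integral_def by (simp only:)
  qed
  then show ?thesis by (simp add: sym_weak_def)
qed

lemma vector_measure_on_entry: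
  fixes \<mu> :: "'a::topological_space set \<Rightarrow> real^'n::finite^'m::finite"
  shows "vector_measure_on U \<mu> \<Longrightarrow> vector_measure_on U (\<lambda>B. \<mu> B $ i $ j)"
  by (rule vector_measure_on_bounded_linear[OF vector_measure_on_bounded_linear[OF _ bounded_linear_vec_nth[of i]] bounded_linear_vec_nth[of j]])

lemma matrix_inner: "(M :: real^'n::finite^'m::finite) \<bullet> N = (\<Sum>i\<in>UNIV. \<Sum>j\<in>UNIV. M $ i $ j * N $ i $ j)"
  by (simp add: inner_vec_def)

lemma abs_entry_le_norm: "\<bar>(M :: real^'n::finite^'m::finite) $ i $ j\<bar> \<le> norm M"
  by (rule order_trans[OF component_le_norm_cart Finite_Cartesian_Product.norm_nth_le])

text \<open>The description of a symmetrised gradient that is used from here on: its entries as functionals \<open>T i j\<close>, and its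
variation \<open>\<rho>\<close>, tied to the entries by the duality bound \<open>M \<bullet> T f \<le> |M| \<integral> f d\<rho>\<close> for \<open>f \<ge> 0\<close> and all matrices \<open>M\<close>.\<close>

lemma sym_gradient_functionals:
  assumes \<mu>: "is_sym_gradient U u \<mu>" and u: "u absolutely_integrable_on U" and U: "open U"
  obtains T \<rho> where "\<forall>i j. daniell (T i j)"
    "\<forall>i j. \<forall>\<phi>\<in>test_functions U. T i j \<phi> = sym_weak U u i j \<phi>"
    "\<forall>i j. \<forall>B\<in>sets borel. T i j (indicator B) = \<mu> (B \<inter> U) $ i $ j"
    "\<forall>i j. \<forall>f\<in>borel_measurable borel. T i j f = signed_integral U (\<lambda>B. \<mu> B $ i $ j) f"
    "sets \<rho> = sets borel" "finite_measure \<rho>" "\<forall>B\<in>sets borel. emeasure \<rho> B = total_variation \<mu> (B \<inter> U)"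
    "\<forall>M. \<forall>f\<in>bounded_borel. (\<forall>x. 0 \<le> f x) \<longrightarrow> (\<Sum>i\<in>UNIV. \<Sum>j\<in>UNIV. M $ i $ j * T i j f) \<le> norm M * (LINT x|\<rho>. f x)"
proof -
  have vm: "vector_measure_on U \<mu>" and Ub: "U \<in> sets borel" using \<mu> U by (simp_all add: is_sym_gradient_def)
  have "\<forall>i j. \<exists>T. daniell T \<and> (\<forall>B\<in>sets borel. T (indicator B) = \<mu> (B \<inter> U) $ i $ j) \<and>
      (\<forall>f\<in>borel_measurable borel. signed_integral U (\<lambda>B. \<mu> B $ i $ j) f = T f)"
    by (intro allI daniell_signed_integral vector_measure_on_entry vm Ub)
  then obtain T where T: "\<And>i j. daniell (T i j)" "\<And>i j B. B \<in> sets borel \<Longrightarrow> T i j (indicator B) = \<mu> (B \<inter> U) $ i $ j"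
      "\<And>i j f. f \<in> borel_measurable borel \<Longrightarrow> signed_integral U (\<lambda>B. \<mu> B $ i $ j) f = T i j f"
    by metis
  have fin: "total_variation \<mu> U < \<infinity>" by (rule total_variation_matrix_finite[OF vm]) (simp add: Ub)
  obtain \<rho> where \<rho>: "sets \<rho> = sets borel" "finite_measure \<rho>"
    "\<forall>B\<in>sets borel. emeasure \<rho> B = total_variation \<mu> (B \<inter> U)"
    "\<forall>B\<in>sets borel. norm (\<mu> (B \<inter> U)) \<le> measure \<rho> B"
    by (rule variation_measure[OF vm Ub fin])
  have sp: "space \<rho> = UNIV" using sets_eq_imp_space_eq[OF \<rho>(1)] by simp
  have le: "(\<Sum>i\<in>UNIV. \<Sum>j\<in>UNIV. M $ i $ j * T i j f) \<le> norm M * (LINT x|\<rho>. f x)"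
    if f: "f \<in> bounded_borel" "\<And>x. 0 \<le> f x" for M f
  proof (rule daniell_mono[OF _ _ _ f])
    show "daniell (\<lambda>f. \<Sum>i\<in>UNIV. \<Sum>j\<in>UNIV. M $ i $ j * T i j f)"
      by (rule daniell_sum_functionals[OF finite_class.finite_UNIV], rule daniell_sum_functionals[OF finite_class.finite_UNIV], rule daniell_cmult, rule T(1))
    show "daniell (\<lambda>f. norm M * (LINT x|\<rho>. f x))"
      by (rule daniell_cmult, rule daniell_finite_measure[OF \<rho>(1,2)])
    fix B :: "(real^'a) set" assume B: "B \<in> sets borel"
    have "(\<Sum>i\<in>UNIV. \<Sum>j\<in>UNIV. M $ i $ j * T i j (indicator B)) = M \<bullet> \<mu> (B \<inter> U)"
      by (simp add: matrix_inner T(2)[OF B])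
    also have "\<dots> \<le> norm M * norm (\<mu> (B \<inter> U))" by (rule norm_cauchy_schwarz)
    also have "\<dots> \<le> norm M * measure \<rho> B" using \<rho>(4) B by (intro mult_left_mono) simp_all
    also have "\<dots> = norm M * (LINT x|\<rho>. indicator B x)" by (simp add: \<rho>(1) sp B)
    finally show "(\<Sum>i\<in>UNIV. \<Sum>j\<in>UNIV. M $ i $ j * T i j (indicator B)) \<le> norm M * (LINT x|\<rho>. indicator B x)" .
  qed
  have weak: "T i j \<phi> = sym_weak U u i j \<phi>" if \<phi>: "\<phi> \<in> test_functions U" for i j \<phi>
  proof -
    have "T i j \<phi> = signed_integral U (\<lambda>B. \<mu> B $ i $ j) \<phi>" by (rule T(3)[OF test_functions_measurable[OF \<phi>], symmetric])
    also have "\<dots> = - (1/2) * (LINT x:U|lebesgue. u x $ i * partial_deriv j \<phi> x + u x $ j * partial_deriv i \<phi> x)"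
      using \<mu> \<phi> by (simp add: is_sym_gradient_def)
    also have "\<dots> = sym_weak U u i j \<phi>" by (rule sym_weak_eq[OF u \<phi>, symmetric])
    finally show ?thesis .
  qed
  show ?thesis
    by (rule that[of T \<rho>]) (use T weak \<rho> le in simp_all)
qed

lemma vector_measure_on_matrixI:
  fixes \<mu> :: "'a::topological_space set \<Rightarrow> real^'n::finite^'m::finite"
  assumes "\<And>i j. vector_measure_on U (\<lambda>B. \<mu> B $ i $ j)"
  shows "vector_measure_on U \<mu>"
  unfolding vector_measure_on_def sums_def
proof (intro allI impI vec_tendstoI)
  fix A :: "nat \<Rightarrow> 'a set" and i j assume "range A \<subseteq> borel_subsets U" "disjoint_family A"
  then have "(\<lambda>n. \<mu> (A n) $ i $ j) sums (\<mu> (\<Union>n. A n) $ i $ j)"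
    using assms[of i j] by (simp add: vector_measure_on_def)
  then show "(\<lambda>n. (\<Sum>k<n. \<mu> (A k)) $ i $ j) \<longlonglongrightarrow> \<mu> (\<Union>n. A n) $ i $ j"
    by (simp add: sums_def)
qed

text \<open>The converse: entries that have the right values on test functions form a symmetrised gradient, and the duality bound
against a positive functional \<open>\<Lambda>\<close> controls its total variation. Taking \<open>M = \<mu> B\<close> in the bound gives
\<open>|\<mu> B|\<^sup>2 \<le> |\<mu> B| \<Lambda> B\<close>. All estimates of total variations below are obtained in this way, so that only inequalities
between integrals of test functions have to be verified.\<close>

lemma sym_gradient_of_functionals:
  fixes w :: "real^'d::finite \<Rightarrow> real^'d"
  assumes S: "open S" and w: "w absolutely_integrable_on S"
    and T: "\<And>i j. daniell (T i j)" "\<And>i j \<phi>. \<phi> \<in> test_functions S \<Longrightarrow> T i j \<phi> = sym_weak S w i j \<phi>"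
    and \<Lambda>: "daniell \<Lambda>" "\<And>B. B \<in> sets borel \<Longrightarrow> 0 \<le> \<Lambda> (indicator B)"
    and le: "\<And>M \<phi>. \<phi> \<in> test_functions S \<Longrightarrow> (\<And>x. 0 \<le> \<phi> x) \<Longrightarrow>
        (\<Sum>i\<in>UNIV. \<Sum>j\<in>UNIV. M $ i $ j * T i j \<phi>) \<le> norm (M :: real^'d^'d) * \<Lambda> \<phi>"
  shows "\<exists>\<mu>. is_sym_gradient S w \<mu> \<and> total_variation \<mu> S \<le> ennreal (\<Lambda> (indicator S))"
proof -
  have Sb: "S \<in> sets borel" using S by simp
  define \<mu> where "\<mu> B = (\<chi> i j. T i j (indicator B))" for B
  have ent: "vector_measure_on S (\<lambda>B. \<mu> B $ i $ j)" for i j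
    unfolding \<mu>_def using vector_measure_on_subset[OF daniell_vector_measure[OF T(1)[of i j]] subset_UNIV] by simp
  have vm: "vector_measure_on S \<mu>" by (rule vector_measure_on_matrixI[OF ent])
  have sym: "transpose (\<mu> B) = \<mu> B" if B: "B \<in> borel_subsets S" for B
  proof -
    have "T j i (indicator B) = T i j (indicator B)" for i j
      by (rule daniell_eq_of_test_functions[OF T(1) T(1) S]) (use B T(2) sym_weak_commute in auto)
    then show ?thesis by (simp add: transpose_def \<mu>_def vec_eq_iff)
  qed
  have weak: "signed_integral S (\<lambda>B. \<mu> B $ i $ j) \<phi> = T i j \<phi>" if \<phi>: "\<phi> \<in> test_functions S" for i j \<phi>
  proof -
    obtain T' where T': "daniell T'" "\<forall>B\<in>sets borel. T' (indicator B) = \<mu> (B \<inter> S) $ i $ j"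
        "\<forall>f\<in>borel_measurable borel. signed_integral S (\<lambda>B. \<mu> B $ i $ j) f = T' f"
      using daniell_signed_integral[OF ent Sb, of i j] by auto
    have "T' \<phi> = T i j (\<lambda>x. indicator S x * \<phi> x)"
    proof (rule daniell_eq[OF T'(1) daniell_weight[OF T(1)] _ test_functions_bounded_borel[OF \<phi>]])
      show "indicator S \<in> (bounded_borel :: (real^'d \<Rightarrow> real) set)" by (rule bounded_borel_indicator[OF Sb])
      fix B :: "(real^'d) set" assume B: "B \<in> sets borel"
      have "(\<lambda>x. indicator S x * indicator B x :: real) = indicator (B \<inter> S)" by (auto simp: indicator_def)
      then show "T' (indicator B) = T i j (\<lambda>x. indicator S x * indicator B x)" using T'(2) B by (simp add: \<mu>_def)
    qed
    also have "(\<lambda>x. indicator S x * \<phi> x) = \<phi>"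
    proof -
      obtain K where "K \<subseteq> S" "\<forall>x. x \<notin> K \<longrightarrow> \<phi> x = 0" by (rule test_functions_support[OF \<phi>])
      then show ?thesis by (intro ext) (auto simp: indicator_def)
    qed
    finally show ?thesis using T'(3) test_functions_measurable[OF \<phi>] by simp
  qed
  have isg: "is_sym_gradient S w \<mu>"
    unfolding is_sym_gradient_def using vm sym weak T(2) sym_weak_eq[OF w] by simp
  have bound: "norm (\<mu> B) \<le> \<Lambda> (indicator B)" if B: "B \<in> borel_subsets S" for B
  proof -
    \<comment> \<open>The choice \<open>M = \<mu> B\<close> is optimal in the duality bound.\<close>
    define M where "M = \<mu> B"
    have "0 \<le> norm M * \<Lambda> (indicator B) - (\<Sum>i\<in>UNIV. \<Sum>j\<in>UNIV. M $ i $ j * T i j (indicator B))"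
    proof (rule daniell_nonneg_of_test_functions[where T = "\<lambda>f. norm M * \<Lambda> f - (\<Sum>i\<in>UNIV. \<Sum>j\<in>UNIV. M $ i $ j * T i j f)", OF _ S])
      show "daniell (\<lambda>f. norm M * \<Lambda> f - (\<Sum>i\<in>UNIV. \<Sum>j\<in>UNIV. M $ i $ j * T i j f))"
        by (rule daniell_minus[OF daniell_cmult[OF \<Lambda>(1)]],
            rule daniell_sum_functionals[OF finite_class.finite_UNIV], rule daniell_sum_functionals[OF finite_class.finite_UNIV], rule daniell_cmult, rule T(1))
    qed (use le B in simp_all)
    also have "(\<Sum>i\<in>UNIV. \<Sum>j\<in>UNIV. M $ i $ j * T i j (indicator B)) = M \<bullet> M"
      by (simp add: matrix_inner) (simp add: M_def \<mu>_def)
    finally have "norm M * norm M \<le> norm M * \<Lambda> (indicator B)"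
      by (simp add: power2_norm_eq_inner[symmetric] power2_eq_square)
    then show ?thesis using \<Lambda>(2)[of B] B by (cases "norm M = 0") (auto simp: M_def)
  qed
  have "total_variation \<mu> S \<le> ennreal (\<Lambda> (indicator S))"
  proof (rule total_variation_le_finite[OF vm subset_refl])
    fix \<A> assume \<A>: "finite \<A>" "\<A> \<subseteq> sets borel" "disjoint \<A>" "\<Union>\<A> \<subseteq> S"
    have \<A>S: "A \<in> borel_subsets S" if "A \<in> \<A>" for A using that \<A>(2,4) by auto
    have v\<Lambda>: "vector_measure_on UNIV (\<lambda>B. \<Lambda> (indicator B))" by (rule daniell_vector_measure[OF \<Lambda>(1)])
    have "(\<Sum>A\<in>\<A>. norm (\<mu> A)) \<le> (\<Sum>A\<in>\<A>. \<Lambda> (indicator A))" using \<A>S bound by (intro sum_mono) simp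
    also have "\<dots> = \<Lambda> (indicator (\<Union>\<A>))"
      by (rule vector_measure_on_finite_UN[OF v\<Lambda>, symmetric]) (use \<A> in auto)
    also have "\<dots> \<le> \<Lambda> (indicator (\<Union>\<A>)) + \<Lambda> (indicator (S - \<Union>\<A>))"
      using \<Lambda>(2)[of "S - \<Union>\<A>"] Sb \<A>(1,2) by (simp add: sets.Diff sets.finite_Union)
    also have "\<dots> = \<Lambda> (indicator (\<Union>\<A> \<union> (S - \<Union>\<A>)))"
      by (rule vector_measure_on_Un[OF v\<Lambda>, symmetric]) (use Sb \<A>(1,2) in \<open>auto simp: sets.Diff sets.finite_Union\<close>)
    also have "\<Union>\<A> \<union> (S - \<Union>\<A>) = S" using \<A>(4) by blast
    finally show "(\<Sum>A\<in>\<A>. ennreal (norm (\<mu> A))) \<le> ennreal (\<Lambda> (indicator S))"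
      by (simp add: sum_ennreal ennreal_leI)
  qed
  then show ?thesis using isg by blast
qed

lemma sym_gradient_unique:
  assumes "is_sym_gradient U u \<mu>" "is_sym_gradient U u \<nu>" "u absolutely_integrable_on U" "open U" "B \<in> borel_subsets U"
  shows "\<mu> B = \<nu> B"
proof -
  obtain S \<rho> where S: "\<forall>i j. daniell (S i j)" "\<forall>i j. \<forall>\<phi>\<in>test_functions U. S i j \<phi> = sym_weak U u i j \<phi>"
     "\<forall>i j. \<forall>B\<in>sets borel. S i j (indicator B) = \<mu> (B \<inter> U) $ i $ j"
    by (rule sym_gradient_functionals[OF assms(1,3,4)])
  obtain T \<rho>' where T: "\<forall>i j. daniell (T i j)" "\<forall>i j. \<forall>\<phi>\<in>test_functions U. T i j \<phi> = sym_weak U u i j \<phi>"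
     "\<forall>i j. \<forall>B\<in>sets borel. T i j (indicator B) = \<nu> (B \<inter> U) $ i $ j"
    by (rule sym_gradient_functionals[OF assms(2,3,4)])
  have "S i j (indicator B) = T i j (indicator B)" for i j
    by (rule daniell_eq_of_test_functions[OF S(1)[rule_format] T(1)[rule_format] assms(4)]) (use S T assms(5) in auto)
  moreover have "B \<inter> U = B" using assms(5) by auto
  ultimately show ?thesis using S(3) T(3) assms(5) by (simp add: vec_eq_iff)
qed

text \<open>The representing set function may stay the same, because values outside \<open>borel_subsets V\<close> are irrelevant.\<close>

lemma sym_gradient_restrict:
  assumes "is_sym_gradient U u \<mu>" "u absolutely_integrable_on U" "open U" "open V" "V \<subseteq> U"
  shows "is_sym_gradient V u \<mu>"
proof -
  obtain T \<rho> where T: "\<forall>i j. daniell (T i j)" "\<forall>i j. \<forall>\<phi>\<in>test_functions U. T i j \<phi> = sym_weak U u i j \<phi>"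
     "\<forall>i j. \<forall>B\<in>sets borel. T i j (indicator B) = \<mu> (B \<inter> U) $ i $ j"
    by (rule sym_gradient_functionals[OF assms(1-3)])
  have vm: "vector_measure_on V \<mu>" using assms by (auto simp: is_sym_gradient_def intro: vector_measure_on_subset)
  have uV: "u absolutely_integrable_on V"
    using set_integrable_subset[OF assms(2) _ assms(5)] assms(4) sets_borel_lebesgue by auto
  have "signed_integral V (\<lambda>B. \<mu> B $ i $ j) \<phi> = sym_weak V u i j \<phi>" if \<phi>: "\<phi> \<in> test_functions V" for i j \<phi>
  proof -
    have \<phi>U: "\<phi> \<in> test_functions U" using \<phi> test_functions_mono[OF assms(5)] by blast
    obtain T' where T': "daniell T'" "\<forall>B\<in>sets borel. T' (indicator B) = \<mu> (B \<inter> V) $ i $ j"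
        "\<forall>f\<in>borel_measurable borel. signed_integral V (\<lambda>B. \<mu> B $ i $ j) f = T' f"
      using daniell_signed_integral[OF vector_measure_on_entry[OF vm], of i j] assms(4) by auto
    have "T' \<phi> = T i j (\<lambda>x. indicator V x * \<phi> x)"
    proof (rule daniell_eq[OF T'(1) daniell_weight[OF T(1)[rule_format]] _ test_functions_bounded_borel[OF \<phi>]])
      show "indicator V \<in> (bounded_borel :: (real^'a \<Rightarrow> real) set)" using assms(4) by (simp add: bounded_borel_indicator)
      fix B :: "(real^'a) set" assume B: "B \<in> sets borel"
      have "(\<lambda>x. indicator V x * indicator B x :: real) = indicator (B \<inter> V)" by (auto simp: indicator_def)
      moreover have "B \<inter> V \<inter> U = B \<inter> V" using assms(5) by auto
      moreover have "B \<inter> V \<in> sets borel" using B assms(4) by auto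
      ultimately show "T' (indicator B) = T i j (\<lambda>x. indicator V x * indicator B x)" using T'(2) T(3) B by simp
    qed
    also have "(\<lambda>x. indicator V x * \<phi> x) = \<phi>"
    proof -
      obtain K where "K \<subseteq> V" "\<forall>x. x \<notin> K \<longrightarrow> \<phi> x = 0" by (rule test_functions_support[OF \<phi>])
      then show ?thesis by (intro ext) (auto simp: indicator_def)
    qed
    also have "T i j \<phi> = sym_weak V u i j \<phi>" using T(2) \<phi>U sym_weak_restrict[OF \<phi> assms(5)] by simp
    finally show ?thesis using T'(3) test_functions_measurable[OF \<phi>] by simp
  qed
  then show ?thesis using assms(1,5) vm sym_weak_eq[OF uV] by (auto simp: is_sym_gradient_def)
qed

lemma total_variation_sym_gradient:
  assumes "is_sym_gradient U u \<mu>" "u absolutely_integrable_on U" "open U"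
  shows "total_variation (sym_gradient U u) U = total_variation \<mu> U"
proof -
  have "is_sym_gradient U u (sym_gradient U u)" unfolding sym_gradient_def by (rule someI[of "is_sym_gradient U u", OF assms(1)])
  then show ?thesis using sym_gradient_unique[OF _ assms] by (intro total_variation_cong) auto
qed

section \<open>Weak compactness of bounded sequences of measures\<close>

text \<open>Both averages count multiples of \<open>1 / m\<close> below \<open>y\<close>. They reduce integrals of continuous functions to measures of open
superlevel sets (strict inequality) and of closed ones (weak inequality), for which the two halves of the convergence
in \<open>portmanteau_compact_support\<close> are known.\<close>

lemma level_average:
  fixes y :: real and m :: nat
  assumes y: "0 \<le> y" "y \<le> 1" and m: "m > 0"
  shows "(\<Sum>j\<in>{1..m}. of_bool (y > real j / real m)) / real m \<le> y"
    and "y \<le> (\<Sum>j\<in>{1..m}. of_bool (y > real j / real m)) / real m + 1 / real m"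
    and "(\<Sum>j\<in>{1..m}. of_bool (y \<ge> real j / real m)) / real m \<le> y"
    and "y \<le> (\<Sum>j\<in>{1..m}. of_bool (y \<ge> real j / real m)) / real m + 1 / real m"
proof -
  define k where "k = nat \<lfloor>real m * y\<rfloor>"
  have k: "real k \<le> real m * y" "real m * y < real k + 1" using y by (auto simp: k_def)
  have km: "k \<le> m"
  proof -
    have "real m * y \<le> real m" using y by (intro mult_left_le) auto
    then show ?thesis using k(1) by linarith
  qed
  have ge: "y \<ge> real j / real m \<longleftrightarrow> j \<le> k" for j
  proof -
    have "y \<ge> real j / real m \<longleftrightarrow> real j \<le> real m * y" using m by (simp add: divide_le_eq mult.commute)
    also have "\<dots> \<longleftrightarrow> j \<le> k" using k by linarith
    finally show ?thesis .
  qed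
  have cnt: "(\<Sum>j\<in>{1..m}. of_bool (j \<le> k)) = real k" if "k \<le> m" for k
  proof -
    have "{1..m} \<inter> {j. j \<le> k} = {1..k}" using that by auto
    then show ?thesis by (simp add: sum_of_bool_eq)
  qed
  have s1: "(\<Sum>j\<in>{1..m}. of_bool (y \<ge> real j / real m)) = real k"
    unfolding ge by (rule cnt[OF km])
  have s2: "real k - 1 \<le> (\<Sum>j\<in>{1..m}. of_bool (y > real j / real m) :: real)" "(\<Sum>j\<in>{1..m}. of_bool (y > real j / real m)) \<le> real k"
     "real m * y \<le> (\<Sum>j\<in>{1..m}. of_bool (y > real j / real m)) + 1"
  proof -
    define k' where "k' = (if real k = real m * y then k - 1 else k)"
    have gt: "y > real j / real m \<longleftrightarrow> j \<le> k'" if "j \<ge> 1" for j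
    proof -
      have "y > real j / real m \<longleftrightarrow> real j < real m * y" using m by (simp add: divide_less_eq mult.commute)
      also have "\<dots> \<longleftrightarrow> j \<le> k'" using k that unfolding k'_def by (auto split: if_splits)
      finally show ?thesis .
    qed
    have "k' \<le> k" by (simp add: k'_def)
    then have km': "k' \<le> m" using km by linarith
    have "(\<Sum>j\<in>{1..m}. of_bool (y > real j / real m)) = (\<Sum>j\<in>{1..m}. of_bool (j \<le> k') :: real)"
      by (rule sum.cong[OF refl]) (simp only: gt atLeastAtMost_iff)
    also have "\<dots> = real k'" by (rule cnt[OF km'])
    finally have "(\<Sum>j\<in>{1..m}. of_bool (y > real j / real m)) = real k'" .
    then show "real k - 1 \<le> (\<Sum>j\<in>{1..m}. of_bool (y > real j / real m) :: real)" "(\<Sum>j\<in>{1..m}. of_bool (y > real j / real m)) \<le> real k"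
     "real m * y \<le> (\<Sum>j\<in>{1..m}. of_bool (y > real j / real m)) + 1"
      using k by (auto simp: k'_def split: if_splits)
  qed
  show "(\<Sum>j\<in>{1..m}. of_bool (y \<ge> real j / real m)) / real m \<le> y"
    unfolding s1 using k(1) m by (simp add: divide_le_eq mult.commute)
  show "y \<le> (\<Sum>j\<in>{1..m}. of_bool (y \<ge> real j / real m)) / real m + 1 / real m"
    unfolding s1 add_divide_distrib[symmetric] using k(2) m by (simp add: le_divide_eq mult.commute)
  show "(\<Sum>j\<in>{1..m}. of_bool (y > real j / real m)) / real m \<le> y"
  proof -
    have "(\<Sum>j\<in>{1..m}. of_bool (y > real j / real m)) \<le> real m * y" using s2(2) k(1) by linarith
    then show ?thesis using m by (simp add: divide_le_eq mult.commute)
  qed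
  show "y \<le> (\<Sum>j\<in>{1..m}. of_bool (y > real j / real m)) / real m + 1 / real m"
    unfolding add_divide_distrib[symmetric] using s2(3) m by (simp add: le_divide_eq mult.commute)
qed

lemma integral_level_average:
  fixes \<phi> :: "'a::topological_space \<Rightarrow> real"
  assumes M: "sets M = sets borel" "finite_measure M" "measure M UNIV \<le> C"
    and \<phi>: "\<phi> \<in> borel_measurable borel" "\<And>x. 0 \<le> \<phi> x" "\<And>x. \<phi> x \<le> 1" and m: "m > (0::nat)"
  shows "(\<Sum>j\<in>{1..m}. measure M {x. \<phi> x > real j / real m}) / real m \<le> (LINT x|M. \<phi> x)"
    and "(LINT x|M. \<phi> x) \<le> (\<Sum>j\<in>{1..m}. measure M {x. \<phi> x > real j / real m}) / real m + C / real m"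
    and "(\<Sum>j\<in>{1..m}. measure M {x. \<phi> x \<ge> real j / real m}) / real m \<le> (LINT x|M. \<phi> x)"
    and "(LINT x|M. \<phi> x) \<le> (\<Sum>j\<in>{1..m}. measure M {x. \<phi> x \<ge> real j / real m}) / real m + C / real m"
proof -
  interpret finite_measure M by fact
  have sp: "space M = UNIV" using sets_eq_imp_space_eq[OF M(1)] by simp
  have meas: "{x. \<phi> x > real j / real m} \<in> sets M" "{x. \<phi> x \<ge> real j / real m} \<in> sets M" for j
    unfolding M(1) using \<phi>(1) by simp_all
  have \<phi>M: "\<phi> \<in> borel_measurable M" using \<phi>(1) measurable_cong_sets[OF M(1) refl] by blast
  have int\<phi>: "integrable M \<phi>" by (rule integrable_const_bound[of _ 1]) (use \<phi> \<phi>M in auto)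
  have int: "integrable M (\<lambda>x. (\<Sum>j\<in>{1..m}. indicator (A j) x) / real m)"
    and eq: "(LINT x|M. (\<Sum>j\<in>{1..m}. indicator (A j) x) / real m) = (\<Sum>j\<in>{1..m}. measure M (A j)) / real m"
    if A: "\<And>j. A j \<in> sets M" for A
  proof -
    have i: "integrable M (indicator (A j) :: 'a \<Rightarrow> real)" for j
      using A by (simp add: emeasure_eq_measure)
    show "integrable M (\<lambda>x. (\<Sum>j\<in>{1..m}. indicator (A j) x) / real m)"
      by (intro integrable_divide_zero Bochner_Integration.integrable_sum i)
    show "(LINT x|M. (\<Sum>j\<in>{1..m}. indicator (A j) x) / real m) = (\<Sum>j\<in>{1..m}. measure M (A j)) / real m"
      using i A by (simp add: sp)
  qed
  have c1: "(\<Sum>j\<in>{1..m}. indicator {x. \<phi> x > real j / real m} x) = (\<Sum>j\<in>{1..m}. of_bool (\<phi> x > real j / real m) :: real)" for x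
    by (simp add: indicator_def)
  have c2: "(\<Sum>j\<in>{1..m}. indicator {x. \<phi> x \<ge> real j / real m} x) = (\<Sum>j\<in>{1..m}. of_bool (\<phi> x \<ge> real j / real m) :: real)" for x
    by (simp add: indicator_def)
  have int1: "integrable M (\<lambda>x. (\<Sum>j\<in>{1..m}. of_bool (\<phi> x > real j / real m)) / real m)"
    and eq1: "(LINT x|M. (\<Sum>j\<in>{1..m}. of_bool (\<phi> x > real j / real m)) / real m) = (\<Sum>j\<in>{1..m}. measure M {x. \<phi> x > real j / real m}) / real m"
    using int[of "\<lambda>j. {x. \<phi> x > real j / real m}", OF meas(1)] eq[of "\<lambda>j. {x. \<phi> x > real j / real m}", OF meas(1)]
    by (simp_all only: c1)
  have int2: "integrable M (\<lambda>x. (\<Sum>j\<in>{1..m}. of_bool (\<phi> x \<ge> real j / real m)) / real m)"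
    and eq2: "(LINT x|M. (\<Sum>j\<in>{1..m}. of_bool (\<phi> x \<ge> real j / real m)) / real m) = (\<Sum>j\<in>{1..m}. measure M {x. \<phi> x \<ge> real j / real m}) / real m"
    using int[of "\<lambda>j. {x. \<phi> x \<ge> real j / real m}", OF meas(2)] eq[of "\<lambda>j. {x. \<phi> x \<ge> real j / real m}", OF meas(2)]
    by (simp_all only: c2)
  have ic: "integrable M (\<lambda>x. 1 / real m :: real)" by simp
  have ce: "(LINT x|M. 1 / real m) \<le> C / real m" using M(3) m by (simp add: sp divide_right_mono)
  show "(\<Sum>j\<in>{1..m}. measure M {x. \<phi> x > real j / real m}) / real m \<le> (LINT x|M. \<phi> x)"
    unfolding eq1[symmetric]
    by (rule integral_mono[OF int1 int\<phi>]) (rule level_average(1)[OF \<phi>(2,3) m])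
  show "(\<Sum>j\<in>{1..m}. measure M {x. \<phi> x \<ge> real j / real m}) / real m \<le> (LINT x|M. \<phi> x)"
    unfolding eq2[symmetric]
    by (rule integral_mono[OF int2 int\<phi>]) (rule level_average(3)[OF \<phi>(2,3) m])
  have "(LINT x|M. \<phi> x) \<le> (LINT x|M. (\<Sum>j\<in>{1..m}. of_bool (\<phi> x > real j / real m)) / real m + 1 / real m)"
    by (rule integral_mono[OF int\<phi> Bochner_Integration.integrable_add[OF int1 ic]]) (rule level_average(2)[OF \<phi>(2,3) m])
  also have "\<dots> = (\<Sum>j\<in>{1..m}. measure M {x. \<phi> x > real j / real m}) / real m + (LINT x|M. 1 / real m)"
    unfolding eq1[symmetric] by (rule Bochner_Integration.integral_add[OF int1 ic])
  finally show "(LINT x|M. \<phi> x) \<le> (\<Sum>j\<in>{1..m}. measure M {x. \<phi> x > real j / real m}) / real m + C / real m" using ce by linarith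
  have "(LINT x|M. \<phi> x) \<le> (LINT x|M. (\<Sum>j\<in>{1..m}. of_bool (\<phi> x \<ge> real j / real m)) / real m + 1 / real m)"
    by (rule integral_mono[OF int\<phi> Bochner_Integration.integrable_add[OF int2 ic]]) (rule level_average(4)[OF \<phi>(2,3) m])
  also have "\<dots> = (\<Sum>j\<in>{1..m}. measure M {x. \<phi> x \<ge> real j / real m}) / real m + (LINT x|M. 1 / real m)"
    unfolding eq2[symmetric] by (rule Bochner_Integration.integral_add[OF int2 ic])
  finally show "(LINT x|M. \<phi> x) \<le> (\<Sum>j\<in>{1..m}. measure M {x. \<phi> x \<ge> real j / real m}) / real m + C / real m" using ce by linarith
qed

text \<open>The lower bound for the integrals comes from open superlevel sets and the upper bound from compact ones. Compact
support keeps all of them bounded, so mass that escapes to infinity does no harm.\<close>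

lemma portmanteau_compact_support:
  fixes \<phi> :: "'a::euclidean_space \<Rightarrow> real"
  assumes P: "\<And>k::nat. sets (P k) = sets borel" "\<And>k. finite_measure (P k)" "\<And>k. measure (P k) UNIV \<le> C"
    and M: "sets M = sets borel" "finite_measure M" "measure M UNIV \<le> C"
    and op: "\<And>A e. open A \<Longrightarrow> bounded A \<Longrightarrow> e > 0 \<Longrightarrow> \<forall>\<^sub>F k in sequentially. measure M A - e \<le> measure (P k) A"
    and cp: "\<And>A e. compact A \<Longrightarrow> e > 0 \<Longrightarrow> \<forall>\<^sub>F k in sequentially. measure (P k) A \<le> measure M A + e"
    and \<phi>: "continuous_on UNIV \<phi>" "\<And>x. 0 \<le> \<phi> x" "\<And>x. \<phi> x \<le> 1" and K: "compact K" "\<And>x. x \<notin> K \<Longrightarrow> \<phi> x = 0"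
  shows "(\<lambda>k. LINT x|P k. \<phi> x) \<longlonglongrightarrow> (LINT x|M. \<phi> x)"
proof (rule LIMSEQ_I)
  fix e :: real assume e: "e > 0"
  have C0: "0 \<le> C" by (rule order_trans[OF measure_nonneg M(3)])
  obtain m :: nat where m: "2 * C / e < real m" "m > 0"
    using reals_Archimedean2[of "max (2 * C / e) 0"] by auto
  have Cm: "C / real m < e / 2" using m e by (simp add: field_simps)
  have \<phi>b: "\<phi> \<in> borel_measurable borel" using \<phi>(1) by (rule borel_measurable_continuous_onI)
  define A where "A j = {x. \<phi> x > real j / real m}" for j
  define F where "F j = {x. \<phi> x \<ge> real j / real m}" for j
  have AK: "A j \<subseteq> K" for j
  proof
    fix x assume x: "x \<in> A j"
    have "0 \<le> real j / real m" by simp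
    also have "real j / real m < \<phi> x" using x by (simp add: A_def)
    finally have "\<phi> x \<noteq> 0" by simp
    then show "x \<in> K" using K(2) by blast
  qed
  have A: "open (A j)" "bounded (A j)" for j
  proof -
    show "open (A j)" unfolding A_def by (rule open_Collect_less[OF continuous_on_const \<phi>(1)])
    show "bounded (A j)" by (rule bounded_subset[OF compact_imp_bounded[OF K(1)] AK])
  qed
  have F: "compact (F j)" if "j \<in> {1..m}" for j
  proof -
    have "F j \<subseteq> K"
    proof
      fix x assume x: "x \<in> F j"
      have "real j / real m > 0" using that m by auto
      then have "\<phi> x \<noteq> 0" using x by (auto simp: F_def)
      then show "x \<in> K" using K(2) by blast
    qed
    moreover have "closed (F j)" unfolding F_def by (rule closed_Collect_le[OF continuous_on_const \<phi>(1)])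
    ultimately show ?thesis using compact_Int_closed[OF K(1), of "F j"] by (simp add: inf.absorb2)
  qed
  have e2: "e/4 > 0" using e by simp
  have "\<forall>\<^sub>F k in sequentially. \<forall>j\<in>{1..m}. measure M (A j) - e/4 \<le> measure (P k) (A j)"
    using op[OF A e2] by (intro eventually_ball_finite) auto
  moreover have "\<forall>\<^sub>F k in sequentially. \<forall>j\<in>{1..m}. measure (P k) (F j) \<le> measure M (F j) + e/4"
    using cp[OF F e2] by (intro eventually_ball_finite) auto
  ultimately have ev: "\<forall>\<^sub>F k in sequentially. norm ((LINT x|P k. \<phi> x) - (LINT x|M. \<phi> x)) < e"
  proof eventually_elim
    case (elim k)
    have m0: "real m > 0" using m by simp
    have "(LINT x|M. \<phi> x) \<le> (\<Sum>j\<in>{1..m}. measure M (A j)) / real m + C / real m"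
      unfolding A_def by (rule integral_level_average(2)[OF M \<phi>b \<phi>(2,3) m(2)])
    also have "(\<Sum>j\<in>{1..m}. measure M (A j)) / real m \<le> (\<Sum>j\<in>{1..m}. measure (P k) (A j) + e/4) / real m"
      using elim(1) by (intro divide_right_mono sum_mono) (auto simp: algebra_simps)
    also have "\<dots> = (\<Sum>j\<in>{1..m}. measure (P k) (A j)) / real m + e/4"
      using m0 by (simp add: sum.distrib add_divide_distrib)
    also have "(\<Sum>j\<in>{1..m}. measure (P k) (A j)) / real m \<le> (LINT x|P k. \<phi> x)"
      unfolding A_def by (rule integral_level_average(1)[OF P \<phi>b \<phi>(2,3) m(2)])
    finally have 1: "(LINT x|M. \<phi> x) \<le> (LINT x|P k. \<phi> x) + e/4 + C / real m" by simp
    have "(LINT x|P k. \<phi> x) \<le> (\<Sum>j\<in>{1..m}. measure (P k) (F j)) / real m + C / real m"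
      unfolding F_def by (rule integral_level_average(4)[OF P \<phi>b \<phi>(2,3) m(2)])
    also have "(\<Sum>j\<in>{1..m}. measure (P k) (F j)) / real m \<le> (\<Sum>j\<in>{1..m}. measure M (F j) + e/4) / real m"
      using elim(2) by (intro divide_right_mono sum_mono) auto
    also have "\<dots> = (\<Sum>j\<in>{1..m}. measure M (F j)) / real m + e/4"
      using m0 by (simp add: sum.distrib add_divide_distrib)
    also have "(\<Sum>j\<in>{1..m}. measure M (F j)) / real m \<le> (LINT x|M. \<phi> x)"
      unfolding F_def by (rule integral_level_average(3)[OF M \<phi>b \<phi>(2,3) m(2)])
    finally have 2: "(LINT x|P k. \<phi> x) \<le> (LINT x|M. \<phi> x) + e/4 + C / real m" by simp
    have "\<bar>(LINT x|P k. \<phi> x) - (LINT x|M. \<phi> x)\<bar> < e" using 1 2 Cm e by linarith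
    then show ?case by simp
  qed
  then show "\<exists>no. \<forall>n\<ge>no. norm ((LINT x|P n. \<phi> x) - (LINT x|M. \<phi> x)) < e" by (simp add: eventually_sequentially)
qed

text \<open>The measures \<open>P k\<close> themselves satisfy the hypotheses of the De Giorgi--Letta construction, with the lower and upper
limits of \<open>P k U\<close>. The resulting measure is the weak limit: it is below the lower limit on open sets, and compact sets can
be enlarged to members of \<open>R\<close>.\<close>

lemma weak_limit_exists:
  fixes P :: "nat \<Rightarrow> 'a::euclidean_space measure"
  assumes P: "\<And>k. sets (P k) = sets borel" "\<And>k. finite_measure (P k)" "\<And>k. measure (P k) UNIV \<le> C"
    and R: "\<And>U. U \<in> R \<Longrightarrow> open U" "\<And>U. U \<in> R \<Longrightarrow> bounded U"
       "\<And>K U. compact K \<Longrightarrow> open U \<Longrightarrow> K \<subseteq> U \<Longrightarrow> \<exists>V\<in>R. K \<subseteq> V \<and> closure V \<subseteq> U"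
    and conv: "\<And>U. U \<in> R \<Longrightarrow> convergent (\<lambda>k. emeasure (P k) U)"
  shows "\<exists>M. sets M = sets borel \<and> finite_measure M \<and> measure M UNIV \<le> C \<and>
    (\<forall>(\<phi> :: 'a \<Rightarrow> real) K. continuous_on UNIV \<phi> \<longrightarrow> (\<forall>x. 0 \<le> \<phi> x \<and> \<phi> x \<le> 1) \<longrightarrow> compact K \<longrightarrow> (\<forall>x. x \<notin> K \<longrightarrow> \<phi> x = 0) \<longrightarrow>
       (\<lambda>k. LINT x|P k. \<phi> x) \<longlonglongrightarrow> (LINT x|M. \<phi> x))"
proof -
  define al where "al U = liminf (\<lambda>k. emeasure (P k) U)" for U
  define be where "be U = limsup (\<lambda>k. emeasure (P k) U)" for U
  have om: "open U \<Longrightarrow> U \<in> sets (P k)" for U k by (simp add: P(1))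
  have C0: "0 \<le> C" by (rule order_trans[OF measure_nonneg P(3)[of 0]])
  have Ple: "emeasure (P k) U \<le> ennreal C" for k U
  proof -
    interpret finite_measure "P k" by (rule P(2))
    have "measure (P k) U \<le> measure (P k) UNIV"
      using bounded_measure[of U] sets_eq_imp_space_eq[OF P(1)[of k]] by simp
    then show ?thesis using P(3)[of k] by (simp add: emeasure_eq_measure ennreal_leI)
  qed
  interpret letta_increasing al be R
  proof
    show "al U \<le> be U" for U unfolding al_def be_def by (rule Liminf_le_Limsup) simp
    show "al U \<le> al V" if "open U" "open V" "bounded V" "U \<subseteq> V" for U V
      unfolding al_def using that om by (intro Liminf_mono always_eventually allI emeasure_mono) auto
    show "be U \<le> be V" if "open U" "open V" "bounded V" "U \<subseteq> V" for U V
      unfolding be_def using that om by (intro Limsup_mono always_eventually allI emeasure_mono) auto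
    show "be {} = 0" by (simp add: be_def Limsup_const)
    show "al U + al V \<le> al (U \<union> V)" if "open U" "open V" "bounded U" "bounded V" "U \<inter> V = {}" for U V
    proof -
      have "emeasure (P k) U + emeasure (P k) V = emeasure (P k) (U \<union> V)" for k
        by (rule plus_emeasure) (use that om in auto)
      then show ?thesis using liminf_superadd_ennreal[of "\<lambda>k. emeasure (P k) U" "\<lambda>k. emeasure (P k) V"] by (simp add: al_def)
    qed
    show "be (U' \<union> V) \<le> be U + be V" if "open U'" "open U" "open V" "closure U' \<subseteq> U" for U' U V
    proof -
      have "emeasure (P k) (U' \<union> V) \<le> emeasure (P k) U + emeasure (P k) V" for k
      proof -
        have "emeasure (P k) (U' \<union> V) \<le> emeasure (P k) (U \<union> V)"
          using that om closure_subset[of U'] by (intro emeasure_mono) auto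
        also have "\<dots> \<le> emeasure (P k) U + emeasure (P k) V" using that om by (intro emeasure_subadditive) auto
        finally show ?thesis .
      qed
      then have "be (U' \<union> V) \<le> limsup (\<lambda>k. emeasure (P k) U + emeasure (P k) V)"
        unfolding be_def by (intro Limsup_mono always_eventually allI)
      also have "\<dots> \<le> be U + be V" unfolding be_def by (rule limsup_subadd_ennreal)
      finally show ?thesis .
    qed
    show "be U \<le> al U" if UR: "U \<in> R" for U
    proof -
      obtain l where l: "(\<lambda>k. emeasure (P k) U) \<longlonglongrightarrow> l" using conv[OF UR] by (auto simp: convergent_def)
      then show ?thesis using lim_imp_Liminf[OF sequentially_bot l] lim_imp_Limsup[OF sequentially_bot l] by (simp add: al_def be_def)
    qed
    show "\<exists>V\<in>R. open V \<and> bounded V \<and> K \<subseteq> V \<and> closure V \<subseteq> U" if "compact K" "open U" "K \<subseteq> U" for K U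
      using R(3)[OF that] R(1,2) by blast
  qed
  obtain M where M: "sets M = sets borel" "\<forall>B\<in>sets borel. emeasure M B = outer B"
    by (rule measure_space_obtain[OF measure_space_outer])
  have spM: "space M = UNIV" using sets_eq_imp_space_eq[OF M(1)] by simp
  have "emeasure M UNIV = inner UNIV" using M(2) by (simp add: outer_open)
  also have "\<dots> \<le> ennreal C" unfolding inner_def
  proof (rule SUP_least)
    fix V
    have "al V \<le> be V" unfolding al_def be_def by (rule Liminf_le_Limsup) simp
    also have "\<dots> \<le> ennreal C" unfolding be_def by (rule Limsup_bounded) (use Ple in simp)
    finally show "al V \<le> ennreal C" .
  qed
  finally have mass: "emeasure M UNIV \<le> ennreal C" .
  have fin: "finite_measure M"
    by (rule finite_measureI) (use mass spM in \<open>auto simp: top_unique\<close>)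
  interpret M: finite_measure M by (rule fin)
  have mass': "measure M UNIV \<le> C" using mass C0 by (simp add: M.emeasure_eq_measure)
  have op: "\<forall>\<^sub>F k in sequentially. measure M A - e \<le> measure (P k) A" if A: "open A" "bounded A" and e: "e > 0" for A e
  proof (cases "measure M A - e \<le> 0")
    case True
    then have "measure M A - e \<le> measure (P k) A" for k using measure_nonneg[of "P k" A] by linarith
    then show ?thesis by simp
  next
    case False
    have "ennreal (measure M A - e) < emeasure M A" using False e by (simp add: M.emeasure_eq_measure ennreal_less_iff)
    also have "\<dots> \<le> al A" using M(2) A inner_le_al[OF A] by (simp add: outer_open)
    finally have "\<forall>\<^sub>F k in sequentially. ennreal (measure M A - e) < emeasure (P k) A"
      unfolding al_def by (rule less_LiminfD)
    then show ?thesis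
    proof eventually_elim
      case (elim k)
      interpret finite_measure "P k" by (rule P(2))
      show ?case using elim False by (simp add: emeasure_eq_measure ennreal_less_iff)
    qed
  qed
  have cp: "\<forall>\<^sub>F k in sequentially. measure (P k) A \<le> measure M A + e" if A: "compact A" and e: "e > 0" for A e
  proof -
    have Am: "A \<in> sets borel" using A by (simp add: borel_compact)
    have "outer A = ennreal (measure M A)" using M(2) Am by (simp add: M.emeasure_eq_measure[symmetric])
    also have "\<dots> < ennreal (measure M A + e)" using e by (simp add: ennreal_less_iff)
    finally have "outer A < ennreal (measure M A + e)" .
    then obtain U where U: "open U" "A \<subseteq> U" "inner U < ennreal (measure M A + e)"
      unfolding outer_def INF_less_iff by auto
    obtain V where V: "V \<in> R" "A \<subseteq> V" "closure V \<subseteq> U" using R(3)[OF A U(1,2)] by blast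
    have "be V \<le> inner U" by (rule be_le_inner) (use V R U in auto)
    then have "limsup (\<lambda>k. emeasure (P k) V) < ennreal (measure M A + e)" using U(3) by (simp add: be_def)
    then have "\<forall>\<^sub>F k in sequentially. emeasure (P k) V < ennreal (measure M A + e)" by (rule Limsup_lessD)
    then show ?thesis
    proof eventually_elim
      case (elim k)
      interpret finite_measure "P k" by (rule P(2))
      have "ennreal (measure (P k) A) = emeasure (P k) A" by (simp add: emeasure_eq_measure)
      also have "\<dots> \<le> emeasure (P k) V" by (rule emeasure_mono[OF V(2) om[OF R(1)[OF V(1)]]])
      also have "\<dots> < ennreal (measure M A + e)" by (rule elim)
      finally have "ennreal (measure (P k) A) < ennreal (measure M A + e)" .
      then have "measure (P k) A < measure M A + e" using measure_nonneg[of "P k" A] by (simp add: ennreal_less_iff)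
      then show ?case by simp
    qed
  qed
  show ?thesis
  proof (intro exI[of _ M] conjI allI impI)
    fix \<phi> :: "'a \<Rightarrow> real" and K assume a: "continuous_on UNIV \<phi>" "\<forall>x. 0 \<le> \<phi> x \<and> \<phi> x \<le> 1" "compact K" "\<forall>x. x \<notin> K \<longrightarrow> \<phi> x = (0::real)"
    show "(\<lambda>k. LINT x|P k. \<phi> x) \<longlonglongrightarrow> (LINT x|M. \<phi> x)"
      by (rule portmanteau_compact_support[OF P M(1) fin mass' op cp a(1) _ _ a(3)]) (use a in auto)
  qed (use M fin mass' in auto)
qed

text \<open>Countably many sequences are treated at once, since a symmetrised gradient has several entries that need a common
subsequence.\<close>

lemma weak_compactness:
  fixes P :: "'i::countable \<Rightarrow> nat \<Rightarrow> (real^'d::finite) measure"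
  assumes P: "\<And>i k. sets (P i k) = sets borel" "\<And>i k. finite_measure (P i k)" "\<And>i k. measure (P i k) UNIV \<le> C"
  shows "\<exists>r Q. strict_mono (r :: nat \<Rightarrow> nat) \<and> (\<forall>i. sets (Q i) = sets borel \<and> finite_measure (Q i) \<and> measure (Q i) UNIV \<le> C \<and>
     (\<forall>\<phi>\<in>test_functions UNIV. (\<lambda>k. LINT x|P i (r k). \<phi> x) \<longlonglongrightarrow> (LINT x|Q i. \<phi> x)))"
proof -
  obtain R :: "(real^'d) set set" where R: "countable R" "\<And>U. U \<in> R \<Longrightarrow> open U" "\<And>U. U \<in> R \<Longrightarrow> bounded U"
    "\<And>K U. compact K \<Longrightarrow> open U \<Longrightarrow> K \<subseteq> U \<Longrightarrow> \<exists>V\<in>R. K \<subseteq> V \<and> closure V \<subseteq> U"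
    using countable_dense_opens by metis
  have "countable ((UNIV :: 'i set) \<times> R)" using R(1) by simp
  then obtain r where r: "strict_mono (r :: nat \<Rightarrow> nat)" "\<forall>s\<in>UNIV \<times> R. convergent (\<lambda>k. emeasure (P (fst s) (r k)) (snd s))"
    using ennreal_diagonal_subsequence[of "UNIV \<times> R" "\<lambda>s k. emeasure (P (fst s) k) (snd s)"] by blast
  define lim where "lim i M \<longleftrightarrow> sets M = sets borel \<and> finite_measure M \<and> measure M UNIV \<le> C \<and>
    (\<forall>(\<phi> :: real^'d \<Rightarrow> real) K. continuous_on UNIV \<phi> \<longrightarrow> (\<forall>x. 0 \<le> \<phi> x \<and> \<phi> x \<le> 1) \<longrightarrow> compact K \<longrightarrow> (\<forall>x. x \<notin> K \<longrightarrow> \<phi> x = 0) \<longrightarrow>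
       (\<lambda>k. LINT x|P i (r k). \<phi> x) \<longlonglongrightarrow> (LINT x|M. \<phi> x))" for i and M :: "(real^'d) measure"
  have "\<exists>M. lim i M" for i
    unfolding lim_def
    by (rule weak_limit_exists[OF P(1) P(2) P(3) R(2,3,4)]) (use r(2) in force)+
  then have ex: "\<exists>M. lim i M" for i .
  define Q where "Q i = (SOME M. lim i M)" for i
  have lim: "lim i (Q i)" for i unfolding Q_def by (rule someI_ex[OF ex])
  have Q: "\<And>i. sets (Q i) = sets borel" "\<And>i. finite_measure (Q i)" "\<And>i. measure (Q i) UNIV \<le> C"
    "\<And>i (\<phi> :: real^'d \<Rightarrow> real) K. continuous_on UNIV \<phi> \<Longrightarrow> (\<forall>x. 0 \<le> \<phi> x \<and> \<phi> x \<le> 1) \<Longrightarrow> compact K \<Longrightarrow> (\<forall>x. x \<notin> K \<longrightarrow> \<phi> x = 0) \<Longrightarrow>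
       (\<lambda>k. LINT x|P i (r k). \<phi> x) \<longlonglongrightarrow> (LINT x|Q i. \<phi> x)"
  proof -
    fix i
    show "sets (Q i) = sets borel" "finite_measure (Q i)" "measure (Q i) UNIV \<le> C" using lim[of i] unfolding lim_def by simp_all
    fix \<phi> :: "real^'d \<Rightarrow> real" and K assume "continuous_on UNIV \<phi>" "\<forall>x. 0 \<le> \<phi> x \<and> \<phi> x \<le> 1" "compact K" "\<forall>x. x \<notin> K \<longrightarrow> \<phi> x = 0"
    then show "(\<lambda>k. LINT x|P i (r k). \<phi> x) \<longlonglongrightarrow> (LINT x|Q i. \<phi> x)" using lim[of i] unfolding lim_def by blast
  qed
  have "(\<lambda>k. LINT x|P i (r k). \<phi> x) \<longlonglongrightarrow> (LINT x|Q i. \<phi> x)" if \<phi>: "\<phi> \<in> test_functions UNIV" for i \<phi>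
  proof -
    obtain B where B: "B > 0" "\<And>x. \<bar>\<phi> x\<bar> \<le> B" using test_functions_bounded[OF \<phi>] by metis
    obtain K where K: "compact K" "K \<subseteq> UNIV" "\<forall>x. x \<notin> K \<longrightarrow> \<phi> x = 0" by (rule test_functions_support[OF \<phi>])
    have c: "continuous_on UNIV \<phi>" by (rule smooth_continuous[OF test_functions_smooth[OF \<phi>]])
    \<comment> \<open>Weak convergence is known for functions with values in \<open>[0, 1]\<close>.\<close>
    define p where "p x = max (\<phi> x) 0 / B" for x
    define n where "n x = max (- \<phi> x) 0 / B" for x
    have pl: "(\<lambda>k. LINT x|P i (r k). p x) \<longlonglongrightarrow> (LINT x|Q i. p x)"
    proof (rule Q(4)[OF _ _ K(1)])
      show "continuous_on UNIV p" unfolding p_def using c B by (intro continuous_intros) auto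
      show "\<forall>x. 0 \<le> p x \<and> p x \<le> 1" using B by (auto simp: p_def divide_le_eq abs_le_iff)
    qed (use K in \<open>auto simp: p_def\<close>)
    have nl: "(\<lambda>k. LINT x|P i (r k). n x) \<longlonglongrightarrow> (LINT x|Q i. n x)"
    proof (rule Q(4)[OF _ _ K(1)])
      show "continuous_on UNIV n" unfolding n_def using c B by (intro continuous_intros) auto
      show "\<forall>x. 0 \<le> n x \<and> n x \<le> 1" using B by (auto simp: n_def divide_le_eq abs_le_iff)
    qed (use K in \<open>auto simp: n_def\<close>)
    have pb: "p \<in> bounded_borel" "n \<in> bounded_borel"
    proof -
      have "p \<in> borel_measurable borel" "n \<in> borel_measurable borel"
        unfolding p_def n_def using test_functions_measurable[OF \<phi>] by measurable
      moreover have "\<bar>p x\<bar> \<le> 1" "\<bar>n x\<bar> \<le> 1" for x using B by (auto simp: p_def n_def divide_le_eq abs_le_iff)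
      ultimately show "p \<in> bounded_borel" "n \<in> bounded_borel" by (auto intro: bounded_borelI)
    qed
    have eq: "(LINT x|M. \<phi> x) = B * (LINT x|M. p x) - B * (LINT x|M. n x)"
      if M: "sets M = sets borel" "finite_measure M" for M
    proof -
      have d: "daniell (\<lambda>f. LINT x|M. f x)" by (rule daniell_finite_measure[OF M])
      have "\<phi> = (\<lambda>x. B * p x - B * n x)" using B by (auto simp: p_def n_def max_def)
      then have "(LINT x|M. \<phi> x) = (LINT x|M. B * p x - B * n x)" by metis
      also have "\<dots> = (LINT x|M. B * p x) - (LINT x|M. B * n x)"
        by (rule daniell_diff[OF d]) (intro bounded_borel_mult bounded_borel_const pb)+
      also have "\<dots> = B * (LINT x|M. p x) - B * (LINT x|M. n x)" by simp
      finally show ?thesis .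
    qed
    show ?thesis unfolding eq[OF P(1,2)] eq[OF Q(1,2)] by (intro tendsto_diff tendsto_mult tendsto_const pl nl)
  qed
  then show ?thesis using r(1) Q(1-3) by blast
qed

section \<open>Gluing functions of bounded deformation with a cutoff\<close>

lemma convex_combination_integrable:
  fixes u v :: "'a::euclidean_space \<Rightarrow> 'b::euclidean_space" and \<eta> :: "'a \<Rightarrow> real"
  assumes u: "u absolutely_integrable_on S" and v: "v absolutely_integrable_on S"
    and \<eta>: "\<eta> \<in> borel_measurable borel" "\<And>x. 0 \<le> \<eta> x" "\<And>x. \<eta> x \<le> 1"
  shows "(\<lambda>x. \<eta> x *\<^sub>R u x + (1 - \<eta> x) *\<^sub>R v x) absolutely_integrable_on S"
  unfolding set_integrable_def
proof (rule Bochner_Integration.integrable_bound)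
  have \<eta>m: "\<eta> \<in> borel_measurable lebesgue" by (rule borel_measurable_lebesgueI[OF \<eta>(1)])
  note iu = u[unfolded set_integrable_def] and iv = v[unfolded set_integrable_def]
  show "integrable lebesgue (\<lambda>x. norm (indicator S x *\<^sub>R u x) + norm (indicator S x *\<^sub>R v x))"
    by (intro Bochner_Integration.integrable_add integrable_norm iu iv)
  have "(\<lambda>x. \<eta> x *\<^sub>R (indicator S x *\<^sub>R u x) + (1 - \<eta> x) *\<^sub>R (indicator S x *\<^sub>R v x)) \<in> borel_measurable lebesgue"
    by (rule borel_measurable_add[OF borel_measurable_scaleR[OF \<eta>m borel_measurable_integrable[OF iu]]
        borel_measurable_scaleR[OF borel_measurable_diff[OF borel_measurable_const \<eta>m] borel_measurable_integrable[OF iv]]])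
  moreover have "(\<lambda>x. \<eta> x *\<^sub>R (indicator S x *\<^sub>R u x) + (1 - \<eta> x) *\<^sub>R (indicator S x *\<^sub>R v x)) = (\<lambda>x. indicator S x *\<^sub>R (\<eta> x *\<^sub>R u x + (1 - \<eta> x) *\<^sub>R v x))"
    by (auto simp: algebra_simps)
  ultimately show "(\<lambda>x. indicator S x *\<^sub>R (\<eta> x *\<^sub>R u x + (1 - \<eta> x) *\<^sub>R v x)) \<in> borel_measurable lebesgue" by simp
  have "norm (indicator S x *\<^sub>R (\<eta> x *\<^sub>R u x + (1 - \<eta> x) *\<^sub>R v x)) \<le> norm (norm (indicator S x *\<^sub>R u x) + norm (indicator S x *\<^sub>R v x))" for x
  proof -
    have "norm (\<eta> x *\<^sub>R u x + (1 - \<eta> x) *\<^sub>R v x) \<le> norm (\<eta> x *\<^sub>R u x) + norm ((1 - \<eta> x) *\<^sub>R v x)" by (rule norm_triangle_ineq)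
    also have "\<dots> \<le> norm (u x) + norm (v x)" using \<eta>(2,3)[of x] by (intro add_mono) (auto intro: mult_left_le_one_le)
    finally show ?thesis by (simp add: indicator_def)
  qed
  then show "AE x in lebesgue. norm (indicator S x *\<^sub>R (\<eta> x *\<^sub>R u x + (1 - \<eta> x) *\<^sub>R v x)) \<le> norm (norm (indicator S x *\<^sub>R u x) + norm (indicator S x *\<^sub>R v x))" by simp
qed

text \<open>By the product rule \<open>E w = \<eta> E u + (1 - \<eta>) E v + (u - v) \<odot> \<nabla>\<eta>\<close>, where \<open>\<odot>\<close> is the symmetrised tensor product. The last term
has at most \<open>d\<^sup>2\<close> entries, each bounded by \<open>L |u - v|\<close>.\<close>

lemma BD_cutoff:
  fixes u v :: "real^'d::finite \<Rightarrow> real^'d" and \<eta> :: "real^'d \<Rightarrow> real"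
  assumes S: "open S" and u: "u absolutely_integrable_on S" and v: "v absolutely_integrable_on S"
    and \<mu>: "is_sym_gradient S u \<mu>" and \<nu>: "is_sym_gradient S v \<nu>"
    and \<eta>: "\<eta> \<in> test_functions UNIV" "\<And>x. 0 \<le> \<eta> x" "\<And>x. \<eta> x \<le> 1"
    and L: "\<And>j x. \<bar>partial_deriv j \<eta> x\<bar> \<le> L"
  defines "w \<equiv> (\<lambda>x. \<eta> x *\<^sub>R u x + (1 - \<eta> x) *\<^sub>R v x)"
  shows "\<exists>\<kappa>. is_sym_gradient S w \<kappa> \<and> total_variation \<kappa> S \<le> total_variation \<mu> S + total_variation \<nu> S +
      ennreal (real CARD('d) * real CARD('d) * L * (LINT x:S|lebesgue. norm (u x - v x)))"
proof -
  have wS: "w absolutely_integrable_on S"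
    unfolding w_def by (rule convex_combination_integrable[OF u v test_functions_measurable[OF \<eta>(1)] \<eta>(2,3)])
  define d where "d x = norm (u x - v x)" for x
  have uv: "set_integrable lebesgue S (\<lambda>x. u x - v x)" by (rule set_integral_diff(1)[OF u v])
  have dS: "set_integrable lebesgue S d" unfolding d_def by (rule set_integrable_norm[OF uv])
  have Sb: "S \<in> sets borel" using S by simp
  have L0: "0 \<le> L" by (rule order_trans[OF abs_ge_zero L])
  obtain Tu \<rho>u where Tu: "\<forall>i j. daniell (Tu i j)"
    "\<forall>i j. \<forall>\<phi>\<in>test_functions S. Tu i j \<phi> = sym_weak S u i j \<phi>"
    "\<forall>i j. \<forall>B\<in>sets borel. Tu i j (indicator B) = \<mu> (B \<inter> S) $ i $ j"
    "\<forall>i j. \<forall>f\<in>borel_measurable borel. Tu i j f = signed_integral S (\<lambda>B. \<mu> B $ i $ j) f"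
    "sets \<rho>u = sets borel" "finite_measure \<rho>u" "\<forall>B\<in>sets borel. emeasure \<rho>u B = total_variation \<mu> (B \<inter> S)"
    "\<forall>M. \<forall>f\<in>bounded_borel. (\<forall>x. 0 \<le> f x) \<longrightarrow> (\<Sum>i\<in>UNIV. \<Sum>j\<in>UNIV. M $ i $ j * Tu i j f) \<le> norm M * (LINT x|\<rho>u. f x)"
    by (rule sym_gradient_functionals[OF \<mu> u S])
  obtain Tv \<rho>v where Tv: "\<forall>i j. daniell (Tv i j)"
    "\<forall>i j. \<forall>\<phi>\<in>test_functions S. Tv i j \<phi> = sym_weak S v i j \<phi>"
    "\<forall>i j. \<forall>B\<in>sets borel. Tv i j (indicator B) = \<nu> (B \<inter> S) $ i $ j"
    "\<forall>i j. \<forall>f\<in>borel_measurable borel. Tv i j f = signed_integral S (\<lambda>B. \<nu> B $ i $ j) f"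
    "sets \<rho>v = sets borel" "finite_measure \<rho>v" "\<forall>B\<in>sets borel. emeasure \<rho>v B = total_variation \<nu> (B \<inter> S)"
    "\<forall>M. \<forall>f\<in>bounded_borel. (\<forall>x. 0 \<le> f x) \<longrightarrow> (\<Sum>i\<in>UNIV. \<Sum>j\<in>UNIV. M $ i $ j * Tv i j f) \<le> norm M * (LINT x|\<rho>v. f x)"
    by (rule sym_gradient_functionals[OF \<nu> v S])
  note Tud = Tu(1)[rule_format] and Tvd = Tv(1)[rule_format]
  define WU where "WU i = weighted_integral S (\<lambda>x. u x $ i)" for i
  define WV where "WV i = weighted_integral S (\<lambda>x. v x $ i)" for i
  have WUd: "daniell (WU i)" for i unfolding WU_def by (rule daniell_weighted_integral[OF set_integrable_component[OF u]])
  have WVd: "daniell (WV i)" for i unfolding WV_def by (rule daniell_weighted_integral[OF set_integrable_component[OF v]])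
  define D where "D = weighted_integral S d"
  have Dd: "daniell D" unfolding D_def by (rule daniell_weighted_integral[OF dS])
  have \<eta>b: "\<eta> \<in> bounded_borel" by (rule test_functions_bounded_borel[OF \<eta>(1)])
  have \<eta>1b: "(\<lambda>x. 1 - \<eta> x) \<in> bounded_borel"
    using bounded_borel_add[OF bounded_borel_const[of 1] bounded_borel_mult[OF bounded_borel_const[of "-1"] \<eta>b]] by simp
  have \<eta>'b: "partial_deriv j \<eta> \<in> bounded_borel" for j by (rule partial_deriv_bounded_borel[OF \<eta>(1)])
  \<comment> \<open>The entries of \<open>(u - v) \<odot> \<nabla>\<eta>\<close>.\<close>
  define G where "G i j f = (1/2) * ((WU i (\<lambda>x. partial_deriv j \<eta> x * f x) - WV i (\<lambda>x. partial_deriv j \<eta> x * f x)) +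
     (WU j (\<lambda>x. partial_deriv i \<eta> x * f x) - WV j (\<lambda>x. partial_deriv i \<eta> x * f x)))" for i j f
  have Gd: "daniell (G i j)" for i j
    unfolding G_def by (intro daniell_cmult daniell_plus daniell_minus daniell_weight[OF WUd \<eta>'b] daniell_weight[OF WVd \<eta>'b])
  define T where "T i j f = (Tu i j (\<lambda>x. \<eta> x * f x) + Tv i j (\<lambda>x. (1 - \<eta> x) * f x)) + G i j f" for i j f
  have Td: "daniell (T i j)" for i j
    unfolding T_def by (intro daniell_plus daniell_weight[OF Tud \<eta>b] daniell_weight[OF Tvd \<eta>1b] Gd)
  have Tweak: "T i j \<phi> = sym_weak S w i j \<phi>" if \<phi>: "\<phi> \<in> test_functions S" for i j \<phi>
  proof -
    have \<phi>b: "\<phi> \<in> bounded_borel" by (rule test_functions_bounded_borel[OF \<phi>])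
    have \<phi>'b: "partial_deriv k \<phi> \<in> bounded_borel" for k by (rule partial_deriv_bounded_borel[OF \<phi>])
    have \<eta>\<phi>: "(\<lambda>x. \<eta> x * \<phi> x) \<in> test_functions S" by (rule test_functions_mult[OF \<phi> test_functions_smooth[OF \<eta>(1)]])
    have pd: "partial_deriv k (\<lambda>x. \<eta> x * \<phi> x) = (\<lambda>x. \<eta> x * partial_deriv k \<phi> x + partial_deriv k \<eta> x * \<phi> x)" for k
      by (rule ext, rule partial_deriv_mult[OF smooth_differentiable[OF test_functions_smooth[OF \<eta>(1)]] smooth_differentiable[OF test_functions_smooth[OF \<phi>]]])
    have e1: "Tu i j (\<lambda>x. \<eta> x * \<phi> x) = - (1/2) * ((WU i (\<lambda>x. \<eta> x * partial_deriv j \<phi> x) + WU i (\<lambda>x. partial_deriv j \<eta> x * \<phi> x)) +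
       (WU j (\<lambda>x. \<eta> x * partial_deriv i \<phi> x) + WU j (\<lambda>x. partial_deriv i \<eta> x * \<phi> x)))"
      using Tu(2) \<eta>\<phi> daniell_add[OF WUd bounded_borel_mult[OF \<eta>b \<phi>'b] bounded_borel_mult[OF \<eta>'b \<phi>b]]
      by (simp add: sym_weak_def pd WU_def[symmetric])
    have e2: "Tv i j (\<lambda>x. \<eta> x * \<phi> x) = - (1/2) * ((WV i (\<lambda>x. \<eta> x * partial_deriv j \<phi> x) + WV i (\<lambda>x. partial_deriv j \<eta> x * \<phi> x)) +
       (WV j (\<lambda>x. \<eta> x * partial_deriv i \<phi> x) + WV j (\<lambda>x. partial_deriv i \<eta> x * \<phi> x)))"
      using Tv(2) \<eta>\<phi> daniell_add[OF WVd bounded_borel_mult[OF \<eta>b \<phi>'b] bounded_borel_mult[OF \<eta>'b \<phi>b]]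
      by (simp add: sym_weak_def pd WV_def[symmetric])
    have e3: "Tv i j (\<lambda>x. (1 - \<eta> x) * \<phi> x) = Tv i j \<phi> - Tv i j (\<lambda>x. \<eta> x * \<phi> x)"
      using daniell_diff[OF Tvd \<phi>b bounded_borel_mult[OF \<eta>b \<phi>b]] by (simp add: left_diff_distrib)
    have e4: "Tv i j \<phi> = - (1/2) * (WV i (partial_deriv j \<phi>) + WV j (partial_deriv i \<phi>))"
      using Tv(2) \<phi> by (simp add: sym_weak_def WV_def[symmetric])
    have e5: "weighted_integral S (\<lambda>x. w x $ a) f = WU a (\<lambda>x. \<eta> x * f x) + (WV a f - WV a (\<lambda>x. \<eta> x * f x))"
      if f: "f \<in> bounded_borel" for a f
    proof -
      note i1 = weighted_integrable[OF set_integrable_component[OF u, of a] bounded_borel_mult[OF \<eta>b f]]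
      note i2 = weighted_integrable[OF set_integrable_component[OF v, of a] f]
      note i3 = weighted_integrable[OF set_integrable_component[OF v, of a] bounded_borel_mult[OF \<eta>b f]]
      have "weighted_integral S (\<lambda>x. w x $ a) f = (LINT x|lebesgue. (indicator S x * u x $ a) * (\<eta> x * f x) +
          ((indicator S x * v x $ a) * f x - (indicator S x * v x $ a) * (\<eta> x * f x)))"
        unfolding weighted_integral_def w_def by (rule Bochner_Integration.integral_cong) (simp_all add: algebra_simps)
      also have "\<dots> = WU a (\<lambda>x. \<eta> x * f x) + (WV a f - WV a (\<lambda>x. \<eta> x * f x))"
        unfolding WU_def WV_def weighted_integral_def
        by (simp only: Bochner_Integration.integral_add[OF i1 Bochner_Integration.integrable_diff[OF i2 i3]] Bochner_Integration.integral_diff[OF i2 i3])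
      finally show ?thesis .
    qed
    have "T i j \<phi> = - (1/2) * ((WU i (\<lambda>x. \<eta> x * partial_deriv j \<phi> x) + (WV i (partial_deriv j \<phi>) - WV i (\<lambda>x. \<eta> x * partial_deriv j \<phi> x))) +
       (WU j (\<lambda>x. \<eta> x * partial_deriv i \<phi> x) + (WV j (partial_deriv i \<phi>) - WV j (\<lambda>x. \<eta> x * partial_deriv i \<phi> x))))"
      unfolding T_def G_def e3 e1 e4 e2 by (simp add: algebra_simps)
    then show ?thesis by (simp only: sym_weak_def e5[OF \<phi>'b])
  qed
  define K where "K = real CARD('d) * real CARD('d) * L"
  have K0: "0 \<le> K" using L0 by (simp add: K_def)
  define \<Lambda> where "\<Lambda> f = ((LINT x|\<rho>u. f x) + (LINT x|\<rho>v. f x)) + K * D f" for f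
  have \<Lambda>d: "daniell \<Lambda>"
    unfolding \<Lambda>_def by (intro daniell_plus daniell_cmult Dd daniell_finite_measure[OF Tu(5,6)] daniell_finite_measure[OF Tv(5,6)])
  have Dnn: "0 \<le> D f" if "\<And>x. 0 \<le> f x" for f
    unfolding D_def weighted_integral_def by (rule Bochner_Integration.integral_nonneg) (simp add: that d_def indicator_def)
  have \<Lambda>nn: "0 \<le> \<Lambda> (indicator B)" for B
    unfolding \<Lambda>_def by (intro add_nonneg_nonneg mult_nonneg_nonneg K0 Dnn Bochner_Integration.integral_nonneg) simp_all
  have Gle: "\<bar>G i j f\<bar> \<le> L * D f" if f: "f \<in> bounded_borel" "\<And>x. 0 \<le> f x" for i j f
  proof -
    have h: "\<bar>WU a (\<lambda>x. partial_deriv b \<eta> x * f x) - WV a (\<lambda>x. partial_deriv b \<eta> x * f x)\<bar> \<le> L * D f" for a b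
    proof -
      note i1 = weighted_integrable[OF set_integrable_component[OF u, of a] bounded_borel_mult[OF \<eta>'b[of b] f(1)]]
      note i2 = weighted_integrable[OF set_integrable_component[OF v, of a] bounded_borel_mult[OF \<eta>'b[of b] f(1)]]
      have "WU a (\<lambda>x. partial_deriv b \<eta> x * f x) - WV a (\<lambda>x. partial_deriv b \<eta> x * f x) =
         (LINT x|lebesgue. (indicator S x * u x $ a) * (partial_deriv b \<eta> x * f x) - (indicator S x * v x $ a) * (partial_deriv b \<eta> x * f x))"
        unfolding WU_def WV_def weighted_integral_def by (rule Bochner_Integration.integral_diff[OF i1 i2, symmetric])
      also have "\<bar>\<dots>\<bar> \<le> (LINT x|lebesgue. L * ((indicator S x * d x) * f x))"
      proof (rule order_trans[OF integral_abs_bound integral_mono])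
        show "integrable lebesgue (\<lambda>x. \<bar>(indicator S x * u x $ a) * (partial_deriv b \<eta> x * f x) - (indicator S x * v x $ a) * (partial_deriv b \<eta> x * f x)\<bar>)"
          by (intro integrable_abs Bochner_Integration.integrable_diff i1 i2)
        show "integrable lebesgue (\<lambda>x. L * ((indicator S x * d x) * f x))"
          by (rule integrable_mult_right[OF weighted_integrable[OF dS f(1)]])
        fix x
        have "(indicator S x * u x $ a) * (partial_deriv b \<eta> x * f x) - (indicator S x * v x $ a) * (partial_deriv b \<eta> x * f x)
          = (indicator S x * f x) * ((u x - v x) $ a * partial_deriv b \<eta> x)" by (simp add: algebra_simps)
        also have "\<bar>\<dots>\<bar> = (indicator S x * f x) * (\<bar>(u x - v x) $ a\<bar> * \<bar>partial_deriv b \<eta> x\<bar>)"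
          using f(2)[of x] by (simp add: abs_mult)
        also have "\<dots> \<le> (indicator S x * f x) * (d x * L)"
          using f(2)[of x] L[of b x] component_le_norm_cart[of "u x - v x" a]
          by (intro mult_left_mono mult_mono) (simp_all add: d_def)
        also have "\<dots> = L * ((indicator S x * d x) * f x)" by (simp add: algebra_simps)
        finally show "\<bar>(indicator S x * u x $ a) * (partial_deriv b \<eta> x * f x) - (indicator S x * v x $ a) * (partial_deriv b \<eta> x * f x)\<bar> \<le> L * ((indicator S x * d x) * f x)" .
      qed
      also have "\<dots> = L * D f" by (simp add: D_def weighted_integral_def)
      finally show ?thesis .
    qed
    show ?thesis using h[of i j] h[of j i] unfolding G_def abs_le_iff by (auto simp: field_simps)
  qed
  have le: "(\<Sum>i\<in>UNIV. \<Sum>j\<in>UNIV. M $ i $ j * T i j \<phi>) \<le> norm M * \<Lambda> \<phi>"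
    if \<phi>: "\<phi> \<in> test_functions S" "\<And>x. 0 \<le> \<phi> x" for M :: "real^'d^'d" and \<phi>
  proof -
    have \<phi>b: "\<phi> \<in> bounded_borel" by (rule test_functions_bounded_borel[OF \<phi>(1)])
    have mono\<rho>: "(LINT x|\<rho>. h x * \<phi> x) \<le> (LINT x|\<rho>. \<phi> x)"
      if \<rho>: "sets \<rho> = sets borel" "finite_measure \<rho>" and h: "h \<in> bounded_borel" "\<And>x. h x \<le> 1" for \<rho> h
    proof -
      have "0 \<le> (LINT x|\<rho>. \<phi> x - h x * \<phi> x)"
      proof (rule Bochner_Integration.integral_nonneg)
        show "0 \<le> \<phi> x - h x * \<phi> x" for x using mult_right_mono[OF h(2)[of x] \<phi>(2)[of x]] by simp
      qed
      also have "\<dots> = (LINT x|\<rho>. \<phi> x) - (LINT x|\<rho>. h x * \<phi> x)"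
        by (rule daniell_diff[OF daniell_finite_measure[OF \<rho>] \<phi>b bounded_borel_mult[OF h(1) \<phi>b]])
      finally show ?thesis by simp
    qed
    have u1: "(\<Sum>i\<in>UNIV. \<Sum>j\<in>UNIV. M $ i $ j * Tu i j (\<lambda>x. \<eta> x * \<phi> x)) \<le> norm M * (LINT x|\<rho>u. \<phi> x)"
    proof -
      have "(\<Sum>i\<in>UNIV. \<Sum>j\<in>UNIV. M $ i $ j * Tu i j (\<lambda>x. \<eta> x * \<phi> x)) \<le> norm M * (LINT x|\<rho>u. \<eta> x * \<phi> x)"
        using Tu(8) bounded_borel_mult[OF \<eta>b \<phi>b] \<eta>(2) \<phi>(2) by simp
      also have "\<dots> \<le> norm M * (LINT x|\<rho>u. \<phi> x)" by (rule mult_left_mono[OF mono\<rho>[OF Tu(5,6) \<eta>b \<eta>(3)]]) simp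
      finally show ?thesis .
    qed
    have v1: "(\<Sum>i\<in>UNIV. \<Sum>j\<in>UNIV. M $ i $ j * Tv i j (\<lambda>x. (1 - \<eta> x) * \<phi> x)) \<le> norm M * (LINT x|\<rho>v. \<phi> x)"
    proof -
      have "(\<Sum>i\<in>UNIV. \<Sum>j\<in>UNIV. M $ i $ j * Tv i j (\<lambda>x. (1 - \<eta> x) * \<phi> x)) \<le> norm M * (LINT x|\<rho>v. (1 - \<eta> x) * \<phi> x)"
        using Tv(8) bounded_borel_mult[OF \<eta>1b \<phi>b] \<eta>(3) \<phi>(2) by simp
      also have "\<dots> \<le> norm M * (LINT x|\<rho>v. \<phi> x)" by (rule mult_left_mono[OF mono\<rho>[OF Tv(5,6) \<eta>1b]]) (simp_all add: \<eta>(2))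
      finally show ?thesis .
    qed
    have g1: "(\<Sum>i\<in>UNIV. \<Sum>j\<in>UNIV. M $ i $ j * G i j \<phi>) \<le> norm M * (K * D \<phi>)"
    proof -
      have "M $ i $ j * G i j \<phi> \<le> norm M * (L * D \<phi>)" for i j
      proof -
        have "M $ i $ j * G i j \<phi> \<le> \<bar>M $ i $ j\<bar> * \<bar>G i j \<phi>\<bar>" by (metis abs_ge_self abs_mult)
        also have "\<dots> \<le> norm M * (L * D \<phi>)" by (intro mult_mono abs_entry_le_norm Gle[OF \<phi>b \<phi>(2)]) simp_all
        finally show ?thesis .
      qed
      then have "(\<Sum>i\<in>UNIV. \<Sum>j\<in>UNIV. M $ i $ j * G i j \<phi>) \<le> (\<Sum>i\<in>(UNIV::'d set). \<Sum>j\<in>(UNIV::'d set). norm M * (L * D \<phi>))"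
        by (intro sum_mono)
      also have "\<dots> = norm M * (K * D \<phi>)" by (simp add: K_def)
      finally show ?thesis .
    qed
    have "(\<Sum>i\<in>UNIV. \<Sum>j\<in>UNIV. M $ i $ j * T i j \<phi>) =
       ((\<Sum>i\<in>UNIV. \<Sum>j\<in>UNIV. M $ i $ j * Tu i j (\<lambda>x. \<eta> x * \<phi> x)) + (\<Sum>i\<in>UNIV. \<Sum>j\<in>UNIV. M $ i $ j * Tv i j (\<lambda>x. (1 - \<eta> x) * \<phi> x)))
       + (\<Sum>i\<in>UNIV. \<Sum>j\<in>UNIV. M $ i $ j * G i j \<phi>)"
      unfolding T_def by (simp only: distrib_left sum.distrib)
    also have "\<dots> \<le> norm M * \<Lambda> \<phi>" unfolding \<Lambda>_def distrib_left by (intro add_mono u1 v1 g1)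
    finally show ?thesis .
  qed
  have ex: "\<exists>\<kappa>. is_sym_gradient S w \<kappa> \<and> total_variation \<kappa> S \<le> ennreal (\<Lambda> (indicator S))"
    by (rule sym_gradient_of_functionals[OF S wS Td Tweak \<Lambda>d \<Lambda>nn le])
  have "ennreal (\<Lambda> (indicator S)) = total_variation \<mu> S + total_variation \<nu> S + ennreal (K * (LINT x:S|lebesgue. norm (u x - v x)))"
  proof -
    have m: "(LINT x|\<rho>. indicator S x) = measure \<rho> S" if "sets \<rho> = sets borel" for \<rho> :: "(real^'d) measure"
      using that Sb sets_eq_imp_space_eq[OF that] by simp
    interpret u: finite_measure \<rho>u by (rule Tu(6))
    interpret v: finite_measure \<rho>v by (rule Tv(6))
    have Dd: "D (indicator S) = (LINT x:S|lebesgue. norm (u x - v x))"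
      unfolding D_def weighted_integral_def set_lebesgue_integral_def d_def
      by (rule Bochner_Integration.integral_cong) (simp_all add: indicator_def)
    have "ennreal (\<Lambda> (indicator S)) = ennreal (measure \<rho>u S) + ennreal (measure \<rho>v S) + ennreal (K * D (indicator S))"
      unfolding \<Lambda>_def m[OF Tu(5)] m[OF Tv(5)] using K0 Dnn[of "indicator S"] by (simp add: ennreal_plus)
    then show ?thesis using Tu(7) Tv(7) Sb by (simp add: u.emeasure_eq_measure[symmetric] v.emeasure_eq_measure[symmetric] Dd)
  qed
  then show ?thesis
    using ex by (simp add: K_def)
qed

section \<open>Compactness in the space of functions of bounded deformation\<close>

lemma total_variation_entry_le:
  fixes \<mu> :: "'a::topological_space set \<Rightarrow> real^'n::finite^'m::finite"
  assumes \<mu>: "vector_measure_on U \<mu>" and B: "B \<in> borel_subsets U"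
  shows "total_variation (\<lambda>B. \<mu> B $ i $ j) B \<le> total_variation \<mu> B"
proof (rule total_variation_le_finite[OF vector_measure_on_entry[OF \<mu>]])
  fix \<A> assume \<A>: "finite \<A>" "\<A> \<subseteq> sets borel" "disjoint \<A>" "\<Union>\<A> \<subseteq> B"
  have "(\<Sum>A\<in>\<A>. ennreal (norm (\<mu> A $ i $ j))) \<le> (\<Sum>A\<in>\<A>. ennreal (norm (\<mu> A)))"
    using abs_entry_le_norm by (intro sum_mono ennreal_leI) simp
  also have "\<dots> \<le> total_variation \<mu> B" by (rule total_variation_ge_finite[OF \<A>]) (use B in simp)
  finally show "(\<Sum>A\<in>\<A>. ennreal (norm (\<mu> A $ i $ j))) \<le> total_variation \<mu> B" .
qed (use B in simp)

text \<open>Uniform mass bounds for the Jordan parts of all entries, as weak compactness requires; the index \<open>True\<close> stands for the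
positive part.\<close>

lemma jordan_parts_mass:
  fixes \<mu> :: "'a::topological_space set \<Rightarrow> real^'n::finite^'m::finite"
  assumes \<mu>: "vector_measure_on U \<mu>" and U: "U \<in> sets borel" and C: "total_variation \<mu> U \<le> ennreal C" "0 \<le> C"
  shows "\<exists>P. \<forall>i j b. sets (P i j b) = sets borel \<and> finite_measure (P i j b) \<and> measure (P i j b) UNIV \<le> C \<and>
     (\<forall>\<phi>\<in>borel_measurable borel. signed_integral U (\<lambda>B. \<mu> B $ i $ j) \<phi> = (LINT x|P i j True. \<phi> x) - (LINT x|P i j False. \<phi> x))"
proof -
  have "\<exists>p. \<forall>b::bool. sets (p b) = sets borel \<and> finite_measure (p b) \<and> measure (p b) UNIV \<le> C \<and>
     (\<forall>\<phi>\<in>borel_measurable borel. signed_integral U (\<lambda>B. \<mu> B $ i $ j) \<phi> = (LINT x|p True. \<phi> x) - (LINT x|p False. \<phi> x))" for i j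
  proof -
    let ?\<nu> = "\<lambda>B. \<mu> B $ i $ j"
    have \<nu>: "vector_measure_on U ?\<nu>" by (rule vector_measure_on_entry[OF \<mu>])
    obtain P N where PN: "sets P = sets borel" "sets N = sets borel" "finite_measure P" "finite_measure N"
      "\<forall>B\<in>sets borel. measure P B = (enn2real (total_variation ?\<nu> (B \<inter> U)) + ?\<nu> (B \<inter> U)) / 2"
      "\<forall>B\<in>sets borel. measure N B = (enn2real (total_variation ?\<nu> (B \<inter> U)) - ?\<nu> (B \<inter> U)) / 2"
      "\<forall>\<phi>\<in>borel_measurable borel. signed_integral U ?\<nu> \<phi> = (LINT x|P. \<phi> x) - (LINT x|N. \<phi> x)"
      by (rule signed_integral_representation[OF \<nu> U])
    have "total_variation ?\<nu> U \<le> ennreal C"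
      by (rule order_trans[OF total_variation_entry_le[OF \<mu>] C(1)]) (use U in simp)
    then have tv: "enn2real (total_variation ?\<nu> U) \<le> C" using enn2real_leI[OF C(2)] by simp
    have "ennreal \<bar>?\<nu> U\<bar> \<le> total_variation ?\<nu> U" using norm_le_total_variation[OF U, of ?\<nu>] by simp
    also have "\<dots> \<le> ennreal C" by fact
    finally have "\<bar>?\<nu> U\<bar> \<le> C" using C(2) by simp
    then have \<nu>C: "?\<nu> U \<le> C" "- ?\<nu> U \<le> C" by (simp_all only: abs_le_iff)
    have PNU: "measure P UNIV = (enn2real (total_variation ?\<nu> U) + ?\<nu> U) / 2" "measure N UNIV = (enn2real (total_variation ?\<nu> U) - ?\<nu> U) / 2"
      using PN(5)[rule_format, of UNIV] PN(6)[rule_format, of UNIV] by simp_all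
    have "measure P UNIV \<le> (C + C) / 2" unfolding PNU(1) by (rule divide_right_mono[OF add_mono[OF tv \<nu>C(1)]]) simp
    moreover have "measure N UNIV \<le> (C + C) / 2" unfolding PNU(2) diff_conv_add_uminus by (rule divide_right_mono[OF add_mono[OF tv \<nu>C(2)]]) simp
    ultimately have "measure P UNIV \<le> C \<and> measure N UNIV \<le> C" by simp
    then show ?thesis using PN(1-4,7) by (intro exI[of _ "\<lambda>b. if b then P else N"]) simp
  qed
  then have "\<forall>ij. \<exists>p. \<forall>b::bool. sets (p b) = sets borel \<and> finite_measure (p b) \<and> measure (p b) UNIV \<le> C \<and>
     (\<forall>\<phi>\<in>borel_measurable borel. signed_integral U (\<lambda>B. \<mu> B $ (fst ij) $ (snd ij)) \<phi> = (LINT x|p True. \<phi> x) - (LINT x|p False. \<phi> x))" by blast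
  from choice[OF this] obtain p where "\<forall>ij. \<forall>b::bool. sets (p ij b) = sets borel \<and> finite_measure (p ij b) \<and> measure (p ij b) UNIV \<le> C \<and>
     (\<forall>\<phi>\<in>borel_measurable borel. signed_integral U (\<lambda>B. \<mu> B $ (fst ij) $ (snd ij)) \<phi> = (LINT x|p ij True. \<phi> x) - (LINT x|p ij False. \<phi> x))" ..
  then show ?thesis by (intro exI[of _ "\<lambda>i j. p (i, j)"]) simp
qed

text \<open>The Jordan parts of the entries of the symmetrised gradients and their variations converge weakly along a
subsequence. The entries of the limit represent the weak derivatives of \<open>u\<close>, because a test function on \<open>U\<close> is a test
function on \<open>V k\<close> for large \<open>k\<close> and the functions converge in mean. The duality bound passes to the limit.
Exhausting domains \<open>V k\<close> are admitted since the lemma is also used to glue local information on one function.\<close>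

lemma BD_closure:
  fixes u :: "real^'d::finite \<Rightarrow> real^'d" and U :: "(real^'d) set"
  assumes U: "open U" and u: "u absolutely_integrable_on U"
    and V: "\<And>k::nat. open (V k)" "\<And>k. V k \<subseteq> U" "\<And>K. compact K \<Longrightarrow> K \<subseteq> U \<Longrightarrow> \<forall>\<^sub>F k in sequentially. K \<subseteq> V k"
    and v: "\<And>k. v k absolutely_integrable_on V k" "\<And>k. is_sym_gradient (V k) (v k) (\<mu> k)"
    and C: "\<And>k. total_variation (\<mu> k) (V k) \<le> ennreal C" "0 \<le> C"
    and lim: "(\<lambda>k. LINT x:V k|lebesgue. norm (v k x - u x)) \<longlonglongrightarrow> 0"
  shows "\<exists>\<kappa>. is_sym_gradient U u \<kappa> \<and> total_variation \<kappa> U \<le> ennreal C"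
proof -
  have vm: "vector_measure_on (V k) (\<mu> k)" for k using v(2)[of k] by (simp add: is_sym_gradient_def)
  have Vb: "V k \<in> sets borel" for k using V(1) by simp
  have uV: "u absolutely_integrable_on V k" for k
    using set_integrable_subset[OF u _ V(2)] Vb sets_borel_lebesgue by blast
  have "\<forall>k. \<exists>P. \<forall>i j b. sets (P i j b) = sets borel \<and> finite_measure (P i j b) \<and> measure (P i j b) UNIV \<le> C \<and>
     (\<forall>\<phi>\<in>borel_measurable borel. signed_integral (V k) (\<lambda>B. \<mu> k B $ i $ j) \<phi> = (LINT x|P i j True. \<phi> x) - (LINT x|P i j False. \<phi> x))"
    by (intro allI jordan_parts_mass vm Vb C)
  from choice[OF this] obtain P where P: "\<forall>k i j b. sets (P k i j b) = sets borel \<and> finite_measure (P k i j b) \<and> measure (P k i j b) UNIV \<le> C \<and>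
     (\<forall>\<phi>\<in>borel_measurable borel. signed_integral (V k) (\<lambda>B. \<mu> k B $ i $ j) \<phi> = (LINT x|P k i j True. \<phi> x) - (LINT x|P k i j False. \<phi> x))" ..
  have "\<forall>k. \<exists>\<rho>. sets \<rho> = sets borel \<and> finite_measure \<rho> \<and> measure \<rho> UNIV \<le> C \<and>
     (\<forall>M. \<forall>\<phi>\<in>bounded_borel. (\<forall>x. 0 \<le> \<phi> x) \<longrightarrow>
       (\<Sum>i\<in>UNIV. \<Sum>j\<in>UNIV. M $ i $ j * signed_integral (V k) (\<lambda>B. \<mu> k B $ i $ j) \<phi>) \<le> norm M * (LINT x|\<rho>. \<phi> x))"
  proof
    fix k
    obtain T \<rho> where T: "\<forall>i j. daniell (T i j)"
      "\<forall>i j. \<forall>\<phi>\<in>test_functions (V k). T i j \<phi> = sym_weak (V k) (v k) i j \<phi>"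
      "\<forall>i j. \<forall>B\<in>sets borel. T i j (indicator B) = \<mu> k (B \<inter> V k) $ i $ j"
      "\<forall>i j. \<forall>f\<in>borel_measurable borel. T i j f = signed_integral (V k) (\<lambda>B. \<mu> k B $ i $ j) f"
      "sets \<rho> = sets borel" "finite_measure \<rho>" "\<forall>B\<in>sets borel. emeasure \<rho> B = total_variation (\<mu> k) (B \<inter> V k)"
      "\<forall>M. \<forall>f\<in>bounded_borel. (\<forall>x. 0 \<le> f x) \<longrightarrow> (\<Sum>i\<in>UNIV. \<Sum>j\<in>UNIV. M $ i $ j * T i j f) \<le> norm M * (LINT x|\<rho>. f x)"
      by (rule sym_gradient_functionals[OF v(2) v(1) V(1)])
    interpret \<rho>: finite_measure \<rho> by (rule T(6))
    have "ennreal (measure \<rho> UNIV) \<le> ennreal C" using T(7) C(1)[of k] by (simp add: \<rho>.emeasure_eq_measure[symmetric])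
    then have "measure \<rho> UNIV \<le> C" using C(2) by simp
    moreover have "(\<Sum>i\<in>UNIV. \<Sum>j\<in>UNIV. M $ i $ j * signed_integral (V k) (\<lambda>B. \<mu> k B $ i $ j) \<phi>) \<le> norm M * (LINT x|\<rho>. \<phi> x)"
      if "\<phi> \<in> bounded_borel" "\<forall>x. 0 \<le> \<phi> x" for M \<phi>
    proof -
      have "\<phi> \<in> borel_measurable borel" using that(1) by (simp add: bounded_borel_def)
      then have "T i j \<phi> = signed_integral (V k) (\<lambda>B. \<mu> k B $ i $ j) \<phi>" for i j using T(4) by simp
      then show ?thesis using T(8)[rule_format, OF that(1), of M] that(2) by simp
    qed
    ultimately show "\<exists>\<rho>. sets \<rho> = sets borel \<and> finite_measure \<rho> \<and> measure \<rho> UNIV \<le> C \<and>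
     (\<forall>M. \<forall>\<phi>\<in>bounded_borel. (\<forall>x. 0 \<le> \<phi> x) \<longrightarrow>
       (\<Sum>i\<in>UNIV. \<Sum>j\<in>UNIV. M $ i $ j * signed_integral (V k) (\<lambda>B. \<mu> k B $ i $ j) \<phi>) \<le> norm M * (LINT x|\<rho>. \<phi> x))"
      using T(5,6) by (intro exI[of _ \<rho>]) simp
  qed
  from choice[OF this] obtain \<rho> where \<rho>: "\<forall>k. sets (\<rho> k) = sets borel \<and> finite_measure (\<rho> k) \<and> measure (\<rho> k) UNIV \<le> C \<and>
     (\<forall>M. \<forall>\<phi>\<in>bounded_borel. (\<forall>x. 0 \<le> \<phi> x) \<longrightarrow>
       (\<Sum>i\<in>UNIV. \<Sum>j\<in>UNIV. M $ i $ j * signed_integral (V k) (\<lambda>B. \<mu> k B $ i $ j) \<phi>) \<le> norm M * (LINT x|\<rho> k. \<phi> x))" ..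
  \<comment> \<open>One index set for all entries of both Jordan parts and, at \<open>None\<close>, the variation.\<close>
  define X where "X s k = (case s of None \<Rightarrow> \<rho> k | Some (i, j, b) \<Rightarrow> P k i j b)" for s :: "('d \<times> 'd \<times> bool) option" and k
  have X: "sets (X s k) = sets borel" "finite_measure (X s k)" "measure (X s k) UNIV \<le> C" for s k
    using P \<rho> by (auto simp: X_def split: option.split prod.split)
  obtain r Q where r: "strict_mono (r :: nat \<Rightarrow> nat)" and Q: "\<forall>s. sets (Q s) = sets borel \<and> finite_measure (Q s) \<and> measure (Q s) UNIV \<le> C \<and>
     (\<forall>\<phi>\<in>test_functions UNIV. (\<lambda>k. LINT x|X s (r k). \<phi> x) \<longlonglongrightarrow> (LINT x|Q s. \<phi> x))"
    using weak_compactness[of X C, OF X] by blast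
  have Qd: "daniell (\<lambda>f. LINT x|Q s. f x)" for s using Q by (intro daniell_finite_measure) simp_all
  define T where "T i j f = (LINT x|Q (Some (i, j, True)). f x) - (LINT x|Q (Some (i, j, False)). f x)" for i j and f :: "real^'d \<Rightarrow> real"
  have Td: "daniell (T i j)" for i j unfolding T_def by (intro daniell_minus Qd)
  have U\<phi>: "\<phi> \<in> test_functions UNIV" if "\<phi> \<in> test_functions U" for \<phi> using that test_functions_mono[of U UNIV] by blast
  have Tlim: "(\<lambda>k. signed_integral (V (r k)) (\<lambda>B. \<mu> (r k) B $ i $ j) \<phi>) \<longlonglongrightarrow> T i j \<phi>" if \<phi>: "\<phi> \<in> test_functions U" for i j \<phi>
  proof -
    have "signed_integral (V (r k)) (\<lambda>B. \<mu> (r k) B $ i $ j) \<phi> = (LINT x|X (Some (i, j, True)) (r k). \<phi> x) - (LINT x|X (Some (i, j, False)) (r k). \<phi> x)" for k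
      using P test_functions_measurable[OF \<phi>] by (simp add: X_def)
    moreover have "(\<lambda>k. LINT x|X s (r k). \<phi> x) \<longlonglongrightarrow> (LINT x|Q s. \<phi> x)" for s using Q U\<phi>[OF \<phi>] by simp
    ultimately show ?thesis unfolding T_def by (simp add: tendsto_diff)
  qed
  have Tweak: "T i j \<phi> = sym_weak U u i j \<phi>" if \<phi>: "\<phi> \<in> test_functions U" for i j \<phi>
  proof -
    obtain K where K: "compact K" "K \<subseteq> U" "\<forall>x. x \<notin> K \<longrightarrow> \<phi> x = 0" by (rule test_functions_support[OF \<phi>])
    obtain B1 where B1: "B1 > 0" "\<And>x. \<bar>partial_deriv i \<phi> x\<bar> \<le> B1"
      using test_functions_bounded[OF partial_deriv_test_functions[OF \<phi>, of i]] by metis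
    obtain B2 where B2: "B2 > 0" "\<And>x. \<bar>partial_deriv j \<phi> x\<bar> \<le> B2"
      using test_functions_bounded[OF partial_deriv_test_functions[OF \<phi>, of j]] by metis
    define I where "I k = (LINT x:V k|lebesgue. norm (v k x - u x))" for k
    have wle: "\<bar>weighted_integral (V k) (\<lambda>x. v k x $ a) f - weighted_integral (V k) (\<lambda>x. u x $ a) f\<bar> \<le> B * I k"
      if f: "f \<in> bounded_borel" "\<And>x. \<bar>f x\<bar> \<le> B" for a f B k
    proof -
      note i1 = weighted_integrable[OF set_integrable_component[OF v(1)[of k], where i = a] f(1)]
      note i2 = weighted_integrable[OF set_integrable_component[OF uV[of k], where i = a] f(1)]
      have uv: "set_integrable lebesgue (V k) (\<lambda>x. v k x - u x)" by (rule set_integral_diff(1)[OF v(1) uV])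
      have n: "integrable lebesgue (\<lambda>x. indicator (V k) x * norm (v k x - u x))"
        using set_integrable_norm[OF uv] by (simp add: set_integrable_def)
      have "weighted_integral (V k) (\<lambda>x. v k x $ a) f - weighted_integral (V k) (\<lambda>x. u x $ a) f =
         (LINT x|lebesgue. (indicator (V k) x * v k x $ a) * f x - (indicator (V k) x * u x $ a) * f x)"
        unfolding weighted_integral_def by (rule Bochner_Integration.integral_diff[OF i1 i2, symmetric])
      also have "\<bar>\<dots>\<bar> \<le> (LINT x|lebesgue. B * (indicator (V k) x * norm (v k x - u x)))"
      proof (rule order_trans[OF integral_abs_bound integral_mono])
        show "integrable lebesgue (\<lambda>x. \<bar>(indicator (V k) x * v k x $ a) * f x - (indicator (V k) x * u x $ a) * f x\<bar>)"
          by (intro integrable_abs Bochner_Integration.integrable_diff i1 i2)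
        show "integrable lebesgue (\<lambda>x. B * (indicator (V k) x * norm (v k x - u x)))" by (rule integrable_mult_right[OF n])
        fix x
        have "(indicator (V k) x * v k x $ a) * f x - (indicator (V k) x * u x $ a) * f x = indicator (V k) x * ((v k x - u x) $ a * f x)"
          by (simp add: algebra_simps)
        also have "\<bar>\<dots>\<bar> = indicator (V k) x * (\<bar>(v k x - u x) $ a\<bar> * \<bar>f x\<bar>)" by (simp add: abs_mult)
        also have "\<dots> \<le> indicator (V k) x * (norm (v k x - u x) * B)"
          using f(2)[of x] component_le_norm_cart[of "v k x - u x" a] by (intro mult_left_mono mult_mono) simp_all
        also have "\<dots> = B * (indicator (V k) x * norm (v k x - u x))" by (simp add: algebra_simps)
        finally show "\<bar>(indicator (V k) x * v k x $ a) * f x - (indicator (V k) x * u x $ a) * f x\<bar> \<le> B * (indicator (V k) x * norm (v k x - u x))" .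
      qed
      also have "\<dots> = B * I k" by (simp add: I_def set_lebesgue_integral_def)
      finally show ?thesis .
    qed
    \<comment> \<open>Both sides come from the weak formulation on \<open>V k\<close>, so only \<open>v k - u\<close> tested with derivatives of \<open>\<phi>\<close> remains.\<close>
    have ev: "\<forall>\<^sub>F k in sequentially. norm (signed_integral (V k) (\<lambda>B. \<mu> k B $ i $ j) \<phi> - sym_weak U u i j \<phi>) \<le> (B1 + B2) * I k"
      using V(3)[OF K(1,2)]
    proof eventually_elim
      case (elim k)
      have \<phi>k: "\<phi> \<in> test_functions (V k)"
        by (rule test_functionsI[OF test_functions_smooth[OF \<phi>] K(1) elim]) (use K(3) in blast)
      have "signed_integral (V k) (\<lambda>B. \<mu> k B $ i $ j) \<phi> = sym_weak (V k) (v k) i j \<phi>"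
        using v(2)[of k] \<phi>k by (simp add: is_sym_gradient_def sym_weak_eq[OF v(1) \<phi>k])
      moreover have "sym_weak U u i j \<phi> = sym_weak (V k) u i j \<phi>" by (rule sym_weak_restrict[OF \<phi>k V(2), symmetric])
      ultimately have "signed_integral (V k) (\<lambda>B. \<mu> k B $ i $ j) \<phi> - sym_weak U u i j \<phi> =
        - (1/2) * ((weighted_integral (V k) (\<lambda>x. v k x $ i) (partial_deriv j \<phi>) - weighted_integral (V k) (\<lambda>x. u x $ i) (partial_deriv j \<phi>)) +
         (weighted_integral (V k) (\<lambda>x. v k x $ j) (partial_deriv i \<phi>) - weighted_integral (V k) (\<lambda>x. u x $ j) (partial_deriv i \<phi>)))"
        unfolding sym_weak_def by (simp add: algebra_simps)
      moreover have "\<bar>weighted_integral (V k) (\<lambda>x. v k x $ i) (partial_deriv j \<phi>) - weighted_integral (V k) (\<lambda>x. u x $ i) (partial_deriv j \<phi>)\<bar> \<le> B2 * I k"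
        by (rule wle[OF partial_deriv_bounded_borel[OF \<phi>] B2(2)])
      moreover have "\<bar>weighted_integral (V k) (\<lambda>x. v k x $ j) (partial_deriv i \<phi>) - weighted_integral (V k) (\<lambda>x. u x $ j) (partial_deriv i \<phi>)\<bar> \<le> B1 * I k"
        by (rule wle[OF partial_deriv_bounded_borel[OF \<phi>] B1(2)])
      moreover have "\<bar>x\<bar> \<le> (B1 + B2) * I k" if "x = - (1/2) * (p + q)" "\<bar>p\<bar> \<le> B2 * I k" "\<bar>q\<bar> \<le> B1 * I k" for x p q
      proof -
        have "\<bar>x\<bar> = \<bar>p + q\<bar> / 2" unfolding that(1) by simp
        also have "\<dots> \<le> \<bar>p + q\<bar>" by simp
        also have "\<dots> \<le> \<bar>p\<bar> + \<bar>q\<bar>" by (rule abs_triangle_ineq)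
        finally show ?thesis using that(2,3) by (simp add: distrib_right)
      qed
      ultimately show ?case unfolding real_norm_def by blast
    qed
    have "(\<lambda>k. (B1 + B2) * I k) \<longlonglongrightarrow> (B1 + B2) * 0" using lim unfolding I_def by (intro tendsto_mult tendsto_const)
    then have "(\<lambda>k. signed_integral (V k) (\<lambda>B. \<mu> k B $ i $ j) \<phi> - sym_weak U u i j \<phi>) \<longlonglongrightarrow> 0"
      using Lim_null_comparison[OF ev] by simp
    then have "(\<lambda>k. signed_integral (V k) (\<lambda>B. \<mu> k B $ i $ j) \<phi>) \<longlonglongrightarrow> sym_weak U u i j \<phi>" by (rule Lim_transform2[rotated, OF _ tendsto_const, simplified] | simp add: LIM_zero_cancel)
    from LIMSEQ_subseq_LIMSEQ[OF this r] have "(\<lambda>k. signed_integral (V (r k)) (\<lambda>B. \<mu> (r k) B $ i $ j) \<phi>) \<longlonglongrightarrow> sym_weak U u i j \<phi>"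
      by (simp add: o_def)
    then show ?thesis by (rule LIMSEQ_unique[OF Tlim[OF \<phi>]])
  qed
  define \<Lambda> where "\<Lambda> f = (LINT x|Q None. f x)" for f :: "real^'d \<Rightarrow> real"
  have \<Lambda>d: "daniell \<Lambda>" unfolding \<Lambda>_def by (rule Qd)
  have \<Lambda>nn: "0 \<le> \<Lambda> (indicator B)" for B unfolding \<Lambda>_def by (rule Bochner_Integration.integral_nonneg) simp
  have le: "(\<Sum>i\<in>UNIV. \<Sum>j\<in>UNIV. M $ i $ j * T i j \<phi>) \<le> norm M * \<Lambda> \<phi>"
    if \<phi>: "\<phi> \<in> test_functions U" "\<And>x. 0 \<le> \<phi> x" for M :: "real^'d^'d" and \<phi>
  proof (rule LIMSEQ_le)
    show "(\<lambda>k. \<Sum>i\<in>UNIV. \<Sum>j\<in>UNIV. M $ i $ j * signed_integral (V (r k)) (\<lambda>B. \<mu> (r k) B $ i $ j) \<phi>) \<longlonglongrightarrow> (\<Sum>i\<in>UNIV. \<Sum>j\<in>UNIV. M $ i $ j * T i j \<phi>)"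
      by (intro tendsto_sum tendsto_mult tendsto_const Tlim[OF \<phi>(1)])
    have "(\<lambda>k. LINT x|X None (r k). \<phi> x) \<longlonglongrightarrow> (LINT x|Q None. \<phi> x)" using Q U\<phi>[OF \<phi>(1)] by simp
    then show "(\<lambda>k. norm M * (LINT x|\<rho> (r k). \<phi> x)) \<longlonglongrightarrow> norm M * \<Lambda> \<phi>"
      unfolding \<Lambda>_def by (intro tendsto_mult tendsto_const) (simp add: X_def)
    show "\<exists>N. \<forall>n\<ge>N. (\<Sum>i\<in>UNIV. \<Sum>j\<in>UNIV. M $ i $ j * signed_integral (V (r n)) (\<lambda>B. \<mu> (r n) B $ i $ j) \<phi>) \<le> norm M * (LINT x|\<rho> (r n). \<phi> x)"
      using \<rho> test_functions_bounded_borel[OF \<phi>(1)] \<phi>(2) by simp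
  qed
  obtain \<kappa> where \<kappa>: "is_sym_gradient U u \<kappa>" "total_variation \<kappa> U \<le> ennreal (\<Lambda> (indicator U))"
    using sym_gradient_of_functionals[OF U u Td Tweak \<Lambda>d \<Lambda>nn le] by blast
  have "\<Lambda> (indicator U) \<le> C"
  proof -
    interpret finite_measure "Q None" using Q by simp
    have sQ: "sets (Q None) = sets borel" using Q by simp
    have sp: "space (Q None) = UNIV" using sets_eq_imp_space_eq[OF sQ] by simp
    have "\<Lambda> (indicator U) = measure (Q None) U" unfolding \<Lambda>_def using U sQ sp by simp
    also have "\<dots> \<le> measure (Q None) UNIV" using bounded_measure[of U] sp by simp
    also have "\<dots> \<le> C" using Q by simp
    finally show ?thesis .
  qed
  then show ?thesis using \<kappa> order_trans[OF \<kappa>(2) ennreal_leI] by blast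
qed

section \<open>The topology of local convergence in the mean\<close>

text \<open>The radius and the size of the domain are tied to one index, so that the neighbourhoods of \<open>u\<close> form a decreasing
sequence.\<close>

definition L1loc_ball :: "(real^'d::finite \<Rightarrow> real^'d) \<Rightarrow> nat \<Rightarrow> (real^'d \<Rightarrow> real^'d) set" where
  "L1loc_ball u k = {v \<in> L1loc. (LINT x:cball 0 (real k)|lebesgue. norm (v x - u x)) < 1 / (real k + 1)}"

lemma L1loc_integrable_bounded:
  assumes "u \<in> L1loc" "bounded S" "S \<in> sets lebesgue"
  shows "u absolutely_integrable_on S"
proof -
  obtain r where "\<forall>x\<in>S. norm x \<le> r" using assms(2) unfolding bounded_iff by blast
  then have r: "S \<subseteq> cball 0 r" by auto
  have "u absolutely_integrable_on cball 0 r" using assms(1) by (simp add: L1loc_def)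
  then show ?thesis using set_integrable_subset[OF _ assms(3) r] by blast
qed

lemma L1loc_add: "u \<in> L1loc \<Longrightarrow> v \<in> L1loc \<Longrightarrow> (\<lambda>x. u x + v x) \<in> L1loc"
  and L1loc_diff: "u \<in> L1loc \<Longrightarrow> v \<in> L1loc \<Longrightarrow> (\<lambda>x. u x - v x) \<in> L1loc"
  by (auto simp: L1loc_def)

lemma L1loc_norm_diff_integrable:
  assumes "u \<in> L1loc" "v \<in> L1loc" "bounded S" "S \<in> sets lebesgue"
  shows "set_integrable lebesgue S (\<lambda>x. norm (u x - v x))"
  by (rule set_integrable_norm[OF L1loc_integrable_bounded[OF L1loc_diff[OF assms(1,2)] assms(3,4)]])

lemma L1loc_dist_mono:
  assumes "u \<in> L1loc" "v \<in> L1loc" "S \<subseteq> T" "bounded T" "S \<in> sets lebesgue" "T \<in> sets lebesgue"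
  shows "(LINT x:S|lebesgue. norm (u x - v x)) \<le> (LINT x:T|lebesgue. norm (u x - v x))"
proof -
  have bS: "bounded S" using assms(3,4) bounded_subset by blast
  show ?thesis
    unfolding set_lebesgue_integral_def
  proof (rule integral_mono)
    show "integrable lebesgue (\<lambda>x. indicator S x *\<^sub>R norm (u x - v x))"
      using L1loc_norm_diff_integrable[OF assms(1,2) bS assms(5)] by (simp add: set_integrable_def)
    show "integrable lebesgue (\<lambda>x. indicator T x *\<^sub>R norm (u x - v x))"
      using L1loc_norm_diff_integrable[OF assms(1,2,4,6)] by (simp add: set_integrable_def)
    show "indicator S x *\<^sub>R norm (u x - v x) \<le> indicator T x *\<^sub>R norm (u x - v x)" for x
      using assms(3) by (auto simp: indicator_def)
  qed
qed

lemma L1loc_dist_triangle: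
  assumes "u \<in> L1loc" "v \<in> L1loc" "w \<in> L1loc" "bounded S" "S \<in> sets lebesgue"
  shows "(LINT x:S|lebesgue. norm (u x - w x)) \<le> (LINT x:S|lebesgue. norm (u x - v x)) + (LINT x:S|lebesgue. norm (v x - w x))"
proof -
  note i1 = L1loc_norm_diff_integrable[OF assms(1,2,4,5), unfolded set_integrable_def]
  note i2 = L1loc_norm_diff_integrable[OF assms(2,3,4,5), unfolded set_integrable_def]
  have "(LINT x:S|lebesgue. norm (u x - w x)) \<le> (LINT x|lebesgue. indicator S x *\<^sub>R norm (u x - v x) + indicator S x *\<^sub>R norm (v x - w x))"
    unfolding set_lebesgue_integral_def
  proof (rule integral_mono[OF _ Bochner_Integration.integrable_add[OF i1 i2]])
    show "integrable lebesgue (\<lambda>x. indicator S x *\<^sub>R norm (u x - w x))"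
      using L1loc_norm_diff_integrable[OF assms(1,3,4,5)] by (simp add: set_integrable_def)
    show "indicator S x *\<^sub>R norm (u x - w x) \<le> indicator S x *\<^sub>R norm (u x - v x) + indicator S x *\<^sub>R norm (v x - w x)" for x
      using norm_triangle_ineq[of "u x - v x" "v x - w x"] by (simp add: indicator_def)
  qed
  also have "\<dots> = (LINT x:S|lebesgue. norm (u x - v x)) + (LINT x:S|lebesgue. norm (v x - w x))"
    unfolding set_lebesgue_integral_def by (rule Bochner_Integration.integral_add[OF i1 i2])
  finally show ?thesis .
qed

lemma L1loc_dist_commute: "(LINT x:S|lebesgue. norm (u x - v x)) = (LINT x:S|lebesgue. norm (v x - u x))"
  by (simp add: norm_minus_commute)

lemma cball_lebesgue [simp]: "cball (a::real^'d::finite) r \<in> sets lebesgue"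
  using sets_borel_lebesgue by (auto intro!: subsetD[OF sets_borel_lebesgue])

lemma L1loc_ball_subset: "L1loc_ball u k \<subseteq> L1loc"
  by (auto simp: L1loc_ball_def)

lemma centre_in_L1loc_ball: "u \<in> L1loc \<Longrightarrow> u \<in> L1loc_ball u k"
  by (simp add: L1loc_ball_def)

lemma openin_L1loc_basic:
  "u \<in> L1loc \<Longrightarrow> compact K \<Longrightarrow> 0 < \<epsilon> \<Longrightarrow> openin L1loc_topology {v \<in> L1loc. (LINT x:K|lebesgue. norm (v x - u x)) < \<epsilon>}"
  unfolding L1loc_topology_def by (rule topology_generated_by_Basis) blast

lemma openin_L1loc_ball: "u \<in> L1loc \<Longrightarrow> openin L1loc_topology (L1loc_ball u k)"
  unfolding L1loc_ball_def by (rule openin_L1loc_basic) simp_all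

lemma L1loc_ball_antimono:
  assumes "u \<in> L1loc" "j \<le> k" shows "L1loc_ball u k \<subseteq> L1loc_ball u j"
proof
  fix v assume v: "v \<in> L1loc_ball u k"
  have "(LINT x:cball 0 (real j)|lebesgue. norm (v x - u x)) \<le> (LINT x:cball 0 (real k)|lebesgue. norm (v x - u x))"
    using assms v by (intro L1loc_dist_mono) (auto simp: L1loc_ball_def)
  also have "\<dots> < 1 / (real k + 1)" using v by (simp add: L1loc_ball_def)
  also have "\<dots> \<le> 1 / (real j + 1)" using assms(2) by (intro divide_left_mono) auto
  finally show "v \<in> L1loc_ball u j" using v by (simp add: L1loc_ball_def)
qed

lemma topspace_L1loc [simp]: "topspace L1loc_topology = L1loc"
proof
  show "topspace L1loc_topology \<subseteq> L1loc" by (auto simp: L1loc_topology_def)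
  show "L1loc \<subseteq> topspace L1loc_topology"
    using openin_subset[OF openin_L1loc_ball] centre_in_L1loc_ball by blast
qed

lemma L1loc_ball_basis:
  assumes "openin L1loc_topology N" "u \<in> N"
  shows "\<exists>k. L1loc_ball u k \<subseteq> N"
proof -
  have uL: "u \<in> L1loc" using openin_subset[OF assms(1)] assms(2) by auto
  have "generate_topology_on {{v \<in> L1loc. (LINT x:K|lebesgue. norm (v x - u x)) < \<epsilon>} | u K \<epsilon>. u \<in> L1loc \<and> compact K \<and> 0 < \<epsilon>} N"
    using assms(1) by (simp add: L1loc_topology_def openin_topology_generated_by_iff)
  then show ?thesis using assms(2)
  proof induction
    case Empty then show ?case by simp
  next
    case (Int a b)
    then obtain j k where "L1loc_ball u j \<subseteq> a" "L1loc_ball u k \<subseteq> b" by auto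
    moreover have "L1loc_ball u (max j k) \<subseteq> L1loc_ball u j" "L1loc_ball u (max j k) \<subseteq> L1loc_ball u k"
      by (rule L1loc_ball_antimono[OF uL], simp)+
    ultimately show ?case by blast
  next
    case (UN K) then show ?case by blast
  next
    case (Basis s)
    then obtain w K \<epsilon> where s: "s = {v \<in> L1loc. (LINT x:K|lebesgue. norm (v x - w x)) < \<epsilon>}" and w: "w \<in> L1loc" "compact K" "0 < \<epsilon>" by blast
    have Km: "K \<in> sets lebesgue" using w(2) sets_borel_lebesgue borel_compact by blast
    define \<delta> where "\<delta> = \<epsilon> - (LINT x:K|lebesgue. norm (u x - w x))"
    have \<delta>: "\<delta> > 0" using Basis(2) s by (simp add: \<delta>_def)
    obtain r where "\<forall>x\<in>K. norm x \<le> r" using compact_imp_bounded[OF w(2)] unfolding bounded_iff by blast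
    then have r: "K \<subseteq> cball 0 r" by auto
    obtain k :: nat where k: "max r (1 / \<delta>) < real k" using reals_Archimedean2 by blast
    have Kk: "K \<subseteq> cball 0 (real k)" using r k by (auto simp: dist_norm)
    have kd: "1 / (real k + 1) \<le> \<delta>"
    proof -
      have "1 < \<delta> * real k" using k \<delta> by (simp add: field_simps)
      also have "\<dots> \<le> \<delta> * (real k + 1)" using \<delta> by simp
      finally show ?thesis by (simp add: divide_le_eq)
    qed
    have "v \<in> s" if v: "v \<in> L1loc_ball u k" for v
    proof -
      have vL: "v \<in> L1loc" using v by (simp add: L1loc_ball_def)
      have "(LINT x:K|lebesgue. norm (v x - w x)) \<le> (LINT x:K|lebesgue. norm (v x - u x)) + (LINT x:K|lebesgue. norm (u x - w x))"
        by (rule L1loc_dist_triangle[OF vL uL w(1) compact_imp_bounded[OF w(2)] Km])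
      also have "(LINT x:K|lebesgue. norm (v x - u x)) \<le> (LINT x:cball 0 (real k)|lebesgue. norm (v x - u x))"
        by (rule L1loc_dist_mono[OF vL uL Kk _ Km]) simp_all
      also have "\<dots> < 1 / (real k + 1)" using v by (simp add: L1loc_ball_def)
      finally show ?thesis using kd vL by (simp add: s \<delta>_def)
    qed
    then show ?case by blast
  qed
qed

text \<open>Inner approximation by a compact set and outer approximation by an open set, after cutting off a tail; a member of
\<open>R\<close> fits in between.\<close>

lemma finite_measure_set_approx:
  fixes A :: "(real^'d::finite) set"
  assumes A: "A \<in> sets lebesgue" "emeasure lebesgue A < \<infinity>" and e: "e > 0"
    and R: "\<And>K U. compact K \<Longrightarrow> open U \<Longrightarrow> K \<subseteq> U \<Longrightarrow> \<exists>V\<in>R. K \<subseteq> V \<and> closure V \<subseteq> U"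
  shows "\<exists>U\<in>R. \<exists>E \<in> lmeasurable. measure lebesgue E < e \<and> (A - U) \<union> (U - A) \<subseteq> E"
proof -
  have Al: "A \<in> lmeasurable" using A by (simp add: fmeasurable_def)
  define B where "B n = A \<inter> cball 0 (real n)" for n :: nat
  have Bl: "B n \<in> lmeasurable" for n unfolding B_def by (rule fmeasurable_Int_fmeasurable[OF Al]) simp
  have "(\<lambda>n. measure lebesgue (B n)) \<longlonglongrightarrow> measure lebesgue (\<Union>n. B n)"
  proof (rule Lim_measure_incseq)
    show "range B \<subseteq> sets lebesgue" using Bl by auto
    show "incseq B" by (auto simp: incseq_def B_def)
    have "emeasure lebesgue (\<Union>n. B n) \<le> emeasure lebesgue A" by (rule emeasure_mono) (auto simp: B_def A)
    then show "emeasure lebesgue (\<Union>n. B n) \<noteq> \<infinity>" using A(2) by (auto simp: top_unique)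
  qed
  moreover have "(\<Union>n. B n) = A"
  proof -
    have "x \<in> (\<Union>n. B n)" if "x \<in> A" for x
    proof -
      obtain n :: nat where "norm x < real n" using reals_Archimedean2 by blast
      then show ?thesis using that by (auto simp: B_def intro!: exI[of _ n])
    qed
    then show ?thesis by (auto simp: B_def)
  qed
  ultimately have "(\<lambda>n. measure lebesgue (B n)) \<longlonglongrightarrow> measure lebesgue A" by simp
  then have "\<forall>\<^sub>F n in sequentially. measure lebesgue A - e/3 < measure lebesgue (B n)"
    using e by (intro order_tendstoD(1)) auto
  then obtain n where n: "measure lebesgue A - e/3 < measure lebesgue (B n)" by (auto simp: eventually_sequentially)
  have E1: "measure lebesgue (A - B n) < e/3"
    using measurable_measure_Diff[of A lebesgue "B n"] Al Bl n by (simp add: B_def)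
  obtain C where C: "closed C" "C \<subseteq> B n" "B n - C \<in> lmeasurable" "emeasure lebesgue (B n - C) < ennreal (e/3)"
    using sets_lebesgue_inner_closed[of "B n" "e/3"] Bl e by auto
  obtain O' where O: "open O'" "B n \<subseteq> O'" "O' - B n \<in> lmeasurable" "emeasure lebesgue (O' - B n) < ennreal (e/3)"
    using sets_lebesgue_outer_open[of "B n" "e/3"] Bl e by auto
  have mC: "measure lebesgue (B n - C) < e/3" and mO: "measure lebesgue (O' - B n) < e/3"
    using C(3,4) O(3,4) e by (simp_all add: emeasure_eq_measure2 ennreal_less_iff)
  have "bounded C" by (rule bounded_subset[of "cball 0 (real n)"]) (use C(2) in \<open>auto simp: B_def\<close>)
  then have "compact C" using C(1) by (simp add: compact_eq_bounded_closed)
  then obtain U where U: "U \<in> R" "C \<subseteq> U" "closure U \<subseteq> O'" using R[of C O'] O(1,2) C(2) by blast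
  define E where "E = (A - B n) \<union> ((B n - C) \<union> (O' - B n))"
  have AB: "A - B n \<in> lmeasurable" using Al Bl by (intro fmeasurable_Diff) auto
  have CO: "(B n - C) \<union> (O' - B n) \<in> lmeasurable" by (rule fmeasurable.Un[OF C(3) O(3)])
  have "measure lebesgue E \<le> measure lebesgue (A - B n) + measure lebesgue ((B n - C) \<union> (O' - B n))"
    unfolding E_def by (rule measure_Un_le) (use AB CO in auto)
  also have "measure lebesgue ((B n - C) \<union> (O' - B n)) \<le> measure lebesgue (B n - C) + measure lebesgue (O' - B n)"
    by (rule measure_Un_le) (use C(3) O(3) in auto)
  finally have "measure lebesgue E < e" using E1 mC mO by linarith
  moreover have "E \<in> lmeasurable" unfolding E_def by (rule fmeasurable.Un[OF AB CO])
  moreover have "(A - U) \<union> (U - A) \<subseteq> E"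
  proof -
    have "U \<subseteq> O'" using U(3) closure_subset by blast
    moreover have "B n \<subseteq> A" by (simp add: B_def)
    ultimately show ?thesis using U(2) C(2) O(2) unfolding E_def by blast
  qed
  ultimately show ?thesis using U(1) by blast
qed

lemma lmeasurable_integrable_indicator:
  assumes "U \<in> lmeasurable" shows "integrable lebesgue (indicator U :: 'a::euclidean_space \<Rightarrow> real)"
proof (rule integrable_real_indicator)
  show "U \<in> sets lebesgue" by (rule fmeasurableD[OF assms])
  show "emeasure lebesgue U < \<infinity>" using fmeasurableD2[OF assms] unfolding infinity_ennreal_def less_top[symmetric] by blast
qed

text \<open>Lists rather than functions on finite sets, because lists over a countable alphabet are countable.\<close>

definition step_function :: "('b::real_vector \<times> 'a set) list \<Rightarrow> 'a \<Rightarrow> 'b" where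
  "step_function xs x = (\<Sum>(c, U)\<leftarrow>xs. indicator U x *\<^sub>R c)"

lemma step_function_simps:
  "step_function [] x = 0" "step_function ((c, U) # xs) x = indicator U x *\<^sub>R c + step_function xs x"
  "step_function (xs @ ys) x = step_function xs x + step_function ys x"
  by (simp_all add: step_function_def)

lemma step_function_integrable:
  fixes xs :: "((real^'d::finite) \<times> (real^'d) set) list"
  assumes "\<And>c U. (c, U) \<in> set xs \<Longrightarrow> U \<in> lmeasurable"
  shows "integrable lebesgue (step_function xs)"
  using assms
proof (induction xs)
  case Nil then show ?case by (simp add: step_function_def[abs_def])
next
  case (Cons p xs)
  obtain c U where p: "p = (c, U)" by (cases p)
  have U: "U \<in> lmeasurable" using Cons.prems[of c U] p by simp
  have "integrable lebesgue (\<lambda>x. indicator U x *\<^sub>R c + step_function xs x)"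
  proof (rule Bochner_Integration.integrable_add)
    show "integrable lebesgue (\<lambda>x. indicator U x *\<^sub>R c)"
      by (intro integrable_scaleR_left lmeasurable_integrable_indicator[OF U])
    show "integrable lebesgue (step_function xs)" using Cons by auto
  qed
  then show ?case by (simp add: p step_function_simps(2) cong: Bochner_Integration.integrable_cong)
qed

text \<open>Induction over integrable functions: multiples of indicators, sums and dominated limits.\<close>

lemma L1_step_approx:
  fixes f :: "real^'d::finite \<Rightarrow> real^'d"
  assumes R: "\<And>U. U \<in> R \<Longrightarrow> U \<in> lmeasurable"
      "\<And>K U. compact K \<Longrightarrow> open U \<Longrightarrow> K \<subseteq> U \<Longrightarrow> \<exists>V\<in>R. K \<subseteq> V \<and> closure V \<subseteq> U"
    and Q: "\<And>X. open X \<Longrightarrow> X \<noteq> {} \<Longrightarrow> \<exists>q\<in>Q. q \<in> X"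
    and f: "integrable lebesgue f" and e: "e > 0"
  shows "\<exists>xs\<in>lists (Q \<times> R). (LINT x|lebesgue. norm (f x - step_function xs x)) < e"
  using f e
proof (induction arbitrary: e rule: integrable_induct)
  case (base A c)
  define a where "a = e / (2 * (norm c + 1))"
  have nc: "norm c + 1 > 0" using norm_ge_zero[of c] by linarith
  have a: "a > 0" using base nc by (simp add: a_def)
  obtain U E where U: "U \<in> R" and E: "E \<in> lmeasurable" "measure lebesgue E < a" "(A - U) \<union> (U - A) \<subseteq> E"
    using finite_measure_set_approx[OF base(1,2) a R(2)] by blast
  have Ul: "U \<in> lmeasurable" by (rule R(1)[OF U])
  define b where "b = e / (2 * (measure lebesgue U + 1))"
  have mU: "measure lebesgue U + 1 > 0" using measure_nonneg[of lebesgue U] by linarith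
  have b: "b > 0" using base(3) mU by (simp add: b_def)
  obtain q where q: "q \<in> Q" "q \<in> ball c b" using Q[of "ball c b"] b by auto
  have iE: "integrable lebesgue (\<lambda>x. norm c * indicator E x :: real)"
    by (intro integrable_mult_right lmeasurable_integrable_indicator[OF E(1)])
  have iU: "integrable lebesgue (\<lambda>x. norm (c - q) * indicator U x :: real)"
    by (intro integrable_mult_right lmeasurable_integrable_indicator[OF Ul])
  have iA: "integrable lebesgue (\<lambda>x. indicator A x *\<^sub>R c - indicator U x *\<^sub>R q)"
    by (intro Bochner_Integration.integrable_diff integrable_scaleR_left lmeasurable_integrable_indicator[OF Ul] integrable_real_indicator[OF base(1,2)])
  have "(LINT x|lebesgue. norm (indicator A x *\<^sub>R c - indicator U x *\<^sub>R q)) \<le> (LINT x|lebesgue. norm c * indicator E x + norm (c - q) * indicator U x)"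
  proof (rule integral_mono[OF integrable_norm[OF iA] Bochner_Integration.integrable_add[OF iE iU]])
    fix x
    consider "x \<in> A" "x \<in> U" | "x \<in> A" "x \<notin> U" | "x \<notin> A" "x \<in> U" | "x \<notin> A" "x \<notin> U" by blast
    then show "norm (indicator A x *\<^sub>R c - indicator U x *\<^sub>R q) \<le> norm c * indicator E x + norm (c - q) * indicator U x"
    proof cases
      case 3
      have "norm q \<le> norm c + norm (c - q)" using norm_triangle_ineq[of c "q - c"] by (simp add: norm_minus_commute)
      then show ?thesis using 3 E(3) by (auto simp: indicator_def)
    qed (use E(3) in \<open>auto simp: indicator_def\<close>)
  qed
  also have "\<dots> = norm c * measure lebesgue E + norm (c - q) * measure lebesgue U"
    using Bochner_Integration.integral_add[OF iE iU] E(1) Ul by simp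
  also have "\<dots> < e"
  proof -
    have "norm c * measure lebesgue E \<le> norm c * a" using E(2) by (intro mult_left_mono) auto
    also have "\<dots> < (norm c + 1) * a" using a by simp
    also have "\<dots> = e / 2" using nc by (simp add: a_def field_simps)
    finally have 1: "norm c * measure lebesgue E < e / 2" .
    have "norm (c - q) * measure lebesgue U \<le> b * measure lebesgue U"
      using q(2) by (intro mult_right_mono) (auto simp: dist_norm)
    also have "\<dots> \<le> b * (measure lebesgue U + 1)" using b by simp
    also have "\<dots> = e / 2" using mU by (simp add: b_def field_simps)
    finally show ?thesis using 1 by linarith
  qed
  finally have "(LINT x|lebesgue. norm (indicator A x *\<^sub>R c - step_function [(q, U)] x)) < e" by (simp add: step_function_simps)
  then show ?case using q(1) U by (intro bexI[of _ "[(q, U)]"]) auto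
next
  case (add f g)
  obtain xs where xs: "xs \<in> lists (Q \<times> R)" "(LINT x|lebesgue. norm (f x - step_function xs x)) < e/2" using add.IH(1)[of "e/2"] add.prems by auto
  obtain ys where ys: "ys \<in> lists (Q \<times> R)" "(LINT x|lebesgue. norm (g x - step_function ys x)) < e/2" using add.IH(2)[of "e/2"] add.prems by auto
  have ix: "integrable lebesgue (step_function xs)" by (rule step_function_integrable) (use xs(1) R(1) in auto)
  have iy: "integrable lebesgue (step_function ys)" by (rule step_function_integrable) (use ys(1) R(1) in auto)
  note i1 = Bochner_Integration.integrable_diff[OF add.hyps(1) ix] and i2 = Bochner_Integration.integrable_diff[OF add.hyps(2) iy]
  have "(LINT x|lebesgue. norm (f x + g x - step_function (xs @ ys) x)) \<le> (LINT x|lebesgue. norm (f x - step_function xs x) + norm (g x - step_function ys x))"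
  proof (rule integral_mono[OF integrable_norm Bochner_Integration.integrable_add[OF integrable_norm[OF i1] integrable_norm[OF i2]]])
    show "integrable lebesgue (\<lambda>x. f x + g x - step_function (xs @ ys) x)"
      unfolding step_function_simps by (intro Bochner_Integration.integrable_diff Bochner_Integration.integrable_add add.hyps ix iy)
    show "norm (f x + g x - step_function (xs @ ys) x) \<le> norm (f x - step_function xs x) + norm (g x - step_function ys x)" for x
      unfolding step_function_simps by (rule order_trans[OF _ norm_triangle_ineq]) (simp add: algebra_simps)
  qed
  also have "\<dots> = (LINT x|lebesgue. norm (f x - step_function xs x)) + (LINT x|lebesgue. norm (g x - step_function ys x))"
    by (rule Bochner_Integration.integral_add[OF integrable_norm[OF i1] integrable_norm[OF i2]])
  also have "\<dots> < e" using xs(2) ys(2) by linarith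
  finally show ?case using xs(1) ys(1) by (intro bexI[of _ "xs @ ys"]) auto
next
  case (lim f s)
  have "(\<lambda>i. LINT x|lebesgue. norm (f x - s i x)) \<longlonglongrightarrow> (LINT x|lebesgue. norm (f x - f x))"
  proof (rule integral_dominated_convergence[where w = "\<lambda>x. 3 * norm (f x)"])
    note fm = borel_measurable_integrable[OF lim.hyps(4)] and sm = borel_measurable_integrable[OF lim.hyps(1)]
    show "(\<lambda>x. norm (f x - f x)) \<in> borel_measurable lebesgue" by simp
    show "(\<lambda>x. norm (f x - s i x)) \<in> borel_measurable lebesgue" for i
      by (rule measurable_compose[OF borel_measurable_diff[OF fm sm] borel_measurable_norm])
    show "integrable lebesgue (\<lambda>x. 3 * norm (f x))" by (rule integrable_mult_right[OF integrable_norm[OF lim.hyps(4)]])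
    have "(\<lambda>i. norm (f x - s i x)) \<longlonglongrightarrow> norm (f x - f x)" for x
      by (rule tendsto_norm[OF tendsto_diff[OF tendsto_const lim.hyps(2)]]) simp
    then show "AE x in lebesgue. (\<lambda>i. norm (f x - s i x)) \<longlonglongrightarrow> norm (f x - f x)" by simp
    have "norm (norm (f x - s i x)) \<le> 3 * norm (f x)" for i x
      using norm_triangle_ineq4[of "f x" "s i x"] lim.hyps(3)[of x i] by simp
    then show "AE x in lebesgue. norm (norm (f x - s i x)) \<le> 3 * norm (f x)" for i by simp
  qed
  then have "\<forall>\<^sub>F i in sequentially. (LINT x|lebesgue. norm (f x - s i x)) < e/2"
    using lim.prems by (intro order_tendstoD(2)) auto
  then obtain i where i: "(LINT x|lebesgue. norm (f x - s i x)) < e/2" by (auto simp: eventually_sequentially)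
  obtain xs where xs: "xs \<in> lists (Q \<times> R)" "(LINT x|lebesgue. norm (s i x - step_function xs x)) < e/2" using lim.IH[of "e/2" i] lim.prems by auto
  have ix: "integrable lebesgue (step_function xs)" by (rule step_function_integrable) (use xs(1) R(1) in auto)
  note i1 = Bochner_Integration.integrable_diff[OF lim.hyps(4) lim.hyps(1)[of i]] and i2 = Bochner_Integration.integrable_diff[OF lim.hyps(1)[of i] ix]
  have "(LINT x|lebesgue. norm (f x - step_function xs x)) \<le> (LINT x|lebesgue. norm (f x - s i x) + norm (s i x - step_function xs x))"
  proof (rule integral_mono[OF integrable_norm Bochner_Integration.integrable_add[OF integrable_norm[OF i1] integrable_norm[OF i2]]])
    show "integrable lebesgue (\<lambda>x. f x - step_function xs x)" by (rule Bochner_Integration.integrable_diff[OF lim.hyps(4) ix])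
    show "norm (f x - step_function xs x) \<le> norm (f x - s i x) + norm (s i x - step_function xs x)" for x
      by (rule order_trans[OF _ norm_triangle_ineq]) simp
  qed
  also have "\<dots> = (LINT x|lebesgue. norm (f x - s i x)) + (LINT x|lebesgue. norm (s i x - step_function xs x))"
    by (rule Bochner_Integration.integral_add[OF integrable_norm[OF i1] integrable_norm[OF i2]])
  also have "\<dots> < e" using i xs(2) by linarith
  finally show ?case using xs(1) by blast
qed

text \<open>The centres are the countably many combinations of indicators of sets from a countable family of bounded open sets,
with coefficients from a countable dense set.\<close>

lemma L1loc_countable_base:
  obtains \<N> :: "(real^'d::finite \<Rightarrow> real^'d) set set" where "countable \<N>" "\<forall>N\<in>\<N>. openin L1loc_topology N"
    "\<forall>u\<in>L1loc. \<forall>k. \<exists>N\<in>\<N>. u \<in> N \<and> N \<subseteq> L1loc_ball u k"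
proof -
  obtain R :: "(real^'d) set set" where R: "countable R" "\<And>U. U \<in> R \<Longrightarrow> open U" "\<And>U. U \<in> R \<Longrightarrow> bounded U"
    "\<And>K U. compact K \<Longrightarrow> open U \<Longrightarrow> K \<subseteq> U \<Longrightarrow> \<exists>V\<in>R. K \<subseteq> V \<and> closure V \<subseteq> U"
    using countable_dense_opens by metis
  have Rl: "U \<in> lmeasurable" if "U \<in> R" for U using R(2,3)[OF that] by (rule lmeasurable_open[rotated])
  obtain Q :: "(real^'d) set" where Q: "countable Q" "\<And>X. open X \<Longrightarrow> X \<noteq> {} \<Longrightarrow> \<exists>q\<in>Q. q \<in> X"
    using countable_dense_setE by metis
  define D where "D = step_function ` lists (Q \<times> R)"
  have cD: "countable D" unfolding D_def using Q(1) R(1) by (intro countable_image countable_lists countable_SIGMA)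
  have DL: "d \<in> L1loc" if dD: "d \<in> D" for d
  proof -
    obtain xs where xs: "d = step_function xs" "xs \<in> lists (Q \<times> R)" using dD by (auto simp: D_def)
    have i: "integrable lebesgue d" unfolding xs(1) by (rule step_function_integrable) (use xs(2) Rl in auto)
    have "d absolutely_integrable_on K" if K: "compact K" for K
    proof -
      have "K \<in> sets lebesgue" using K sets_borel_lebesgue borel_compact by blast
      moreover have "set_integrable lebesgue UNIV d" using i by (simp add: set_integrable_def)
      ultimately show ?thesis using set_integrable_subset[OF _ _ subset_UNIV, of lebesgue d K] by blast
    qed
    then show ?thesis by (simp add: L1loc_def)
  qed
  \<comment> \<open>Centre, radius of the domain and size of the neighbourhood vary independently.\<close>
  define nb where "nb p = {v \<in> L1loc. (LINT x:cball 0 (real (fst (snd p)))|lebesgue. norm (v x - fst p x)) < 1 / (real (snd (snd p)) + 1)}"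
    for p :: "(real^'d \<Rightarrow> real^'d) \<times> nat \<times> nat"
  define \<N> where "\<N> = nb ` (D \<times> UNIV)"
  have "countable \<N>" unfolding \<N>_def using cD by (intro countable_image countable_SIGMA) auto
  moreover have "\<forall>N\<in>\<N>. openin L1loc_topology N"
  proof
    fix N assume "N \<in> \<N>"
    then obtain p where p: "N = nb p" "fst p \<in> D" by (auto simp: \<N>_def)
    show "openin L1loc_topology N" unfolding p(1) nb_def by (rule openin_L1loc_basic[OF DL[OF p(2)]]) simp_all
  qed
  moreover have "\<exists>N\<in>\<N>. u \<in> N \<and> N \<subseteq> L1loc_ball u k" if u: "u \<in> L1loc" for u k
  proof -
    define m where "m = 2 * k + 1"
    let ?B = "cball (0::real^'d) (real k)"
    have m: "1 / (real m + 1) + 1 / (real m + 1) \<le> 1 / (real k + 1)" by (simp add: m_def field_simps)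
    have fi: "integrable lebesgue (\<lambda>x. indicator ?B x *\<^sub>R u x)"
      using L1loc_integrable_bounded[OF u, of ?B] by (simp add: set_integrable_def)
    obtain xs where xs: "xs \<in> lists (Q \<times> R)" "(LINT x|lebesgue. norm (indicator ?B x *\<^sub>R u x - step_function xs x)) < 1 / (real m + 1)"
      using L1_step_approx[OF Rl R(4) Q(2) fi, of "1 / (real m + 1)"] by auto
    define d where "d = step_function xs"
    have dD: "d \<in> D" using xs(1) by (simp add: d_def D_def)
    have di: "integrable lebesgue d" unfolding d_def by (rule step_function_integrable) (use xs(1) Rl in auto)
    have "(LINT x:?B|lebesgue. norm (u x - d x)) \<le> (LINT x|lebesgue. norm (indicator ?B x *\<^sub>R u x - d x))"
      unfolding set_lebesgue_integral_def
    proof (rule integral_mono[OF _ integrable_norm[OF Bochner_Integration.integrable_diff[OF fi di]]])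
      show "integrable lebesgue (\<lambda>x. indicator ?B x *\<^sub>R norm (u x - d x))"
        using L1loc_norm_diff_integrable[OF u DL[OF dD], of ?B] by (simp add: set_integrable_def)
    qed (simp add: indicator_def)
    then have ud: "(LINT x:?B|lebesgue. norm (u x - d x)) < 1 / (real m + 1)" using xs(2) by (simp add: d_def)
    have "nb (d, k, m) \<in> \<N>" using dD by (auto simp: \<N>_def)
    moreover have "u \<in> nb (d, k, m)" using ud u by (simp add: nb_def)
    moreover have "nb (d, k, m) \<subseteq> L1loc_ball u k"
    proof
      fix v assume "v \<in> nb (d, k, m)"
      then have v: "v \<in> L1loc" "(LINT x:?B|lebesgue. norm (v x - d x)) < 1 / (real m + 1)" by (auto simp: nb_def)
      have "(LINT x:?B|lebesgue. norm (v x - u x)) \<le> (LINT x:?B|lebesgue. norm (v x - d x)) + (LINT x:?B|lebesgue. norm (d x - u x))"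
        by (rule L1loc_dist_triangle[OF v(1) DL[OF dD] u]) simp_all
      also have "(LINT x:?B|lebesgue. norm (d x - u x)) = (LINT x:?B|lebesgue. norm (u x - d x))" by (rule L1loc_dist_commute)
      finally show "v \<in> L1loc_ball u k" using v ud m by (simp add: L1loc_ball_def)
    qed
    ultimately show ?thesis by blast
  qed
  ultimately show ?thesis using that[of \<N>] by blast
qed

section \<open>Gamma-limits\<close>

lemma Gamma_liminf_L1loc:
  assumes "u \<in> L1loc"
  shows "Gamma_liminf L1loc_topology f u = (SUP k. liminf (\<lambda>n. INF y\<in>L1loc_ball u k. f n y))"
  unfolding Gamma_liminf_def
proof (rule antisym)
  show "(SUP N\<in>{N. openin L1loc_topology N \<and> u \<in> N}. liminf (\<lambda>n. INF y\<in>N. f n y)) \<le> (SUP k. liminf (\<lambda>n. INF y\<in>L1loc_ball u k. f n y))"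
  proof (rule SUP_least, safe)
    fix N assume N: "openin L1loc_topology N" "u \<in> N"
    obtain k where k: "L1loc_ball u k \<subseteq> N" using L1loc_ball_basis[OF N] by blast
    have "liminf (\<lambda>n. INF y\<in>N. f n y) \<le> liminf (\<lambda>n. INF y\<in>L1loc_ball u k. f n y)"
      by (intro Liminf_mono always_eventually allI INF_superset_mono k order_refl)
    also have "\<dots> \<le> (SUP k. liminf (\<lambda>n. INF y\<in>L1loc_ball u k. f n y))" by (rule SUP_upper) simp
    finally show "liminf (\<lambda>n. INF y\<in>N. f n y) \<le> (SUP k. liminf (\<lambda>n. INF y\<in>L1loc_ball u k. f n y))" .
  qed
  show "(SUP k. liminf (\<lambda>n. INF y\<in>L1loc_ball u k. f n y)) \<le> (SUP N\<in>{N. openin L1loc_topology N \<and> u \<in> N}. liminf (\<lambda>n. INF y\<in>N. f n y))"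
  proof (rule SUP_least)
    fix k
    show "liminf (\<lambda>n. INF y\<in>L1loc_ball u k. f n y) \<le> (SUP N\<in>{N. openin L1loc_topology N \<and> u \<in> N}. liminf (\<lambda>n. INF y\<in>N. f n y))"
      by (rule SUP_upper) (simp add: openin_L1loc_ball[OF assms] centre_in_L1loc_ball[OF assms])
  qed
qed

lemma Gamma_limsup_L1loc:
  assumes "u \<in> L1loc"
  shows "Gamma_limsup L1loc_topology f u = (SUP k. limsup (\<lambda>n. INF y\<in>L1loc_ball u k. f n y))"
  unfolding Gamma_limsup_def
proof (rule antisym)
  show "(SUP N\<in>{N. openin L1loc_topology N \<and> u \<in> N}. limsup (\<lambda>n. INF y\<in>N. f n y)) \<le> (SUP k. limsup (\<lambda>n. INF y\<in>L1loc_ball u k. f n y))"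
  proof (rule SUP_least, safe)
    fix N assume N: "openin L1loc_topology N" "u \<in> N"
    obtain k where k: "L1loc_ball u k \<subseteq> N" using L1loc_ball_basis[OF N] by blast
    have "limsup (\<lambda>n. INF y\<in>N. f n y) \<le> limsup (\<lambda>n. INF y\<in>L1loc_ball u k. f n y)"
      by (intro Limsup_mono always_eventually allI INF_superset_mono k order_refl)
    also have "\<dots> \<le> (SUP k. limsup (\<lambda>n. INF y\<in>L1loc_ball u k. f n y))" by (rule SUP_upper) simp
    finally show "limsup (\<lambda>n. INF y\<in>N. f n y) \<le> (SUP k. limsup (\<lambda>n. INF y\<in>L1loc_ball u k. f n y))" .
  qed
  show "(SUP k. limsup (\<lambda>n. INF y\<in>L1loc_ball u k. f n y)) \<le> (SUP N\<in>{N. openin L1loc_topology N \<and> u \<in> N}. limsup (\<lambda>n. INF y\<in>N. f n y))"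
  proof (rule SUP_least)
    fix k
    show "limsup (\<lambda>n. INF y\<in>L1loc_ball u k. f n y) \<le> (SUP N\<in>{N. openin L1loc_topology N \<and> u \<in> N}. limsup (\<lambda>n. INF y\<in>N. f n y))"
      by (rule SUP_upper) (simp add: openin_L1loc_ball[OF assms] centre_in_L1loc_ball[OF assms])
  qed
qed

text \<open>A neighbourhood of \<open>u\<close> is also a neighbourhood of \<open>v k\<close> for large \<open>k\<close>.\<close>

lemma Gamma_liminf_lsc:
  assumes "limitin X v u sequentially"
  shows "Gamma_liminf X f u \<le> liminf (\<lambda>k::nat. Gamma_liminf X f (v k))"
  unfolding Gamma_liminf_def[of X f u]
proof (rule SUP_least, safe)
  fix N assume N: "openin X N" "u \<in> N"
  have "\<forall>\<^sub>F k in sequentially. v k \<in> N" using assms N by (simp add: limitin_def)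
  then have "\<forall>\<^sub>F k in sequentially. liminf (\<lambda>n. INF y\<in>N. f n y) \<le> Gamma_liminf X f (v k)"
    by (rule eventually_mono) (auto simp: Gamma_liminf_def N intro!: SUP_upper)
  then show "liminf (\<lambda>n. INF y\<in>N. f n y) \<le> liminf (\<lambda>k. Gamma_liminf X f (v k))" by (rule Liminf_bounded)
qed

text \<open>Along the subsequence the infima over the countably many base sets converge, and every ball contains a base set
around its centre.\<close>

lemma Gamma_diagonal:
  fixes F :: "nat \<Rightarrow> (real^'d::finite \<Rightarrow> real^'d) \<Rightarrow> 's \<Rightarrow> ennreal"
  assumes R: "countable R"
  shows "\<exists>r. strict_mono (r :: nat \<Rightarrow> nat) \<and> (\<forall>U\<in>R. \<forall>u\<in>L1loc.
     Gamma_limsup L1loc_topology (\<lambda>n y. F (r n) y U) u \<le> Gamma_liminf L1loc_topology (\<lambda>n y. F (r n) y U) u)"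
proof -
  obtain \<N> :: "(real^'d \<Rightarrow> real^'d) set set" where \<N>: "countable \<N>" "\<forall>N\<in>\<N>. openin L1loc_topology N"
    "\<forall>u\<in>L1loc. \<forall>k. \<exists>N\<in>\<N>. u \<in> N \<and> N \<subseteq> L1loc_ball u k"
    by (rule L1loc_countable_base)
  define a where "a s n = (INF y\<in>snd s. F n y (fst s))" for s n
  have "countable (R \<times> \<N>)" using R \<N>(1) by (rule countable_SIGMA)
  then obtain r where r: "strict_mono (r :: nat \<Rightarrow> nat)" "\<forall>s\<in>R \<times> \<N>. convergent (\<lambda>k. a s (r k))"
    using ennreal_diagonal_subsequence by blast
  have "Gamma_limsup L1loc_topology (\<lambda>n y. F (r n) y U) u \<le> Gamma_liminf L1loc_topology (\<lambda>n y. F (r n) y U) u"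
    if U: "U \<in> R" and u: "u \<in> L1loc" for U u
    unfolding Gamma_limsup_L1loc[OF u]
  proof (rule SUP_least)
    fix k
    obtain N where N: "N \<in> \<N>" "u \<in> N" "N \<subseteq> L1loc_ball u k" using \<N>(3) u by blast
    obtain l where l: "(\<lambda>n. INF y\<in>N. F (r n) y U) \<longlonglongrightarrow> l"
      using r(2) U N(1) by (auto simp: a_def convergent_def)
    have "limsup (\<lambda>n. INF y\<in>L1loc_ball u k. F (r n) y U) \<le> limsup (\<lambda>n. INF y\<in>N. F (r n) y U)"
      by (intro Limsup_mono always_eventually allI INF_superset_mono N(3) order_refl)
    also have "\<dots> = liminf (\<lambda>n. INF y\<in>N. F (r n) y U)"
      using lim_imp_Liminf[OF sequentially_bot l] lim_imp_Limsup[OF sequentially_bot l] by simp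
    also have "\<dots> \<le> Gamma_liminf L1loc_topology (\<lambda>n y. F (r n) y U) u"
      unfolding Gamma_liminf_def using \<N>(2) N by (intro SUP_upper) auto
    finally show "limsup (\<lambda>n. INF y\<in>L1loc_ball u k. F (r n) y U) \<le> Gamma_liminf L1loc_topology (\<lambda>n y. F (r n) y U) u" .
  qed
  then show ?thesis using r(1) by blast
qed

section \<open>The fundamental estimate\<close>

lemma
  assumes F: "(F :: ('d::finite) functional) \<in> functional_class c1 c2 c3 c4 c5 \<sigma>" and u: "u \<in> L1loc"
  shows functional_class_measure: "measure_space UNIV (sets borel) (F u)"
    and functional_class_local: "open U \<Longrightarrow> bounded U \<Longrightarrow> v \<in> L1loc \<Longrightarrow> (\<And>x. x \<in> U \<Longrightarrow> u x = v x) \<Longrightarrow> F u U = F v U"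
    and functional_class_lower_bound: "open U \<Longrightarrow> bounded U \<Longrightarrow> u \<in> BD U \<Longrightarrow> ennreal c1 * total_variation (sym_gradient U u) U \<le> F u U + ennreal c2 * emeasure lborel U"
    and functional_class_upper_bound: "open U \<Longrightarrow> bounded U \<Longrightarrow> u \<in> BD U \<Longrightarrow> F u U \<le> ennreal c3 * total_variation (sym_gradient U u) U + ennreal c4 * emeasure lborel U"
    and functional_class_infinite: "open U \<Longrightarrow> bounded U \<Longrightarrow> u \<notin> BD U \<Longrightarrow> F u U = \<infinity>"
proof -
  note conj = F[unfolded functional_class_def mem_Collect_eq]
  note growth = conj[THEN conjunct2, THEN conjunct2, THEN conjunct1, THEN bspec, OF u, THEN spec, of U]
  show "measure_space UNIV (sets borel) (F u)" using bspec[OF conj[THEN conjunct1] u] by (rule conjunct1)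
  show "F u U = F v U" if "open U" "bounded U" "v \<in> L1loc" "\<And>x. x \<in> U \<Longrightarrow> u x = v x"
  proof -
    have "AE x in lebesgue. x \<in> U \<longrightarrow> u x = v x" using that(4) by simp
    then show ?thesis
      using conj[THEN conjunct2, THEN conjunct1, THEN spec, of U, THEN bspec, OF u, THEN bspec, OF that(3)] that(1,2) by (simp only: simp_thms)
  qed
  show "ennreal c1 * total_variation (sym_gradient U u) U \<le> F u U + ennreal c2 * emeasure lborel U"
    if "open U" "bounded U" "u \<in> BD U" using growth that by (simp only: simp_thms)
  show "F u U \<le> ennreal c3 * total_variation (sym_gradient U u) U + ennreal c4 * emeasure lborel U"
    if "open U" "bounded U" "u \<in> BD U" using growth that by (simp only: simp_thms)
  show "F u U = \<infinity>" if "open U" "bounded U" "u \<notin> BD U" using growth that by (simp only: simp_thms)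
qed

lemma BD_of_finite_value:
  assumes F: "(F :: ('d::finite) functional) \<in> functional_class c1 c2 c3 c4 c5 \<sigma>" and u: "u \<in> L1loc" and c: "0 < c1" "0 \<le> c2"
    and S: "open S" "bounded S" and fin: "F u S < \<infinity>"
  shows "u \<in> BD S" "total_variation (sym_gradient S u) S \<le> ennreal (1 / c1) * (F u S + ennreal c2 * emeasure lborel S)"
proof -
  show bd: "u \<in> BD S" using functional_class_infinite[OF F u S] fin by (cases "u \<in> BD S") auto
  have "total_variation (sym_gradient S u) S = ennreal (1 / c1) * (ennreal c1 * total_variation (sym_gradient S u) S)"
    using c by (simp add: mult.assoc[symmetric] ennreal_mult[symmetric])
  also have "\<dots> \<le> ennreal (1 / c1) * (F u S + ennreal c2 * emeasure lborel S)"
    by (intro mult_left_mono functional_class_lower_bound[OF F u S bd]) simp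
  finally show "total_variation (sym_gradient S u) S \<le> ennreal (1 / c1) * (F u S + ennreal c2 * emeasure lborel S)" .
qed

lemma BD_sym_gradient: "u \<in> BD S \<Longrightarrow> is_sym_gradient S u (sym_gradient S u)"
proof -
  assume "u \<in> BD S"
  then obtain \<mu> where "is_sym_gradient S u \<mu>" by (auto simp: BD_def)
  then show ?thesis unfolding sym_gradient_def by (rule someI[of "is_sym_gradient S u"])
qed

lemma BD_integrable: "u \<in> BD S \<Longrightarrow> u absolutely_integrable_on S"
  by (simp add: BD_def)

text \<open>The growth conditions applied on one transition layer: from above to the glued function, whose variation \<open>BD_cutoff\<close>
bounds, and from below to \<open>u\<close> and \<open>v\<close>.\<close>

lemma strip_estimate:
  fixes F :: "('d::finite) functional"
  assumes F: "F \<in> functional_class c1 c2 c3 c4 c5 \<sigma>" and c: "0 < c1" "0 \<le> c2" "0 \<le> c3" "0 \<le> c4"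
    and u: "u \<in> L1loc" and v: "v \<in> L1loc" and S: "open S" "bounded S" and fin: "F u S < \<infinity>" "F v S < \<infinity>"
    and \<eta>: "\<eta> \<in> test_functions UNIV" "\<And>x. 0 \<le> \<eta> x" "\<And>x. \<eta> x \<le> 1" and L: "\<And>j x. \<bar>partial_deriv j \<eta> x\<bar> \<le> L"
    and w: "(\<lambda>x. \<eta> x *\<^sub>R u x + (1 - \<eta> x) *\<^sub>R v x) \<in> L1loc"
  shows "F (\<lambda>x. \<eta> x *\<^sub>R u x + (1 - \<eta> x) *\<^sub>R v x) S \<le>
    ennreal (c3 / c1) * (F u S + F v S) + ennreal (2 * c3 * c2 / c1 + c4) * emeasure lborel S
      + ennreal (c3 * (real CARD('d) * real CARD('d) * L * (LINT x:S|lebesgue. norm (u x - v x))))"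
proof -
  define w where "w = (\<lambda>x. \<eta> x *\<^sub>R u x + (1 - \<eta> x) *\<^sub>R v x)"
  define I where "I = real CARD('d) * real CARD('d) * L * (LINT x:S|lebesgue. norm (u x - v x))"
  define vol where "vol = emeasure lborel S"
  note bu = BD_of_finite_value[OF F u c(1,2) S fin(1)] and bv = BD_of_finite_value[OF F v c(1,2) S fin(2)]
  have L0: "0 \<le> L" by (rule order_trans[OF abs_ge_zero L])
  have "0 \<le> (LINT x:S|lebesgue. norm (u x - v x))"
    unfolding set_lebesgue_integral_def by (rule Bochner_Integration.integral_nonneg) simp
  then have I0: "0 \<le> I" unfolding I_def using L0 by (intro mult_nonneg_nonneg) auto
  obtain \<kappa> where \<kappa>: "is_sym_gradient S w \<kappa>" "total_variation \<kappa> S \<le> total_variation (sym_gradient S u) S + total_variation (sym_gradient S v) S + ennreal I"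
    using BD_cutoff[OF S(1) BD_integrable[OF bu(1)] BD_integrable[OF bv(1)] BD_sym_gradient[OF bu(1)] BD_sym_gradient[OF bv(1)] \<eta> L]
    unfolding w_def I_def by blast
  have wi: "w absolutely_integrable_on S"
    unfolding w_def by (rule convex_combination_integrable[OF BD_integrable[OF bu(1)] BD_integrable[OF bv(1)] test_functions_measurable[OF \<eta>(1)] \<eta>(2,3)])
  have wBD: "w \<in> BD S" using wi \<kappa>(1) by (auto simp: BD_def)
  have wL: "w \<in> L1loc" using w by (simp add: w_def)
  have tv: "total_variation (sym_gradient S w) S \<le> ennreal (1 / c1) * (F u S + ennreal c2 * vol) + ennreal (1 / c1) * (F v S + ennreal c2 * vol) + ennreal I"
    unfolding total_variation_sym_gradient[OF \<kappa>(1) wi S(1)] vol_def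
    by (rule order_trans[OF \<kappa>(2)]) (intro add_mono bu(2) bv(2) order_refl)
  have "F w S \<le> ennreal c3 * total_variation (sym_gradient S w) S + ennreal c4 * vol"
    unfolding vol_def by (rule functional_class_upper_bound[OF F wL S wBD])
  also have "\<dots> \<le> ennreal c3 * (ennreal (1 / c1) * (F u S + ennreal c2 * vol) + ennreal (1 / c1) * (F v S + ennreal c2 * vol) + ennreal I) + ennreal c4 * vol"
    by (intro add_mono mult_left_mono tv) simp_all
  also have "\<dots> = (ennreal c3 * ennreal (1 / c1)) * (F u S + F v S) + ((ennreal c3 * ennreal (1 / c1)) * ennreal c2 + (ennreal c3 * ennreal (1 / c1)) * ennreal c2 + ennreal c4) * vol + ennreal c3 * ennreal I"
    by (simp add: algebra_simps)
  also have "ennreal c3 * ennreal (1 / c1) = ennreal (c3 / c1)" using c by (simp add: ennreal_mult[symmetric])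
  also have "ennreal (c3 / c1) * ennreal c2 + ennreal (c3 / c1) * ennreal c2 + ennreal c4 = ennreal (2 * c3 * c2 / c1 + c4)"
    using c by (simp add: ennreal_mult[symmetric] ennreal_plus[symmetric] del: ennreal_plus)
  also have "ennreal c3 * ennreal I = ennreal (c3 * I)" using c I0 by (simp add: ennreal_mult)
  finally show ?thesis unfolding w_def I_def vol_def .
qed

lemma convex_combination_L1loc:
  assumes "u \<in> L1loc" "v \<in> L1loc" "\<eta> \<in> test_functions UNIV" "\<And>x. 0 \<le> \<eta> x" "\<And>x. \<eta> x \<le> 1"
  shows "(\<lambda>x. \<eta> x *\<^sub>R u x + (1 - \<eta> x) *\<^sub>R v x) \<in> L1loc"
  unfolding L1loc_def mem_Collect_eq
proof (intro allI impI)
  fix K :: "(real^'a) set" assume "compact K"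
  then show "(\<lambda>x. \<eta> x *\<^sub>R u x + (1 - \<eta> x) *\<^sub>R v x) absolutely_integrable_on K"
    by (intro convex_combination_integrable[OF _ _ test_functions_measurable[OF assms(3)] assms(4,5)]) (use assms(1,2) in \<open>auto simp: L1loc_def\<close>)
qed

lemma test_functions_common_derivative_bound:
  assumes "\<And>i. i < (N::nat) \<Longrightarrow> \<eta> i \<in> test_functions (UNIV :: (real^'d::finite) set)"
  shows "\<exists>L\<ge>0. \<forall>i<N. \<forall>j x. \<bar>partial_deriv j (\<eta> i) x\<bar> \<le> L"
proof -
  have "\<exists>B\<ge>0. \<forall>x. \<bar>partial_deriv j (\<eta> i) x\<bar> \<le> B" if i: "i < N" for i j
  proof (rule test_functions_bounded[OF partial_deriv_test_functions[OF assms[OF i]]])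
    fix B :: real assume "B > 0" "\<And>x. \<bar>partial_deriv j (\<eta> i) x\<bar> \<le> B"
    then show "\<exists>B\<ge>0. \<forall>x. \<bar>partial_deriv j (\<eta> i) x\<bar> \<le> B" by (intro exI[of _ B]) auto
  qed
  then obtain B where B: "\<And>i j. i < N \<Longrightarrow> B i j \<ge> 0" "\<And>i j x. i < N \<Longrightarrow> \<bar>partial_deriv j (\<eta> i) x\<bar> \<le> B i j" by metis
  define L where "L = (\<Sum>i<N. \<Sum>j\<in>UNIV. B i j)"
  have "B i j \<le> L" if "i < N" for i j
  proof -
    have "B i j \<le> (\<Sum>j\<in>UNIV. B i j)" by (rule member_le_sum) (use B(1) that in auto)
    also have "\<dots> \<le> L" unfolding L_def by (rule member_le_sum[of i "{..<N}" "\<lambda>i. \<Sum>j\<in>UNIV. B i j"]) (use B(1) that in \<open>auto intro!: sum_nonneg\<close>)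
    finally show ?thesis .
  qed
  moreover have "0 \<le> L" unfolding L_def using B(1) by (intro sum_nonneg) auto
  ultimately show ?thesis using B(2) by (intro exI[of _ L]) (meson order_trans)
qed

text \<open>The constant \<open>C\<close> must be independent of \<open>F\<close>, \<open>u\<close> and \<open>v\<close>, while the layer depends on them; so cutoffs for all \<open>N\<close> layers are fixed
in advance, with a common bound for their derivatives. The bound on \<open>|w - z|\<close> says that \<open>w\<close> is close to any
function that both \<open>u\<close> and \<open>v\<close> are close to.\<close>

lemma fundamental_estimate:
  fixes U U' V :: "(real^'d::finite) set" and c1 c2 c3 c4 c5 :: real and \<sigma> :: "real \<Rightarrow> real"
  assumes c: "0 < c1" "0 \<le> c2" "0 \<le> c3" "0 \<le> c4"
    and U: "open U" "bounded U" and V: "open V" "bounded V" and U': "open U'" "closure U' \<subseteq> U" and N: "N > (0::nat)"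
  shows "\<exists>C\<ge>0. \<forall>F\<in>functional_class c1 c2 c3 c4 c5 \<sigma>. \<forall>u\<in>L1loc. \<forall>v\<in>L1loc. \<exists>w\<in>L1loc.
     (\<forall>x z. norm (w x - z) \<le> norm (u x - z) + norm (v x - z)) \<and>
     F w (U' \<union> V) \<le> F u U + F v V + ennreal (1 / real N) * (ennreal (c3 / c1) * (F u U + F v V) + ennreal (2 * c3 * c2 / c1 + c4) * emeasure lborel V)
       + ennreal (C * (LINT x:U \<inter> V|lebesgue. norm (u x - v x)))"
proof -
  have "bounded U'" by (rule bounded_subset[OF U(2) order_trans[OF closure_subset U'(2)]])
  then have "compact (closure U')" by (simp add: compact_closure)
  then obtain \<Phi> where \<Phi>: "\<Phi> \<in> test_functions U" "\<And>x. 0 \<le> \<Phi> x" "\<And>x. \<Phi> x \<le> 1" "\<And>x. x \<in> closure U' \<Longrightarrow> \<Phi> x = 1"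
    using smooth_cutoff[OF _ U(1) U'(2)] by metis
  obtain K where K: "compact K" "K \<subseteq> U" "\<forall>x. x \<notin> K \<longrightarrow> \<Phi> x = 0" by (rule test_functions_support[OF \<Phi>(1)])
  have \<Phi>U: "x \<in> U" if "\<Phi> x > 0" for x using that K(2,3) by fastforce
  have \<Phi>c: "continuous_on UNIV \<Phi>" by (rule smooth_continuous[OF test_functions_smooth[OF \<Phi>(1)]])
  have N0: "real N > 0" using N by simp
  \<comment> \<open>The \<open>i\<close>-th cutoff changes only where \<open>\<Phi>\<close> lies in the middle third of \<open>(i/N, (i+1)/N)\<close>.\<close>
  define \<eta> where "\<eta> i x = smooth_step (3 * (real N * \<Phi> x - real i) - 1)" for i :: nat and x
  have \<eta>t: "\<eta> i \<in> test_functions UNIV" for i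
  proof (rule test_functionsI[OF _ K(1) subset_UNIV])
    have s: "smooth (\<lambda>x. (3 * real N) * \<Phi> x + (- 3 * real i - 1))"
      by (rule smooth_add[OF smooth_mult[OF smooth_const test_functions_smooth[OF \<Phi>(1)]] smooth_const])
    have "smooth (\<lambda>x. smooth_step ((3 * real N) * \<Phi> x + (- 3 * real i - 1)))" by (rule smooth_smooth_step[OF s])
    moreover have "\<eta> i = (\<lambda>x. smooth_step ((3 * real N) * \<Phi> x + (- 3 * real i - 1)))"
      by (rule ext) (simp add: \<eta>_def algebra_simps)
    ultimately show "smooth (\<eta> i)" by simp
    show "\<eta> i x = 0" if "x \<notin> K" for x
      using K(3) that unfolding \<eta>_def by (intro smooth_step_0) simp
  qed
  have \<eta>0: "0 \<le> \<eta> i x" and \<eta>1: "\<eta> i x \<le> 1" for i x by (simp_all add: \<eta>_def smooth_step_ge_0 smooth_step_le_1)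
  obtain L where L: "L \<ge> 0" "\<forall>i<N. \<forall>j x. \<bar>partial_deriv j (\<eta> i) x\<bar> \<le> L"
    using test_functions_common_derivative_bound[of N \<eta>] \<eta>t by blast
  \<comment> \<open>On \<open>A i\<close> the \<open>i\<close>-th glued function is \<open>u\<close>, on \<open>B i\<close> it is \<open>v\<close>, and \<open>S i\<close> contains the transition layer. The transition takes place in the middle third of \<open>S i\<close>, so that the three open sets overlap.\<close>
  define S where "S i = V \<inter> {x. real i / real N < \<Phi> x \<and> \<Phi> x < (real i + 1) / real N}" for i :: nat
  define A where "A i = (U' \<union> V) \<inter> {x. (real i + 2/3) / real N < \<Phi> x}" for i :: nat
  define B where "B i = V \<inter> {x. \<Phi> x < (real i + 1/3) / real N}" for i :: nat
  have oU'V: "open (U' \<union> V)" using U'(1) V(1) by blast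
  have So: "open (S i)" for i
    unfolding S_def Collect_conj_eq
    by (intro open_Int V(1) open_Collect_less continuous_on_const \<Phi>c)
  have Ao: "open (A i)" for i unfolding A_def by (intro open_Int oU'V open_Collect_less continuous_on_const \<Phi>c)
  have Bo: "open (B i)" for i unfolding B_def by (intro open_Int V(1) open_Collect_less continuous_on_const \<Phi>c)
  have nn: "0 \<le> real i / real N" "0 \<le> (real i + 2/3) / real N" for i using N0 by simp_all
  have SU: "S i \<subseteq> U" "S i \<subseteq> V" for i
    using \<Phi>U order_le_less_trans[OF nn(1)[of i]] by (auto simp: S_def)
  have AU: "A i \<subseteq> U" for i using \<Phi>U order_le_less_trans[OF nn(2)[of i]] by (auto simp: A_def)
  have BV: "B i \<subseteq> V" for i by (auto simp: B_def)
  have Sb: "bounded (S i)" for i by (rule bounded_subset[OF V(2) SU(2)])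
  have Ab: "bounded (A i)" for i by (rule bounded_subset[OF U(2) AU])
  have Bb: "bounded (B i)" for i by (rule bounded_subset[OF V(2) BV])
  have Sdisj: "disjoint_family_on S {..<N}"
    unfolding disjoint_family_on_def
  proof (intro ballI impI)
    have d: "S i \<inter> S j = {}" if ij: "i < j" for i j :: nat
    proof -
      have "(real i + 1) / real N \<le> real j / real N" using ij N0 by (intro divide_right_mono) auto
      then show ?thesis by (auto simp: S_def)
    qed
    fix i j :: nat assume "i \<noteq> j" then show "S i \<inter> S j = {}" using d[of i j] d[of j i] by (cases "i < j") auto
  qed
  have third: "a + 2/3 < t \<Longrightarrow> 1 \<le> 3 * (t - a) - 1" "t < a + 1/3 \<Longrightarrow> 3 * (t - a) - 1 \<le> 0" for a t :: real
    by (simp_all add: field_simps)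
  define D where "D = c3 * (real CARD('d) * real CARD('d) * L)"
  have D0: "0 \<le> D" unfolding D_def using c L by simp
  show ?thesis
  proof (intro exI[of _ D] conjI D0 ballI)
    fix F :: "'d functional" and u v :: "real^'d \<Rightarrow> real^'d"
    assume F: "F \<in> functional_class c1 c2 c3 c4 c5 \<sigma>" and u: "u \<in> L1loc" and v: "v \<in> L1loc"
    define w where "w i = (\<lambda>x. \<eta> i x *\<^sub>R u x + (1 - \<eta> i x) *\<^sub>R v x)" for i
    have wL: "w i \<in> L1loc" for i unfolding w_def by (rule convex_combination_L1loc[OF u v \<eta>t \<eta>0 \<eta>1])
    have wn: "norm (w i x - z) \<le> norm (u x - z) + norm (v x - z)" for i x z
    proof -
      have "w i x - z = \<eta> i x *\<^sub>R (u x - z) + (1 - \<eta> i x) *\<^sub>R (v x - z)" by (simp add: w_def algebra_simps)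
      also have "norm \<dots> \<le> norm (\<eta> i x *\<^sub>R (u x - z)) + norm ((1 - \<eta> i x) *\<^sub>R (v x - z))" by (rule norm_triangle_ineq)
      also have "\<dots> \<le> norm (u x - z) + norm (v x - z)"
        using \<eta>0[of i x] \<eta>1[of i x] by (intro add_mono) (auto intro: mult_left_le_one_le)
      finally show ?thesis .
    qed
    note mu = functional_class_measure[OF F u] and mv = functional_class_measure[OF F v]
    show "\<exists>w\<in>L1loc. (\<forall>x z. norm (w x - z) \<le> norm (u x - z) + norm (v x - z)) \<and>
     F w (U' \<union> V) \<le> F u U + F v V + ennreal (1 / real N) * (ennreal (c3 / c1) * (F u U + F v V) + ennreal (2 * c3 * c2 / c1 + c4) * emeasure lborel V)
       + ennreal (D * (LINT x:U \<inter> V|lebesgue. norm (u x - v x)))"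
    proof (cases "F u U < \<infinity> \<and> F v V < \<infinity>")
      case False
      then show ?thesis using wL wn by (intro bexI[of _ "w 0"] conjI allI) (auto simp: less_top[symmetric])
    next
      case fin: True
      have FuS: "F u (S i) < \<infinity>" for i
        using borel_measure_space_mono[OF mu SU(1)[of i]] So U fin by (auto intro: order_le_less_trans)
      have FvS: "F v (S i) < \<infinity>" for i
        using borel_measure_space_mono[OF mv SU(2)[of i]] So V fin by (auto intro: order_le_less_trans)
      define h where "h i = ennreal (c3 / c1) * (F u (S i) + F v (S i)) + ennreal (2 * c3 * c2 / c1 + c4) * emeasure lborel (S i)" for i
      define T where "T = ennreal (c3 / c1) * (F u U + F v V) + ennreal (2 * c3 * c2 / c1 + c4) * emeasure lborel V"
      have "(\<Sum>i<N. h i) = ennreal (c3 / c1) * ((\<Sum>i<N. F u (S i)) + (\<Sum>i<N. F v (S i))) + ennreal (2 * c3 * c2 / c1 + c4) * (\<Sum>i<N. emeasure lborel (S i))"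
        unfolding h_def by (simp only: sum.distrib sum_distrib_left[symmetric])
      also have "\<dots> \<le> T"
      proof -
        have "(\<Sum>i<N. F u (S i)) \<le> F u U" by (rule borel_measure_space_sum_disjoint[OF mu _ _ Sdisj]) (use So SU U in auto)
        moreover have "(\<Sum>i<N. F v (S i)) \<le> F v V" by (rule borel_measure_space_sum_disjoint[OF mv _ _ Sdisj]) (use So SU V in auto)
        moreover have "(\<Sum>i<N. emeasure lborel (S i)) \<le> emeasure lborel V"
        proof -
          have "(\<Sum>i<N. emeasure lborel (S i)) = emeasure lborel (\<Union>i<N. S i)"
            by (rule sum_emeasure) (use So Sdisj in auto)
          also have "\<dots> \<le> emeasure lborel V" using SU(2) V(1) by (intro emeasure_mono) auto
          finally show ?thesis .
        qed
        ultimately show ?thesis unfolding T_def by (intro add_mono mult_left_mono) simp_all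
      qed
      finally have hT: "(\<Sum>i<N. h i) \<le> T" .
      \<comment> \<open>Some strip carries at most the average.\<close>
      have "Min (h ` {..<N}) \<in> h ` {..<N}" using N by (intro Min_in) auto
      then obtain i where i: "i < N" "h i = Min (h ` {..<N})" by (metis imageE lessThan_iff)
      have "h i \<le> h j" if "j < N" for j using i(2) that by simp
      then have "(\<Sum>j<N. h i) \<le> (\<Sum>j<N. h j)" by (intro sum_mono) simp
      then have "of_nat N * h i \<le> T" using hT by simp
      then have "ennreal (1 / real N) * (of_nat N * h i) \<le> ennreal (1 / real N) * T" by (rule mult_left_mono) simp
      moreover have "ennreal (1 / real N) * (of_nat N * h i) = h i"
        using N0 by (simp add: mult.assoc[symmetric] ennreal_of_nat_eq_real_of_nat ennreal_mult[symmetric])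
      ultimately have hi: "h i \<le> ennreal (1 / real N) * T" by simp
      have Im: "(LINT x:S i|lebesgue. norm (u x - v x)) \<le> (LINT x:U \<inter> V|lebesgue. norm (u x - v x))"
        by (rule L1loc_dist_mono[OF u v]) (use SU So U V sets_borel_lebesgue in \<open>auto simp: bounded_Int\<close>)
      have "F (w i) (S i) \<le> h i + ennreal (c3 * (real CARD('d) * real CARD('d) * L * (LINT x:S i|lebesgue. norm (u x - v x))))"
        unfolding w_def h_def
        by (rule strip_estimate[OF F c u v So Sb FuS FvS \<eta>t \<eta>0 \<eta>1 _ wL[unfolded w_def]]) (use L(2) i(1) in blast)
      also have "\<dots> \<le> ennreal (1 / real N) * T + ennreal (D * (LINT x:U \<inter> V|lebesgue. norm (u x - v x)))"
        using mult_left_mono[OF Im D0] by (intro add_mono hi ennreal_leI) (simp add: D_def mult.assoc)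
      finally have FS: "F (w i) (S i) \<le> ennreal (1 / real N) * T + ennreal (D * (LINT x:U \<inter> V|lebesgue. norm (u x - v x)))" .
      have "F (w i) (A i) = F u (A i)"
      proof (rule functional_class_local[OF F wL Ao Ab u])
        fix x assume "x \<in> A i"
        then have "real i + 2/3 < real N * \<Phi> x" using N0 by (simp add: A_def divide_less_eq mult.commute)
        then have "\<eta> i x = 1" unfolding \<eta>_def by (intro smooth_step_1 third(1))
        then show "w i x = u x" by (simp add: w_def)
      qed
      also have "\<dots> \<le> F u U" using Ao U by (intro borel_measure_space_mono[OF mu AU]) auto
      finally have FA: "F (w i) (A i) \<le> F u U" .
      have "F (w i) (B i) = F v (B i)"
      proof (rule functional_class_local[OF F wL Bo Bb v])
        fix x assume "x \<in> B i"
        then have "real N * \<Phi> x < real i + 1/3" using N0 by (simp add: B_def less_divide_eq mult.commute)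
        then have "\<eta> i x = 0" unfolding \<eta>_def by (intro smooth_step_0 third(2))
        then show "w i x = v x" by (simp add: w_def)
      qed
      also have "\<dots> \<le> F v V" using Bo V by (intro borel_measure_space_mono[OF mv BV]) auto
      finally have FB: "F (w i) (B i) \<le> F v V" .
      have cover: "U' \<union> V \<subseteq> A i \<union> (B i \<union> S i)"
      proof
        fix x assume x: "x \<in> U' \<union> V"
        show "x \<in> A i \<union> (B i \<union> S i)"
        proof (cases "x \<in> U'")
          case True
          then have "\<Phi> x = 1" using \<Phi>(4) closure_subset by blast
          moreover have "(real i + 2/3) / real N < 1" using i(1) N0 by (simp add: divide_less_eq)
          ultimately show ?thesis using x by (simp add: A_def)
        next
          case False
          then have xV: "x \<in> V" using x by simp
          define t where "t = real N * \<Phi> x"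
          have t: "\<Phi> x = t / real N" using N0 by (simp add: t_def)
          consider "real i + 2/3 < t" | "t < real i + 1/3" | "real i < t" "t < real i + 1" by linarith
          then show ?thesis
            by cases (use xV N0 in \<open>auto simp: A_def B_def S_def t divide_strict_right_mono\<close>)
        qed
      qed
      have mw: "measure_space UNIV (sets borel) (F (w i))" by (rule functional_class_measure[OF F wL])
      have "F (w i) (U' \<union> V) \<le> F (w i) (A i \<union> (B i \<union> S i))"
        using oU'V Ao Bo So by (intro borel_measure_space_mono[OF mw cover]) auto
      also have "\<dots> \<le> F (w i) (A i) + (F (w i) (B i) + F (w i) (S i))"
        using Ao Bo So by (intro borel_measure_space_subadd3[OF mw]) auto
      also have "\<dots> \<le> F u U + (F v V + (ennreal (1 / real N) * T + ennreal (D * (LINT x:U \<inter> V|lebesgue. norm (u x - v x)))))"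
        by (intro add_mono FA FB FS)
      finally have "F (w i) (U' \<union> V) \<le> F u U + F v V + ennreal (1 / real N) * T + ennreal (D * (LINT x:U \<inter> V|lebesgue. norm (u x - v x)))"
        by (simp add: add.assoc)
      then show ?thesis unfolding T_def using wL wn by (intro bexI[of _ "w i"] conjI allI) auto
    qed
  qed
qed

section \<open>Gamma-limits of a sequence of functionals\<close>

text \<open>A sequence in the class for which convergence on the countable family \<open>R\<close> has been arranged. The set functions of the
De Giorgi--Letta construction will be \<open>lower u\<close> and \<open>upper u\<close>.\<close>

locale functional_sequence =
  fixes c1 c2 c3 c4 c5 :: real and \<sigma> :: "real \<Rightarrow> real" and F :: "nat \<Rightarrow> ('d::finite) functional"
    and R :: "(real^'d) set set"
  assumes c: "0 < c1" "0 \<le> c2" "0 \<le> c3" "0 \<le> c4"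
    and F: "\<And>n. F n \<in> functional_class c1 c2 c3 c4 c5 \<sigma>"
    and R: "countable R" "\<And>U. U \<in> R \<Longrightarrow> open U" "\<And>U. U \<in> R \<Longrightarrow> bounded U"
       "\<And>K U. compact K \<Longrightarrow> open U \<Longrightarrow> K \<subseteq> U \<Longrightarrow> \<exists>V\<in>R. K \<subseteq> V \<and> closure V \<subseteq> U"
    and R_conv: "\<And>U u. U \<in> R \<Longrightarrow> u \<in> L1loc \<Longrightarrow>
       Gamma_limsup L1loc_topology (\<lambda>n y. F n y U) u \<le> Gamma_liminf L1loc_topology (\<lambda>n y. F n y U) u"
begin

definition lower :: "(real^'d \<Rightarrow> real^'d) \<Rightarrow> (real^'d) set \<Rightarrow> ennreal" where
  "lower u U = Gamma_liminf L1loc_topology (\<lambda>n y. F n y U) u"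

definition upper :: "(real^'d \<Rightarrow> real^'d) \<Rightarrow> (real^'d) set \<Rightarrow> ennreal" where
  "upper u U = Gamma_limsup L1loc_topology (\<lambda>n y. F n y U) u"

text \<open>The quantities whose limits define the \<open>\<Gamma>\<close>-limits; a larger \<open>k\<close> means a smaller neighbourhood of \<open>u\<close>.\<close>

definition near :: "(real^'d \<Rightarrow> real^'d) \<Rightarrow> (real^'d) set \<Rightarrow> nat \<Rightarrow> nat \<Rightarrow> ennreal" where
  "near u U k n = (INF y\<in>L1loc_ball u k. F n y U)"

lemma lower_eq: "u \<in> L1loc \<Longrightarrow> lower u U = (SUP k. liminf (near u U k))"
  unfolding lower_def near_def[abs_def] by (rule Gamma_liminf_L1loc)

lemma upper_eq: "u \<in> L1loc \<Longrightarrow> upper u U = (SUP k. limsup (near u U k))"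
  unfolding upper_def near_def[abs_def] by (rule Gamma_limsup_L1loc)

lemma liminf_near_le_lower: "u \<in> L1loc \<Longrightarrow> liminf (near u U k) \<le> lower u U"
  unfolding lower_eq by (rule SUP_upper) simp

lemma limsup_near_le_upper: "u \<in> L1loc \<Longrightarrow> limsup (near u U k) \<le> upper u U"
  unfolding upper_eq by (rule SUP_upper) simp

lemma ball_measure_space: "y \<in> L1loc_ball u k \<Longrightarrow> measure_space UNIV (sets borel) (F n y)"
  using functional_class_measure[OF F] by (simp add: L1loc_ball_def)

lemma near_mono:
  assumes "open U" "open V" "U \<subseteq> V" shows "near u U k n \<le> near u V k n"
  unfolding near_def
proof (rule INF_mono)
  fix y assume y: "y \<in> L1loc_ball u k"
  show "\<exists>x\<in>L1loc_ball u k. F n x U \<le> F n y V"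
    by (rule bexI[of _ y]) (use borel_measure_space_mono[OF ball_measure_space[OF y] assms(3)] y assms in simp_all)
qed

lemma lower_mono: "u \<in> L1loc \<Longrightarrow> open U \<Longrightarrow> open V \<Longrightarrow> U \<subseteq> V \<Longrightarrow> lower u U \<le> lower u V"
  unfolding lower_eq by (intro SUP_mono' Liminf_mono always_eventually allI near_mono)

lemma upper_mono: "u \<in> L1loc \<Longrightarrow> open U \<Longrightarrow> open V \<Longrightarrow> U \<subseteq> V \<Longrightarrow> upper u U \<le> upper u V"
  unfolding upper_eq by (intro SUP_mono' Limsup_mono always_eventually allI near_mono)

lemma lower_le_upper: "u \<in> L1loc \<Longrightarrow> lower u U \<le> upper u U"
  unfolding lower_eq upper_eq by (intro SUP_mono' Liminf_le_Limsup) simp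

lemma near_antimono_index: "u \<in> L1loc \<Longrightarrow> j \<le> k \<Longrightarrow> near u U j n \<le> near u U k n"
  unfolding near_def by (rule INF_superset_mono[OF L1loc_ball_antimono]) auto

text \<open>Unlike for upper limits, one competitor on \<open>U \<union> V\<close> may be used for both sets.\<close>

lemma lower_superadd:
  assumes u: "u \<in> L1loc" and UV: "open U" "open V" "U \<inter> V = {}"
  shows "lower u U + lower u V \<le> lower u (U \<union> V)"
  unfolding lower_eq[OF u, of U] lower_eq[OF u, of V] lower_eq[OF u, of "U \<union> V"]
proof (rule SUP_add_SUP_le_ennreal)
  fix i j :: nat
  have "near u U i n + near u V j n \<le> near u (U \<union> V) (max i j) n" for n
  proof -
    have "near u U i n + near u V j n \<le> near u U (max i j) n + near u V (max i j) n"
      by (intro add_mono near_antimono_index[OF u]) simp_all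
    also have "\<dots> \<le> near u (U \<union> V) (max i j) n"
      unfolding near_def[of u "U \<union> V"]
    proof (rule INF_greatest)
      fix y assume y: "y \<in> L1loc_ball u (max i j)"
      obtain M where M: "sets M = sets (borel :: (real^'d) measure)" "\<forall>B\<in>sets borel. emeasure M B = F n y B"
        by (rule measure_space_obtain[OF ball_measure_space[OF y]])
      have "near u U (max i j) n + near u V (max i j) n \<le> F n y U + F n y V"
        unfolding near_def using y by (intro add_mono INF_lower)
      also have "\<dots> = emeasure M U + emeasure M V" using M(2) UV by simp
      also have "\<dots> = emeasure M (U \<union> V)" by (rule plus_emeasure) (use M(1) UV in auto)
      also have "\<dots> = F n y (U \<union> V)" using M(2) UV by auto
      finally show "near u U (max i j) n + near u V (max i j) n \<le> F n y (U \<union> V)" .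
    qed
    finally show ?thesis .
  qed
  then have "liminf (\<lambda>n. near u U i n + near u V j n) \<le> liminf (near u (U \<union> V) (max i j))"
    by (intro Liminf_mono always_eventually allI)
  then show "liminf (near u U i) + liminf (near u V j) \<le> (SUP k. liminf (near u (U \<union> V) k))"
    using liminf_superadd_ennreal[of "near u U i" "near u V j"] SUP_upper[of "max i j" UNIV "\<lambda>k. liminf (near u (U \<union> V) k)"]
    by (meson order_trans UNIV_I)
qed simp_all

text \<open>Almost optimal competitors for \<open>U\<close> and for \<open>V\<close> differ, and the fundamental estimate glues them. If both are in
\<open>L1loc_ball u m\<close>, then the glued function is within \<open>2 / (m + 1)\<close> of \<open>u\<close> in mean, hence in \<open>L1loc_ball u k\<close> as
soon as \<open>m \<ge> 2 k + 1\<close>.\<close>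

lemma upper_weak_subadd:
  assumes u: "u \<in> L1loc" and U': "open U'" "closure U' \<subseteq> U" and U: "open U" "bounded U" and V: "open V" "bounded V"
  shows "upper u (U' \<union> V) \<le> upper u U + upper u V"
proof (cases "upper u U + upper u V = \<infinity>")
  case True show ?thesis unfolding True by simp
next
  case fin: False
  define s where "s = upper u U + upper u V"
  define A where "A = ennreal (c3 / c1)"
  define B where "B = ennreal (2 * c3 * c2 / c1 + c4) * emeasure lborel V"
  have vol: "emeasure lborel V < \<infinity>" by (rule bounded_open_finite_measure[OF V])
  define T where "T = A * s + B"
  have Tfin: "T < \<infinity>"
    unfolding T_def A_def B_def s_def using fin vol by (simp add: ennreal_mult_eq_top_iff less_top[symmetric])
  have "\<forall>N. \<exists>C. 0 < N \<longrightarrow> 0 \<le> C \<and> (\<forall>F\<in>functional_class c1 c2 c3 c4 c5 \<sigma>. \<forall>u\<in>L1loc. \<forall>v\<in>L1loc. \<exists>w\<in>L1loc.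
     (\<forall>x z. norm (w x - z) \<le> norm (u x - z) + norm (v x - z)) \<and>
     F w (U' \<union> V) \<le> F u U + F v V + ennreal (1 / real N) * (ennreal (c3 / c1) * (F u U + F v V) + ennreal (2 * c3 * c2 / c1 + c4) * emeasure lborel V)
       + ennreal (C * (LINT x:U \<inter> V|lebesgue. norm (u x - v x))))"
    using fundamental_estimate[OF c U V U', of _ c5 \<sigma>] by meson
  from choice[OF this] obtain g where G: "\<forall>N>0. 0 \<le> g N \<and> (\<forall>F\<in>functional_class c1 c2 c3 c4 c5 \<sigma>. \<forall>u\<in>L1loc. \<forall>v\<in>L1loc. \<exists>w\<in>L1loc.
     (\<forall>x z. norm (w x - z) \<le> norm (u x - z) + norm (v x - z)) \<and>
     F w (U' \<union> V) \<le> F u U + F v V + ennreal (1 / real N) * (ennreal (c3 / c1) * (F u U + F v V) + ennreal (2 * c3 * c2 / c1 + c4) * emeasure lborel V)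
       + ennreal (g N * (LINT x:U \<inter> V|lebesgue. norm (u x - v x))))" ..
  note g = G[THEN spec, THEN mp, THEN conjunct1] G[THEN spec, THEN mp, THEN conjunct2, THEN bspec, THEN bspec, THEN bspec]
  have "bounded (U \<inter> V)" using U(2) by (simp add: bounded_Int)
  then obtain r where r: "\<forall>x\<in>U \<inter> V. norm x \<le> r" unfolding bounded_iff by blast
  have UVm: "U \<inter> V \<in> sets lebesgue" using U V sets_borel_lebesgue by (meson borel_open open_Int subsetD)
  show ?thesis unfolding upper_eq[OF u, of "U' \<union> V"]
  proof (rule SUP_least)
    fix k
    obtain m1 :: nat where m1: "r < real m1" using reals_Archimedean2 by blast
    define m0 where "m0 = max m1 (2 * k + 1)"
    show "limsup (near u (U' \<union> V) k) \<le> upper u U + upper u V"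
    proof (rule ennreal_le_of_small_perturbation[OF g(1) Tfin, where l = m0])
      fix N m :: nat assume N: "0 < N" and m: "m0 \<le> m"
      define D where "D = ennreal (g N * (2 / (real m + 1)))"
      have UVm0: "U \<inter> V \<subseteq> cball 0 (real m)"
      proof
        fix x assume "x \<in> U \<inter> V"
        then have "norm x \<le> r" using r by blast
        then show "x \<in> cball 0 (real m)" using m1 m by (simp add: m0_def)
      qed
      have km: "cball 0 (real k) \<subseteq> cball (0::real^'d) (real m)" using m by (auto simp: m0_def)
      have m2: "2 / (real m + 1) \<le> 1 / (real k + 1)"
      proof -
        have "2 * (real k + 1) \<le> real m + 1" using m by (simp add: m0_def)
        then show ?thesis by (simp add: field_simps)
      qed
      have main: "near u (U' \<union> V) k n \<le> (F n y U + F n z V) + (ennreal (1 / real N) * (A * (F n y U + F n z V) + B) + D)"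
        if y: "y \<in> L1loc_ball u m" and z: "z \<in> L1loc_ball u m" for n y z
      proof -
        have yL: "y \<in> L1loc" "(LINT x:cball 0 (real m)|lebesgue. norm (y x - u x)) < 1 / (real m + 1)"
          and zL: "z \<in> L1loc" "(LINT x:cball 0 (real m)|lebesgue. norm (z x - u x)) < 1 / (real m + 1)"
          using y z by (simp_all add: L1loc_ball_def)
        obtain w where w: "w \<in> L1loc" "\<forall>x a. norm (w x - a) \<le> norm (y x - a) + norm (z x - a)"
          "F n w (U' \<union> V) \<le> F n y U + F n z V + ennreal (1 / real N) * (ennreal (c3 / c1) * (F n y U + F n z V) + ennreal (2 * c3 * c2 / c1 + c4) * emeasure lborel V)
       + ennreal (g N * (LINT x:U \<inter> V|lebesgue. norm (y x - z x)))"
          using g(2)[OF N F yL(1) zL(1)] by blast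
        have "(LINT x:cball 0 (real k)|lebesgue. norm (w x - u x)) \<le> (LINT x:cball 0 (real m)|lebesgue. norm (w x - u x))"
          by (rule L1loc_dist_mono[OF w(1) u km]) simp_all
        also have "\<dots> \<le> (LINT x:cball 0 (real m)|lebesgue. norm (y x - u x)) + (LINT x:cball 0 (real m)|lebesgue. norm (z x - u x))"
        proof -
          note iy = L1loc_norm_diff_integrable[OF yL(1) u, of "cball 0 (real m)", OF bounded_cball cball_lebesgue]
          note iz = L1loc_norm_diff_integrable[OF zL(1) u, of "cball 0 (real m)", OF bounded_cball cball_lebesgue]
          note iw = L1loc_norm_diff_integrable[OF w(1) u, of "cball 0 (real m)", OF bounded_cball cball_lebesgue]
          have "(LINT x:cball 0 (real m)|lebesgue. norm (w x - u x)) \<le> (LINT x:cball 0 (real m)|lebesgue. norm (y x - u x) + norm (z x - u x))"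
            by (rule set_integral_mono[OF iw set_integral_add(1)[OF iy iz]]) (use w(2) in blast)
          also have "\<dots> = (LINT x:cball 0 (real m)|lebesgue. norm (y x - u x)) + (LINT x:cball 0 (real m)|lebesgue. norm (z x - u x))"
            by (rule set_integral_add(2)[OF iy iz])
          finally show ?thesis .
        qed
        also have "\<dots> < 1 / (real m + 1) + 1 / (real m + 1)" using yL(2) zL(2) by linarith
        also have "\<dots> = 2 / (real m + 1)" by simp
        also have "\<dots> \<le> 1 / (real k + 1)" by (rule m2)
        finally have "w \<in> L1loc_ball u k" using w(1) by (simp add: L1loc_ball_def)
        then have "near u (U' \<union> V) k n \<le> F n w (U' \<union> V)" unfolding near_def by (rule INF_lower)
        also note w(3)
        also have "(LINT x:U \<inter> V|lebesgue. norm (y x - z x)) \<le> 2 / (real m + 1)"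
        proof -
          have "(LINT x:U \<inter> V|lebesgue. norm (y x - z x)) \<le> (LINT x:cball 0 (real m)|lebesgue. norm (y x - z x))"
            by (rule L1loc_dist_mono[OF yL(1) zL(1) UVm0 _ UVm]) simp_all
          also have "\<dots> \<le> (LINT x:cball 0 (real m)|lebesgue. norm (y x - u x)) + (LINT x:cball 0 (real m)|lebesgue. norm (u x - z x))"
            by (rule L1loc_dist_triangle[OF yL(1) u zL(1)]) simp_all
          also have "(LINT x:cball 0 (real m)|lebesgue. norm (u x - z x)) = (LINT x:cball 0 (real m)|lebesgue. norm (z x - u x))"
            by (rule L1loc_dist_commute)
          finally have "(LINT x:U \<inter> V|lebesgue. norm (y x - z x)) \<le> 1 / (real m + 1) + 1 / (real m + 1)" using yL(2) zL(2) by linarith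
          then show ?thesis by simp
        qed
        then have "ennreal (g N * (LINT x:U \<inter> V|lebesgue. norm (y x - z x))) \<le> D"
          unfolding D_def using g(1)[OF N] by (intro ennreal_leI mult_left_mono)
        finally show ?thesis by (simp add: A_def B_def add.assoc add_left_mono)
      qed
      \<comment> \<open>The bound is affine in the energies of \<open>y\<close> and \<open>z\<close>, which may now be minimised separately.\<close>
      let ?q = "1 + ennreal (1 / real N) * A"
      let ?E = "ennreal (1 / real N) * B + D"
      have qfin: "?q < \<infinity>" by (simp add: A_def ennreal_mult_less_top)
      have ne: "L1loc_ball u m \<noteq> {}" using centre_in_L1loc_ball[OF u] by blast
      have nn: "near u (U' \<union> V) k n \<le> ?q * (near u U m n + near u V m n) + ?E" for n
      proof -
        have e: "a + b + (ennreal (1 / real N) * (A * (a + b) + B) + D) = (?q * a + ?E) + ?q * b" for a b :: ennreal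
          by (simp add: algebra_simps)
        have "near u (U' \<union> V) k n \<le> (INF y\<in>L1loc_ball u m. ?q * F n y U + ?E) + (INF z\<in>L1loc_ball u m. ?q * F n z V)"
          by (rule le_INF_add_INF_ennreal) (use main e in simp)
        also have "(INF y\<in>L1loc_ball u m. ?q * F n y U + ?E) = ?q * near u U m n + ?E"
          unfolding near_def by (rule affine_ennreal_INF[OF qfin ne])
        also have "(INF z\<in>L1loc_ball u m. ?q * F n z V) = ?q * near u V m n"
          unfolding near_def using affine_ennreal_INF[OF qfin ne, of "\<lambda>z. F n z V" 0] by simp
        finally show ?thesis by (simp add: algebra_simps)
      qed
      have "limsup (near u (U' \<union> V) k) \<le> limsup (\<lambda>n. ?q * (near u U m n + near u V m n) + ?E)"
        by (intro Limsup_mono always_eventually allI nn)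
      also have "\<dots> = ?q * limsup (\<lambda>n. near u U m n + near u V m n) + ?E"
        by (rule affine_ennreal_limsup[OF qfin])
      also have "\<dots> \<le> ?q * (upper u U + upper u V) + ?E"
        by (intro add_mono mult_left_mono order_trans[OF limsup_subadd_ennreal] limsup_near_le_upper[OF u]) simp_all
      also have "\<dots> = upper u U + upper u V + ennreal (1 / real N) * T + ennreal (g N * (2 / (real m + 1)))"
        by (simp add: T_def s_def D_def algebra_simps)
      finally show "limsup (near u (U' \<union> V) k) \<le> upper u U + upper u V + ennreal (1 / real N) * T + ennreal (g N * (2 / (real m + 1)))" .
    qed
  qed
qed

end

section \<open>Lower and upper Gamma-limits agree on bounded open sets\<close>

context functional_sequence
begin

lemma near_lower_witness:
  assumes u: "u \<in> L1loc" and fin: "lower u U < M"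
  shows "\<exists>n. \<exists>y\<in>L1loc_ball u k. F n y U < M"
proof -
  have "liminf (near u U k) < M" using liminf_near_le_lower[OF u] fin by (rule order_le_less_trans)
  then have "\<exists>n. near u U k n < M"
  proof (rule contrapos_pp)
    assume "\<not> (\<exists>n. near u U k n < M)"
    then have "M \<le> liminf (near u U k)" by (intro Liminf_bounded always_eventually) (auto simp: not_less)
    then show "\<not> liminf (near u U k) < M" by simp
  qed
  then show ?thesis unfolding near_def INF_less_iff by blast
qed

text \<open>Competitors with energy below \<open>M\<close> converge to \<open>u\<close> in mean on \<open>U\<close> and have bounded variation there by the lower
growth condition.\<close>

lemma BD_of_finite_lower:
  assumes u: "u \<in> L1loc" and U: "open U" "bounded U" and M: "lower u U < ennreal M" "0 \<le> M"
  shows "u \<in> BD U" and "total_variation (sym_gradient U u) U \<le> ennreal ((M + c2 * measure lborel U) / c1)"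
proof -
  have "\<forall>k. \<exists>n. \<exists>y\<in>L1loc_ball u k. F n y U < ennreal M" using near_lower_witness[OF u M(1)] by blast
  from choice[OF this] obtain n where n: "\<forall>k. \<exists>y\<in>L1loc_ball u k. F (n k) y U < ennreal M" by blast
  then obtain y where y: "\<And>k. y k \<in> L1loc_ball u k" "\<And>k. F (n k) (y k) U < ennreal M" by metis
  have yL: "y k \<in> L1loc" for k using y(1) L1loc_ball_subset by blast
  define C where "C = (M + c2 * measure lborel U) / c1"
  have C0: "0 \<le> C" unfolding C_def using c M by (intro divide_nonneg_nonneg add_nonneg_nonneg mult_nonneg_nonneg) auto
  have fin: "F (n k) (y k) U < \<infinity>" for k using y(2)[of k] by (rule order_less_trans) simp
  note bd = BD_of_finite_value[OF F yL c(1,2) U fin]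
  note vol = emeasure_bounded_open[OF U]
  have tv: "total_variation (sym_gradient U (y k)) U \<le> ennreal C" for k
  proof -
    have "total_variation (sym_gradient U (y k)) U \<le> ennreal (1 / c1) * (F (n k) (y k) U + ennreal c2 * emeasure lborel U)" by (rule bd(2))
    also have "\<dots> \<le> ennreal (1 / c1) * (ennreal M + ennreal c2 * ennreal (measure lborel U))"
      unfolding vol using y(2)[of k] by (intro mult_left_mono add_mono) simp_all
    also have "\<dots> = ennreal C"
      unfolding C_def using c M by (simp add: ennreal_mult[symmetric] ennreal_plus[symmetric] del: ennreal_plus)
    finally show ?thesis .
  qed
  obtain r where r: "\<forall>x\<in>U. norm x \<le> r" using U(2) unfolding bounded_iff by blast
  obtain k0 :: nat where k0: "r < real k0" using reals_Archimedean2 by blast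
  have Um: "U \<in> sets lebesgue" using U(1) sets_borel_lebesgue by auto
  have lim: "(\<lambda>k. LINT x:U|lebesgue. norm (y k x - u x)) \<longlonglongrightarrow> 0"
  proof (rule tendsto_sandwich[where f = "\<lambda>_. 0" and h = "\<lambda>k. 1 / (real k + 1)"])
    show "\<forall>\<^sub>F k in sequentially. 0 \<le> (LINT x:U|lebesgue. norm (y k x - u x))"
      unfolding set_lebesgue_integral_def by (intro always_eventually allI Bochner_Integration.integral_nonneg) simp
    show "\<forall>\<^sub>F k in sequentially. (LINT x:U|lebesgue. norm (y k x - u x)) \<le> 1 / (real k + 1)"
    proof (rule eventually_sequentiallyI)
      fix k assume k: "k0 \<le> k"
      have sub: "U \<subseteq> cball 0 (real k)"
      proof
        fix x assume "x \<in> U"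
        then have "norm x \<le> r" using r by blast
        then show "x \<in> cball 0 (real k)" using k0 k by simp
      qed
      have "(LINT x:U|lebesgue. norm (y k x - u x)) \<le> (LINT x:cball 0 (real k)|lebesgue. norm (y k x - u x))"
        by (rule L1loc_dist_mono[OF yL u sub bounded_cball Um cball_lebesgue])
      also have "\<dots> < 1 / (real k + 1)" using y(1)[of k] by (simp add: L1loc_ball_def)
      finally show "(LINT x:U|lebesgue. norm (y k x - u x)) \<le> 1 / (real k + 1)" by simp
    qed
    show "(\<lambda>k. 1 / (real k + 1)) \<longlonglongrightarrow> 0"
      using LIMSEQ_inverse_real_of_nat by (simp add: inverse_eq_divide add.commute)
  qed simp
  have uU: "u absolutely_integrable_on U" by (rule L1loc_integrable_bounded[OF u U(2) Um])
  have "\<exists>\<kappa>. is_sym_gradient U u \<kappa> \<and> total_variation \<kappa> U \<le> ennreal C"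
    by (rule BD_closure[where V = "\<lambda>_. U" and v = y and \<mu> = "\<lambda>k. sym_gradient U (y k)", OF U(1) uU U(1) order_refl _
      BD_integrable[OF bd(1)] BD_sym_gradient[OF bd(1)] tv C0 lim]) simp
  then obtain \<kappa> where \<kappa>: "is_sym_gradient U u \<kappa>" "total_variation \<kappa> U \<le> ennreal C" by blast
  show "u \<in> BD U" using uU \<kappa>(1) by (auto simp: BD_def)
  show "total_variation (sym_gradient U u) U \<le> ennreal ((M + c2 * measure lborel U) / c1)"
    using \<kappa>(2) total_variation_sym_gradient[OF \<kappa>(1) uU U(1)] by (simp add: C_def)
qed

lemma lower_coercive:
  assumes u: "u \<in> L1loc" and U: "open U" "bounded U"
  shows "u \<notin> BD U \<Longrightarrow> lower u U = \<infinity>"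
    and "ennreal c1 * total_variation (sym_gradient U u) U \<le> lower u U + ennreal c2 * emeasure lborel U"
proof -
  have b: "u \<in> BD U \<and> ennreal c1 * total_variation (sym_gradient U u) U \<le> lower u U + ennreal c2 * emeasure lborel U" if lfin: "lower u U \<noteq> \<infinity>"
  proof -
    obtain l where l: "lower u U = ennreal l" "0 \<le> l" using lfin by (cases "lower u U") auto
    have less: "lower u U < ennreal (l + e)" if "e > 0" for e using l that by (simp add: ennreal_less_iff)
    have "ennreal c1 * total_variation (sym_gradient U u) U \<le> lower u U + ennreal c2 * emeasure lborel U"
    proof (rule ennreal_le_add_epsilon)
      fix e :: real assume e: "e > 0"
      then have le: "0 \<le> l + e" using l by simp
      have m: "0 \<le> l + e + c2 * measure lborel U" using le c by simp
      have "ennreal c1 * total_variation (sym_gradient U u) U \<le> ennreal c1 * ennreal ((l + e + c2 * measure lborel U) / c1)"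
        by (intro mult_left_mono BD_of_finite_lower(2)[OF u U less[OF e] le]) simp
      also have "\<dots> = ennreal (l + e + c2 * measure lborel U)" using c m by (simp add: ennreal_mult[symmetric])
      also have "\<dots> = lower u U + ennreal c2 * emeasure lborel U + ennreal e"
        unfolding l(1) emeasure_bounded_open[OF U] using c l e
        by (simp add: ennreal_mult[symmetric] ennreal_plus[symmetric] add_ac del: ennreal_plus)
      finally show "ennreal c1 * total_variation (sym_gradient U u) U \<le> lower u U + ennreal c2 * emeasure lborel U + ennreal e" .
    qed
    moreover have "u \<in> BD U" by (rule BD_of_finite_lower(1)[OF u U less[of 1]]) (use l in simp_all)
    ultimately show ?thesis by blast
  qed
  show "u \<notin> BD U \<Longrightarrow> lower u U = \<infinity>" using b by blast
  show "ennreal c1 * total_variation (sym_gradient U u) U \<le> lower u U + ennreal c2 * emeasure lborel U"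
    using b by (cases "lower u U = \<infinity>") auto
qed

lemma upper_le_constant:
  assumes u: "u \<in> L1loc" and le: "\<And>n. F n u U \<le> C" shows "upper u U \<le> C"
  unfolding upper_eq[OF u]
proof (rule SUP_least)
  fix k
  have "near u U k n \<le> C" for n
    unfolding near_def using INF_lower[OF centre_in_L1loc_ball[OF u], of "\<lambda>y. F n y U" k] le[of n] by (rule order_trans)
  then show "limsup (near u U k) \<le> C" by (intro Limsup_bounded always_eventually allI)
qed

text \<open>The constant sequence \<open>u\<close> is a competitor.\<close>

lemma upper_growth:
  assumes "u \<in> L1loc" "open U" "bounded U" "u \<in> BD U"
  shows "upper u U \<le> ennreal c3 * total_variation (sym_gradient U u) U + ennreal c4 * emeasure lborel U"
  by (rule upper_le_constant[OF assms(1) functional_class_upper_bound[OF F assms]])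

lemma upper_empty: assumes u: "u \<in> L1loc" shows "upper u {} = 0"
proof -
  have "F n u {} = 0" for n
  proof -
    obtain M where M: "sets M = sets borel" "\<forall>B\<in>sets borel. emeasure M B = F n u B"
      by (rule measure_space_obtain[OF functional_class_measure[OF F u]])
    then show ?thesis using emeasure_empty[of M] by (metis sets.empty_sets)
  qed
  then have "upper u {} \<le> 0" by (intro upper_le_constant[OF u]) simp
  then show ?thesis by simp
qed

lemma lower_upper_letta: assumes u: "u \<in> L1loc" shows "letta_increasing (lower u) (upper u) R"
proof
  show "lower u U \<le> upper u U" for U by (rule lower_le_upper[OF u])
  show "lower u U \<le> lower u V" if "open U" "open V" "U \<subseteq> V" for U V by (rule lower_mono[OF u that])
  show "upper u U \<le> upper u V" if "open U" "open V" "U \<subseteq> V" for U V by (rule upper_mono[OF u that])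
  show "upper u {} = 0" by (rule upper_empty[OF u])
  show "lower u U + lower u V \<le> lower u (U \<union> V)" if "open U" "open V" "U \<inter> V = {}" for U V
    by (rule lower_superadd[OF u that])
  show "upper u (U' \<union> V) \<le> upper u U + upper u V"
    if "open U'" "open U" "open V" "bounded U" "bounded V" "closure U' \<subseteq> U" for U' U V
    by (rule upper_weak_subadd[OF u that(1,6,2,4,3,5)])
  show "upper u U \<le> lower u U" if "U \<in> R" for U unfolding upper_def lower_def by (rule R_conv[OF that u])
  show "\<exists>V\<in>R. open V \<and> bounded V \<and> K \<subseteq> V \<and> closure V \<subseteq> U" if "compact K" "open U" "K \<subseteq> U" for K U
    using R(4)[OF that] R(2,3) by blast
qed

abbreviation inner :: "(real^'d \<Rightarrow> real^'d) \<Rightarrow> (real^'d) set \<Rightarrow> ennreal" where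
  "inner u \<equiv> letta_increasing.inner (lower u)"

abbreviation limit :: "'d functional" where
  "limit u \<equiv> letta_increasing.outer (lower u)"

text \<open>The substantial case is \<open>inner u U < \<infinity>\<close>. Then \<open>u\<close> is in \<open>BD (V k)\<close> for an exhaustion of \<open>U\<close> by relatively compact sets \<open>V k\<close>,
with a uniform bound on the variation, so \<open>u\<close> is in \<open>BD U\<close>. Now the upper growth bound is a finite measure on \<open>U\<close>, so
\<open>upper u\<close> is small on \<open>U - closure (V k)\<close> for large \<open>k\<close>, and weak subadditivity adds this boundary layer to
the relatively compact part.\<close>

lemma upper_le_inner:
  assumes u: "u \<in> L1loc" and U: "open U" "bounded U"
  shows "upper u U \<le> inner u U"
proof (cases "inner u U = \<infinity>")
  case True then show ?thesis by simp
next
  case False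
  then obtain l where l: "inner u U = ennreal l" "0 \<le> l" by (cases "inner u U") auto
  note L = lower_upper_letta[OF u]
  \<comment> \<open>Finite unions along an enumeration of \<open>W\<close> exhaust \<open>U\<close>.\<close>
  define W where "W = {V\<in>R. closure V \<subseteq> U}"
  have Wc: "countable W" unfolding W_def using R(1) by (simp add: countable_Collect)
  have ne: "W \<noteq> {}" using R(4)[of "{}" U] U(1) by (auto simp: W_def)
  have fW: "from_nat_into W i \<in> W" for i by (rule from_nat_into[OF ne])
  define V where "V k = \<Union>(from_nat_into W ` {..k})" for k :: nat
  have Vo: "open (V k)" for k unfolding V_def using fW R(2) by (auto simp: W_def)
  have Vc: "closure (V k) \<subseteq> U" for k
  proof -
    have "closure (V k) \<subseteq> (\<Union>i\<in>{..k}. closure (from_nat_into W i))"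
    proof (rule closure_minimal)
      show "V k \<subseteq> (\<Union>i\<in>{..k}. closure (from_nat_into W i))" unfolding V_def by (intro UN_mono closure_subset order_refl)
      show "closed (\<Union>i\<in>{..k}. closure (from_nat_into W i))" by (intro closed_UN) simp_all
    qed
    also have "\<dots> \<subseteq> U" using fW by (auto simp: W_def)
    finally show ?thesis .
  qed
  have VU: "V k \<subseteq> U" for k using Vc closure_subset by (rule order_trans[rotated])
  have Vb: "bounded (V k)" for k by (rule bounded_subset[OF U(2) VU])
  have Vm: "V k \<subseteq> V (Suc k)" for k unfolding V_def by (intro Union_mono image_mono) simp
  have ev: "\<forall>\<^sub>F k in sequentially. K \<subseteq> V k" if K: "compact K" "K \<subseteq> U" for K
  proof -
    obtain V' where V': "V' \<in> R" "K \<subseteq> V'" "closure V' \<subseteq> U" using R(4)[OF K(1) U(1) K(2)] by blast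
    then have "V' \<in> W" by (simp add: W_def)
    then obtain i where i: "from_nat_into W i = V'" using from_nat_into_surj[OF Wc] by blast
    show ?thesis
    proof (rule eventually_sequentiallyI)
      fix k assume "i \<le> k"
      then have "V' \<subseteq> V k" unfolding V_def using i by auto
      then show "K \<subseteq> V k" using V'(2) by simp
    qed
  qed
  \<comment> \<open>The bound of \<open>BD_of_finite_lower\<close> for \<open>M = l + 1\<close>, made independent of \<open>k\<close>.\<close>
  define C where "C = (l + 1 + c2 * measure lborel U) / c1"
  have C0: "0 \<le> C" unfolding C_def using c l by (intro divide_nonneg_nonneg add_nonneg_nonneg mult_nonneg_nonneg) auto
  have less: "lower u (V k) < ennreal (l + 1)" for k
  proof -
    have "lower u (V k) \<le> ennreal l" using letta_increasing.al_le_inner[OF L Vo Vb Vc] by (simp add: l)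
    also have "\<dots> < ennreal (l + 1)" using l by (simp add: ennreal_less_iff)
    finally show ?thesis .
  qed
  have l1: "0 \<le> l + 1" using l by simp
  note bd = BD_of_finite_lower[OF u Vo Vb less l1]
  have tv: "total_variation (sym_gradient (V k) u) (V k) \<le> ennreal C" for k
  proof (rule order_trans[OF bd(2)])
    have "U \<in> fmeasurable lborel" by (rule fmeasurableI) (use U bounded_open_finite_measure[OF U] in auto)
    then have "measure lborel (V k) \<le> measure lborel U" using VU Vo by (intro measure_mono_fmeasurable) auto
    then show "ennreal ((l + 1 + c2 * measure lborel (V k)) / c1) \<le> ennreal C"
      unfolding C_def using c by (intro ennreal_leI divide_right_mono add_mono mult_left_mono) auto
  qed
  have Um: "U \<in> sets lebesgue" using U(1) sets_borel_lebesgue by auto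
  have uU: "u absolutely_integrable_on U" by (rule L1loc_integrable_bounded[OF u U(2) Um])
  have "\<exists>\<kappa>. is_sym_gradient U u \<kappa> \<and> total_variation \<kappa> U \<le> ennreal C"
    by (rule BD_closure[where V = V and v = "\<lambda>_. u" and \<mu> = "\<lambda>k. sym_gradient (V k) u", OF U(1) uU Vo VU ev
      BD_integrable[OF bd(1)] BD_sym_gradient[OF bd(1)] tv C0]) (simp_all add: set_lebesgue_integral_def)
  then obtain \<kappa> where \<kappa>: "is_sym_gradient U u \<kappa>" "total_variation \<kappa> U \<le> ennreal C" by blast
  have vm: "vector_measure_on U \<kappa>" using \<kappa>(1) by (simp add: is_sym_gradient_def)
  have tvfin: "total_variation \<kappa> U < \<infinity>" using \<kappa>(2) by (rule order_le_less_trans) simp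
  have Ub: "U \<in> sets borel" using U(1) by simp
  obtain \<rho> where \<rho>: "sets \<rho> = sets borel" "finite_measure \<rho>" "\<forall>B\<in>sets borel. emeasure \<rho> B = total_variation \<kappa> (B \<inter> U)"
    by (rule variation_measure[OF vm Ub tvfin])
  define A where "A k = U - closure (V k)" for k
  have Ao: "open (A k)" for k unfolding A_def using U(1) by (intro open_Diff) simp_all
  have AU: "A k \<subseteq> U" for k by (auto simp: A_def)
  have Ab: "bounded (A k)" for k by (rule bounded_subset[OF U(2) AU])
  have Adec: "decseq A" unfolding A_def by (intro decseq_SucI Diff_mono order_refl closure_mono Vm)
  have Aempty: "(\<Inter>k. A k) = {}"
  proof -
    have "x \<notin> (\<Inter>k. A k)" for x
    proof
      assume x: "x \<in> (\<Inter>k. A k)"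
      then have "x \<in> U" using AU by blast
      then have "\<forall>\<^sub>F k in sequentially. {x} \<subseteq> V k" by (intro ev) simp_all
      then obtain k where "x \<in> V k" unfolding eventually_sequentially by auto
      then have "x \<notin> A k" using closure_subset by (auto simp: A_def)
      then show False using x by blast
    qed
    then show ?thesis by blast
  qed
  have lim\<rho>: "(\<lambda>k. emeasure \<rho> (A k)) \<longlonglongrightarrow> 0"
  proof -
    have "(\<lambda>k. emeasure \<rho> (A k)) \<longlonglongrightarrow> emeasure \<rho> (\<Inter>k. A k)"
      by (rule Lim_emeasure_decseq[OF _ Adec]) (use Ao \<rho>(1) finite_measure.emeasure_finite[OF \<rho>(2)] in auto)
    then show ?thesis by (simp add: Aempty)
  qed
  have limv: "(\<lambda>k. emeasure lborel (A k)) \<longlonglongrightarrow> 0"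
  proof -
    have "(\<lambda>k. emeasure lborel (A k)) \<longlonglongrightarrow> emeasure lborel (\<Inter>k. A k)"
      by (rule Lim_emeasure_decseq[OF _ Adec]) (use Ao emeasure_bounded_open[OF Ao Ab] in auto)
    then show ?thesis by (simp add: Aempty)
  qed
  show ?thesis
  proof (rule ennreal_le_add_epsilon)
    fix e :: real assume e: "e > 0"
    define d where "d = e / (c3 + c4 + 1)"
    have d0: "0 < d" unfolding d_def using e c by (intro divide_pos_pos) auto
    have "\<forall>\<^sub>F k in sequentially. emeasure \<rho> (A k) < ennreal d \<and> emeasure lborel (A k) < ennreal d"
      using order_tendstoD(2)[OF lim\<rho>, of "ennreal d"] order_tendstoD(2)[OF limv, of "ennreal d"] d0 by (simp add: eventually_conj)
    then obtain k where k: "emeasure \<rho> (A k) < ennreal d" "emeasure lborel (A k) < ennreal d"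
      unfolding eventually_sequentially by blast
    have Kc: "compact (closure (V k))" using Vb by (simp add: compact_closure)
    obtain V2 where V2: "V2 \<in> R" "closure (V k) \<subseteq> V2" "closure V2 \<subseteq> U" using R(4)[OF Kc U(1) Vc] by blast
    obtain V1 where V1: "V1 \<in> R" "closure (V k) \<subseteq> V1" "closure V1 \<subseteq> V2" using R(4)[OF Kc R(2)[OF V2(1)] V2(2)] by blast
    have cover: "U \<subseteq> V1 \<union> A k" using V1(2) by (auto simp: A_def)
    have "upper u U \<le> upper u (V1 \<union> A k)"
      by (rule upper_mono[OF u U(1) _ cover]) (use R(2)[OF V1(1)] Ao in blast)
    also have "\<dots> \<le> upper u V2 + upper u (A k)"
      by (rule upper_weak_subadd[OF u R(2)[OF V1(1)] V1(3) R(2,3)[OF V2(1)] Ao Ab])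
    also have "upper u V2 \<le> inner u U"
      by (rule letta_increasing.be_le_inner[OF L R(2,3)[OF V2(1)] V2(3) U(1)])
    also have "upper u (A k) \<le> ennreal e"
    proof -
      have \<kappa>A: "is_sym_gradient (A k) u \<kappa>" by (rule sym_gradient_restrict[OF \<kappa>(1) uU U(1) Ao AU])
      have uA: "u absolutely_integrable_on A k"
        using Ao sets_borel_lebesgue by (intro L1loc_integrable_bounded[OF u Ab]) auto
      have "u \<in> BD (A k)" using \<kappa>A uA by (auto simp: BD_def)
      then have "upper u (A k) \<le> ennreal c3 * total_variation (sym_gradient (A k) u) (A k) + ennreal c4 * emeasure lborel (A k)"
        by (rule upper_growth[OF u Ao Ab])
      also have "total_variation (sym_gradient (A k) u) (A k) = emeasure \<rho> (A k)"
        using \<rho>(3) Ao[of k] total_variation_sym_gradient[OF \<kappa>A uA Ao] Int_absorb2[OF AU[of k]] by simp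
      also have "ennreal c3 * emeasure \<rho> (A k) + ennreal c4 * emeasure lborel (A k) \<le> ennreal c3 * ennreal d + ennreal c4 * ennreal d"
        using k by (intro add_mono mult_left_mono) simp_all
      also have "\<dots> = ennreal ((c3 + c4) * d)"
        using c d0 by (simp add: ennreal_mult[symmetric] ennreal_plus[symmetric] distrib_right del: ennreal_plus)
      also have "\<dots> \<le> ennreal e"
      proof (rule ennreal_leI)
        have "(c3 + c4) * d \<le> (c3 + c4 + 1) * d" using d0 by (intro mult_right_mono) auto
        also have "\<dots> = e" using c by (simp add: d_def)
        finally show "(c3 + c4) * d \<le> e" .
      qed
      finally show ?thesis .
    qed
    finally show "upper u U \<le> inner u U + ennreal e" by (simp add: add_mono)
  qed
qed

lemma limit_open: "u \<in> L1loc \<Longrightarrow> open U \<Longrightarrow> limit u U = inner u U"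
  by (rule letta_increasing.outer_open[OF lower_upper_letta])

lemma limit_bounded_open:
  assumes u: "u \<in> L1loc" and U: "open U" "bounded U"
  shows "lower u U = limit u U" and "upper u U = limit u U"
proof -
  have "upper u U \<le> limit u U" unfolding limit_open[OF u U(1)] by (rule upper_le_inner[OF u U])
  moreover have "limit u U \<le> lower u U" unfolding limit_open[OF u U(1)] by (rule letta_increasing.inner_le_al[OF lower_upper_letta[OF u] U])
  moreover have "lower u U \<le> upper u U" by (rule lower_le_upper[OF u])
  ultimately show "lower u U = limit u U" and "upper u U = limit u U" by simp_all
qed

end

section \<open>The limit functional belongs to the class\<close>

lemma continuous_L1loc:
  fixes f :: "real^'d::finite \<Rightarrow> real^'d"
  assumes f: "continuous_on UNIV f" shows "f \<in> L1loc"
  unfolding L1loc_def mem_Collect_eq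
proof (intro allI impI)
  fix K :: "(real^'d) set" assume K: "compact K"
  obtain a where a: "K \<subseteq> cbox (-a) a" using bounded_subset_cbox_symmetric[OF compact_imp_bounded[OF K]] by blast
  have "f absolutely_integrable_on cbox (-a) a"
    by (rule absolutely_integrable_continuous[OF continuous_on_subset[OF f subset_UNIV]])
  moreover have "K \<in> sets lebesgue" using compact_imp_closed[OF K] sets_borel_lebesgue by auto
  ultimately show "f absolutely_integrable_on K" using a by (rule set_integrable_subset)
qed

lemma affine_map_L1loc: "(\<lambda>y. A *v y + b) \<in> (L1loc :: (real^'d::finite \<Rightarrow> real^'d) set)"
  by (intro continuous_L1loc continuous_on_add continuous_on_const matrix_vector_mult_linear_continuous_on)

lemma L1loc_glue:
  fixes u v :: "real^'d::finite \<Rightarrow> real^'d"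
  assumes u: "u \<in> L1loc" and v: "v \<in> L1loc" and U: "U \<in> sets lebesgue"
  shows "(\<lambda>x. if x \<in> U then u x else v x) \<in> L1loc"
  unfolding L1loc_def mem_Collect_eq
proof (intro allI impI)
  fix K :: "(real^'d) set" assume K: "compact K"
  have Km: "K \<in> sets lebesgue" using compact_imp_closed[OF K] sets_borel_lebesgue by auto
  have 1: "integrable lebesgue (\<lambda>x. indicator (K \<inter> U) x *\<^sub>R u x)"
    using L1loc_integrable_bounded[OF u _ sets.Int[OF Km U]] compact_imp_bounded[OF K] by (simp add: set_integrable_def bounded_Int)
  have 2: "integrable lebesgue (\<lambda>x. indicator (K - U) x *\<^sub>R v x)"
    using L1loc_integrable_bounded[OF v _ sets.Diff[OF Km U]] bounded_diff[OF compact_imp_bounded[OF K]] by (simp add: set_integrable_def)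
  have "(\<lambda>x. indicator K x *\<^sub>R (if x \<in> U then u x else v x)) = (\<lambda>x. indicator (K \<inter> U) x *\<^sub>R u x + indicator (K - U) x *\<^sub>R v x)"
    by (rule ext) (simp add: indicator_def)
  then show "(\<lambda>x. if x \<in> U then u x else v x) absolutely_integrable_on K"
    unfolding set_integrable_def using Bochner_Integration.integrable_add[OF 1 2] by simp
qed

lemma jump_function_L1loc: "jump_function x \<zeta> \<nu> \<in> L1loc"
proof -
  have "{y. 0 < (y - x) \<bullet> \<nu>} \<in> sets borel" by (intro borel_open open_Collect_less continuous_intros)
  then have H: "{y. 0 < (y - x) \<bullet> \<nu>} \<in> sets lebesgue" using sets_borel_lebesgue by blast
  have "(\<lambda>y. if y \<in> {y. 0 < (y - x) \<bullet> \<nu>} then (\<lambda>_. \<zeta>) y else (\<lambda>_. 0) y) \<in> L1loc"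
    by (rule L1loc_glue[OF continuous_L1loc[OF continuous_on_const] continuous_L1loc[OF continuous_on_const] H])
  then show ?thesis by (simp add: jump_function_def[abs_def])
qed

lemma hyperplane_borel [simp]: "hyperplane x \<nu> \<in> sets borel"
  unfolding hyperplane_def by (intro borel_closed closed_Collect_eq continuous_intros)

text \<open>The right-hand side of the jump condition as a locally finite Borel measure, hence outer regular.\<close>

lemma hyperplane_measure:
  fixes x \<nu> :: "real^'d::finite"
  assumes \<nu>: "norm \<nu> = 1"
  obtains M where "sets M = sets borel" "\<forall>B\<in>sets borel. emeasure M B = ennreal s * hausdorff (CARD('d) - 1) (B \<inter> hyperplane x \<nu>)"
    "\<forall>r. emeasure M (ball 0 r) < \<infinity>"
proof -
  obtain H :: "(real^'d) measure" where H: "sets H = sets borel" "\<forall>B\<in>sets borel. emeasure H B = hausdorff (CARD('d) - 1) B"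
    by (rule measure_space_obtain[OF measure_space_hausdorff])
  define M where "M = scale_measure (ennreal s) (density H (indicator (hyperplane x \<nu>)))"
  have 1: "sets M = sets borel" by (simp add: M_def H)
  have 2: "emeasure M B = ennreal s * hausdorff (CARD('d) - 1) (B \<inter> hyperplane x \<nu>)" if B: "B \<in> sets borel" for B
  proof -
    have "emeasure (density H (indicator (hyperplane x \<nu>))) B = emeasure H (hyperplane x \<nu> \<inter> B)"
      by (rule emeasure_restricted) (use H(1) B in simp_all)
    also have "\<dots> = hausdorff (CARD('d) - 1) (B \<inter> hyperplane x \<nu>)"
      using H(2) sets.Int[OF B hyperplane_borel] by (simp add: Int_commute)
    finally show ?thesis by (simp add: M_def)
  qed
  have 3: "emeasure M (ball 0 r) < \<infinity>" for r
  proof -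
    have "hausdorff (CARD('d) - 1) (ball 0 r \<inter> hyperplane x \<nu>) \<le> hausdorff (CARD('d) - 1) (cball 0 r \<inter> hyperplane x \<nu>)"
      by (rule hausdorff_mono) auto
    also have "\<dots> < \<infinity>" by (rule hausdorff_hyperplane_finite[OF \<nu>])
    finally show ?thesis using 2[of "ball 0 r"] by (simp add: ennreal_mult_less_top)
  qed
  show thesis by (rule that[OF 1]) (use 2 3 in blast)+
qed

lemma
  assumes F: "(F :: ('d::finite) functional) \<in> functional_class c1 c2 c3 c4 c5 \<sigma>" and u: "u \<in> L1loc"
  shows functional_class_rigid: "transpose W = - W \<Longrightarrow> B \<in> sets borel \<Longrightarrow> F (\<lambda>y. u y + (W *v y + b)) B = F u B"
    and functional_class_linear: "transpose A = A \<Longrightarrow> B \<in> sets borel \<Longrightarrow>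
      F (\<lambda>y. u y + A *v y) B \<le> F u B + ennreal (c5 * norm A) * emeasure lborel B"
    and functional_class_jump: "norm \<nu> = 1 \<Longrightarrow> B \<in> sets borel \<Longrightarrow> F (\<lambda>y. u y + jump_function x \<zeta> \<nu> y) B \<le>
        F u B + ennreal (\<sigma> (norm \<zeta>)) * hausdorff (CARD('d) - 1) (B \<inter> hyperplane x \<nu>)"
proof -
  note conj = F[unfolded functional_class_def mem_Collect_eq]
  note rest = conj[THEN conjunct2, THEN conjunct2, THEN conjunct2]
  show "F (\<lambda>y. u y + (W *v y + b)) B = F u B" if "transpose W = - W" "B \<in> sets borel"
    by (rule rest[THEN conjunct1, THEN bspec, OF u, THEN spec, THEN spec, THEN mp, OF that(1), THEN bspec, OF that(2)])
  show "F (\<lambda>y. u y + A *v y) B \<le> F u B + ennreal (c5 * norm A) * emeasure lborel B" if "transpose A = A" "B \<in> sets borel"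
    by (rule rest[THEN conjunct2, THEN conjunct1, THEN bspec, OF u, THEN spec, THEN mp, OF that(1), THEN bspec, OF that(2)])
  show "F (\<lambda>y. u y + jump_function x \<zeta> \<nu> y) B \<le>
        F u B + ennreal (\<sigma> (norm \<zeta>)) * hausdorff (CARD('d) - 1) (B \<inter> hyperplane x \<nu>)" if "norm \<nu> = 1" "B \<in> sets borel"
    by (rule rest[THEN conjunct2, THEN conjunct2, THEN bspec, OF u, THEN spec, THEN spec, THEN spec, THEN mp, OF that(1), THEN bspec, OF that(2)])
qed

context functional_sequence
begin

text \<open>Outside \<open>U\<close> a competitor for \<open>v\<close> is replaced by \<open>u\<close>; this keeps its distance and does not change its energy on \<open>U\<close>.\<close>

lemma near_cong:
  assumes u: "u \<in> L1loc" and v: "v \<in> L1loc" and U: "open U" "bounded U"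
    and eq: "AE x in lebesgue. x \<in> U \<longrightarrow> u x = v x"
  shows "near u U k n \<le> near v U k n"
  unfolding near_def
proof (rule INF_mono)
  fix y assume y: "y \<in> L1loc_ball v k"
  have yL: "y \<in> L1loc" using y L1loc_ball_subset by blast
  have Um: "U \<in> sets lebesgue" using U(1) sets_borel_lebesgue by auto
  \<comment> \<open>Off \<open>U\<close> the distance to \<open>u\<close> becomes 0; on \<open>U\<close> it is the distance of \<open>y\<close> to \<open>v\<close> almost everywhere.\<close>
  define z where "z = (\<lambda>x. if x \<in> U then y x else u x)"
  have zL: "z \<in> L1loc" unfolding z_def by (rule L1loc_glue[OF yL u Um])
  have "(LINT x:cball 0 (real k)|lebesgue. norm (z x - u x)) \<le> (LINT x:cball 0 (real k)|lebesgue. norm (y x - v x))"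
    unfolding set_lebesgue_integral_def
  proof (rule integral_mono_AE)
    show "integrable lebesgue (\<lambda>x. indicator (cball 0 (real k)) x *\<^sub>R norm (z x - u x))"
      using L1loc_norm_diff_integrable[OF zL u bounded_cball cball_lebesgue] by (simp add: set_integrable_def)
    show "integrable lebesgue (\<lambda>x. indicator (cball 0 (real k)) x *\<^sub>R norm (y x - v x))"
      using L1loc_norm_diff_integrable[OF yL v bounded_cball cball_lebesgue] by (simp add: set_integrable_def)
    show "AE x in lebesgue. indicator (cball 0 (real k)) x *\<^sub>R norm (z x - u x) \<le> indicator (cball 0 (real k)) x *\<^sub>R norm (y x - v x)"
      using eq by eventually_elim (auto simp: z_def indicator_def)
  qed
  then have "z \<in> L1loc_ball u k" using y zL by (simp add: L1loc_ball_def)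
  moreover have "F n z U = F n y U"
    by (rule functional_class_local[OF F zL U yL]) (simp add: z_def)
  ultimately show "\<exists>x\<in>L1loc_ball u k. F n x U \<le> F n y U" by (intro bexI[of _ z]) simp_all
qed

lemma lower_cong:
  assumes "u \<in> L1loc" "v \<in> L1loc" "open U" "bounded U" "AE x in lebesgue. x \<in> U \<longrightarrow> u x = v x"
  shows "lower u U \<le> lower v U"
  unfolding lower_eq[OF assms(1)] lower_eq[OF assms(2)]
  by (intro SUP_mono' Liminf_mono always_eventually allI near_cong assms)

text \<open>Adding \<open>t\<close> maps the competitors for \<open>u\<close> to competitors for \<open>u + t\<close> at the same distance.\<close>

lemma upper_shift:
  assumes u: "u \<in> L1loc" and t: "t \<in> L1loc"
    and le: "\<And>n y. y \<in> L1loc \<Longrightarrow> F n (\<lambda>x. y x + t x) V \<le> F n y V + h"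
  shows "upper (\<lambda>x. u x + t x) V \<le> upper u V + h"
  unfolding upper_eq[OF L1loc_add[OF u t]]
proof (rule SUP_least)
  fix k
  have "near (\<lambda>x. u x + t x) V k n \<le> 1 * near u V k n + h" for n
  proof -
    have "near (\<lambda>x. u x + t x) V k n \<le> (INF y\<in>L1loc_ball u k. 1 * F n y V + h)"
    proof (rule INF_greatest)
      fix y assume y: "y \<in> L1loc_ball u k"
      then have yL: "y \<in> L1loc" using L1loc_ball_subset by blast
      have "(\<lambda>x. y x + t x) \<in> L1loc_ball (\<lambda>x. u x + t x) k"
        using y L1loc_add[OF yL t] by (simp add: L1loc_ball_def)
      then have "near (\<lambda>x. u x + t x) V k n \<le> F n (\<lambda>x. y x + t x) V"
        unfolding near_def by (rule INF_lower)
      also have "\<dots> \<le> F n y V + h" by (rule le[OF yL])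
      finally show "near (\<lambda>x. u x + t x) V k n \<le> 1 * F n y V + h" by simp
    qed
    also have "\<dots> = 1 * near u V k n + h"
      unfolding near_def using centre_in_L1loc_ball[OF u] by (intro affine_ennreal_INF) auto
    finally show ?thesis .
  qed
  then have "limsup (near (\<lambda>x. u x + t x) V k) \<le> limsup (\<lambda>n. 1 * near u V k n + h)"
    by (intro Limsup_mono always_eventually allI)
  also have "\<dots> = 1 * limsup (near u V k) + h" by (rule affine_ennreal_limsup) simp
  also have "\<dots> \<le> upper u V + h" using limsup_near_le_upper[OF u] by (simp add: add_right_mono)
  finally show "limsup (near (\<lambda>x. u x + t x) V k) \<le> upper u V + h" .
qed

lemma limit_outer_INF:
  assumes u: "u \<in> L1loc"
  shows "limit u B = (INF U\<in>{U. open U \<and> B \<subseteq> U}. inner u U)"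
  by (rule letta_increasing.outer_def[OF lower_upper_letta[OF u]])

lemma inner_SUP:
  assumes u: "u \<in> L1loc"
  shows "inner u U = (SUP V\<in>{V. open V \<and> bounded V \<and> closure V \<subseteq> U}. lower u V)"
  by (rule letta_increasing.inner_def[OF lower_upper_letta[OF u]])

text \<open>On open sets the inequality follows from \<open>upper_shift\<close>, where the upper limit on a relatively compact set is
bounded by \<open>inner\<close>. For a Borel set \<open>B\<close>, the open neighbourhoods nearly optimal for \<open>limit u\<close> and for \<open>M\<close> are intersected,
which is where outer regularity of \<open>M\<close> enters.\<close>

lemma limit_shift:
  assumes u: "u \<in> L1loc" and t: "t \<in> L1loc"
    and M: "sets M = sets borel" "\<And>r. emeasure M (ball 0 r) < \<infinity>"
    and le: "\<And>n y V. y \<in> L1loc \<Longrightarrow> open V \<Longrightarrow> F n (\<lambda>x. y x + t x) V \<le> F n y V + emeasure M V"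
    and B: "B \<in> sets borel"
  shows "limit (\<lambda>x. u x + t x) B \<le> limit u B + emeasure M B"
proof -
  note ut = L1loc_add[OF u t]
  have inner: "inner (\<lambda>x. u x + t x) U \<le> inner u U + emeasure M U" if U: "open U" for U
    unfolding inner_SUP[OF ut]
  proof (rule SUP_least, safe)
    fix V assume V: "open V" "bounded V" "closure V \<subseteq> U"
    have VU: "V \<subseteq> U" using V(3) closure_subset by blast
    have "lower (\<lambda>x. u x + t x) V \<le> upper (\<lambda>x. u x + t x) V" by (rule lower_le_upper[OF ut])
    also have "\<dots> \<le> upper u V + emeasure M V" by (rule upper_shift[OF u t le[OF _ V(1)]])
    also have "\<dots> \<le> inner u U + emeasure M U"
      using letta_increasing.be_le_inner[OF lower_upper_letta[OF u] V U] VU U M(1) by (intro add_mono emeasure_mono) auto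
    finally show "lower (\<lambda>x. u x + t x) V \<le> inner u U + emeasure M U" .
  qed
  show ?thesis
    unfolding limit_outer_INF[OF u, of B] locally_finite_outer_regular[OF M B]
  proof (rule le_INF_add_INF_ennreal, safe)
    fix U V assume U: "open U" "B \<subseteq> U" and V: "open V" "B \<subseteq> V"
    have UV: "open (U \<inter> V)" using U V by blast
    have "limit (\<lambda>x. u x + t x) B \<le> inner (\<lambda>x. u x + t x) (U \<inter> V)"
      unfolding limit_outer_INF[OF ut] using U V by (intro INF_lower) auto
    also have "\<dots> \<le> inner u (U \<inter> V) + emeasure M (U \<inter> V)" by (rule inner[OF UV])
    also have "\<dots> \<le> inner u U + emeasure M V"
      using V M(1) by (intro add_mono letta_increasing.inner_mono[OF lower_upper_letta[OF u]] emeasure_mono) auto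
    finally show "limit (\<lambda>x. u x + t x) B \<le> inner u U + emeasure M V" .
  qed
qed

text \<open>Applied to \<open>- W\<close> and \<open>- b\<close> as well, the inequality becomes an equality.\<close>

lemma limit_rigid_le:
  assumes u: "u \<in> L1loc" and W: "transpose W = - W" and B: "B \<in> sets borel"
  shows "limit (\<lambda>y. u y + (W *v y + b)) B \<le> limit u B"
proof -
  have "limit (\<lambda>y. u y + (W *v y + b)) B \<le> limit u B + emeasure (null_measure borel) B"
    by (rule limit_shift[OF u affine_map_L1loc _ _ _ B]) (simp_all add: functional_class_rigid[OF F _ W])
  then show ?thesis by simp
qed

lemma limit_in_class: "limit \<in> functional_class c1 c2 c3 c4 c5 \<sigma>"
  unfolding functional_class_def mem_Collect_eq
proof (intro conjI ballI allI impI)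
  fix u :: "real^'d \<Rightarrow> real^'d" assume u: "u \<in> L1loc"
  show "measure_space UNIV (sets borel) (limit u)" by (rule letta_increasing.measure_space_outer[OF lower_upper_letta[OF u]])
  show "limit u B = (INF U\<in>{U. open U \<and> B \<subseteq> U}. limit u U)" for B
    unfolding limit_outer_INF[OF u, of B] by (rule INF_cong) (simp_all add: limit_open[OF u])
  fix U :: "(real^'d) set" assume U: "open U" "bounded U"
  show "ennreal c1 * total_variation (sym_gradient U u) U \<le> limit u U + ennreal c2 * emeasure lborel U"
    using lower_coercive(2)[OF u U] by (simp add: limit_bounded_open[OF u U])
  show "limit u U \<le> ennreal c3 * total_variation (sym_gradient U u) U + ennreal c4 * emeasure lborel U" if "u \<in> BD U"
    using upper_growth[OF u U that] by (simp add: limit_bounded_open[OF u U])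
  show "limit u U = \<infinity>" if "u \<notin> BD U"
    using lower_coercive(1)[OF u U that] by (simp add: limit_bounded_open[OF u U])
next
  fix U and u v :: "real^'d \<Rightarrow> real^'d"
  assume u: "u \<in> L1loc" and v: "v \<in> L1loc" and U: "open U" "bounded U" and eq: "AE x in lebesgue. x \<in> U \<longrightarrow> u x = v x"
  have "AE x in lebesgue. x \<in> U \<longrightarrow> v x = u x" using eq by eventually_elim simp
  then have "lower u U = lower v U" using eq u v U by (intro antisym lower_cong)
  then show "limit u U = limit v U" using limit_bounded_open(1)[OF u U] limit_bounded_open(1)[OF v U] by simp
next
  fix u :: "real^'d \<Rightarrow> real^'d" and W :: "real^'d^'d" and b :: "real^'d" and B :: "(real^'d) set"
  assume u: "u \<in> L1loc" and W: "transpose W = - W" and B: "B \<in> sets borel"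
  define v where "v = (\<lambda>y. u y + (W *v y + b))"
  have vL: "v \<in> L1loc" unfolding v_def by (rule L1loc_add[OF u affine_map_L1loc])
  have "transpose (- W) = - transpose W" by (simp add: transpose_def vec_eq_iff)
  then have W': "transpose (- W) = - (- W)" by (simp only: W)
  have "(- W) *v y = - (W *v y)" for y by (simp add: matrix_vector_mult_def vec_eq_iff sum_negf)
  then have "(\<lambda>y. v y + ((- W) *v y + (- b))) = u" by (intro ext) (simp add: v_def)
  then have "limit u B \<le> limit v B" using limit_rigid_le[OF vL W' B, of "- b"] by simp
  moreover have "limit v B \<le> limit u B" unfolding v_def by (rule limit_rigid_le[OF u W B])
  ultimately show "limit (\<lambda>y. u y + (W *v y + b)) B = limit u B" unfolding v_def by simp
next
  fix u :: "real^'d \<Rightarrow> real^'d" and A :: "real^'d^'d" and B :: "(real^'d) set"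
  assume u: "u \<in> L1loc" and A: "transpose A = A" and B: "B \<in> sets borel"
  have t: "(\<lambda>y. A *v y) \<in> L1loc" using affine_map_L1loc[of A 0] by simp
  have "limit (\<lambda>y. u y + A *v y) B \<le> limit u B + emeasure (scale_measure (ennreal (c5 * norm A)) lborel) B"
  proof (rule limit_shift[OF u t _ _ _ B])
    show "emeasure (scale_measure (ennreal (c5 * norm A)) lborel) (ball (0::real^'d) r) < \<infinity>" for r
      using bounded_open_finite_measure[of "ball (0::real^'d) r"] by (simp add: ennreal_mult_less_top)
    show "F n (\<lambda>x. y x + A *v x) V \<le> F n y V + emeasure (scale_measure (ennreal (c5 * norm A)) lborel) V"
      if "y \<in> L1loc" "open V" for n y V
      using functional_class_linear[OF F that(1) A, of V n] that(2) by simp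
  qed simp
  then show "limit (\<lambda>y. u y + A *v y) B \<le> limit u B + ennreal (c5 * norm A) * emeasure lborel B" by simp
next
  fix u :: "real^'d \<Rightarrow> real^'d" and x \<zeta> \<nu> :: "real^'d" and B :: "(real^'d) set"
  assume u: "u \<in> L1loc" and \<nu>: "norm \<nu> = 1" and B: "B \<in> sets borel"
  obtain M where M: "sets M = sets borel"
    "\<forall>B\<in>sets borel. emeasure M B = ennreal (\<sigma> (norm \<zeta>)) * hausdorff (CARD('d) - 1) (B \<inter> hyperplane x \<nu>)"
    "\<forall>r. emeasure M (ball 0 r) < \<infinity>"
    by (rule hyperplane_measure[OF \<nu>])
  have "limit (\<lambda>y. u y + jump_function x \<zeta> \<nu> y) B \<le> limit u B + emeasure M B"
  proof (rule limit_shift[OF u jump_function_L1loc M(1) _ _ B])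
    show "emeasure M (ball 0 r) < \<infinity>" for r using M(3) by blast
    show "F n (\<lambda>z. y z + jump_function x \<zeta> \<nu> z) V \<le> F n y V + emeasure M V" if "y \<in> L1loc" "open V" for n y V
      using functional_class_jump[OF F that(1) \<nu>, of V n x \<zeta>] M(2) that(2) by simp
  qed
  then show "limit (\<lambda>y. u y + jump_function x \<zeta> \<nu> y) B \<le>
      limit u B + ennreal (\<sigma> (norm \<zeta>)) * hausdorff (CARD('d) - 1) (B \<inter> hyperplane x \<nu>)"
    using M(2) B by simp
qed

text \<open>Lower \<open>\<Gamma>\<close>-limits are lower semicontinuous, and on open sets the limit is a supremum of such functions.\<close>

lemma limit_lsc:
  assumes U: "open U" and v: "\<And>k::nat. v k \<in> L1loc" and lim: "limitin L1loc_topology v u sequentially"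
  shows "limit u U \<le> liminf (\<lambda>k. limit (v k) U)"
proof -
  have u: "u \<in> L1loc" using limitin_topspace[OF lim] by simp
  show ?thesis
    unfolding limit_open[OF u U] inner_SUP[OF u]
  proof (rule SUP_least, safe)
    fix V assume V: "open V" "bounded V" "closure V \<subseteq> U"
    have "lower u V \<le> liminf (\<lambda>k. lower (v k) V)" unfolding lower_def by (rule Gamma_liminf_lsc[OF lim])
    also have "\<dots> \<le> liminf (\<lambda>k. limit (v k) U)"
      using letta_increasing.al_le_inner[OF lower_upper_letta[OF v] V] by (intro Liminf_mono always_eventually allI) (simp add: limit_open[OF v U])
    finally show "lower u V \<le> liminf (\<lambda>k. limit (v k) U)" .
  qed
qed

end

theorem theorem4p1:
  fixes c1 c2 c3 c4 c5 :: real
    and \<sigma> :: "real \<Rightarrow> real"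
    and F :: "nat \<Rightarrow> ('d::finite) functional"
  assumes "c1 \<ge> 0" "c2 \<ge> 0" "c3 \<ge> 0" "c4 \<ge> 0" "c5 \<ge> 0"
    and "0 < c1" "c1 \<le> c3"
    and "continuous_on {0..} \<sigma>" "\<forall>t\<ge>0. \<sigma> t \<ge> 0" "\<sigma> 0 = 0"
    and "Limsup at_top (\<lambda>t. ereal (\<sigma> t / t)) < \<infinity>"
    and "\<forall>n. F n \<in> functional_class c1 c2 c3 c4 c5 \<sigma>"
  shows "\<exists>G \<in> functional_class_sc c1 c2 c3 c4 c5 \<sigma>. \<exists>r :: nat \<Rightarrow> nat. strict_mono r \<and>
    (\<forall>U. open U \<longrightarrow> bounded U \<longrightarrow>
      Gamma_converges L1loc_topology (\<lambda>n u. F (r n) u U) (\<lambda>u. G u U))"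
proof -
  obtain R :: "(real^'d) set set" where R: "countable R" "\<And>U. U \<in> R \<Longrightarrow> open U" "\<And>U. U \<in> R \<Longrightarrow> bounded U"
    "\<And>K U. compact K \<Longrightarrow> open U \<Longrightarrow> K \<subseteq> U \<Longrightarrow> \<exists>V\<in>R. K \<subseteq> V \<and> closure V \<subseteq> U"
    using countable_dense_opens by metis
  obtain r :: "nat \<Rightarrow> nat" where r: "strict_mono r" "\<forall>U\<in>R. \<forall>u\<in>L1loc.
     Gamma_limsup L1loc_topology (\<lambda>n y. F (r n) y U) u \<le> Gamma_liminf L1loc_topology (\<lambda>n y. F (r n) y U) u"
    using Gamma_diagonal[OF R(1), of F] by blast
  interpret functional_sequence c1 c2 c3 c4 c5 \<sigma> "\<lambda>n. F (r n)" R
  proof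
    show "\<exists>V\<in>R. K \<subseteq> V \<and> closure V \<subseteq> U" if "compact K" "open U" "K \<subseteq> U" for K U by (rule R(4)[OF that])
    show "Gamma_limsup L1loc_topology (\<lambda>n y. F (r n) y U) u \<le> Gamma_liminf L1loc_topology (\<lambda>n y. F (r n) y U) u"
      if "U \<in> R" "u \<in> L1loc" for U u using r(2) that by blast
    show "open U" "bounded U" if "U \<in> R" for U by (rule R(2,3)[OF that])+
  qed (use assms R(1) in simp_all)
  show ?thesis
  proof (intro bexI[of _ limit] exI[of _ r] conjI r(1) allI impI)
    show "limit \<in> functional_class_sc c1 c2 c3 c4 c5 \<sigma>"
      unfolding functional_class_sc_def mem_Collect_eq
      by (intro conjI limit_in_class allI impI limit_lsc) simp_all
    fix U :: "(real^'d) set" assume U: "open U" "bounded U"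
    show "Gamma_converges L1loc_topology (\<lambda>n u. F (r n) u U) (\<lambda>u. limit u U)"
      unfolding Gamma_converges_def
      using limit_bounded_open[OF _ U] by (simp add: lower_def upper_def)
  qed
qed

end
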